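(* Let $T>0$, $H\in(1/2,1)$, let $M$ be the Molchan martingale on $[0,T]$ with parameter $H$, and let $Q_0=b_0/\sigma\in C^1([0,T];\mathbb R)$. Let $J$, $\mathcal J$, $\overline J$, the process $Z$, the estimators $\widehat J_{m,N}$ of $J(Q_0)$, the estimators $\widehat Q_{m,N}=\overline J(\widehat J_{m,N})$ of $Q_0$, the set $\mathcal M_N$ and the selected index $\widehat m$ be as defined in the context. Let $N\in\mathbb N^*$, let $\varphi_1,\dots,\varphi_N:[0,T]\to\mathbb R$ be continuous functions forming an orthonormal family in $\mathbb L^2([0,T],dt)$, and let $\mathcal S_m={\rm span}\{\varphi_1,\dots,\varphi_m\}$ for $m\in\{1,\dots,N\}$. Assume that $J(Q_0)\in\mathbb L^2([0,T],d\langle M\rangle_t)$. (1) If the $\varphi_j$'s belong to $\mathcal J$, then there exists a deterministic constant $\mathfrak c_1>0$, not depending on $N$, such that $$\mathbb E[\|\widehat Q_{m,N}-Q_0\|_2^2]\leqslant\mathfrak c_1\left(\min_{\iota\in\mathcal S_m}\|\iota-J(Q_0)\|_{\langle M\rangle}^2+\frac mN\right)\quad\text{for every }m\in\{1,\dots,N\}.$$ (2) If in addition, for every $m,m'\in\{1,\dots,N\}$, $m>m'$ implies $\mathcal S_{m'}\subset\mathcal S_m$, then there exists a deterministic constant $\mathfrak c_2>0$, not depending on $N$, such that $$\mathbb E[\|\widehat Q_{\widehat m,N}-Q_0\|_2^2]\leqslant\mathfrak c_2\left(\min_{m\in\mathcal M_N}\left\{\min_{\iota\in\mathcal S_m}\|\iota-J(Q_0)\|_{\langle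 M\rangle}^2+\frac mN\right\}+\frac1N\right).$$
   Context: Molchan martingale: $B$ is a fractional Brownian motion with Hurst parameter $H$, $\ell(t,s)=\mathfrak c_Hs^{1/2-H}(t-s)^{1/2-H}\mathbf 1_{(0,t)}(s)$ with $$\mathfrak c_H=\left(\frac{\Gamma(3-2H)}{2H\,\Gamma(3/2-H)^3\,\Gamma(H+1/2)}\right)^{1/2},$$ and $M_t=\int_0^t\ell(t,s)\,dB_s=(2-2H)^{1/2}\int_0^ts^{1/2-H}\,dW_s$, where $W$ is the Brownian motion driving the Mandelbrot–Van Ness representation of $B$. Its quadratic variation is $\langle M\rangle_t=t^{2-2H}=\int_0^t(2-2H)s^{1-2H}\,ds$. Underlying model: $X_t=X_0+\int_0^tV(X_s)(b_0(s)\,ds+\sigma(s)\,dB_s)$, $t\in[0,T]$ (pathwise Young integral), with $X_0$ an $\mathbb R\setminus\{0\}$-valued random variable, $V:\mathbb R\to\mathbb R$ twice continuously differentiable with $V',V''$ bounded, $\sigma:[0,T]\to\mathbb R\setminus\{0\}$ $\gamma$-Hölder continuous with $\gamma\in(1-H,1]$, $b_0:[0,T]\to\mathbb R$ continuous; $V,\sigma$ are known, and $Q_0=b_0/\sigma$ is assumed to be in $\mathcal Q=C^1([0,T];\mathbb R)$. With $Y_t=\int_0^t\frac{dX_s}{V(X_s)\sigma(s)}=\int_0^tQ_0(s)\,ds+B_t$, set $Z_t=\int_0^t\ell(t,s)\,dY_s$. Then $$Z_t=j(Q_0)(t)+M_t=\int_0^tJ(Q_0)(s)\,d\langle M\rangle_s+M_t,$$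 where, for $Q\in\mathcal Q$, $j(Q)(t)=\int_0^t\ell(t,s)Q(s)\,ds$ and $J(Q)(t)=(2-2H)^{-1}t^{2H-1}j(Q)'(t)$, $t\in(0,T]$ (the derivative $j(Q)'(t)$ exists for every $t\in(0,T]$). Function space and inverse map: $\mathcal J$ is the set of functions $\iota$ such that $t\in[0,T]\mapsto\int_0^ts^{1-2H}\iota(s)\,ds$ belongs to $\mathcal I_{0+}^{3/2-H}(\mathbb L^1([0,T],dt))$, where $\mathcal I_{0+}^\alpha(f)(t)=\frac1{\Gamma(\alpha)}\int_0^t(t-s)^{\alpha-1}f(s)\,ds$ is the Riemann–Liouville left-sided fractional integral of order $\alpha$. For $\iota\in\mathcal J$ and $t\in[0,T]$, $$\overline J(\iota)(t)=\overline{\mathfrak c}_H\,t^{H-1/2}\int_0^t(t-s)^{H-3/2}s^{1-2H}\iota(s)\,ds,\qquad\overline{\mathfrak c}_H=\frac{2-2H}{\mathfrak c_H\,\Gamma(3/2-H)\,\Gamma(H-1/2)}.$$ Estimators: $M^1,\dots,M^N$ (resp. $Z^1,\dots,Z^N$) are $N$ independent copies of $M$ (resp. $Z$), with $Z^i_t=\int_0^tJ(Q_0)(s)\,d\langle M\rangle_s+M^i_t$. For $K\in\mathcal S_m$, $$\gamma_N(K)=\frac1N\sum_{i=1}^N\left(\int_0^TK(s)^2\,d\langle M^i\rangle_s-2\int_0^TK(s)\,dZ^i_s\right),$$ $\widehat J_{m,N}=\arg\min_{K\in\mathcal S_m}\gamma_N(K)$ (the minimizer is unique), and $\widehat Q_{m,N}=\overline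 J(\widehat J_{m,N})$. Model selection: $m_N\in\{1,\dots,N\}$, $\mathcal M_N=\{1,\dots,m_N\}$, ${\rm pen}(m)=\mathfrak c_{\rm cal}m/N$ where $\mathfrak c_{\rm cal}>0$ is a constant to calibrate in practice, $\widehat m=\arg\min_{m\in\mathcal M_N}\{\gamma_N(\widehat J_{m,N})+{\rm pen}(m)\}$, and $\widehat Q_{\widehat m,N}=\overline J(\widehat J_{\widehat m,N})$. Norms: $\|\cdot\|_2$ is the usual norm of $\mathbb L^2([0,T],dt)$ and $\|\varphi\|_{\langle M\rangle}^2=\int_0^T\varphi(s)^2\,d\langle M\rangle_s$.
   Formalization: In part (2) the calibration constant of the penalty is taken to be any constant greater than 1 rather than any positive constant, since for a constant at most 1 the bound fails (zero drift, m_N = N, trigonometric functions). *)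

theory Defs
  imports "HOL-Probability.Probability"
begin

section \<open>Function spaces\<close>

text \<open>
  Functions on \<open>[0,T]\<close> are total functions on the reals whose values outside \<open>[0,T]\<close> are
  irrelevant.  The library notion \<open>C1_differentiable_on\<close> uses two-sided derivatives, also at
  the end points of a closed interval; here they have to be one-sided.
\<close>

definition C1_on_Icc :: "real \<Rightarrow> (real \<Rightarrow> real) \<Rightarrow> bool" where
  "C1_on_Icc T Q \<longleftrightarrow>
     (\<exists>Q'. continuous_on {0..T} Q' \<and>
           (\<forall>t\<in>{0..T}. (Q has_real_derivative Q' t) (at t within {0..T})))"

definition holder_on :: "real \<Rightarrow> real \<Rightarrow> (real \<Rightarrow> real) \<Rightarrow> bool" where
  "holder_on T \<gamma> f \<longleftrightarrow>
     (\<exists>L. \<forall>s\<in>{0..T}. \<forall>t\<in>{0..T}. \<bar>f t - f s\<bar> \<le> L * \<bar>t - s\<bar> powr \<gamma>)"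

definition L2_fun :: "'a measure \<Rightarrow> ('a \<Rightarrow> real) \<Rightarrow> bool" where
  "L2_fun \<mu> f \<longleftrightarrow> f \<in> borel_measurable \<mu> \<and> integrable \<mu> (\<lambda>x. (f x)\<^sup>2)"

definition L2_norm_sq :: "'a measure \<Rightarrow> ('a \<Rightarrow> real) \<Rightarrow> ennreal" where
  "L2_norm_sq \<mu> f = (\<integral>\<^sup>+ x. ennreal ((f x)\<^sup>2) \<partial>\<mu>)"

definition lebesgue_Icc :: "real \<Rightarrow> real measure" where
  "lebesgue_Icc T = restrict_space lborel {0..T}"

text \<open>The measure \<open>d\<langle>M\<rangle>\<^sub>s = (2 - 2H) s\<^bsup>1-2H\<^esup> ds\<close> on \<open>[0,T]\<close>.\<close>

definition bracket :: "real \<Rightarrow> real \<Rightarrow> real measure" where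
  "bracket H T = density (lebesgue_Icc T) (\<lambda>s. ennreal ((2 - 2 * H) * s powr (1 - 2 * H)))"

section \<open>The deterministic transforms\<close>

definition molchan_const :: "real \<Rightarrow> real" where
  "molchan_const H =
     sqrt (Gamma (3 - 2 * H) / (2 * H * Gamma (3/2 - H) ^ 3 * Gamma (H + 1/2)))"

definition molchan_kernel :: "real \<Rightarrow> real \<Rightarrow> real \<Rightarrow> real" where
  "molchan_kernel H t s =
     molchan_const H * s powr (1/2 - H) * (t - s) powr (1/2 - H) * indicator {0<..<t} s"

definition j_map :: "real \<Rightarrow> (real \<Rightarrow> real) \<Rightarrow> real \<Rightarrow> real" where
  "j_map H Q t = (LINT s:{0..t}|lborel. molchan_kernel H t s * Q s)"

definition J_map :: "real \<Rightarrow> real \<Rightarrow> (real \<Rightarrow> real) \<Rightarrow> real \<Rightarrow> real" where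
  "J_map H T Q t =
     inverse (2 - 2 * H) * t powr (2 * H - 1) * vector_derivative (j_map H Q) (at t within {0..T})"

definition riemann_liouville :: "real \<Rightarrow> (real \<Rightarrow> real) \<Rightarrow> real \<Rightarrow> real" where
  "riemann_liouville \<alpha> f t =
     1 / Gamma \<alpha> * (LINT s:{0..t}|lborel. (t - s) powr (\<alpha> - 1) * f s)"

text \<open>
  For \<open>\<alpha> < 1\<close> the fractional integral of an integrable function is only defined almost
  everywhere, so that membership in its range is equality almost everywhere.
\<close>

definition J_space :: "real \<Rightarrow> real \<Rightarrow> (real \<Rightarrow> real) set" where
  "J_space H T =
     {\<iota>. set_integrable lborel {0..T} (\<lambda>s. s powr (1 - 2 * H) * \<iota> s) \<and>
         (\<exists>f. set_integrable lborel {0..T} f \<and>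
           (AE t in lebesgue_Icc T.
              (LINT s:{0..t}|lborel. s powr (1 - 2 * H) * \<iota> s) = riemann_liouville (3/2 - H) f t))}"

definition inverse_const :: "real \<Rightarrow> real" where
  "inverse_const H = (2 - 2 * H) / (molchan_const H * Gamma (3/2 - H) * Gamma (H - 1/2))"

definition J_inv :: "real \<Rightarrow> (real \<Rightarrow> real) \<Rightarrow> real \<Rightarrow> real" where
  "J_inv H \<iota> t =
     inverse_const H * t powr (H - 1/2) *
     (LINT s:{0..t}|lborel. (t - s) powr (H - 3/2) * s powr (1 - 2 * H) * \<iota> s)"

section \<open>Integrals of deterministic functions against a process\<close>

text \<open>
  A list of triples \<open>(a, u, v)\<close> represents the step function \<open>\<Sum> a * indicator {u<..v}\<close>
  (overlapping intervals are allowed).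
\<close>

definition step_list :: "real \<Rightarrow> (real \<times> real \<times> real) list \<Rightarrow> bool" where
  "step_list T xs \<longleftrightarrow> (\<forall>(a, u, v) \<in> set xs. 0 \<le> u \<and> u \<le> v \<and> v \<le> T)"

definition step_fun :: "(real \<times> real \<times> real) list \<Rightarrow> real \<Rightarrow> real" where
  "step_fun xs s = (\<Sum>(a, u, v) \<leftarrow> xs. a * indicator {u<..v} s)"

definition step_integral ::
  "(real \<times> real \<times> real) list \<Rightarrow> (real \<Rightarrow> 'w \<Rightarrow> real) \<Rightarrow> 'w \<Rightarrow> real" where
  "step_integral xs Y \<omega> = (\<Sum>(a, u, v) \<leftarrow> xs. a * (Y v \<omega> - Y u \<omega>))"

text \<open>
  The random variable \<open>I\<close> is a version of \<open>\<integral>\<^sub>0\<^sup>T f dY\<close>: the integral of step functions is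
  extended by \<open>L\<^sup>2(P)\<close> limits, the squared norm \<open>nrm\<close> on the integrands being the one that
  belongs to the process \<open>Y\<close>.
\<close>

definition is_wiener_integral ::
  "'w measure \<Rightarrow> ((real \<Rightarrow> real) \<Rightarrow> ennreal) \<Rightarrow> real \<Rightarrow> (real \<Rightarrow> 'w \<Rightarrow> real) \<Rightarrow>
   (real \<Rightarrow> real) \<Rightarrow> ('w \<Rightarrow> real) \<Rightarrow> bool" where
  "is_wiener_integral P nrm T Y f I \<longleftrightarrow>
     I \<in> borel_measurable P \<and>
     (\<exists>F. (\<forall>n::nat. step_list T (F n)) \<and>
          (\<lambda>n. nrm (\<lambda>s. f s - step_fun (F n) s)) \<longlonglongrightarrow> 0 \<and>
          (\<lambda>n. L2_norm_sq P (\<lambda>\<omega>. I \<omega> - step_integral (F n) Y \<omega>)) \<longlonglongrightarrow> 0)"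

text \<open>
  The squared norm of the space of integrands of fractional Brownian motion for \<open>H > 1/2\<close>.
  Since \<open>\<bar>u - v\<bar>\<close> is at most \<open>T\<close>, it also controls the \<open>L\<^sup>1\<close> norm, so that it may be used
  for a process that differs from fractional Brownian motion by a bounded drift.
\<close>

definition fbm_norm_sq :: "real \<Rightarrow> real \<Rightarrow> (real \<Rightarrow> real) \<Rightarrow> ennreal" where
  "fbm_norm_sq H T f =
     (\<integral>\<^sup>+ u. (\<integral>\<^sup>+ v. ennreal (\<bar>f u\<bar> * \<bar>f v\<bar> * \<bar>u - v\<bar> powr (2 * H - 2)) \<partial>lebesgue_Icc T)
        \<partial>lebesgue_Icc T)"

section \<open>Fractional Brownian motion, Molchan martingale and observed process\<close>

definition gaussian_rv :: "'w measure \<Rightarrow> ('w \<Rightarrow> real) \<Rightarrow> bool" where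
  "gaussian_rv P X \<longleftrightarrow>
     X \<in> borel_measurable P \<and>
     ((\<exists>\<mu>. AE \<omega> in P. X \<omega> = \<mu>) \<or>
      (\<exists>\<mu> s. 0 < s \<and> distributed P lborel X (\<lambda>x. ennreal (normal_density \<mu> s x))))"

definition fractional_brownian_motion ::
  "'w measure \<Rightarrow> real \<Rightarrow> real \<Rightarrow> (real \<Rightarrow> 'w \<Rightarrow> real) \<Rightarrow> bool" where
  "fractional_brownian_motion P H T B \<longleftrightarrow>
     (\<forall>A a. finite A \<and> A \<subseteq> {0..T} \<longrightarrow> gaussian_rv P (\<lambda>\<omega>. \<Sum>t\<in>A. a t * B t \<omega>)) \<and>
     (\<forall>t\<in>{0..T}. prob_space.expectation P (B t) = 0) \<and>
     (\<forall>s\<in>{0..T}. \<forall>t\<in>{0..T}. prob_space.expectation P (\<lambda>\<omega>. B s \<omega> * B t \<omega>) =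
        (s powr (2 * H) + t powr (2 * H) - \<bar>t - s\<bar> powr (2 * H)) / 2) \<and>
     (AE \<omega> in P. continuous_on {0..T} (\<lambda>t. B t \<omega>))"

definition drifted :: "(real \<Rightarrow> real) \<Rightarrow> (real \<Rightarrow> 'w \<Rightarrow> real) \<Rightarrow> real \<Rightarrow> 'w \<Rightarrow> real" where
  "drifted Q B t \<omega> = (LINT s:{0..t}|lborel. Q s) + B t \<omega>"

text \<open>
  \<open>R\<close> is the transform of \<open>Y\<close> by the Molchan kernel: the Molchan martingale \<open>M\<close> for
  \<open>Y = B\<close>, the process \<open>Z\<close> for \<open>Y = drifted Q\<^sub>0 B\<close>.
\<close>

definition molchan_transform ::
  "'w measure \<Rightarrow> real \<Rightarrow> real \<Rightarrow> (real \<Rightarrow> 'w \<Rightarrow> real) \<Rightarrow> (real \<Rightarrow> 'w \<Rightarrow> real) \<Rightarrow> bool" where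
  "molchan_transform P H T Y R \<longleftrightarrow>
     (\<forall>t\<in>{0..T}. is_wiener_integral P (fbm_norm_sq H T) T Y (molchan_kernel H t) (R t))"

definition independent_processes ::
  "'w measure \<Rightarrow> real \<Rightarrow> nat \<Rightarrow> (nat \<Rightarrow> real \<Rightarrow> 'w \<Rightarrow> real) \<Rightarrow> bool" where
  "independent_processes P T N X \<longleftrightarrow>
     prob_space.indep_vars P (\<lambda>_. Pi\<^sub>M {0..T} (\<lambda>_. borel))
       (\<lambda>i \<omega>. \<lambda>t\<in>{0..T}. X i t \<omega>) {1..N}"

definition molchan_sample ::
  "'w measure \<Rightarrow> real \<Rightarrow> real \<Rightarrow> (real \<Rightarrow> real) \<Rightarrow> nat \<Rightarrow> (nat \<Rightarrow> real \<Rightarrow> 'w \<Rightarrow> real) \<Rightarrow>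
   (nat \<Rightarrow> real \<Rightarrow> 'w \<Rightarrow> real) \<Rightarrow> (nat \<Rightarrow> real \<Rightarrow> 'w \<Rightarrow> real) \<Rightarrow> bool" where
  "molchan_sample P H T Q\<^sub>0 N B M Z \<longleftrightarrow>
     prob_space P \<and>
     (\<forall>i\<in>{1..N}. fractional_brownian_motion P H T (B i) \<and>
        molchan_transform P H T (B i) (M i) \<and>
        molchan_transform P H T (drifted Q\<^sub>0 (B i)) (Z i)) \<and>
     independent_processes P T N M \<and> independent_processes P T N Z"

section \<open>The estimators\<close>

definition span_upto :: "(nat \<Rightarrow> real \<Rightarrow> real) \<Rightarrow> nat \<Rightarrow> (real \<Rightarrow> real) set" where
  "span_upto \<phi> m = {\<lambda>t. \<Sum>j=1..m. a j * \<phi> j t | a. True}"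

definition orthonormal_family :: "real \<Rightarrow> nat \<Rightarrow> (nat \<Rightarrow> real \<Rightarrow> real) \<Rightarrow> bool" where
  "orthonormal_family T N \<phi> \<longleftrightarrow>
     (\<forall>i\<in>{1..N}. \<forall>j\<in>{1..N}.
        (LINT t|lebesgue_Icc T. \<phi> i t * \<phi> j t) = (if i = j then 1 else 0))"

text \<open>
  \<open>D i K\<close> is a version of \<open>\<integral>\<^sub>0\<^sup>T K dZ\<^sup>i\<close> for every \<open>K\<close> in the finite-dimensional space \<open>S\<close>.  Each
  of these integrals is determined only up to a null set depending on \<open>K\<close>; minimising a
  functional of \<open>K\<close> for fixed \<open>\<omega>\<close> is meaningful for versions that are almost surely linear in
  \<open>K\<close>.
\<close>

definition integral_version ::
  "'w measure \<Rightarrow> real \<Rightarrow> real \<Rightarrow> nat \<Rightarrow> (nat \<Rightarrow> real \<Rightarrow> 'w \<Rightarrow> real) \<Rightarrow> (real \<Rightarrow> real) set \<Rightarrow>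
   (nat \<Rightarrow> (real \<Rightarrow> real) \<Rightarrow> 'w \<Rightarrow> real) \<Rightarrow> bool" where
  "integral_version P H T N Z S D \<longleftrightarrow>
     (\<forall>i\<in>{1..N}.
        (\<forall>K\<in>S. is_wiener_integral P (L2_norm_sq (bracket H T)) T (Z i) K (D i K)) \<and>
        (AE \<omega> in P. \<forall>K\<in>S. \<forall>L\<in>S. \<forall>a b.
           D i (\<lambda>t. a * K t + b * L t) \<omega> = a * D i K \<omega> + b * D i L \<omega>))"

definition contrast ::
  "real \<Rightarrow> real \<Rightarrow> nat \<Rightarrow> (nat \<Rightarrow> (real \<Rightarrow> real) \<Rightarrow> 'w \<Rightarrow> real) \<Rightarrow> 'w \<Rightarrow> (real \<Rightarrow> real) \<Rightarrow> real" where
  "contrast H T N D \<omega> K =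
     1 / real N * (\<Sum>i=1..N. (LINT s|bracket H T. (K s)\<^sup>2) - 2 * D i K \<omega>)"

definition J_hat ::
  "real \<Rightarrow> real \<Rightarrow> nat \<Rightarrow> (nat \<Rightarrow> real \<Rightarrow> real) \<Rightarrow> (nat \<Rightarrow> (real \<Rightarrow> real) \<Rightarrow> 'w \<Rightarrow> real) \<Rightarrow>
   nat \<Rightarrow> 'w \<Rightarrow> real \<Rightarrow> real" where
  "J_hat H T N \<phi> D m \<omega> = arg_min (contrast H T N D \<omega>) (\<lambda>K. K \<in> span_upto \<phi> m)"

definition Q_hat ::
  "real \<Rightarrow> real \<Rightarrow> nat \<Rightarrow> (nat \<Rightarrow> real \<Rightarrow> real) \<Rightarrow> (nat \<Rightarrow> (real \<Rightarrow> real) \<Rightarrow> 'w \<Rightarrow> real) \<Rightarrow>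
   nat \<Rightarrow> 'w \<Rightarrow> real \<Rightarrow> real" where
  "Q_hat H T N \<phi> D m \<omega> = J_inv H (J_hat H T N \<phi> D m \<omega>)"

text \<open>
  In a basis orthonormal for \<open>bracket\<close>, every coordinate carries noise of variance \<open>1/N\<close>.  The
  penalty \<open>c_cal * m / N\<close> therefore controls the selected dimension when \<open>c_cal > 1\<close>; for
  \<open>c_cal < 1\<close> and vanishing drift the criterion favours the largest admissible dimension.
\<close>

definition m_hat ::
  "real \<Rightarrow> real \<Rightarrow> nat \<Rightarrow> (nat \<Rightarrow> real \<Rightarrow> real) \<Rightarrow> (nat \<Rightarrow> (real \<Rightarrow> real) \<Rightarrow> 'w \<Rightarrow> real) \<Rightarrow>
   real \<Rightarrow> nat \<Rightarrow> 'w \<Rightarrow> nat" where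
  "m_hat H T N \<phi> D c_cal m_max \<omega> =
     arg_min (\<lambda>m. contrast H T N D \<omega> (J_hat H T N \<phi> D m \<omega>) + c_cal * real m / real N)
       (\<lambda>m. m \<in> {1..m_max})"

text \<open>
  The infimum over the finite-dimensional space is attained; bias and risk are extended
  nonnegative reals, so that a bound on them includes finiteness.
\<close>

definition bias_sq ::
  "real \<Rightarrow> real \<Rightarrow> (real \<Rightarrow> real) \<Rightarrow> (nat \<Rightarrow> real \<Rightarrow> real) \<Rightarrow> nat \<Rightarrow> ennreal" where
  "bias_sq H T Q\<^sub>0 \<phi> m =
     (INF \<iota>\<in>span_upto \<phi> m. L2_norm_sq (bracket H T) (\<lambda>s. \<iota> s - J_map H T Q\<^sub>0 s))"

definition risk ::
  "'w measure \<Rightarrow> real \<Rightarrow> (real \<Rightarrow> real) \<Rightarrow> ('w \<Rightarrow> real \<Rightarrow> real) \<Rightarrow> ennreal" where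
  "risk P T Q\<^sub>0 Q = (\<integral>\<^sup>+ \<omega>. L2_norm_sq (lebesgue_Icc T) (\<lambda>t. Q \<omega> t - Q\<^sub>0 t) \<partial>P)"

end

theory Submission imports Defs
begin

text \<open>
  Put \<open>a = H - 1/2\<close>.  The estimation problem is turned into a sequence model with sub-Gaussian noise, in
  which both bounds are elementary.

  \<^emph>\<open>Noise.\<close>  The kernel \<open>\<bar>u - v\<bar> powr (2 * H - 2)\<close> that governs the covariance of fractional Brownian motion
  is, up to a Beta factor, \<open>\<integral> \<kappa>(r,u) \<kappa>(r,v) dr\<close> with \<open>\<kappa>(r,u) = r powr (-a) * u powr a * (u - r) powr (a - 1)\<close> for
  \<open>0 < r < u\<close> (\<open>abel_kernel_convolution\<close>).  Hence the Wiener integral of \<open>f\<close> has a variance proportional to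
  the squared \<open>L\<^sup>2\<close> norm of \<open>r \<mapsto> \<integral> f(u) \<kappa>(r,u) du\<close> (\<open>fbm_wiener_exp_moment\<close>).  This transform sends the
  Molchan kernel at time \<open>t\<close> to a multiple of \<open>r powr (-a)\<close> on \<open>(0,t)\<close>, whose square is a multiple of the
  density of the bracket, and the constants multiply to one (\<open>molchan_normalisation\<close>).  Therefore the
  integral of \<open>K\<close> over \<open>Z\<close> fluctuates with variance \<open>\<parallel>K\<parallel>\<^sup>2\<close>, the norm being that of the bracket.  Integrals
  are only defined as limits in mean square, so this is recorded as a bound on exponential moments, which
  passes to limits by Fatou's lemma.

  \<^emph>\<open>Drift.\<close>  For continuously differentiable \<open>Q\<close>, the function \<open>j(Q)\<close> is absolutely continuous with density
  \<open>(2 - 2 * H) * s powr (1 - 2 * H) * J(Q)(s)\<close>, so that the mean of the integral of \<open>K\<close> over \<open>Z\<close> is the inner product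
  of \<open>K\<close> and \<open>J(Q)\<close> for the bracket (\<open>step_integral_j_map\<close>).

  \<^emph>\<open>Sequence model.\<close>  In a basis of the approximation spaces that is orthonormal for the bracket, the estimator
  of dimension \<open>m\<close> has the coefficients \<open>d k + \<xi> k / sqrt N\<close> for \<open>k \<le> m\<close>, where \<open>d k\<close> are those of \<open>J(Q)\<close> and
  \<open>\<xi>\<close> is sub-Gaussian with unit variance proxy.  Its loss is the squared bias plus \<open>(\<Sum>k\<le>m. (\<xi> k)\<^sup>2) / N\<close>
  (\<open>sequence_model\<close>).

  \<^emph>\<open>Return to \<open>Q\<close>.\<close>  The map \<open>J_inv\<close> is bounded from \<open>L\<^sup>2\<close> of the bracket to \<open>L\<^sup>2\<close> of Lebesgue measure by Schur's
  test (\<open>J_inv_bounded\<close>), and it inverts \<open>J\<close> by the classical solution of Abel's equation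
  (\<open>abel_inversion\<close>).  The loss for \<open>Q\<close> is thus at most a constant times the loss for \<open>J(Q)\<close>.

  \<^emph>\<open>Bounds.\<close>  The first bound follows since each \<open>\<xi> k\<close> has bounded second moment.  For the second one, let
  \<open>1 < \<kappa> < c_cal\<close>.  The sum over \<open>m\<close> of the positive parts of \<open>(\<Sum>k\<le>m. (\<xi> k)\<^sup>2) - \<kappa> * m\<close> has a mean that is
  bounded uniformly in \<open>N\<close> (\<open>chi_square_excess\<close>), and up to this error the penalty dominates the noise in every
  dimension, so that comparing the criterion at the selected index and at any other one is a deterministic
  matter (\<open>sequence_oracle_inequality\<close>).
\<close>

section \<open>Limits in mean square\<close>

lemma L2_norm_sq_add_le:
  assumes [measurable]: "f \<in> borel_measurable M" "g \<in> borel_measurable M"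
  shows "L2_norm_sq M (\<lambda>x. f x + g x) \<le> 2 * (L2_norm_sq M f + L2_norm_sq M g)"
proof -
  have "(f x + g x)\<^sup>2 \<le> 2 * ((f x)\<^sup>2 + (g x)\<^sup>2)" for x
    using sum_squares_bound[of "f x" "g x"] by (simp add: power2_sum)
  then have "L2_norm_sq M (\<lambda>x. f x + g x)
      \<le> (\<integral>\<^sup>+x. 2 * (ennreal ((f x)\<^sup>2) + ennreal ((g x)\<^sup>2)) \<partial>M)"
    unfolding L2_norm_sq_def
    by (intro nn_integral_mono) (auto simp flip: ennreal_plus ennreal_numeral ennreal_mult' intro!: ennreal_leI)
  also have "\<dots> = 2 * (L2_norm_sq M f + L2_norm_sq M g)"
    unfolding L2_norm_sq_def by (simp add: nn_integral_cmult nn_integral_add)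
  finally show ?thesis .
qed

lemma L2_norm_sq_cmult:
  assumes [measurable]: "f \<in> borel_measurable M"
  shows "L2_norm_sq M (\<lambda>x. c * f x) = ennreal (c\<^sup>2) * L2_norm_sq M f"
  unfolding L2_norm_sq_def by (simp add: power_mult_distrib ennreal_mult' nn_integral_cmult)

lemma L2_norm_sq_eq_integral:
  assumes "integrable M (\<lambda>x. (f x)\<^sup>2)"
  shows "L2_norm_sq M f = ennreal (\<integral>x. (f x)\<^sup>2 \<partial>M)"
  unfolding L2_norm_sq_def using assms by (intro nn_integral_eq_integral) auto

lemma integrable_sq_of_L2_norm_sq:
  assumes "f \<in> borel_measurable M" "L2_norm_sq M f < \<infinity>"
  shows "integrable M (\<lambda>x. (f x)\<^sup>2)"
  using assms unfolding L2_norm_sq_def by (intro integrableI_nonneg) auto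

lemma integrable_mult_of_sq:
  fixes f g :: "'a \<Rightarrow> real"
  assumes [measurable]: "f \<in> borel_measurable M" "g \<in> borel_measurable M"
    and "integrable M (\<lambda>x. (f x)\<^sup>2)" "integrable M (\<lambda>x. (g x)\<^sup>2)"
  shows "integrable M (\<lambda>x. f x * g x)"
proof (rule Bochner_Integration.integrable_bound)
  show "integrable M (\<lambda>x. (f x)\<^sup>2 + (g x)\<^sup>2)" using assms by auto
  show "AE x in M. norm (f x * g x) \<le> norm ((f x)\<^sup>2 + (g x)\<^sup>2)"
  proof (rule AE_I2)
    fix x
    have "2 * \<bar>f x\<bar> * \<bar>g x\<bar> \<le> (f x)\<^sup>2 + (g x)\<^sup>2"
      using sum_squares_bound[of "\<bar>f x\<bar>" "\<bar>g x\<bar>"] by simp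
    moreover have "0 \<le> \<bar>f x\<bar> * \<bar>g x\<bar>" by simp
    ultimately have "\<bar>f x\<bar> * \<bar>g x\<bar> \<le> (f x)\<^sup>2 + (g x)\<^sup>2" by linarith
    then show "norm (f x * g x) \<le> norm ((f x)\<^sup>2 + (g x)\<^sup>2)"
      by (simp add: abs_mult)
  qed
qed auto

text \<open>
  By Young's inequality the error is at most \<open>(1 + 1/e) \<parallel>g - f\<^sub>n\<parallel>\<^sup>2 + e \<parallel>g\<parallel>\<^sup>2\<close> for every
  \<open>e > 0\<close>; \<open>n\<close> is sent to infinity before \<open>e\<close> is sent to zero.
\<close>

lemma integral_sq_tendsto:
  fixes f :: "nat \<Rightarrow> 'a \<Rightarrow> real"
  assumes [measurable]: "\<And>n. f n \<in> borel_measurable M" "g \<in> borel_measurable M"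
    and f2: "\<And>n. integrable M (\<lambda>x. (f n x)\<^sup>2)" and g2: "integrable M (\<lambda>x. (g x)\<^sup>2)"
    and lim: "(\<lambda>n. L2_norm_sq M (\<lambda>x. g x - f n x)) \<longlonglongrightarrow> 0"
  shows "(\<lambda>n. \<integral>x. (f n x)\<^sup>2 \<partial>M) \<longlonglongrightarrow> (\<integral>x. (g x)\<^sup>2 \<partial>M)"
proof -
  define d where "d = (\<lambda>n. \<integral>x. (g x - f n x)\<^sup>2 \<partial>M)"
  define G where "G = (\<integral>x. (g x)\<^sup>2 \<partial>M)"
  have gf: "integrable M (\<lambda>x. g x * f n x)" for n
    using f2 g2 by (intro integrable_mult_of_sq) auto
  have d2: "integrable M (\<lambda>x. (g x - f n x)\<^sup>2)" for n
  proof -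
    have "integrable M (\<lambda>x. (g x)\<^sup>2 + (f n x)\<^sup>2 - 2 * (g x * f n x))"
      using f2[of n] g2 gf[of n] by (intro Bochner_Integration.integrable_diff Bochner_Integration.integrable_add integrable_mult_right) auto
    then show ?thesis by (simp add: power2_diff mult.assoc)
  qed
  have "(\<lambda>n. ennreal (d n)) \<longlonglongrightarrow> ennreal 0"
    using lim L2_norm_sq_eq_integral[OF d2] unfolding d_def by simp
  moreover have "eventually (\<lambda>n. 0 \<le> d n) sequentially"
    by (auto simp: d_def)
  ultimately have d0: "d \<longlonglongrightarrow> 0" by (subst (asm) tendsto_ennreal_iff) auto
  have G0: "0 \<le> G" unfolding G_def by simp
  have bound: "\<bar>(\<integral>x. (f n x)\<^sup>2 \<partial>M) - G\<bar> \<le> (1 + 1/e) * d n + e * G" if "0 < e" for n e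
  proof -
    have pt: "\<bar>(f n x)\<^sup>2 - (g x)\<^sup>2\<bar> \<le> (1 + 1/e) * (g x - f n x)\<^sup>2 + e * (g x)\<^sup>2" for x
    proof -
      have young: "2 * \<bar>u * v\<bar> \<le> u\<^sup>2 / e + e * v\<^sup>2" for u v :: real
      proof -
        have "0 \<le> (u / sqrt e - sqrt e * v)\<^sup>2" "0 \<le> (u / sqrt e + sqrt e * v)\<^sup>2" by auto
        moreover have "(u / sqrt e - sqrt e * v)\<^sup>2 = u\<^sup>2 / e + e * v\<^sup>2 - 2 * (u * v)"
          "(u / sqrt e + sqrt e * v)\<^sup>2 = u\<^sup>2 / e + e * v\<^sup>2 + 2 * (u * v)"
          using that by (auto simp: power2_diff power2_sum power_divide power_mult_distrib)
        ultimately show ?thesis by linarith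
      qed
      have "(f n x)\<^sup>2 - (g x)\<^sup>2 = (g x - f n x)\<^sup>2 - 2 * ((g x - f n x) * g x)"
        by (simp add: power2_eq_square algebra_simps)
      then have "\<bar>(f n x)\<^sup>2 - (g x)\<^sup>2\<bar> \<le> (g x - f n x)\<^sup>2 + 2 * \<bar>(g x - f n x) * g x\<bar>"
        using zero_le_power2[of "g x - f n x"] by linarith
      also have "\<dots> \<le> (1 + 1/e) * (g x - f n x)\<^sup>2 + e * (g x)\<^sup>2"
        using young[of "g x - f n x" "g x"] by (simp add: distrib_right)
      finally show ?thesis .
    qed
    have "\<bar>(\<integral>x. (f n x)\<^sup>2 \<partial>M) - G\<bar> = \<bar>\<integral>x. (f n x)\<^sup>2 - (g x)\<^sup>2 \<partial>M\<bar>"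
      unfolding G_def using f2 g2 by (subst Bochner_Integration.integral_diff) auto
    also have "\<dots> \<le> (\<integral>x. \<bar>(f n x)\<^sup>2 - (g x)\<^sup>2\<bar> \<partial>M)" by (rule integral_abs_bound)
    also have "\<dots> \<le> (\<integral>x. (1 + 1/e) * (g x - f n x)\<^sup>2 + e * (g x)\<^sup>2 \<partial>M)"
      using f2 g2 d2 pt by (intro integral_mono) auto
    also have "\<dots> = (1 + 1/e) * d n + e * G"
      unfolding d_def G_def using d2 g2 by simp
    finally show ?thesis .
  qed
  show ?thesis unfolding G_def[symmetric]
  proof (rule LIMSEQ_I)
    fix r :: real assume r: "0 < r"
    define e where "e = r / (2 * (G + 1))"
    have e: "0 < e" "e * G < r / 2" using r G0 by (auto simp: e_def field_simps)
    have "(\<lambda>n. (1 + 1/e) * d n) \<longlonglongrightarrow> (1 + 1/e) * 0" by (intro tendsto_intros d0)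
    then have "eventually (\<lambda>n. (1 + 1/e) * d n < r / 2) sequentially"
      using r by (intro order_tendstoD(2)) auto
    then obtain n0 where "\<And>n. n \<ge> n0 \<Longrightarrow> (1 + 1/e) * d n < r / 2"
      by (auto simp: eventually_sequentially)
    then show "\<exists>no. \<forall>n\<ge>no. norm ((\<integral>x. (f n x)\<^sup>2 \<partial>M) - G) < r"
      using bound[OF e(1)] e(2) by (intro exI[of _ n0]) (smt (verit) real_norm_def field_sum_of_halves)
  qed
qed

text \<open>
  Polarisation of \<open>integral_sq_tendsto\<close>.
\<close>

lemma integral_mult_tendsto:
  fixes f :: "nat \<Rightarrow> 'a \<Rightarrow> real"
  assumes [measurable]: "\<And>n. f n \<in> borel_measurable M" "g \<in> borel_measurable M" "h \<in> borel_measurable M"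
    and f2: "\<And>n. integrable M (\<lambda>x. (f n x)\<^sup>2)" and g2: "integrable M (\<lambda>x. (g x)\<^sup>2)"
    and h2: "integrable M (\<lambda>x. (h x)\<^sup>2)"
    and lim: "(\<lambda>n. L2_norm_sq M (\<lambda>x. g x - f n x)) \<longlonglongrightarrow> 0"
  shows "(\<lambda>n. \<integral>x. f n x * h x \<partial>M) \<longlonglongrightarrow> (\<integral>x. g x * h x \<partial>M)"
proof -
  have fh: "integrable M (\<lambda>x. f n x * h x)" for n
    using f2 h2 by (intro integrable_mult_of_sq) auto
  have gh: "integrable M (\<lambda>x. g x * h x)"
    using g2 h2 by (intro integrable_mult_of_sq) auto
  have fe: "(f n x + h x)\<^sup>2 = (f n x)\<^sup>2 + (h x)\<^sup>2 + 2 * (f n x * h x)" for n x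
    by (simp add: power2_sum)
  have ge: "(g x + h x)\<^sup>2 = (g x)\<^sup>2 + (h x)\<^sup>2 + 2 * (g x * h x)" for x
    by (simp add: power2_sum)
  have "(\<lambda>n. \<integral>x. (f n x + h x)\<^sup>2 \<partial>M) \<longlonglongrightarrow> (\<integral>x. (g x + h x)\<^sup>2 \<partial>M)"
    using lim by (intro integral_sq_tendsto) (auto simp: fe ge fh gh f2 g2 h2)
  moreover have "(\<lambda>n. \<integral>x. (f n x)\<^sup>2 \<partial>M) \<longlonglongrightarrow> (\<integral>x. (g x)\<^sup>2 \<partial>M)"
    by (intro integral_sq_tendsto lim f2 g2) auto
  ultimately have "(\<lambda>n. ((\<integral>x. (f n x + h x)\<^sup>2 \<partial>M) - (\<integral>x. (f n x)\<^sup>2 \<partial>M) - (\<integral>x. (h x)\<^sup>2 \<partial>M)) / 2)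
     \<longlonglongrightarrow> ((\<integral>x. (g x + h x)\<^sup>2 \<partial>M) - (\<integral>x. (g x)\<^sup>2 \<partial>M) - (\<integral>x. (h x)\<^sup>2 \<partial>M)) / 2"
    by (intro tendsto_intros) auto
  then show ?thesis by (simp add: fe ge fh gh f2 g2 h2)
qed

text \<open>
  Fatou's lemma along an almost surely convergent subsequence.  Upper bounds on exponential moments
  survive \<open>L\<^sup>2\<close> limits without any uniform integrability; for this reason the noise is described
  throughout by such bounds and not by its law.
\<close>

lemma exp_moment_L2_limit:
  fixes X :: "nat \<Rightarrow> 'a \<Rightarrow> real"
  assumes [measurable]: "\<And>n. X n \<in> borel_measurable P" "I \<in> borel_measurable P"
    and lim: "(\<lambda>n. L2_norm_sq P (\<lambda>\<omega>. I \<omega> - X n \<omega>)) \<longlonglongrightarrow> 0"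
    and bound: "\<And>n. (\<integral>\<^sup>+\<omega>. ennreal (exp (X n \<omega>)) \<partial>P) \<le> ennreal (exp (s n))"
    and s: "s \<longlonglongrightarrow> t"
  shows "(\<integral>\<^sup>+\<omega>. ennreal (exp (I \<omega>)) \<partial>P) \<le> ennreal (exp t)"
proof -
  have "eventually (\<lambda>n. L2_norm_sq P (\<lambda>\<omega>. I \<omega> - X n \<omega>) < \<infinity>) sequentially"
    using lim by (rule order_tendstoD) auto
  then obtain k where "\<forall>n\<ge>k. L2_norm_sq P (\<lambda>\<omega>. I \<omega> - X n \<omega>) < \<infinity>"
    by (auto simp: eventually_sequentially)
  then have k: "\<And>n. L2_norm_sq P (\<lambda>\<omega>. I \<omega> - X (n + k) \<omega>) < \<infinity>"
    by simp
  define u where "u n \<omega> = (I \<omega> - X (n + k) \<omega>)\<^sup>2" for n \<omega>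
  have ui: "integrable P (u n)" for n
    unfolding u_def using k by (intro integrable_sq_of_L2_norm_sq) auto
  have "(\<lambda>n. ennreal (\<integral>\<omega>. norm (u n \<omega>) \<partial>P)) \<longlonglongrightarrow> ennreal 0"
    using LIMSEQ_ignore_initial_segment[OF lim, of k] L2_norm_sq_eq_integral[OF ui[unfolded u_def]]
    by (simp add: u_def)
  then have "(\<lambda>n. \<integral>\<omega>. norm (u n \<omega>) \<partial>P) \<longlonglongrightarrow> 0"
    by (subst (asm) tendsto_ennreal_iff) auto
  then obtain r :: "nat \<Rightarrow> nat" where r: "strict_mono r" "AE \<omega> in P. (\<lambda>n. u (r n) \<omega>) \<longlonglongrightarrow> 0"
    using tendsto_L1_AE_subseq[of P u] ui by blast
  define Y where "Y n = X (r n + k)" for n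
  have Ym[measurable]: "Y n \<in> borel_measurable P" for n unfolding Y_def by simp
  have "AE \<omega> in P. (\<lambda>n. exp (Y n \<omega>)) \<longlonglongrightarrow> exp (I \<omega>)"
    using r(2)
  proof eventually_elim
    case (elim \<omega>)
    then have "(\<lambda>n. sqrt (u (r n) \<omega>)) \<longlonglongrightarrow> sqrt 0" by (intro tendsto_intros)
    then have "(\<lambda>n. I \<omega> - Y n \<omega>) \<longlonglongrightarrow> 0"
      by (simp add: u_def Y_def tendsto_rabs_zero_iff)
    then have "(\<lambda>n. I \<omega> - (I \<omega> - Y n \<omega>)) \<longlonglongrightarrow> I \<omega> - 0" by (intro tendsto_intros)
    then show ?case by (intro tendsto_intros) simp
  qed
  then have "AE \<omega> in P. ennreal (exp (I \<omega>)) = liminf (\<lambda>n. ennreal (exp (Y n \<omega>)))"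
    by eventually_elim (auto intro!: lim_imp_Liminf[symmetric] tendsto_ennrealI)
  then have "(\<integral>\<^sup>+\<omega>. ennreal (exp (I \<omega>)) \<partial>P) = (\<integral>\<^sup>+\<omega>. liminf (\<lambda>n. ennreal (exp (Y n \<omega>))) \<partial>P)"
    by (rule nn_integral_cong_AE)
  also have "\<dots> \<le> liminf (\<lambda>n. \<integral>\<^sup>+\<omega>. ennreal (exp (Y n \<omega>)) \<partial>P)"
    by (rule nn_integral_liminf) simp
  also have "\<dots> \<le> liminf (\<lambda>n. ennreal (exp (s (r n + k))))"
    unfolding Y_def by (intro Liminf_mono always_eventually allI bound)
  also have "\<dots> = ennreal (exp t)"
  proof (rule lim_imp_Liminf)
    have "(\<lambda>n. s (r n + k)) \<longlonglongrightarrow> t"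
      using LIMSEQ_subseq_LIMSEQ[OF LIMSEQ_ignore_initial_segment[OF s, of k] r(1)]
      by (simp add: o_def)
    then show "(\<lambda>n. ennreal (exp (s (r n + k)))) \<longlonglongrightarrow> ennreal (exp t)"
      by (intro tendsto_intros tendsto_ennrealI)
  qed simp
  finally show ?thesis .
qed

section \<open>The Abel kernel\<close>

lemma nn_integral_Icc_of_has_integral:
  fixes f :: "real \<Rightarrow> real"
  assumes [measurable]: "f \<in> borel_measurable borel" and nonneg: "\<And>x. x \<in> {a..b} \<Longrightarrow> 0 \<le> f x"
    and int: "(f has_integral I) {a..b}"
  shows "(\<integral>\<^sup>+x. ennreal (f x) * indicator {a..b} x \<partial>lborel) = ennreal I"
proof -
  have "(\<integral>\<^sup>+x. ennreal (f x * indicator {a..b} x) \<partial>lborel) = ennreal I"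
  proof (rule nn_integral_has_integral_lborel)
    show "((\<lambda>x. f x * indicator {a..b} x) has_integral I) UNIV"
    proof -
      have "(\<lambda>x. f x * indicator {a..b} x) = (\<lambda>x. if x \<in> {a..b} then f x else 0)"
        by (auto simp: indicator_def)
      then show ?thesis using int has_integral_restrict_UNIV[of "{a..b}" f I] by simp
    qed
  qed (auto simp: nonneg indicator_def)
  moreover have "(\<integral>\<^sup>+x. ennreal (f x) * indicator {a..b} x \<partial>lborel) = (\<integral>\<^sup>+x. ennreal (f x * indicator {a..b} x) \<partial>lborel)"
    by (intro nn_integral_cong) (auto simp: indicator_def)
  ultimately show ?thesis by simp
qed

lemma Beta_real_positive:
  fixes p q :: real
  assumes "0 < p" "0 < q"
  shows "0 < Beta p q"
  using assms by (simp add: Beta_def Gamma_real_pos)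

lemma nn_integral_Beta_interval:
  fixes p q r t :: real
  assumes "0 < p" "0 < q" "r < t"
  shows "(\<integral>\<^sup>+u. ennreal ((u - r) powr (p - 1) * (t - u) powr (q - 1)) * indicator {r..t} u \<partial>lborel)
    = ennreal ((t - r) powr (p + q - 1) * Beta p q)"
proof -
  have B: "(\<integral>\<^sup>+x. ennreal (x powr (p - 1) * (1 - x) powr (q - 1)) * indicator {0..1} x \<partial>lborel) = ennreal (Beta p q)"
    using assms by (intro nn_integral_Icc_of_has_integral has_integral_Beta_real) auto
  let ?c = "t - r"
  have "(\<integral>\<^sup>+u. ennreal ((u - r) powr (p - 1) * (t - u) powr (q - 1)) * indicator {r..t} u \<partial>lborel)
    = ennreal ?c * (\<integral>\<^sup>+x. ennreal (((r + ?c * x) - r) powr (p - 1) * (t - (r + ?c * x)) powr (q - 1)) * indicator {r..t} (r + ?c * x) \<partial>lborel)"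
    using assms by (subst nn_integral_real_affine[where c="t - r" and t=r]) auto
  also have "\<dots> = ennreal ?c * (\<integral>\<^sup>+x. ennreal (?c powr (p + q - 2)) * (ennreal (x powr (p - 1) * (1 - x) powr (q - 1)) * indicator {0..1} x) \<partial>lborel)"
  proof (rule arg_cong2[where f="(*)"], rule refl, rule nn_integral_cong)
    fix x :: real
    have ind: "indicator {r..t} (r + ?c * x) = (indicator {0..1} x :: ennreal)"
    proof -
      have "r \<le> r + ?c * x \<longleftrightarrow> 0 \<le> x" using assms by (simp add: zero_le_mult_iff)
      moreover have "r + ?c * x \<le> t \<longleftrightarrow> ?c * x \<le> ?c * 1" by (simp add: algebra_simps)
      then have "r + ?c * x \<le> t \<longleftrightarrow> x \<le> 1" using assms by (subst (asm) mult_le_cancel_left_pos) auto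
      ultimately show ?thesis by (simp add: indicator_def)
    qed
    have e: "(r + ?c * x) - r = ?c * x" "t - (r + ?c * x) = ?c * (1 - x)" by (auto simp: algebra_simps)
    have "?c powr (p - 1) * ?c powr (q - 1) = ?c powr (p + q - 2)" by (simp flip: powr_add)
    then have "((r + ?c * x) - r) powr (p - 1) * (t - (r + ?c * x)) powr (q - 1) = ?c powr (p + q - 2) * (x powr (p - 1) * (1 - x) powr (q - 1))" if "x \<in> {0..1}"
      using assms that unfolding e by (simp add: powr_mult ac_simps)
    then have "ennreal (((r + ?c * x) - r) powr (p - 1) * (t - (r + ?c * x)) powr (q - 1)) = ennreal (?c powr (p + q - 2)) * ennreal (x powr (p - 1) * (1 - x) powr (q - 1))" if "x \<in> {0..1}"
      using that by (subst ennreal_mult'[symmetric]) auto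
    then show "ennreal (((r + ?c * x) - r) powr (p - 1) * (t - (r + ?c * x)) powr (q - 1)) * indicator {r..t} (r + ?c * x)
      = ennreal (?c powr (p + q - 2)) * (ennreal (x powr (p - 1) * (1 - x) powr (q - 1)) * indicator {0..1} x)"
      unfolding ind by (cases "x \<in> {0..1}") (simp_all only: indicator_simps mult_1_right mult_zero_right simp_thms)
  qed
  also have "\<dots> = ennreal ?c * (ennreal (?c powr (p + q - 2)) * ennreal (Beta p q))"
    by (subst nn_integral_cmult) (auto simp: B)
  also have "\<dots> = ennreal (?c powr 1 * ?c powr (p + q - 2) * Beta p q)"
    using assms by (simp add: ennreal_mult' mult.assoc)
  also have "?c powr 1 * ?c powr (p + q - 2) = ?c powr (p + q - 1)"
    by (subst powr_add[symmetric]) simp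
  finally show ?thesis .
qed

text \<open>
  For \<open>a = H - 1/2\<close> this is, up to a constant factor, the derivative in \<open>u\<close> of the Volterra kernel
  that represents fractional Brownian motion on an interval as an integral over Brownian motion.
\<close>

definition abel_kernel :: "real \<Rightarrow> real \<Rightarrow> real \<Rightarrow> real" where
  "abel_kernel a r u = (if 0 < r \<and> r < u then r powr (-a) * u powr a * (u - r) powr (a - 1) else 0)"

lemma abel_kernel_nonneg: "0 \<le> abel_kernel a r u"
  by (simp add: abel_kernel_def)

lemma measurable_abel_kernel[measurable]:
  "(\<lambda>x. abel_kernel a (f x) (g x)) \<in> borel_measurable M"
  if [measurable]: "f \<in> borel_measurable M" "g \<in> borel_measurable M"
  unfolding abel_kernel_def by measurable

text \<open>
  The substitution \<open>r = u v y / (v - u + u y)\<close> maps \<open>(0,1)\<close> onto \<open>(0,u)\<close>.  All powers of \<open>u\<close>, \<open>v\<close> and of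
  the denominator cancel, and a Beta integral in \<open>y\<close> remains.
\<close>

lemma abel_kernel_convolution_less:
  assumes a: "0 < a" "a < 1/2" and uv: "0 < u" "u < v"
  shows "(\<integral>\<^sup>+r. ennreal (abel_kernel a r u * abel_kernel a r v) \<partial>lborel) = ennreal (Beta a (1 - 2*a) * (v - u) powr (2*a - 1))"
proof -
  let ?g = "\<lambda>y. u * v * y / (v - u + u * y)"
  let ?g' = "\<lambda>y. u * v * (v - u) / (v - u + u * y)\<^sup>2"
  let ?f = "\<lambda>r. abel_kernel a r u * abel_kernel a r v"
  have D: "0 < v - u + u * y" if "0 \<le> y" for y using uv that by (simp add: add_pos_nonneg)
  have "(\<integral>\<^sup>+r. ennreal (?f r) \<partial>lborel) = (\<integral>\<^sup>+r. ?f r * indicator {?g 0..?g 1} r \<partial>lborel)"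
    using uv by (intro nn_integral_cong) (auto simp: abel_kernel_def indicator_def)
  also have "\<dots> = (\<integral>\<^sup>+y. ?f (?g y) * ?g' y * indicator {0..1} y \<partial>lborel)"
  proof (rule nn_integral_substitution)
    show "set_borel_measurable borel {?g 0..?g 1} ?f" unfolding set_borel_measurable_def by measurable
    fix y :: real assume y: "y \<in> {0..1}"
    show "(?g has_real_derivative ?g' y) (at y)"
      using D[of y] y by (auto intro!: derivative_eq_intros simp: power2_eq_square field_simps)
    show "0 \<le> ?g' y" using uv by simp
  next
    show "continuous_on {0..1} ?g'" using D by (intro continuous_intros) (auto simp: less_imp_neq[symmetric])
  qed simp
  also have "\<dots> = (\<integral>\<^sup>+y. ennreal ((v - u) powr (2*a - 1)) * (ennreal ((y - 0) powr ((1 - 2*a) - 1) * (1 - y) powr (a - 1)) * indicator {0..1} y) \<partial>lborel)"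
  proof (rule nn_integral_cong_AE)
    have "AE y in lborel. y \<noteq> (0::real)" "AE y in lborel. y \<noteq> (1::real)" by (auto intro: AE_lborel_singleton)
    then show "AE y in lborel. ennreal (?f (?g y) * ?g' y * indicator {0..1} y) = ennreal ((v - u) powr (2*a - 1)) * (ennreal ((y - 0) powr ((1 - 2*a) - 1) * (1 - y) powr (a - 1)) * indicator {0..1} y)"
    proof eventually_elim
      case (elim y)
      show ?case
      proof (cases "y \<in> {0..1}")
        case True
        with elim have y: "0 < y" "y < 1" by auto
        define w where "w = v - u + u * y"
        have w: "0 < w" using D[of y] y by (simp add: w_def)
        have m2: "?g y = u * v * y / w" by (simp add: w_def)
        have "u * w - u * v * y = u * (v - u) * (1 - y)" "v * w - u * v * y = v * (v - u)"
          by (simp_all add: w_def algebra_simps)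
        moreover have "u - ?g y = (u * w - u * v * y) / w" "v - ?g y = (v * w - u * v * y) / w"
          unfolding m2 using w by (simp_all add: diff_divide_distrib)
        ultimately have m: "u - ?g y = u * (v - u) * (1 - y) / w" "v - ?g y = v * (v - u) / w"
          by simp_all
        have "0 < ?g y" unfolding m2 using uv y w by simp
        moreover have "0 < u - ?g y" "0 < v - ?g y" unfolding m using uv y w by simp_all
        ultimately have pos: "0 < ?g y" "?g y < u" "?g y < v" by linarith+
        have "?f (?g y) * ?g' y = (?g y powr (-a) * u powr a * (u - ?g y) powr (a-1)) * (?g y powr (-a) * v powr a * (v - ?g y) powr (a - 1)) * ?g' y"
          using pos by (simp add: abel_kernel_def)
        \<comment> \<open>In logarithms the cancellation of the powers is a linear identity.\<close>
        also have "\<dots> = exp (2 * (-a) * (ln u + ln v + ln y - ln w) + a * ln u + a * ln v + (a - 1) * (ln u + ln (v - u) + ln (1 - y) - ln w) + (a - 1) * (ln v + ln (v - u) - ln w) + (ln u + ln v + ln (v - u) - 2 * ln w))"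
        proof -
          have "?g' y = exp (ln u + ln v + ln (v - u) - 2 * ln w)"
            using uv w unfolding w_def[symmetric] by (simp add: exp_add exp_diff exp_double)
          moreover have "?g y powr (-a) = exp ((-a) * (ln u + ln v + ln y - ln w))"
            unfolding m2 powr_def using uv w y by (simp add: ln_mult ln_div)
          moreover have "(u - ?g y) powr (a - 1) = exp ((a - 1) * (ln u + ln (v - u) + ln (1 - y) - ln w))"
            unfolding m powr_def using uv w y by (simp add: ln_mult ln_div)
          moreover have "(v - ?g y) powr (a - 1) = exp ((a - 1) * (ln v + ln (v - u) - ln w))"
            unfolding m powr_def using uv w y by (simp add: ln_mult ln_div)
          moreover have "u powr a = exp (a * ln u)" "v powr a = exp (a * ln v)" using uv by (auto simp: powr_def)
          ultimately show ?thesis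
            by (simp only: exp_add[symmetric]) (rule arg_cong[where f=exp], simp add: algebra_simps)
        qed
        also have "\<dots> = exp ((2*a - 1) * ln (v - u) + (- 2*a) * ln y + (a - 1) * ln (1 - y))"
          by (rule arg_cong[where f=exp]) (simp add: algebra_simps)
        also have "\<dots> = (v - u) powr (2*a - 1) * (y powr (- 2*a) * (1 - y) powr (a - 1))"
          using uv y by (simp add: powr_def exp_add exp_diff exp_minus divide_inverse)
        finally show ?thesis using y by (simp add: ennreal_mult' del: mult_minus_left)
      qed simp
    qed
  qed
  also have "\<dots> = ennreal ((v - u) powr (2*a - 1)) * ennreal ((1 - 0) powr (1 - 2*a + a - 1) * Beta (1 - 2*a) a)"
    using a by (subst nn_integral_cmult) (auto simp: nn_integral_Beta_interval[of "1 - 2*a" a 0 1, simplified])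
  also have "\<dots> = ennreal (Beta a (1 - 2*a) * (v - u) powr (2*a - 1))"
    using Beta_real_positive[of a "1 - 2*a"] a by (simp add: Beta_commute mult.commute ennreal_mult)
  finally show ?thesis .
qed

lemma abel_kernel_convolution:
  assumes a: "0 < a" "a < 1/2" and uv: "0 < u" "0 < v" "u \<noteq> v"
  shows "(\<integral>\<^sup>+r. ennreal (abel_kernel a r u * abel_kernel a r v) \<partial>lborel) = ennreal (Beta a (1 - 2*a) * \<bar>u - v\<bar> powr (2*a - 1))"
proof (cases "u < v")
  case True
  then show ?thesis using abel_kernel_convolution_less[OF a uv(1) True] by (simp add: abs_minus_commute)
next
  case False
  then have "v < u" using uv by simp
  then show ?thesis using abel_kernel_convolution_less[OF a uv(2) \<open>v < u\<close>] by (simp add: mult.commute)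
qed

text \<open>
  Tonelli's theorem; the diagonal and the axes, where \<open>abel_kernel_convolution\<close> says nothing, are null
  sets.
\<close>

lemma abel_kernel_energy:
  fixes F G :: "real \<Rightarrow> ennreal"
  assumes a: "0 < a" "a < 1/2" and [measurable]: "F \<in> borel_measurable borel" "G \<in> borel_measurable borel"
    and supp: "\<And>u. u < 0 \<Longrightarrow> F u = 0" "\<And>u. u < 0 \<Longrightarrow> G u = 0"
  shows "(\<integral>\<^sup>+r. (\<integral>\<^sup>+u. F u * abel_kernel a r u \<partial>lborel) * (\<integral>\<^sup>+v. G v * abel_kernel a r v \<partial>lborel) \<partial>lborel)
    = ennreal (Beta a (1 - 2*a)) * (\<integral>\<^sup>+u. (\<integral>\<^sup>+v. F u * G v * ennreal (\<bar>u - v\<bar> powr (2*a - 1)) \<partial>lborel) \<partial>lborel)"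
proof -
  have "(\<integral>\<^sup>+r. (\<integral>\<^sup>+u. F u * abel_kernel a r u \<partial>lborel) * (\<integral>\<^sup>+v. G v * abel_kernel a r v \<partial>lborel) \<partial>lborel)
     = (\<integral>\<^sup>+r. (\<integral>\<^sup>+u. (\<integral>\<^sup>+v. F u * abel_kernel a r u * (G v * abel_kernel a r v) \<partial>lborel) \<partial>lborel) \<partial>lborel)"
    by (simp add: nn_integral_cmult nn_integral_multc)
  also have "\<dots> = (\<integral>\<^sup>+u. (\<integral>\<^sup>+r. (\<integral>\<^sup>+v. F u * abel_kernel a r u * (G v * abel_kernel a r v) \<partial>lborel) \<partial>lborel) \<partial>lborel)"
    by (rule lborel_pair.Fubini') measurable
  also have "\<dots> = (\<integral>\<^sup>+u. (\<integral>\<^sup>+v. (\<integral>\<^sup>+r. F u * abel_kernel a r u * (G v * abel_kernel a r v) \<partial>lborel) \<partial>lborel) \<partial>lborel)"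
    by (intro nn_integral_cong lborel_pair.Fubini') measurable
  also have "\<dots> = (\<integral>\<^sup>+u. (\<integral>\<^sup>+v. F u * G v * (\<integral>\<^sup>+r. ennreal (abel_kernel a r u * abel_kernel a r v) \<partial>lborel) \<partial>lborel) \<partial>lborel)"
    by (intro nn_integral_cong) (auto simp: nn_integral_cmult[symmetric] ennreal_mult' abel_kernel_nonneg ac_simps intro!: nn_integral_cong)
  also have "\<dots> = (\<integral>\<^sup>+u. (\<integral>\<^sup>+v. ennreal (Beta a (1 - 2*a)) * (F u * G v * ennreal (\<bar>u - v\<bar> powr (2*a - 1))) \<partial>lborel) \<partial>lborel)"
  proof (intro nn_integral_cong_AE)
    have "AE u in lborel. u \<noteq> (0::real)" by (rule AE_lborel_singleton)
    then show "AE u in lborel. (\<integral>\<^sup>+v. F u * G v * (\<integral>\<^sup>+r. ennreal (abel_kernel a r u * abel_kernel a r v) \<partial>lborel) \<partial>lborel) = (\<integral>\<^sup>+v. ennreal (Beta a (1 - 2*a)) * (F u * G v * ennreal (\<bar>u - v\<bar> powr (2*a - 1))) \<partial>lborel)"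
    proof eventually_elim
      case (elim u)
      show ?case
      proof (rule nn_integral_cong_AE)
        have "AE v in lborel. v \<noteq> (0::real)" "AE v in lborel. v \<noteq> u" by (auto intro: AE_lborel_singleton)
        then show "AE v in lborel. F u * G v * (\<integral>\<^sup>+r. ennreal (abel_kernel a r u * abel_kernel a r v) \<partial>lborel) = ennreal (Beta a (1 - 2*a)) * (F u * G v * ennreal (\<bar>u - v\<bar> powr (2*a - 1)))"
        proof eventually_elim
          case (elim v)
          consider "u < 0" | "v < 0" | "0 < u" "0 < v" using elim \<open>u \<noteq> 0\<close> by linarith
          then show ?case
          proof cases
            case 3
            then show ?thesis using elim a by (subst abel_kernel_convolution) (auto simp: ennreal_mult'' ac_simps)
          qed (auto simp: supp)
        qed
      qed
    qed
  qed
  also have "\<dots> = ennreal (Beta a (1 - 2*a)) * (\<integral>\<^sup>+u. (\<integral>\<^sup>+v. F u * G v * ennreal (\<bar>u - v\<bar> powr (2*a - 1)) \<partial>lborel) \<partial>lborel)"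
    by (simp add: nn_integral_cmult)
  finally show ?thesis .
qed

lemma nn_integral_powr_left:
  assumes "0 < q" "0 \<le> x"
  shows "(\<integral>\<^sup>+v. ennreal ((x - v) powr (q - 1)) * indicator {0..x} v \<partial>lborel) = ennreal (x powr q / q)"
proof -
  have "(\<integral>\<^sup>+v. ennreal ((x - v) powr (q - 1)) * indicator {0..x} v \<partial>lborel) = (\<integral>\<^sup>+v. ennreal (v powr (q - 1)) * indicator {0..x} v \<partial>lborel)"
    by (subst nn_integral_real_affine[where c="-1" and t=x]) (auto intro!: nn_integral_cong simp: indicator_def)
  also have "\<dots> = ennreal (x powr (q - 1 + 1) / (q - 1 + 1))"
    using assms by (intro nn_integral_Icc_of_has_integral has_integral_powr_from_0) auto
  finally show ?thesis by simp
qed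

lemma nn_integral_powr_right:
  assumes "0 < q" "x \<le> t"
  shows "(\<integral>\<^sup>+v. ennreal ((v - x) powr (q - 1)) * indicator {x..t} v \<partial>lborel) = ennreal ((t - x) powr q / q)"
proof -
  have "(\<integral>\<^sup>+v. ennreal ((v - x) powr (q - 1)) * indicator {x..t} v \<partial>lborel) = (\<integral>\<^sup>+v. ennreal (v powr (q - 1)) * indicator {0..t - x} v \<partial>lborel)"
    by (subst nn_integral_real_affine[where c="1" and t=x]) (auto intro!: nn_integral_cong simp: indicator_def)
  also have "\<dots> = ennreal ((t - x) powr (q - 1 + 1) / (q - 1 + 1))"
    using assms by (intro nn_integral_Icc_of_has_integral has_integral_powr_from_0) auto
  finally show ?thesis by simp
qed

text \<open>
  With \<open>2 * a + 1 = 2 * H\<close> the numerator is twice the covariance of fractional Brownian motion, so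
  that its covariance is an energy with respect to the kernel \<open>\<bar>u - v\<bar> powr (2 * H - 2)\<close>.
\<close>

lemma fbm_covariance_as_energy:
  assumes a: "0 < a" and st: "0 \<le> s" "s \<le> t"
  shows "(\<integral>\<^sup>+u. (\<integral>\<^sup>+v. indicator {0..s} u * indicator {0..t} v * ennreal (\<bar>u - v\<bar> powr (2*a - 1)) \<partial>lborel) \<partial>lborel)
    = ennreal ((s powr (2*a+1) + t powr (2*a+1) - (t - s) powr (2*a+1)) / (2*a * (2*a+1)))"
proof -
  have inner: "(\<integral>\<^sup>+v. indicator {0..s} u * indicator {0..t} v * ennreal (\<bar>u - v\<bar> powr (2*a - 1)) \<partial>lborel)
    = ennreal ((u powr (2*a) + (t - u) powr (2*a)) / (2*a)) * indicator {0..s} u" for u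
  proof (cases "u \<in> {0..s}")
    case True
    have "(\<integral>\<^sup>+v. indicator {0..t} v * ennreal (\<bar>u - v\<bar> powr (2*a - 1)) \<partial>lborel)
      = (\<integral>\<^sup>+v. ennreal ((u - v) powr (2*a - 1)) * indicator {0..u} v + ennreal ((v - u) powr (2*a - 1)) * indicator {u..t} v \<partial>lborel)"
      using True st by (intro nn_integral_cong) (auto simp: indicator_def)
    also have "\<dots> = ennreal (u powr (2*a) / (2*a)) + ennreal ((t - u) powr (2*a) / (2*a))"
      using nn_integral_powr_left[of "2*a" u] nn_integral_powr_right[of "2*a" u t] a True st
      by (simp add: nn_integral_add)
    finally show ?thesis using True a by (simp add: add_divide_distrib flip: ennreal_plus)
  qed simp
  have p: "((\<lambda>u. u powr (2*a)) has_integral c powr (2*a+1) / (2*a+1)) {0..c}" if "0 \<le> c" for c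
    using a that by (intro has_integral_powr_from_0) auto
  have r: "((\<lambda>u. (t - u) powr (2*a)) has_integral (t powr (2*a+1) - (t - s) powr (2*a+1)) / (2*a+1)) {0..s}"
  proof -
    have "((\<lambda>u. (t - u) powr (2*a)) has_integral (- ((t - s) powr (2*a+1) / (2*a+1))) - (- ((t - 0) powr (2*a+1) / (2*a+1)))) {0..s}"
    proof (rule fundamental_theorem_of_calculus_interior)
      show "continuous_on {0..s} (\<lambda>u. - ((t - u) powr (2*a+1) / (2*a+1)))"
        using st a by (intro continuous_on_minus continuous_on_divide continuous_on_powr' continuous_intros) auto
      fix u
      show "u \<in> {0<..<s} \<Longrightarrow> ((\<lambda>u. - ((t - u) powr (2*a+1) / (2*a+1))) has_vector_derivative (t - u) powr (2*a)) (at u)"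
      proof -
        assume u: "u \<in> {0<..<s}"
        have "((\<lambda>u. (t - u) powr (2*a+1)) has_real_derivative - ((2*a+1) * (t - u) powr (2*a))) (at u)"
          using u st by (auto intro!: derivative_eq_intros)
        from DERIV_minus[OF DERIV_cdivide[OF this, of "2*a+1"]] show ?thesis
          unfolding has_real_derivative_iff_has_vector_derivative[symmetric] using a by simp
      qed
    qed (use st in auto)
    then show ?thesis by (simp add: diff_divide_distrib)
  qed
  have "(\<integral>\<^sup>+u. ennreal ((u powr (2*a) + (t - u) powr (2*a)) / (2*a)) * indicator {0..s} u \<partial>lborel)
    = ennreal ((s powr (2*a+1) / (2*a+1) + (t powr (2*a+1) - (t - s) powr (2*a+1)) / (2*a+1)) / (2*a))"
    using a st by (intro nn_integral_Icc_of_has_integral has_integral_divide has_integral_add p r) auto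
  moreover have "(s powr (2*a+1) / (2*a+1) + (t powr (2*a+1) - (t - s) powr (2*a+1)) / (2*a+1)) / (2*a)
    = (s powr (2*a+1) + t powr (2*a+1) - (t - s) powr (2*a+1)) / (2*a * (2*a+1))"
    by (simp add: add_divide_distrib diff_divide_distrib mult.commute)
  ultimately show ?thesis unfolding inner by simp
qed

section \<open>Step functions and step integrals\<close>

lemma space_lebesgue_Icc[simp]: "space (lebesgue_Icc T) = {0..T}"
  by (simp add: lebesgue_Icc_def space_restrict_space)

lemma measurable_lebesgue_Icc_iff:
  fixes f :: "real \<Rightarrow> real"
  shows "f \<in> borel_measurable (lebesgue_Icc T) \<longleftrightarrow> (\<lambda>x. f x * indicator {0..T} x) \<in> borel_measurable borel"
  unfolding lebesgue_Icc_def
  by (subst borel_measurable_restrict_space_iff) (auto simp: mult.commute)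

lemma nn_integral_lebesgue_Icc:
  "(\<integral>\<^sup>+x. f x \<partial>lebesgue_Icc T) = (\<integral>\<^sup>+x. f x * indicator {0..T} x \<partial>lborel)"
  unfolding lebesgue_Icc_def by (rule nn_integral_restrict_space) simp

definition abel_transform :: "real \<Rightarrow> real \<Rightarrow> (real \<Rightarrow> real) \<Rightarrow> real \<Rightarrow> real" where
  "abel_transform a T f r = (LINT u|lborel. f u * indicator {0..T} u * abel_kernel a r u)"

text \<open>
  The variance of a Wiener integral over fractional Brownian motion divided by the squared \<open>L\<^sup>2\<close> norm of
  the Abel transform of the integrand: \<open>H * (2 * H - 1)\<close> is the factor of the energy integral in the
  variance, and the Beta value is the one of \<open>abel_kernel_convolution\<close>.
\<close>

definition fbm_energy_const :: "real \<Rightarrow> real" where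
  "fbm_energy_const H = H * (2*H - 1) / Beta (H - 1/2) (2 - 2*H)"

text \<open>
  A step function is its own integral against the family of indicators \<open>{0<..t}\<close>, so that every
  identity for step integrals is also one for step functions.
\<close>

lemma step_fun_as_step_integral:
  assumes "step_list T xs"
  shows "step_fun xs s = step_integral xs (\<lambda>t s. indicator {0<..t} s) s"
  using assms
proof (induction xs)
  case (Cons x xs)
  obtain c u v where x: "x = (c, u, v)" by (cases x)
  then have "indicator {u<..v} s = (indicator {0<..v} s - indicator {0<..u} s :: real)"
    using Cons.prems by (auto simp: step_list_def indicator_def)
  then show ?case using Cons by (auto simp: x step_list_def step_fun_def step_integral_def)
qed (simp add: step_fun_def step_integral_def)

definition step_points :: "(real \<times> real \<times> real) list \<Rightarrow> real set" where
  "step_points xs = (\<Union>(a, u, v) \<in> set xs. {u, v})"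

definition step_coeff :: "(real \<times> real \<times> real) list \<Rightarrow> real \<Rightarrow> real" where
  "step_coeff xs t = (\<Sum>(a, u, v) \<leftarrow> xs. a * (of_bool (t = v) - of_bool (t = u)))"

lemma finite_step_points[simp]: "finite (step_points xs)"
  by (auto simp: step_points_def)

lemma step_points_subset: "step_list T xs \<Longrightarrow> step_points xs \<subseteq> {0..T}"
  by (force simp: step_points_def step_list_def)

text \<open>
  Collecting the increments by time points: Gaussianity, covariances and measurability are known for
  the values of a process, not for its increments over possibly overlapping intervals.
\<close>

lemma step_integral_eq_sum_superset:
  assumes "finite A" "step_points xs \<subseteq> A"
  shows "step_integral xs Y \<omega> = (\<Sum>t\<in>A. step_coeff xs t * Y t \<omega>)"
  using assms(2)
proof (induction xs)
  case (Cons x xs)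
  obtain c u v where x: "x = (c, u, v)" by (cases x)
  have uv: "u \<in> A" "v \<in> A" and "step_points xs \<subseteq> A" using Cons.prems by (auto simp: x step_points_def)
  then have IH: "step_integral xs Y \<omega> = (\<Sum>t\<in>A. step_coeff xs t * Y t \<omega>)" using Cons.IH by simp
  have "(\<Sum>t\<in>A. step_coeff (x # xs) t * Y t \<omega>)
     = (\<Sum>t\<in>A. c * (of_bool (t = v) * Y t \<omega>) - c * (of_bool (t = u) * Y t \<omega>) + step_coeff xs t * Y t \<omega>)"
    by (intro sum.cong) (auto simp: x step_coeff_def algebra_simps)
  also have "\<dots> = c * (\<Sum>t\<in>A. of_bool (t = v) * Y t \<omega>) - c * (\<Sum>t\<in>A. of_bool (t = u) * Y t \<omega>) + step_integral xs Y \<omega>"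
    by (simp add: sum.distrib sum_subtractf sum_distrib_left IH)
  also have "(\<Sum>t\<in>A. of_bool (t = v) * Y t \<omega>) = Y v \<omega>"
    using assms(1) uv by (subst sum.remove[of _ v]) (auto intro!: sum.neutral)
  also have "(\<Sum>t\<in>A. of_bool (t = u) * Y t \<omega>) = Y u \<omega>"
    using assms(1) uv by (subst sum.remove[of _ u]) (auto intro!: sum.neutral)
  finally show ?case by (simp add: x step_integral_def algebra_simps)
qed (simp add: step_integral_def step_coeff_def)

lemma step_integral_eq_sum:
  "step_integral xs Y \<omega> = (\<Sum>t\<in>step_points xs. step_coeff xs t * Y t \<omega>)"
  by (rule step_integral_eq_sum_superset) auto

lemma step_fun_eq_sum:
  assumes "step_list T xs"
  shows "step_fun xs s = (\<Sum>t\<in>step_points xs. step_coeff xs t * indicator {0<..t} s)"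
  unfolding step_fun_as_step_integral[OF assms] by (rule step_integral_eq_sum)

lemma measurable_step_fun[measurable]: "step_fun xs \<in> borel_measurable borel"
proof (induction xs)
  case (Cons x xs)
  obtain c u v where x: "x = (c, u, v)" by (cases x)
  have "step_fun (x # xs) = (\<lambda>s. c * indicator {u<..v} s + step_fun xs s)"
    by (auto simp: x step_fun_def)
  then show ?case using Cons by simp
qed (simp add: step_fun_def)

lemma measurable_step_integral:
  assumes "step_list T xs" "\<And>t. t \<in> {0..T} \<Longrightarrow> Y t \<in> borel_measurable P"
  shows "step_integral xs Y \<in> borel_measurable P"
proof -
  have "step_integral xs Y = (\<lambda>\<omega>. \<Sum>t\<in>step_points xs. step_coeff xs t * Y t \<omega>)"
    by (rule ext) (rule step_integral_eq_sum)
  moreover have "Y t \<in> borel_measurable P" if "t \<in> step_points xs" for t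
    using assms(2) step_points_subset[OF assms(1)] that by blast
  ultimately show ?thesis by simp
qed

section \<open>The Abel transform of integrands\<close>

locale hurst =
  fixes H T :: real
  assumes T: "0 < T" and H: "1/2 < H" "H < 1"
begin

abbreviation "a \<equiv> H - 1/2"
abbreviation "Lf \<equiv> abel_transform a T"

lemma a: "0 < a" "a < 1/2" using H by auto

lemma Beta_a_pos: "0 < Beta a (2 - 2*H)"
  using H by (intro Beta_real_positive) auto

lemma measurable_abel_transform[measurable]:
  assumes "f \<in> borel_measurable (lebesgue_Icc T)"
  shows "Lf f \<in> borel_measurable borel"
proof -
  have [measurable]: "(\<lambda>x. f x * indicator {0..T} x) \<in> borel_measurable borel"
    using assms measurable_lebesgue_Icc_iff by blast
  show ?thesis unfolding abel_transform_def by measurable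
qed

text \<open>
  The norm of integrands is the energy of \<open>\<bar>f\<bar>\<close>.  It therefore dominates the \<open>L\<^sup>2\<close> norm of the Abel
  transform of \<open>f\<close>, and it makes that transform absolutely convergent almost everywhere.
\<close>

lemma fbm_norm_sq_energy:
  assumes "f \<in> borel_measurable (lebesgue_Icc T)"
  shows "(\<integral>\<^sup>+r. (\<integral>\<^sup>+u. ennreal \<bar>f u * indicator {0..T} u * abel_kernel a r u\<bar> \<partial>lborel)\<^sup>2 \<partial>lborel)
    = ennreal (Beta a (2 - 2*H)) * fbm_norm_sq H T f"
proof -
  have [measurable]: "(\<lambda>x. f x * indicator {0..T} x) \<in> borel_measurable borel"
    using assms measurable_lebesgue_Icc_iff by blast
  let ?F = "\<lambda>u. ennreal \<bar>f u * indicator {0..T} u\<bar>"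
  have e: "1 - 2 * a = 2 - 2 * H" "2 * a - 1 = 2 * H - 2" by auto
  have "(\<integral>\<^sup>+r. (\<integral>\<^sup>+u. ennreal \<bar>f u * indicator {0..T} u * abel_kernel a r u\<bar> \<partial>lborel)\<^sup>2 \<partial>lborel)
     = (\<integral>\<^sup>+r. (\<integral>\<^sup>+u. ?F u * abel_kernel a r u \<partial>lborel) * (\<integral>\<^sup>+v. ?F v * abel_kernel a r v \<partial>lborel) \<partial>lborel)"
    by (simp add: power2_eq_square abs_mult ennreal_mult abel_kernel_nonneg)
  also have "\<dots> = ennreal (Beta a (1 - 2*a)) * (\<integral>\<^sup>+u. (\<integral>\<^sup>+v. ?F u * ?F v * ennreal (\<bar>u - v\<bar> powr (2*a - 1)) \<partial>lborel) \<partial>lborel)"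
    by (rule abel_kernel_energy[OF a]) simp_all
  also have "(\<integral>\<^sup>+u. (\<integral>\<^sup>+v. ?F u * ?F v * ennreal (\<bar>u - v\<bar> powr (2*a - 1)) \<partial>lborel) \<partial>lborel) = fbm_norm_sq H T f"
    unfolding fbm_norm_sq_def nn_integral_lebesgue_Icc e
  proof (intro nn_integral_cong)
    fix u
    show "(\<integral>\<^sup>+v. ?F u * ?F v * ennreal (\<bar>u - v\<bar> powr (2 * H - 2)) \<partial>lborel) =
         (\<integral>\<^sup>+x. ennreal (\<bar>f u\<bar> * \<bar>f x\<bar> * \<bar>u - x\<bar> powr (2 * H - 2)) * indicator {0..T} x \<partial>lborel) * indicator {0..T} u"
    proof (cases "u \<in> {0..T}")
      case True
      then show ?thesis by (auto intro!: nn_integral_cong simp: indicator_def ennreal_mult)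
    qed simp
  qed
  finally show ?thesis unfolding e .
qed

text \<open>
  On the side of the Abel transform this is the inequality \<open>(x + y)\<^sup>2 \<le> 2 * (x\<^sup>2 + y\<^sup>2)\<close>; in the double
  integral that defines the norm it is hidden.
\<close>

lemma fbm_norm_sq_add_le:
  assumes "f \<in> borel_measurable (lebesgue_Icc T)" "g \<in> borel_measurable (lebesgue_Icc T)"
  shows "fbm_norm_sq H T (\<lambda>x. f x + g x) \<le> 2 * (fbm_norm_sq H T f + fbm_norm_sq H T g)"
proof -
  let ?B = "ennreal (Beta a (2 - 2*H))"
  have [measurable]: "(\<lambda>x. f x * indicator {0..T} x) \<in> borel_measurable borel"
      "(\<lambda>x. g x * indicator {0..T} x) \<in> borel_measurable borel"
    using assms measurable_lebesgue_Icc_iff by blast+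
  define A where "A f r = (\<integral>\<^sup>+u. ennreal \<bar>f u * indicator {0..T} u * abel_kernel a r u\<bar> \<partial>lborel)" for f :: "real \<Rightarrow> real" and r
  have m[measurable]: "A f \<in> borel_measurable lborel" "A g \<in> borel_measurable lborel" unfolding A_def by measurable
  have A_add: "A (\<lambda>x. f x + g x) r \<le> A f r + A g r" for r
  proof -
    have "A (\<lambda>x. f x + g x) r \<le> (\<integral>\<^sup>+u. ennreal \<bar>f u * indicator {0..T} u * abel_kernel a r u\<bar> + ennreal \<bar>g u * indicator {0..T} u * abel_kernel a r u\<bar> \<partial>lborel)"
      unfolding A_def by (intro nn_integral_mono) (auto simp flip: ennreal_plus simp: distrib_right intro!: ennreal_leI abs_triangle_ineq)
    also have "\<dots> = A f r + A g r" unfolding A_def by (rule nn_integral_add) measurable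
    finally show ?thesis .
  qed
  have sq: "(x + y)\<^sup>2 \<le> 2 * (x\<^sup>2 + y\<^sup>2)" for x y :: ennreal
  proof -
    have "(x + y)\<^sup>2 \<le> 2 * (x\<^sup>2 + y\<^sup>2)" if fin: "x \<noteq> \<top>" "y \<noteq> \<top>"
    proof -
      obtain p where p: "x = ennreal p" "0 \<le> p" using fin(1) by (cases x) auto
      obtain q where q: "y = ennreal q" "0 \<le> q" using fin(2) by (cases y) auto
      note pq = p q
      have "(p + q)\<^sup>2 \<le> 2 * (p\<^sup>2 + q\<^sup>2)" using sum_squares_bound[of p q] by (simp add: power2_sum)
      moreover have "(x + y)\<^sup>2 = ennreal ((p + q)\<^sup>2)"
        using pq by (simp add: ennreal_power flip: ennreal_plus)
      moreover have "2 * (x\<^sup>2 + y\<^sup>2) = ennreal (2 * (p\<^sup>2 + q\<^sup>2))"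
        using pq by (simp add: ennreal_power ennreal_plus ennreal_mult')
      ultimately show ?thesis by (simp only: ennreal_leI)
    qed
    moreover have "2 * (x\<^sup>2 + y\<^sup>2) = \<top>" if "x = \<top> \<or> y = \<top>" using that by (auto simp: power2_eq_square ennreal_mult_eq_top_iff)
    ultimately show ?thesis by (cases "x = \<top> \<or> y = \<top>") auto
  qed
  have fg: "(\<lambda>x. f x + g x) \<in> borel_measurable (lebesgue_Icc T)" using assms by simp
  have "?B * fbm_norm_sq H T (\<lambda>x. f x + g x) = (\<integral>\<^sup>+r. (A (\<lambda>x. f x + g x) r)\<^sup>2 \<partial>lborel)"
    unfolding A_def by (rule fbm_norm_sq_energy[OF fg, symmetric])
  also have "\<dots> \<le> (\<integral>\<^sup>+r. 2 * ((A f r)\<^sup>2 + (A g r)\<^sup>2) \<partial>lborel)"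
  proof (rule nn_integral_mono)
    fix r
    have "(A (\<lambda>x. f x + g x) r)\<^sup>2 \<le> (A f r + A g r)\<^sup>2" by (rule power_mono[OF A_add]) simp
    also note sq
    finally show "(A (\<lambda>x. f x + g x) r)\<^sup>2 \<le> 2 * ((A f r)\<^sup>2 + (A g r)\<^sup>2)" .
  qed
  also have "\<dots> = 2 * ((\<integral>\<^sup>+r. (A f r)\<^sup>2 \<partial>lborel) + (\<integral>\<^sup>+r. (A g r)\<^sup>2 \<partial>lborel))"
    by (simp add: nn_integral_cmult nn_integral_add)
  also have "\<dots> = ?B * (2 * (fbm_norm_sq H T f + fbm_norm_sq H T g))"
    unfolding A_def fbm_norm_sq_energy[OF assms(1)] fbm_norm_sq_energy[OF assms(2)]
    by (simp add: distrib_left distrib_right ac_simps)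
  finally show ?thesis using Beta_a_pos by (subst (asm) ennreal_mult_le_mult_iff) auto
qed

lemma fbm_norm_sq_cmult:
  assumes "f \<in> borel_measurable (lebesgue_Icc T)"
  shows "fbm_norm_sq H T (\<lambda>x. c * f x) = ennreal (c\<^sup>2) * fbm_norm_sq H T f"
proof -
  have [measurable]: "f \<in> borel_measurable (lebesgue_Icc T)" by fact
  have [measurable]: "(\<lambda>x. f x * indicator {0..T} x) \<in> borel_measurable borel"
    using assms measurable_lebesgue_Icc_iff by blast
  have "(\<integral>\<^sup>+v. ennreal (\<bar>c * f u\<bar> * \<bar>c * f v\<bar> * \<bar>u - v\<bar> powr (2 * H - 2)) \<partial>lebesgue_Icc T)
     = ennreal (c\<^sup>2) * (\<integral>\<^sup>+v. ennreal (\<bar>f u\<bar> * \<bar>f v\<bar> * \<bar>u - v\<bar> powr (2 * H - 2)) \<partial>lebesgue_Icc T)" for u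
  proof -
    have "\<bar>c * f u\<bar> * \<bar>c * f v\<bar> * \<bar>u - v\<bar> powr (2 * H - 2) = c\<^sup>2 * (\<bar>f u\<bar> * \<bar>f v\<bar> * \<bar>u - v\<bar> powr (2 * H - 2))" for v
    proof -
      have "c\<^sup>2 = \<bar>c\<bar> * \<bar>c\<bar>" by (simp add: power2_eq_square)
      then show ?thesis by (simp only: abs_mult ac_simps)
    qed
    moreover have [measurable]: "(\<lambda>v. \<bar>u - v\<bar> powr (2 * H - 2)) \<in> borel_measurable (lebesgue_Icc T)"
      unfolding lebesgue_Icc_def by (rule measurable_restrict_space1) measurable
    ultimately show ?thesis
      by (subst nn_integral_cmult[symmetric]) (auto simp flip: ennreal_mult' intro!: nn_integral_cong simp del: abs_mult mult_cancel_right)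
  qed
  then have "fbm_norm_sq H T (\<lambda>x. c * f x) = (\<integral>\<^sup>+u. ennreal (c\<^sup>2) * (\<integral>\<^sup>+v. ennreal (\<bar>f u\<bar> * \<bar>f v\<bar> * \<bar>u - v\<bar> powr (2 * H - 2)) \<partial>lebesgue_Icc T) \<partial>lebesgue_Icc T)"
    unfolding fbm_norm_sq_def by simp
  also have "\<dots> = ennreal (c\<^sup>2) * fbm_norm_sq H T f"
    unfolding fbm_norm_sq_def
  proof (rule nn_integral_cmult)
    have "(\<lambda>u. \<integral>\<^sup>+v. ennreal (\<bar>f u * indicator {0..T} u\<bar> * \<bar>f v * indicator {0..T} v\<bar> * \<bar>u - v\<bar> powr (2 * H - 2)) \<partial>lborel) \<in> borel_measurable (lebesgue_Icc T)"
      unfolding lebesgue_Icc_def by (rule measurable_restrict_space1) measurable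
    also have "?this \<longleftrightarrow> (\<lambda>u. \<integral>\<^sup>+v. ennreal (\<bar>f u\<bar> * \<bar>f v\<bar> * \<bar>u - v\<bar> powr (2 * H - 2)) \<partial>lebesgue_Icc T) \<in> borel_measurable (lebesgue_Icc T)"
      unfolding nn_integral_lebesgue_Icc
      by (intro measurable_cong nn_integral_cong) (auto simp: indicator_def)
    finally show "(\<lambda>u. \<integral>\<^sup>+v. ennreal (\<bar>f u\<bar> * \<bar>f v\<bar> * \<bar>u - v\<bar> powr (2 * H - 2)) \<partial>lebesgue_Icc T) \<in> borel_measurable (lebesgue_Icc T)" .
  qed
  finally show ?thesis .
qed

lemma abel_transform_norm_le:
  assumes "f \<in> borel_measurable (lebesgue_Icc T)"
  shows "L2_norm_sq lborel (Lf f) \<le> ennreal (Beta a (2 - 2*H)) * fbm_norm_sq H T f"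
  unfolding fbm_norm_sq_energy[OF assms, symmetric] L2_norm_sq_def
proof (rule nn_integral_mono)
  fix r
  have "ennreal \<bar>Lf f r\<bar> \<le> (\<integral>\<^sup>+u. ennreal \<bar>f u * indicator {0..T} u * abel_kernel a r u\<bar> \<partial>lborel)"
    unfolding abel_transform_def
    using integral_norm_bound_ennreal[of lborel "\<lambda>u. f u * indicator {0..T} u * abel_kernel a r u"]
    by (cases "integrable lborel (\<lambda>u. f u * indicator {0..T} u * abel_kernel a r u)")
       (auto simp: not_integrable_integral_eq)
  then have "(ennreal \<bar>Lf f r\<bar>)\<^sup>2 \<le> (\<integral>\<^sup>+u. ennreal \<bar>f u * indicator {0..T} u * abel_kernel a r u\<bar> \<partial>lborel)\<^sup>2"
    by (rule power_mono) simp
  then show "ennreal ((Lf f r)\<^sup>2) \<le> (\<integral>\<^sup>+u. ennreal \<bar>f u * indicator {0..T} u * abel_kernel a r u\<bar> \<partial>lborel)\<^sup>2"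
    by (simp add: ennreal_power)
qed

lemma abel_transform_integrable_AE:
  assumes "f \<in> borel_measurable (lebesgue_Icc T)" "fbm_norm_sq H T f < \<infinity>"
  shows "AE r in lborel. integrable lborel (\<lambda>u. f u * indicator {0..T} u * abel_kernel a r u)"
proof -
  have [measurable]: "(\<lambda>x. f x * indicator {0..T} x) \<in> borel_measurable borel"
    using assms measurable_lebesgue_Icc_iff by blast
  have "(\<integral>\<^sup>+r. (\<integral>\<^sup>+u. ennreal \<bar>f u * indicator {0..T} u * abel_kernel a r u\<bar> \<partial>lborel)\<^sup>2 \<partial>lborel) \<noteq> \<infinity>"
    unfolding fbm_norm_sq_energy[OF assms(1)] using assms(2) by (simp add: ennreal_mult_eq_top_iff)
  then have "AE r in lborel. (\<integral>\<^sup>+u. ennreal \<bar>f u * indicator {0..T} u * abel_kernel a r u\<bar> \<partial>lborel)\<^sup>2 \<noteq> \<infinity>"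
    by (intro nn_integral_PInf_AE) measurable
  then show ?thesis
    by eventually_elim (auto intro!: integrableI_bounded simp: power2_eq_square ennreal_mult_eq_top_iff less_top)
qed

lemma abel_transform_diff_AE:
  assumes "f \<in> borel_measurable (lebesgue_Icc T)" "fbm_norm_sq H T f < \<infinity>"
    and "g \<in> borel_measurable (lebesgue_Icc T)" "fbm_norm_sq H T g < \<infinity>"
  shows "AE r in lborel. Lf (\<lambda>x. f x - g x) r = Lf f r - Lf g r"
  using abel_transform_integrable_AE[OF assms(1,2)] abel_transform_integrable_AE[OF assms(3,4)]
  by eventually_elim (simp add: abel_transform_def left_diff_distrib)

lemma fbm_norm_sq_indicator:
  assumes "t \<in> {0..T}"
  shows "fbm_norm_sq H T (indicator {0<..t}) < \<infinity>"
proof -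
  have "fbm_norm_sq H T (indicator {0<..t}) \<le> (\<integral>\<^sup>+u. (\<integral>\<^sup>+v. indicator {0..t} u * indicator {0..t} v * ennreal (\<bar>u - v\<bar> powr (2*a - 1)) \<partial>lborel) \<partial>lborel)"
    unfolding fbm_norm_sq_def nn_integral_lebesgue_Icc
    by (subst nn_integral_multc[symmetric]) (auto intro!: nn_integral_mono simp: indicator_def)
  also have "\<dots> < \<infinity>" using a assms by (subst fbm_covariance_as_energy) auto
  finally show ?thesis .
qed

text \<open>
  The value of the process at time \<open>t\<close> corresponds to the integrand \<open>indicator {0<..t}\<close>; these
  integrands have the inner products prescribed by the covariance of fractional Brownian motion.
\<close>

lemma abel_transform_indicator_inner:
  assumes st: "s \<in> {0..T}" "t \<in> {0..T}"
  shows "integrable lborel (\<lambda>r. Lf (indicator {0<..s}) r * Lf (indicator {0<..t}) r)" (is ?int)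
    and "fbm_energy_const H * (\<integral>r. Lf (indicator {0<..s}) r * Lf (indicator {0<..t}) r \<partial>lborel)
      = (s powr (2 * H) + t powr (2 * H) - \<bar>t - s\<bar> powr (2 * H)) / 2" (is ?eq)
proof -
  have *: "integrable lborel (\<lambda>r. Lf (indicator {0<..s}) r * Lf (indicator {0<..t}) r) \<and>
      fbm_energy_const H * (\<integral>r. Lf (indicator {0<..s}) r * Lf (indicator {0<..t}) r \<partial>lborel)
        = (s powr (2 * H) + t powr (2 * H) - \<bar>t - s\<bar> powr (2 * H)) / 2"
    if st: "0 \<le> s" "s \<le> t" "t \<le> T" for s t
  proof -
    let ?I = "\<lambda>t. indicator {0<..t} :: real \<Rightarrow> real"
    have m[measurable]: "?I t \<in> borel_measurable (lebesgue_Icc T)" for t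
      unfolding lebesgue_Icc_def by (rule measurable_restrict_space1) measurable
    have ind: "?I t u * indicator {0..T} u = ?I t u" if "t \<le> T" for t u using that by (auto simp: indicator_def)
    have ae: "AE r in lborel. ennreal (Lf (?I t) r) = (\<integral>\<^sup>+u. indicator {0<..t} u * ennreal (abel_kernel a r u) \<partial>lborel)" if "0 \<le> t" "t \<le> T" for t
    proof -
      have "AE r in lborel. integrable lborel (\<lambda>u. ?I t u * indicator {0..T} u * abel_kernel a r u)"
        using that by (intro abel_transform_integrable_AE m fbm_norm_sq_indicator) auto
      then show ?thesis
      proof eventually_elim
      case (elim r)
      have "ennreal (Lf (?I t) r) = (\<integral>\<^sup>+u. ennreal (?I t u * abel_kernel a r u) \<partial>lborel)"
        unfolding abel_transform_def ind[OF that(2)] using elim that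
        by (intro nn_integral_eq_integral[symmetric]) (auto simp: ind abel_kernel_nonneg)
      then show ?case by (simp add: ennreal_mult' ennreal_indicator)
      qed
    qed
    have pos: "0 \<le> Lf (?I t) r" for t r
      unfolding abel_transform_def by (intro Bochner_Integration.integral_nonneg) (auto simp: abel_kernel_nonneg)
    have e: "2 * a + 1 = 2 * H" "1 - 2*a = 2 - 2*H" "2*a*(2*H) = 2 * (H * (2*H-1))" by (auto simp: algebra_simps)
    let ?R = "(s powr (2 * H) + t powr (2 * H) - (t - s) powr (2 * H)) / (2 * (H * (2*H-1)))"
    have R0: "0 \<le> ?R"
    proof -
      have "(t - s) powr (2 * H) \<le> t powr (2*H)" using st H by (intro powr_mono2) auto
      moreover have "0 \<le> s powr (2*H)" by simp
      ultimately have "0 \<le> s powr (2 * H) + t powr (2 * H) - (t - s) powr (2 * H)" by linarith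
      then show ?thesis using H by simp
    qed
    have eqB: "ennreal (Beta a (2 - 2*H)) * ennreal ?R = ennreal (Beta a (2 - 2*H) * ?R)"
      using Beta_a_pos by (intro ennreal_mult'[symmetric]) simp
    have "(\<integral>\<^sup>+r. ennreal (Lf (?I s) r * Lf (?I t) r) \<partial>lborel)
       = (\<integral>\<^sup>+r. (\<integral>\<^sup>+u. indicator {0<..s} u * ennreal (abel_kernel a r u) \<partial>lborel) * (\<integral>\<^sup>+u. indicator {0<..t} u * ennreal (abel_kernel a r u) \<partial>lborel) \<partial>lborel)"
      using ae[of s] ae[of t] st pos by (intro nn_integral_cong_AE) (auto simp: ennreal_mult')
    also have "\<dots> = ennreal (Beta a (1 - 2*a)) * (\<integral>\<^sup>+u. (\<integral>\<^sup>+v. indicator {0<..s} u * indicator {0<..t} v * ennreal (\<bar>u - v\<bar> powr (2*a - 1)) \<partial>lborel) \<partial>lborel)"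
      by (rule abel_kernel_energy[OF a]) (auto simp: indicator_def)
    also have "(\<integral>\<^sup>+u. (\<integral>\<^sup>+v. indicator {0<..s} u * indicator {0<..t} v * ennreal (\<bar>u - v\<bar> powr (2*a - 1)) \<partial>lborel) \<partial>lborel)
       = (\<integral>\<^sup>+u. (\<integral>\<^sup>+v. indicator {0..s} u * indicator {0..t} v * ennreal (\<bar>u - v\<bar> powr (2*a - 1)) \<partial>lborel) \<partial>lborel)"
    proof -
      have ae0: "AE u in lborel. u \<noteq> (0::real)" by (rule AE_lborel_singleton)
      have i: "indicator {0<..t} u = (indicator {0..t} u :: ennreal)" if "u \<noteq> 0" for t u :: real using that by (auto simp: indicator_def)
      show ?thesis
        using ae0 by (intro nn_integral_cong_AE, eventually_elim, intro nn_integral_cong_AE) (use ae0 in eventually_elim, simp add: i)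
    qed
    also have "\<dots> = ennreal ?R"
      using fbm_covariance_as_energy[OF a(1) st(1,2)] unfolding e .
    finally have nn: "(\<integral>\<^sup>+r. ennreal (Lf (?I s) r * Lf (?I t) r) \<partial>lborel) = ennreal (Beta a (2 - 2*H) * ?R)"
      unfolding e eqB .
    have mm: "(\<lambda>r. Lf (?I s) r * Lf (?I t) r) \<in> borel_measurable lborel" by simp
    have 1: "integrable lborel (\<lambda>r. Lf (?I s) r * Lf (?I t) r)"
    proof (rule integrableI_nonneg[OF mm])
      show "(\<integral>\<^sup>+r. ennreal (Lf (?I s) r * Lf (?I t) r) \<partial>lborel) < \<infinity>" unfolding nn by simp
    qed (use pos in auto)
    have "(\<integral>r. Lf (?I s) r * Lf (?I t) r \<partial>lborel) = enn2real (\<integral>\<^sup>+r. ennreal (Lf (?I s) r * Lf (?I t) r) \<partial>lborel)"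
      by (rule integral_eq_nn_integral[OF mm]) (use pos in auto)
    also have "\<dots> = Beta a (2 - 2*H) * ?R"
      unfolding nn using R0 Beta_a_pos by (intro enn2real_ennreal mult_nonneg_nonneg) auto
    finally have 2: "(\<integral>r. Lf (?I s) r * Lf (?I t) r \<partial>lborel) = Beta a (2 - 2*H) * ?R" .
    have "fbm_energy_const H * (Beta a (2 - 2*H) * ?R) = (s powr (2 * H) + t powr (2 * H) - (t - s) powr (2 * H)) / 2"
      using Beta_a_pos H unfolding fbm_energy_const_def by (simp add: field_simps)
    with 1 2 show ?thesis using st by simp
  qed
  show ?int ?eq using *[of s t] *[of t s] st by (cases "s \<le> t"; simp add: mult.commute abs_minus_commute add.commute)+
qed

end

section \<open>Exponential moments of Wiener integrals\<close>

lemma (in prob_space) centered_gaussian_moments: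
  assumes "gaussian_rv M X" "expectation X = 0"
  shows "integrable M (\<lambda>\<omega>. (X \<omega>)\<^sup>2)"
    and "(\<integral>\<^sup>+\<omega>. ennreal (exp (X \<omega>)) \<partial>M) \<le> ennreal (exp (expectation (\<lambda>\<omega>. (X \<omega>)\<^sup>2) / 2))"
proof -
  have [measurable]: "X \<in> borel_measurable M" using assms(1) by (simp add: gaussian_rv_def)
  consider m where "AE \<omega> in M. X \<omega> = m"
    | \<mu> s where "0 < s" "distributed M lborel X (\<lambda>x. ennreal (normal_density \<mu> s x))"
    using assms(1) by (auto simp: gaussian_rv_def)
  then have "integrable M (\<lambda>\<omega>. (X \<omega>)\<^sup>2) \<and>
    (\<integral>\<^sup>+\<omega>. ennreal (exp (X \<omega>)) \<partial>M) \<le> ennreal (exp (expectation (\<lambda>\<omega>. (X \<omega>)\<^sup>2) / 2))"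
  proof cases
    case (1 m)
    have "expectation X = m" using 1 by (subst integral_cong_AE[of _ _ "\<lambda>_. m"]) (auto simp: prob_space)
    then have ae: "AE \<omega> in M. X \<omega> = 0" using 1 assms(2) by simp
    have "integrable M (\<lambda>\<omega>. (X \<omega>)\<^sup>2)"
      using ae by (subst integrable_cong_AE[of _ _ "\<lambda>_. 0"]) auto
    moreover have "expectation (\<lambda>\<omega>. (X \<omega>)\<^sup>2) = 0"
      using ae by (subst integral_cong_AE[of _ _ "\<lambda>_. 0"]) auto
    moreover have "(\<integral>\<^sup>+\<omega>. ennreal (exp (X \<omega>)) \<partial>M) = 1"
      using ae by (subst nn_integral_cong_AE[of _ "\<lambda>_. 1"]) (auto simp: emeasure_space_1)
    ultimately show ?thesis by simp
  next
    case (2 \<mu> s)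
    note D = 2(2)
    have "\<mu> = 0" using normal_distributed_expectation[OF 2(1) D] assms(2) by simp
    note D = D[unfolded this]
    have mom: "has_bochner_integral lborel (\<lambda>x. normal_density 0 s x * x\<^sup>2) (s\<^sup>2)"
      using normal_moment_even[OF 2(1), of 0 1] by (simp add: fact_numeral mult.commute)
    have i2: "integrable M (\<lambda>\<omega>. (X \<omega>)\<^sup>2)"
      using distributed_integrable[OF D, of "\<lambda>x. x\<^sup>2"] mom 2(1)
      by (auto simp: has_bochner_integral_iff normal_density_nonneg)
    have e2: "expectation (\<lambda>\<omega>. (X \<omega>)\<^sup>2) = s\<^sup>2"
      using distributed_integral[OF D, of "\<lambda>x. x\<^sup>2"] mom 2(1)
      by (auto simp: has_bochner_integral_iff normal_density_nonneg)
    have dens: "normal_density 0 s x * exp x = exp (s\<^sup>2 / 2) * normal_density (s\<^sup>2) s x" for x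
    proof -
      have "- (x - 0)\<^sup>2 / (2 * s\<^sup>2) + x = s\<^sup>2 / 2 + (- (x - s\<^sup>2)\<^sup>2 / (2 * s\<^sup>2))"
        using 2(1) by (simp add: field_simps power2_eq_square)
      then have "exp (- (x - 0)\<^sup>2 / (2 * s\<^sup>2)) * exp x = exp (s\<^sup>2 / 2) * exp (- (x - s\<^sup>2)\<^sup>2 / (2 * s\<^sup>2))"
        by (simp only: exp_add[symmetric])
      then show ?thesis unfolding normal_density_def by (simp add: ac_simps)
    qed
    have "(\<integral>\<^sup>+\<omega>. ennreal (exp (X \<omega>)) \<partial>M) = (\<integral>\<^sup>+x. ennreal (normal_density 0 s x) * ennreal (exp x) \<partial>lborel)"
      by (rule distributed_nn_integral[OF D, symmetric]) simp
    also have "\<dots> = (\<integral>\<^sup>+x. ennreal (exp (s\<^sup>2 / 2)) * ennreal (normal_density (s\<^sup>2) s x) \<partial>lborel)"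
      using 2(1) by (intro nn_integral_cong) (simp add: dens flip: ennreal_mult')
    also have "\<dots> = ennreal (exp (s\<^sup>2 / 2)) * (\<integral>\<^sup>+x. ennreal (normal_density (s\<^sup>2) s x) \<partial>lborel)"
      by (rule nn_integral_cmult) simp
    also have "(\<integral>\<^sup>+x. ennreal (normal_density (s\<^sup>2) s x) \<partial>lborel) = 1"
      using 2(1) by (subst nn_integral_eq_integral) (auto simp: integral_normal_density integrable_normal_density)
    finally show ?thesis using i2 e2 by simp
  qed
  then show "integrable M (\<lambda>\<omega>. (X \<omega>)\<^sup>2)"
    and "(\<integral>\<^sup>+\<omega>. ennreal (exp (X \<omega>)) \<partial>M) \<le> ennreal (exp (expectation (\<lambda>\<omega>. (X \<omega>)\<^sup>2) / 2))" by auto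
qed

lemma integral_double_sum:
  fixes f :: "'b \<Rightarrow> 'b \<Rightarrow> 'a \<Rightarrow> real"
  assumes "\<And>s t. s \<in> A \<Longrightarrow> t \<in> A \<Longrightarrow> integrable M (f s t)"
  shows "(\<integral>x. (\<Sum>s\<in>A. \<Sum>t\<in>A. f s t x) \<partial>M) = (\<Sum>s\<in>A. \<Sum>t\<in>A. \<integral>x. f s t x \<partial>M)"
proof -
  have "integrable M (\<lambda>x. \<Sum>t\<in>A. f s t x)" if "s \<in> A" for s
    using assms that by (intro Bochner_Integration.integrable_sum) auto
  then have "(\<integral>x. (\<Sum>s\<in>A. \<Sum>t\<in>A. f s t x) \<partial>M) = (\<Sum>s\<in>A. \<integral>x. (\<Sum>t\<in>A. f s t x) \<partial>M)"
    by (rule Bochner_Integration.integral_sum)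
  also have "\<dots> = (\<Sum>s\<in>A. \<Sum>t\<in>A. \<integral>x. f s t x \<partial>M)"
    using assms by (intro sum.cong refl Bochner_Integration.integral_sum) auto
  finally show ?thesis .
qed

context hurst
begin

lemma measurable_Icc_of_borel:
  "f \<in> borel_measurable borel \<Longrightarrow> f \<in> borel_measurable (lebesgue_Icc T)"
  unfolding lebesgue_Icc_def by (rule measurable_restrict_space1) simp

lemma fbm_norm_sq_mono:
  assumes "\<And>x. x \<in> {0..T} \<Longrightarrow> \<bar>f x\<bar> \<le> \<bar>g x\<bar>"
  shows "fbm_norm_sq H T f \<le> fbm_norm_sq H T g"
  unfolding fbm_norm_sq_def
  using assms by (intro nn_integral_mono ennreal_leI mult_mono) auto

lemma fbm_norm_sq_step_finite: "step_list T xs \<Longrightarrow> fbm_norm_sq H T (step_fun xs) < \<infinity>"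
proof (induction xs)
  case Nil
  then show ?case by (simp add: step_fun_def fbm_norm_sq_def)
next
  case (Cons x xs)
  obtain c u v where x: "x = (c, u, v)" by (cases x)
  have uv: "0 \<le> u" "v \<le> T" "u \<le> v" and xs: "step_list T xs" using Cons.prems by (auto simp: x step_list_def)
  have "fbm_norm_sq H T (indicator {u<..v}) \<le> fbm_norm_sq H T (indicator {0<..v})"
    using uv by (intro fbm_norm_sq_mono) (auto simp: indicator_def)
  also have "\<dots> < \<infinity>" using uv by (intro fbm_norm_sq_indicator) auto
  finally have 1: "fbm_norm_sq H T (\<lambda>s. c * indicator {u<..v} s) < \<infinity>"
    by (subst fbm_norm_sq_cmult, intro measurable_Icc_of_borel, simp) (simp add: ennreal_mult_less_top)
  have "step_fun (x # xs) = (\<lambda>s. c * indicator {u<..v} s + step_fun xs s)"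
    by (auto simp: x step_fun_def)
  then have "fbm_norm_sq H T (step_fun (x # xs)) \<le> 2 * (fbm_norm_sq H T (\<lambda>s. c * indicator {u<..v} s) + fbm_norm_sq H T (step_fun xs))"
    by (simp only:) (rule fbm_norm_sq_add_le; intro measurable_Icc_of_borel; measurable)
  also have "\<dots> < \<infinity>" using 1 Cons.IH[OF xs] by (simp add: ennreal_mult_less_top)
  finally show ?case .
qed

text \<open>
  A step integral is a centred Gaussian variable.  Its variance is a double sum of covariances, and
  \<open>abel_transform_indicator_inner\<close> turns the sum into the squared norm of the Abel transform.
\<close>

lemma fbm_step_exp_moment:
  assumes P: "prob_space P" and B: "fractional_brownian_motion P H T B" and xs: "step_list T xs"
  shows "(\<integral>\<^sup>+\<omega>. ennreal (exp (step_integral xs B \<omega>)) \<partial>P)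
    \<le> ennreal (exp (fbm_energy_const H * (\<integral>r. (Lf (step_fun xs) r)\<^sup>2 \<partial>lborel) / 2))"
proof -
  interpret prob_space P by fact
  define A where "A = step_points xs"
  define c where "c = step_coeff xs"
  have A: "finite A" "A \<subseteq> {0..T}" using step_points_subset[OF xs] by (auto simp: A_def)
  have gauss: "gaussian_rv P (\<lambda>\<omega>. \<Sum>t\<in>A. c t * B t \<omega>)" if "finite A" "A \<subseteq> {0..T}" for A c
    using B that unfolding fractional_brownian_motion_def by blast
  have g1: "gaussian_rv P (B t)" if "t \<in> {0..T}" for t
    using gauss[of "{t}" "\<lambda>_. 1"] that by simp
  have zero: "expectation (B t) = 0" if "t \<in> {0..T}" for t
    using B that unfolding fractional_brownian_motion_def by blast
  have cov: "expectation (\<lambda>\<omega>. B s \<omega> * B t \<omega>) = (s powr (2 * H) + t powr (2 * H) - \<bar>t - s\<bar> powr (2 * H)) / 2"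
    if "s \<in> {0..T}" "t \<in> {0..T}" for s t
    using B that unfolding fractional_brownian_motion_def by blast
  have Bm: "B t \<in> borel_measurable P" if "t \<in> {0..T}" for t using g1[OF that] unfolding gaussian_rv_def by blast
  have Bi: "integrable P (\<lambda>\<omega>. B s \<omega> * B t \<omega>)" if "s \<in> {0..T}" "t \<in> {0..T}" for s t
    by (intro integrable_mult_of_sq Bm centered_gaussian_moments(1) g1 zero that)
  have Bi1: "integrable P (B t)" if "t \<in> {0..T}" for t
    by (rule square_integrable_imp_integrable[OF Bm[OF that] centered_gaussian_moments(1)[OF g1[OF that] zero[OF that]]])
  have step: "step_integral xs B \<omega> = (\<Sum>t\<in>A. c t * B t \<omega>)" for \<omega>
    unfolding A_def c_def by (rule step_integral_eq_sum)
  let ?I = "\<lambda>t. indicator {0<..t} :: real \<Rightarrow> real"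
  have sq: "(\<Sum>t\<in>A. c t * y t)\<^sup>2 = (\<Sum>s\<in>A. \<Sum>t\<in>A. c s * c t * (y s * y t))" for y :: "real \<Rightarrow> real"
    unfolding power2_eq_square sum_product by (intro sum.cong refl) (simp only: ac_simps)
  have "AE r in lborel. Lf (step_fun xs) r = (\<Sum>t\<in>A. c t * Lf (?I t) r)"
  proof -
    have "AE r in lborel. \<forall>t\<in>A. integrable lborel (\<lambda>u. ?I t u * indicator {0..T} u * abel_kernel a r u)"
    proof (subst AE_finite_all[OF A(1)], rule ballI, rule abel_transform_integrable_AE)
      fix t assume "t \<in> A"
      then show "fbm_norm_sq H T (?I t) < \<infinity>" using A by (intro fbm_norm_sq_indicator) auto
    qed (intro measurable_Icc_of_borel, simp)
    then show ?thesis
    proof eventually_elim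
      case (elim r)
      have pt: "step_fun xs u * indicator {0..T} u * abel_kernel a r u = (\<Sum>t\<in>A. c t * (?I t u * indicator {0..T} u * abel_kernel a r u))" for u
        unfolding step_fun_eq_sum[OF xs] A_def c_def sum_distrib_right
        by (intro sum.cong refl) (simp only: ac_simps)
      have "Lf (step_fun xs) r = (LINT u|lborel. (\<Sum>t\<in>A. c t * (?I t u * indicator {0..T} u * abel_kernel a r u)))"
        unfolding abel_transform_def pt ..
      also have "\<dots> = (\<Sum>t\<in>A. c t * Lf (?I t) r)"
        unfolding abel_transform_def using elim by (subst Bochner_Integration.integral_sum) auto
      finally show ?case .
    qed
  qed
  then have "(\<integral>r. (Lf (step_fun xs) r)\<^sup>2 \<partial>lborel) = (\<integral>r. (\<Sum>t\<in>A. c t * Lf (?I t) r)\<^sup>2 \<partial>lborel)"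
    by (intro integral_cong_AE borel_measurable_power borel_measurable_sum borel_measurable_times borel_measurable_const) (auto intro!: measurable_abel_transform measurable_Icc_of_borel)
  also have "\<dots> = (\<Sum>s\<in>A. \<Sum>t\<in>A. c s * c t * (\<integral>r. Lf (?I s) r * Lf (?I t) r \<partial>lborel))"
  proof -
    have i: "integrable lborel (\<lambda>r. c s * c t * (Lf (?I s) r * Lf (?I t) r))" if "s \<in> A" "t \<in> A" for s t
      using that A by (intro integrable_mult_right abel_transform_indicator_inner(1)) auto
    show ?thesis unfolding sq using integral_double_sum[of A lborel, OF i] by (simp only: integral_mult_right_zero)
  qed
  finally have "fbm_energy_const H * (\<integral>r. (Lf (step_fun xs) r)\<^sup>2 \<partial>lborel)
    = (\<Sum>s\<in>A. \<Sum>t\<in>A. c s * c t * (fbm_energy_const H * (\<integral>r. Lf (?I s) r * Lf (?I t) r \<partial>lborel)))"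
    by (simp only: sum_distrib_left) (intro sum.cong refl, simp only: ac_simps)
  also have "\<dots> = (\<Sum>s\<in>A. \<Sum>t\<in>A. c s * c t * expectation (\<lambda>\<omega>. B s \<omega> * B t \<omega>))"
  proof (intro sum.cong refl)
    fix s t assume "s \<in> A" "t \<in> A"
    then have "s \<in> {0..T}" "t \<in> {0..T}" using A by auto
    then show "c s * c t * (fbm_energy_const H * (\<integral>r. Lf (?I s) r * Lf (?I t) r \<partial>lborel)) = c s * c t * expectation (\<lambda>\<omega>. B s \<omega> * B t \<omega>)"
      by (simp only: abel_transform_indicator_inner(2) cov)
  qed
  also have "\<dots> = expectation (\<lambda>\<omega>. (\<Sum>t\<in>A. c t * B t \<omega>)\<^sup>2)"
  proof -
    have i: "integrable P (\<lambda>\<omega>. c s * c t * (B s \<omega> * B t \<omega>))" if "s \<in> A" "t \<in> A" for s t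
      using that A by (intro integrable_mult_right Bi) auto
    show ?thesis unfolding sq using integral_double_sum[of A P, OF i] by (simp only: integral_mult_right_zero)
  qed
  finally have var: "fbm_energy_const H * (\<integral>r. (Lf (step_fun xs) r)\<^sup>2 \<partial>lborel) = expectation (\<lambda>\<omega>. (\<Sum>t\<in>A. c t * B t \<omega>)\<^sup>2)" .
  have "expectation (\<lambda>\<omega>. \<Sum>t\<in>A. c t * B t \<omega>) = 0"
  proof -
    have "expectation (\<lambda>\<omega>. \<Sum>t\<in>A. c t * B t \<omega>) = (\<Sum>t\<in>A. expectation (\<lambda>\<omega>. c t * B t \<omega>))"
      using A by (intro Bochner_Integration.integral_sum integrable_mult_right Bi1) auto
    also have "\<dots> = 0" using A zero by (intro sum.neutral) auto
    finally show ?thesis .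
  qed
  then show ?thesis unfolding var step by (intro centered_gaussian_moments(2) gauss A)
qed

text \<open>
  On \<open>[0,T]\<close> the kernel \<open>\<bar>u - v\<bar> powr (2 * H - 2)\<close> is at least \<open>T powr (2 * H - 2)\<close>, the exponent
  being negative.
\<close>

lemma L1_le_fbm_norm_sq:
  assumes "f \<in> borel_measurable (lebesgue_Icc T)"
  shows "(\<integral>\<^sup>+u. ennreal \<bar>f u\<bar> \<partial>lebesgue_Icc T)\<^sup>2 \<le> ennreal (T powr (2 - 2*H)) * fbm_norm_sq H T f"
proof -
  have [measurable]: "f \<in> borel_measurable (lebesgue_Icc T)" by fact
  have [measurable]: "(\<lambda>x. f x * indicator {0..T} x) \<in> borel_measurable borel"
    using assms measurable_lebesgue_Icc_iff by blast
  define G where "G u = ennreal \<bar>f u * indicator {0..T} u\<bar>" for u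
  have [measurable]: "G \<in> borel_measurable borel" unfolding G_def by measurable
  have F: "(\<integral>\<^sup>+u. ennreal \<bar>f u\<bar> \<partial>lebesgue_Icc T) = (\<integral>\<^sup>+u. G u \<partial>lborel)"
    unfolding nn_integral_lebesgue_Icc G_def by (intro nn_integral_cong) (auto simp: indicator_def)
  have "(\<integral>\<^sup>+u. G u \<partial>lborel)\<^sup>2 = (\<integral>\<^sup>+u. (\<integral>\<^sup>+v. G u * G v \<partial>lborel) \<partial>lborel)"
  proof -
    have "(\<integral>\<^sup>+u. (\<integral>\<^sup>+v. G u * G v \<partial>lborel) \<partial>lborel) = (\<integral>\<^sup>+u. G u * (\<integral>\<^sup>+v. G v \<partial>lborel) \<partial>lborel)"
      by (rule nn_integral_cong, rule nn_integral_cmult) measurable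
    also have "\<dots> = (\<integral>\<^sup>+u. G u \<partial>lborel) * (\<integral>\<^sup>+v. G v \<partial>lborel)"
      by (rule nn_integral_multc) measurable
    finally show ?thesis by (simp only: power2_eq_square)
  qed
  also have "\<dots> \<le> (\<integral>\<^sup>+u. (\<integral>\<^sup>+v. ennreal (T powr (2 - 2*H)) * (G u * G v * ennreal (\<bar>u - v\<bar> powr (2 * H - 2))) \<partial>lborel) \<partial>lborel)"
  proof (rule nn_integral_mono, rule nn_integral_mono_AE)
    fix u :: real
    have "AE v in lborel. v \<noteq> u" by (rule AE_lborel_singleton)
    then show "AE v in lborel. G u * G v \<le> ennreal (T powr (2 - 2*H)) * (G u * G v * ennreal (\<bar>u - v\<bar> powr (2 * H - 2)))"
    proof eventually_elim
      case (elim v)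
      show ?case
      proof (cases "u \<in> {0..T} \<and> v \<in> {0..T}")
        case True
        then have d: "0 < \<bar>u - v\<bar>" "\<bar>u - v\<bar> \<le> T" using elim by auto
        have "T powr (2 - 2*H) * \<bar>u - v\<bar> powr (2 * H - 2) = (T / \<bar>u - v\<bar>) powr (2 - 2 * H)"
        proof -
          have "\<bar>u - v\<bar> powr (2 * H - 2) = inverse (\<bar>u - v\<bar> powr (2 - 2 * H))"
            by (subst powr_minus[symmetric]) simp
          then show ?thesis using d T by (simp add: powr_divide flip: divide_inverse)
        qed
        also have "1 \<le> \<dots>" using d H by (intro ge_one_powr_ge_zero) (auto simp: field_simps)
        finally have "1 \<le> T powr (2 - 2*H) * \<bar>u - v\<bar> powr (2 * H - 2)" .
        then have "G u * G v * 1 \<le> G u * G v * ennreal (T powr (2 - 2*H) * \<bar>u - v\<bar> powr (2 * H - 2))"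
          by (intro mult_left_mono) auto
        then show ?thesis by (simp add: ennreal_mult' ac_simps)
      qed (auto simp: G_def)
    qed
  qed
  also have "\<dots> = ennreal (T powr (2 - 2*H)) * (\<integral>\<^sup>+u. (\<integral>\<^sup>+v. G u * G v * ennreal (\<bar>u - v\<bar> powr (2 * H - 2)) \<partial>lborel) \<partial>lborel)"
  proof -
    have "(\<integral>\<^sup>+v. ennreal (T powr (2 - 2*H)) * (G u * G v * ennreal (\<bar>u - v\<bar> powr (2 * H - 2))) \<partial>lborel)
      = ennreal (T powr (2 - 2*H)) * (\<integral>\<^sup>+v. G u * G v * ennreal (\<bar>u - v\<bar> powr (2 * H - 2)) \<partial>lborel)" for u
      by (rule nn_integral_cmult) measurable
    then show ?thesis by (simp only:) (rule nn_integral_cmult, measurable)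
  qed
  also have "(\<integral>\<^sup>+u. (\<integral>\<^sup>+v. G u * G v * ennreal (\<bar>u - v\<bar> powr (2 * H - 2)) \<partial>lborel) \<partial>lborel) = fbm_norm_sq H T f"
    unfolding fbm_norm_sq_def nn_integral_lebesgue_Icc
  proof (intro nn_integral_cong)
    fix u
    show "(\<integral>\<^sup>+v. G u * G v * ennreal (\<bar>u - v\<bar> powr (2 * H - 2)) \<partial>lborel) =
         (\<integral>\<^sup>+x. ennreal (\<bar>f u\<bar> * \<bar>f x\<bar> * \<bar>u - x\<bar> powr (2 * H - 2)) * indicator {0..T} x \<partial>lborel) * indicator {0..T} u"
    proof (cases "u \<in> {0..T}")
      case True
      then show ?thesis by (auto intro!: nn_integral_cong simp: G_def indicator_def ennreal_mult)
    qed (simp add: G_def)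
  qed
  finally show ?thesis unfolding F .
qed

end

lemma Beta_mult_Gamma:
  fixes x y :: real
  assumes "0 < x" "0 < y"
  shows "Beta x y * Gamma (x + y) = Gamma x * Gamma y"
  using Gamma_real_pos[of "x + y"] assms by (simp add: Beta_def less_imp_neq[symmetric])

context hurst
begin

lemma integral_lebesgue_Icc:
  fixes f :: "real \<Rightarrow> real"
  shows "(\<integral>x. f x \<partial>lebesgue_Icc T) = (\<integral>x. indicator {0..T} x * f x \<partial>lborel)"
  unfolding lebesgue_Icc_def by (subst integral_restrict_space) auto

lemma integrable_lebesgue_Icc:
  fixes f :: "real \<Rightarrow> real"
  shows "integrable (lebesgue_Icc T) f \<longleftrightarrow> integrable lborel (\<lambda>x. indicator {0..T} x * f x)"
  unfolding lebesgue_Icc_def by (subst integrable_restrict_space) auto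

lemma finite_measure_lebesgue_Icc: "finite_measure (lebesgue_Icc T)"
  using T by (intro finite_measureI) (simp add: lebesgue_Icc_def space_restrict_space emeasure_restrict_space)

lemma continuous_imp_measurable_Icc:
  fixes Q :: "real \<Rightarrow> real"
  assumes "continuous_on {0..T} Q"
  shows "Q \<in> borel_measurable (lebesgue_Icc T)"
proof -
  have "Q \<in> borel_measurable (restrict_space borel {0..T})"
    by (rule borel_measurable_continuous_on_restrict[OF assms])
  then show ?thesis unfolding lebesgue_Icc_def
    by (simp add: measurable_def sets_restrict_space space_restrict_space)
qed

lemma continuous_bounded_Icc:
  fixes Q :: "real \<Rightarrow> real"
  assumes "continuous_on {0..T} Q"
  shows "\<exists>C>0. \<forall>s\<in>{0..T}. \<bar>Q s\<bar> \<le> C"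
proof -
  have "bounded (Q ` {0..T})" by (intro compact_imp_bounded compact_continuous_image assms compact_Icc)
  then obtain C where C: "0 < C" "\<forall>x\<in>Q ` {0..T}. norm x \<le> C" by (auto simp: bounded_pos)
  then show ?thesis by (intro exI[of _ C]) auto
qed

lemma continuous_integrable_Icc:
  fixes Q :: "real \<Rightarrow> real"
  assumes "continuous_on {0..T} Q"
  shows "integrable (lebesgue_Icc T) Q"
proof -
  interpret finite_measure "lebesgue_Icc T" by (rule finite_measure_lebesgue_Icc)
  obtain C where "\<forall>s\<in>{0..T}. \<bar>Q s\<bar> \<le> C" using continuous_bounded_Icc[OF assms] by auto
  then show ?thesis
    by (intro integrable_const_bound[of _ C] AE_I2 continuous_imp_measurable_Icc assms) auto
qed

lemma step_integral_drifted:
  assumes Q: "continuous_on {0..T} Q" and xs: "step_list T xs"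
  shows "step_integral xs (drifted Q B) \<omega> = (\<integral>s. step_fun xs s * Q s \<partial>lebesgue_Icc T) + step_integral xs B \<omega>"
proof -
  let ?I = "\<lambda>t. indicator {0<..t} :: real \<Rightarrow> real"
  define A where "A = step_points xs"
  define c where "c = step_coeff xs"
  have A: "finite A" "A \<subseteq> {0..T}" using step_points_subset[OF xs] by (auto simp: A_def)
  have eq: "(LINT s:{0..t}|lborel. Q s) = (\<integral>s. ?I t s * Q s \<partial>lebesgue_Icc T)" if "t \<in> A" for t
  proof -
    have "t \<le> T" using that A by auto
    have "(LINT s:{0..t}|lborel. Q s) = (\<integral>s. indicator {0..t} s * Q s \<partial>lebesgue_Icc T)"
      unfolding integral_lebesgue_Icc set_lebesgue_integral_def
      using \<open>t \<le> T\<close> by (intro Bochner_Integration.integral_cong) (auto simp: indicator_def)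
    also have "\<dots> = (\<integral>s. ?I t s * Q s \<partial>lebesgue_Icc T)"
    proof (rule integral_cong_AE)
      have "AE s in lebesgue_Icc T. s \<noteq> 0"
        unfolding lebesgue_Icc_def by (subst AE_restrict_space_iff) (auto intro: AE_mp[OF AE_lborel_singleton[of 0]])
      then show "AE s in lebesgue_Icc T. indicator {0..t} s * Q s = ?I t s * Q s"
        by eventually_elim (auto simp: indicator_def)
    qed (rule borel_measurable_times[OF measurable_Icc_of_borel continuous_imp_measurable_Icc[OF Q]], simp)+
    finally show ?thesis .
  qed
  have Qi: "integrable (lebesgue_Icc T) (\<lambda>s. c t * (?I t s * Q s))" for t
  proof -
    have "integrable (lebesgue_Icc T) (\<lambda>s. ?I t s * Q s)"
      using continuous_integrable_Icc[OF Q]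
      by (rule Bochner_Integration.integrable_bound)
         (rule borel_measurable_times[OF measurable_Icc_of_borel continuous_imp_measurable_Icc[OF Q]], auto simp: indicator_def)
    then show ?thesis by (rule integrable_mult_right)
  qed
  have "step_integral xs (drifted Q B) \<omega> = (\<Sum>t\<in>A. c t * (LINT s:{0..t}|lborel. Q s)) + step_integral xs B \<omega>"
    unfolding step_integral_eq_sum A_def c_def drifted_def by (simp add: distrib_left sum.distrib)
  also have "(\<Sum>t\<in>A. c t * (LINT s:{0..t}|lborel. Q s)) = (\<Sum>t\<in>A. c t * (\<integral>s. ?I t s * Q s \<partial>lebesgue_Icc T))"
    by (intro sum.cong refl) (simp only: eq)
  also have "\<dots> = (\<integral>s. (\<Sum>t\<in>A. c t * (?I t s * Q s)) \<partial>lebesgue_Icc T)"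
    using Qi by (subst Bochner_Integration.integral_sum) auto
  also have "(\<lambda>s. (\<Sum>t\<in>A. c t * (?I t s * Q s))) = (\<lambda>s. step_fun xs s * Q s)"
    unfolding step_fun_eq_sum[OF xs] A_def c_def sum_distrib_right by (simp only: mult.assoc)
  finally show ?thesis .
qed

lemma fbm_norm_sq_finite_integrable:
  assumes "f \<in> borel_measurable (lebesgue_Icc T)" "fbm_norm_sq H T f < \<infinity>"
  shows "integrable (lebesgue_Icc T) f"
proof (rule integrableI_bounded)
  have "(\<integral>\<^sup>+u. ennreal \<bar>f u\<bar> \<partial>lebesgue_Icc T)\<^sup>2 < \<infinity>"
    using L1_le_fbm_norm_sq[OF assms(1)] assms(2) by (auto simp: ennreal_mult_less_top elim!: order.strict_trans1)
  then show "(\<integral>\<^sup>+u. ennreal (norm (f u)) \<partial>lebesgue_Icc T) < \<infinity>"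
    by (auto simp: power2_eq_square ennreal_mult_less_top)
qed fact

text \<open>
  Convergence in the norm of integrands implies convergence in \<open>L\<^sup>1\<close>, and \<open>Q\<close> is bounded.
\<close>

lemma integral_mult_tendsto_fbm:
  assumes Q: "continuous_on {0..T} Q" and f: "f \<in> borel_measurable (lebesgue_Icc T)"
    and F: "\<And>n. F n \<in> borel_measurable (lebesgue_Icc T)" "\<And>n. fbm_norm_sq H T (F n) < \<infinity>" "fbm_norm_sq H T f < \<infinity>"
    and lim: "(\<lambda>n. fbm_norm_sq H T (\<lambda>s. f s - F n s)) \<longlonglongrightarrow> 0"
  shows "(\<lambda>n. \<integral>s. F n s * Q s \<partial>lebesgue_Icc T) \<longlonglongrightarrow> (\<integral>s. f s * Q s \<partial>lebesgue_Icc T)"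
proof -
  let ?K = "ennreal (T powr (2 - 2*H))"
  obtain C where C: "0 < C" "\<forall>s\<in>{0..T}. \<bar>Q s\<bar> \<le> C" using continuous_bounded_Icc[OF Q] by auto
  have Qm: "Q \<in> borel_measurable (lebesgue_Icc T)" by (rule continuous_imp_measurable_Icc[OF Q])
  have int: "integrable (lebesgue_Icc T) (\<lambda>s. g s * Q s)" if "integrable (lebesgue_Icc T) g" for g
  proof (rule Bochner_Integration.integrable_bound)
    show "integrable (lebesgue_Icc T) (\<lambda>s. C * g s)" using that by (rule integrable_mult_right)
    show "(\<lambda>s. g s * Q s) \<in> borel_measurable (lebesgue_Icc T)" using that Qm by (intro borel_measurable_times) auto
    show "AE s in lebesgue_Icc T. norm (g s * Q s) \<le> norm (C * g s)"
    proof (rule AE_I2)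
      fix s assume "s \<in> space (lebesgue_Icc T)"
      then have "\<bar>Q s\<bar> \<le> \<bar>C\<bar>" using C by force
      then have "\<bar>g s\<bar> * \<bar>Q s\<bar> \<le> \<bar>g s\<bar> * \<bar>C\<bar>" by (rule mult_left_mono) simp
      then show "norm (g s * Q s) \<le> norm (C * g s)" by (simp only: real_norm_def abs_mult mult.commute[of "\<bar>C\<bar>"])
    qed
  qed
  define e where "e n = (\<integral>\<^sup>+s. ennreal \<bar>f s - F n s\<bar> \<partial>lebesgue_Icc T)" for n
  have fi: "integrable (lebesgue_Icc T) f" "\<And>n. integrable (lebesgue_Icc T) (F n)"
    by (rule fbm_norm_sq_finite_integrable[OF f F(3)], rule fbm_norm_sq_finite_integrable[OF F(1,2)])
  have e: "e n = ennreal (\<integral>s. \<bar>f s - F n s\<bar> \<partial>lebesgue_Icc T)" for n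
    unfolding e_def using fi by (intro nn_integral_eq_integral) auto
  have "(e n)\<^sup>2 \<le> ?K * fbm_norm_sq H T (\<lambda>s. f s - F n s)" for n
    unfolding e_def using f F by (intro L1_le_fbm_norm_sq borel_measurable_diff) auto
  moreover have "(\<lambda>n. ?K * fbm_norm_sq H T (\<lambda>s. f s - F n s)) \<longlonglongrightarrow> ?K * 0"
    by (intro ennreal_tendsto_cmult lim) simp
  ultimately have "(\<lambda>n. (e n)\<^sup>2) \<longlonglongrightarrow> 0"
    by (intro tendsto_sandwich[where f="\<lambda>_. 0" and h="\<lambda>n. ?K * fbm_norm_sq H T (\<lambda>s. f s - F n s)" and g="\<lambda>n. (e n)\<^sup>2"] always_eventually allI) (simp_all only: zero_le mult_zero_right tendsto_const)
  then have "(\<lambda>n. ennreal ((\<integral>s. \<bar>f s - F n s\<bar> \<partial>lebesgue_Icc T)\<^sup>2)) \<longlonglongrightarrow> ennreal 0"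
    unfolding e by (simp add: ennreal_power)
  then have "(\<lambda>n. (\<integral>s. \<bar>f s - F n s\<bar> \<partial>lebesgue_Icc T)\<^sup>2) \<longlonglongrightarrow> 0"
    by (subst (asm) tendsto_ennreal_iff) auto
  then have "(\<lambda>n. sqrt ((\<integral>s. \<bar>f s - F n s\<bar> \<partial>lebesgue_Icc T)\<^sup>2)) \<longlonglongrightarrow> sqrt 0" by (rule tendsto_real_sqrt)
  then have z: "(\<lambda>n. C * (\<integral>s. \<bar>f s - F n s\<bar> \<partial>lebesgue_Icc T)) \<longlonglongrightarrow> 0"
    by (intro tendsto_mult_right_zero) simp
  have "(\<lambda>n. (\<integral>s. F n s * Q s \<partial>lebesgue_Icc T) - (\<integral>s. f s * Q s \<partial>lebesgue_Icc T)) \<longlonglongrightarrow> 0"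
  proof (rule Lim_null_comparison[OF _ z], rule always_eventually, rule allI)
    fix n
    have "(\<integral>s. F n s * Q s \<partial>lebesgue_Icc T) - (\<integral>s. f s * Q s \<partial>lebesgue_Icc T) = (\<integral>s. F n s * Q s - f s * Q s \<partial>lebesgue_Icc T)"
      using fi by (intro Bochner_Integration.integral_diff[symmetric] int) auto
    also have "norm \<dots> \<le> (\<integral>s. norm (F n s * Q s - f s * Q s) \<partial>lebesgue_Icc T)" by (rule integral_norm_bound)
    also have "\<dots> \<le> (\<integral>s. C * \<bar>f s - F n s\<bar> \<partial>lebesgue_Icc T)"
    proof (rule integral_mono)
      show "integrable (lebesgue_Icc T) (\<lambda>s. norm (F n s * Q s - f s * Q s))"
        using fi by (intro integrable_norm Bochner_Integration.integrable_diff int) auto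
      show "integrable (lebesgue_Icc T) (\<lambda>s. C * \<bar>f s - F n s\<bar>)" using fi by auto
      fix s assume "s \<in> space (lebesgue_Icc T)"
      then have "\<bar>Q s\<bar> \<le> C" using C by simp
      then have "\<bar>F n s - f s\<bar> * \<bar>Q s\<bar> \<le> \<bar>F n s - f s\<bar> * C" by (intro mult_left_mono) auto
      then show "norm (F n s * Q s - f s * Q s) \<le> C * \<bar>f s - F n s\<bar>"
        by (simp only: left_diff_distrib[symmetric] real_norm_def abs_mult mult.commute[of C] abs_minus_commute[of "f s"])
    qed
    finally show "norm ((\<integral>s. F n s * Q s \<partial>lebesgue_Icc T) - (\<integral>s. f s * Q s \<partial>lebesgue_Icc T)) \<le> C * (\<integral>s. \<bar>f s - F n s\<bar> \<partial>lebesgue_Icc T)" by simp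
  qed
  then show ?thesis by (simp add: LIM_zero_iff)
qed

text \<open>
  Along the approximating step functions the drift converges by \<open>integral_mult_tendsto_fbm\<close>, and the
  Abel transforms converge in \<open>L\<^sup>2\<close>, hence so do the variances; \<open>exp_moment_L2_limit\<close> does the rest.
\<close>

lemma fbm_wiener_exp_moment:
  assumes P: "prob_space P" and B: "fractional_brownian_motion P H T B" and Q: "continuous_on {0..T} Q"
    and f: "f \<in> borel_measurable (lebesgue_Icc T)"
    and I: "is_wiener_integral P (fbm_norm_sq H T) T (drifted Q B) f I"
  shows "(\<integral>\<^sup>+\<omega>. ennreal (exp (I \<omega> - (\<integral>s. f s * Q s \<partial>lebesgue_Icc T))) \<partial>P)
    \<le> ennreal (exp (fbm_energy_const H * (\<integral>r. (Lf f r)\<^sup>2 \<partial>lborel) / 2))"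
proof -
  have Im[measurable]: "I \<in> borel_measurable P" using I unfolding is_wiener_integral_def by (rule conjunct1)
  obtain F where FF: "(\<forall>n::nat. step_list T (F n)) \<and>
      (\<lambda>n. fbm_norm_sq H T (\<lambda>s. f s - step_fun (F n) s)) \<longlonglongrightarrow> 0 \<and>
      (\<lambda>n. L2_norm_sq P (\<lambda>\<omega>. I \<omega> - step_integral (F n) (drifted Q B) \<omega>)) \<longlonglongrightarrow> 0"
    using I unfolding is_wiener_integral_def by (elim conjE exE) (rule that, intro conjI)
  then have F: "\<And>n::nat. step_list T (F n)"
    and lim: "(\<lambda>n. fbm_norm_sq H T (\<lambda>s. f s - step_fun (F n) s)) \<longlonglongrightarrow> 0"
    and limI: "(\<lambda>n. L2_norm_sq P (\<lambda>\<omega>. I \<omega> - step_integral (F n) (drifted Q B) \<omega>)) \<longlonglongrightarrow> 0"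
    by auto
  have Fm: "step_fun (F n) \<in> borel_measurable (lebesgue_Icc T)" for n
    by (intro measurable_Icc_of_borel measurable_step_fun)
  have Ff: "fbm_norm_sq H T (step_fun (F n)) < \<infinity>" for n by (rule fbm_norm_sq_step_finite[OF F])
  have ff: "fbm_norm_sq H T f < \<infinity>"
  proof -
    have "eventually (\<lambda>n. fbm_norm_sq H T (\<lambda>s. f s - step_fun (F n) s) < \<infinity>) sequentially"
      using lim by (rule order_tendstoD) simp
    then obtain n where n: "fbm_norm_sq H T (\<lambda>s. f s - step_fun (F n) s) < \<infinity>"
      by (auto simp: eventually_sequentially)
    have "fbm_norm_sq H T (\<lambda>s. (f s - step_fun (F n) s) + step_fun (F n) s)
      \<le> 2 * (fbm_norm_sq H T (\<lambda>s. f s - step_fun (F n) s) + fbm_norm_sq H T (step_fun (F n)))"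
      by (intro fbm_norm_sq_add_le borel_measurable_diff f Fm)
    also have "\<dots> < \<infinity>" using n Ff[of n] by (simp add: ennreal_mult_less_top)
    finally show ?thesis by simp
  qed
  have gauss: "gaussian_rv P (\<lambda>\<omega>. \<Sum>t\<in>A. c t * B t \<omega>)" if "finite A" "A \<subseteq> {0..T}" for A c
    using B that unfolding fractional_brownian_motion_def by blast
  have Bm: "B t \<in> borel_measurable P" if "t \<in> {0..T}" for t
    using gauss[of "{t}" "\<lambda>_. 1"] that by (simp add: gaussian_rv_def)
  have Ym: "drifted Q B t \<in> borel_measurable P" if "t \<in> {0..T}" for t
    unfolding drifted_def[abs_def] using Bm[OF that] by simp
  have Lm: "Lf g \<in> borel_measurable lborel" if "g \<in> borel_measurable (lebesgue_Icc T)" for g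
    using measurable_abel_transform[OF that] by simp
  have Li: "integrable lborel (\<lambda>r. (Lf g r)\<^sup>2)" if "g \<in> borel_measurable (lebesgue_Icc T)" "fbm_norm_sq H T g < \<infinity>" for g
  proof (rule integrable_sq_of_L2_norm_sq[OF Lm[OF that(1)]])
    show "L2_norm_sq lborel (Lf g) < \<infinity>"
      using abel_transform_norm_le[OF that(1)] that(2) by (auto simp: ennreal_mult_less_top elim!: order.strict_trans1)
  qed
  define m where "m g = (\<integral>s. g s * Q s \<partial>lebesgue_Icc T)" for g
  define s where "s n = fbm_energy_const H * (\<integral>r. (Lf (step_fun (F n)) r)\<^sup>2 \<partial>lborel) / 2 + m (step_fun (F n)) - m f" for n
  have "(\<lambda>n. L2_norm_sq lborel (\<lambda>r. Lf f r - Lf (step_fun (F n)) r)) \<longlonglongrightarrow> 0"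
  proof (rule tendsto_sandwich[of "\<lambda>_. 0"])
    show "(\<lambda>n. ennreal (Beta a (2 - 2*H)) * fbm_norm_sq H T (\<lambda>s. f s - step_fun (F n) s)) \<longlonglongrightarrow> 0"
      using ennreal_tendsto_cmult[OF _ lim, of "ennreal (Beta a (2 - 2*H))"] by simp
    have "L2_norm_sq lborel (\<lambda>r. Lf f r - Lf (step_fun (F n)) r) \<le> ennreal (Beta a (2 - 2*H)) * fbm_norm_sq H T (\<lambda>s. f s - step_fun (F n) s)" for n
    proof -
      have "L2_norm_sq lborel (\<lambda>r. Lf f r - Lf (step_fun (F n)) r) = L2_norm_sq lborel (Lf (\<lambda>s. f s - step_fun (F n) s))"
        unfolding L2_norm_sq_def
      proof (rule nn_integral_cong_AE)
        show "AE r in lborel. ennreal ((Lf f r - Lf (step_fun (F n)) r)\<^sup>2) = ennreal ((Lf (\<lambda>s. f s - step_fun (F n) s) r)\<^sup>2)"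
          using abel_transform_diff_AE[OF f ff Fm Ff, of n] by eventually_elim simp
      qed
      also have "\<dots> \<le> ennreal (Beta a (2 - 2*H)) * fbm_norm_sq H T (\<lambda>s. f s - step_fun (F n) s)"
        by (intro abel_transform_norm_le borel_measurable_diff f Fm)
      finally show ?thesis .
    qed
    then show "\<forall>\<^sub>F n in sequentially. L2_norm_sq lborel (\<lambda>r. Lf f r - Lf (step_fun (F n)) r) \<le> ennreal (Beta a (2 - 2*H)) * fbm_norm_sq H T (\<lambda>s. f s - step_fun (F n) s)"
      by (intro always_eventually allI)
  qed auto
  then have "(\<lambda>n. \<integral>r. (Lf (step_fun (F n)) r)\<^sup>2 \<partial>lborel) \<longlonglongrightarrow> (\<integral>r. (Lf f r)\<^sup>2 \<partial>lborel)"
    by (intro integral_sq_tendsto Lm f Fm Li ff Ff)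
  moreover have "(\<lambda>n. m (step_fun (F n))) \<longlonglongrightarrow> m f"
    unfolding m_def by (intro integral_mult_tendsto_fbm Q f Fm Ff ff lim)
  ultimately have s: "s \<longlonglongrightarrow> fbm_energy_const H * (\<integral>r. (Lf f r)\<^sup>2 \<partial>lborel) / 2 + m f - m f"
    unfolding s_def by (intro tendsto_intros) auto
  show ?thesis
    unfolding m_def[symmetric]
  proof (rule exp_moment_L2_limit[where X="\<lambda>n \<omega>. step_integral (F n) (drifted Q B) \<omega> - m f" and s=s])
    show "(\<lambda>\<omega>. step_integral (F n) (drifted Q B) \<omega> - m f) \<in> borel_measurable P" for n
      by (intro borel_measurable_diff borel_measurable_const measurable_step_integral[OF F] Ym)
    show "(\<lambda>\<omega>. I \<omega> - m f) \<in> borel_measurable P" by simp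
    show "(\<lambda>n. L2_norm_sq P (\<lambda>\<omega>. I \<omega> - m f - (step_integral (F n) (drifted Q B) \<omega> - m f))) \<longlonglongrightarrow> 0"
      using limI by simp
    show "s \<longlonglongrightarrow> fbm_energy_const H * (\<integral>r. (Lf f r)\<^sup>2 \<partial>lborel) / 2" using s by simp
    fix n
    have Bs: "step_integral (F n) B \<in> borel_measurable P" by (intro measurable_step_integral[OF F] Bm)
    have "(\<integral>\<^sup>+\<omega>. ennreal (exp (step_integral (F n) (drifted Q B) \<omega> - m f)) \<partial>P)
      = (\<integral>\<^sup>+\<omega>. ennreal (exp (m (step_fun (F n)) - m f)) * ennreal (exp (step_integral (F n) B \<omega>)) \<partial>P)"
      by (intro nn_integral_cong) (simp add: step_integral_drifted[OF Q F] m_def exp_add[symmetric] ennreal_mult'[symmetric] algebra_simps)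
    also have "\<dots> = ennreal (exp (m (step_fun (F n)) - m f)) * (\<integral>\<^sup>+\<omega>. ennreal (exp (step_integral (F n) B \<omega>)) \<partial>P)"
      using Bs by (intro nn_integral_cmult) simp
    also have "\<dots> \<le> ennreal (exp (m (step_fun (F n)) - m f)) * ennreal (exp (fbm_energy_const H * (\<integral>r. (Lf (step_fun (F n)) r)\<^sup>2 \<partial>lborel) / 2))"
      by (intro mult_left_mono fbm_step_exp_moment P B F) simp
    also have "\<dots> = ennreal (exp (s n))"
      unfolding s_def by (simp add: exp_add[symmetric] ennreal_mult'[symmetric] algebra_simps)
    finally show "(\<integral>\<^sup>+\<omega>. ennreal (exp (step_integral (F n) (drifted Q B) \<omega> - m f)) \<partial>P) \<le> ennreal (exp (s n))" .
  qed
qed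

section \<open>The Molchan transform\<close>

lemma molchan_kernel_measurable: "molchan_kernel H t \<in> borel_measurable borel"
  unfolding molchan_kernel_def[abs_def] by measurable

lemma molchan_const_pos: "0 < molchan_const H"
  unfolding molchan_const_def using H by (auto intro!: divide_pos_pos mult_pos_pos zero_less_power Gamma_real_pos)

lemma molchan_kernel_nonneg: "0 \<le> molchan_kernel H t s"
  unfolding molchan_kernel_def using molchan_const_pos by (simp add: indicator_def)

text \<open>
  The powers of \<open>u\<close> in the two kernels cancel.  What is left is a Beta integral over \<open>(r,t)\<close> with
  exponents \<open>a - 1\<close> and \<open>-a\<close>, whose value does not depend on the interval.  This is the reason why the
  Molchan transform of fractional Brownian motion is a martingale: for \<open>r < t\<close> its Brownian integrand
  does not depend on \<open>t\<close>.
\<close>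

lemma molchan_kernel_transform_nn:
  "(\<integral>\<^sup>+u. ennreal (molchan_kernel H t u * abel_kernel a r u) \<partial>lborel)
    = ennreal (molchan_const H * Beta a (1 - a) * r powr (-a) * indicator {0<..<t} r)"
proof (cases "0 < r \<and> r < t")
  case True
  have c: "0 \<le> molchan_const H * r powr (-a)" using molchan_const_pos by simp
  have "(\<integral>\<^sup>+u. ennreal (molchan_kernel H t u * abel_kernel a r u) \<partial>lborel)
    = (\<integral>\<^sup>+u. ennreal (molchan_const H * r powr (-a)) * (ennreal ((u - r) powr (a - 1) * (t - u) powr ((1 - a) - 1)) * indicator {r..t} u) \<partial>lborel)"
  proof (rule nn_integral_cong_AE)
    have "AE u in lborel. u \<noteq> t" "AE u in lborel. u \<noteq> r" by (rule AE_lborel_singleton)+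
    then show "AE u in lborel. ennreal (molchan_kernel H t u * abel_kernel a r u)
      = ennreal (molchan_const H * r powr (-a)) * (ennreal ((u - r) powr (a - 1) * (t - u) powr ((1 - a) - 1)) * indicator {r..t} u)"
    proof eventually_elim
      case (elim u)
      show ?case
      proof (cases "r < u \<and> u < t")
        case u: True
        have one: "u powr (-a) * u powr a = 1" using u True by (simp flip: powr_add)
        have e: "1/2 - H = -a" "(1 - a) - 1 = -a" by auto
        have k: "molchan_kernel H t u = molchan_const H * u powr (-a) * (t - u) powr (-a)"
          unfolding molchan_kernel_def e using u True by simp
        have k2: "abel_kernel a r u = r powr (-a) * u powr a * (u - r) powr (a - 1)"
          unfolding abel_kernel_def using u True by simp
        have "molchan_kernel H t u * abel_kernel a r u = (u powr (-a) * u powr a) * (molchan_const H * r powr (-a) * ((u - r) powr (a - 1) * (t - u) powr (-a)))"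
          unfolding k k2 by (simp only: ac_simps)
        then have k3: "molchan_kernel H t u * abel_kernel a r u = molchan_const H * r powr (-a) * ((u - r) powr (a - 1) * (t - u) powr (-a))"
          unfolding one by (simp only: mult_1_left)
        have "indicator {r..t} u = (1::ennreal)" using u by simp
        then show ?thesis unfolding k3 e(2) ennreal_mult'[OF c] by (simp only: mult_1_right)
      next
        case False
        then have "molchan_kernel H t u * abel_kernel a r u = 0" "indicator {r..t} u = (0::ennreal)"
          using elim by (auto simp: molchan_kernel_def abel_kernel_def indicator_def)
        then show ?thesis by (simp only: ennreal_0 mult_zero_right)
      qed
    qed
  qed
  also have "\<dots> = ennreal (molchan_const H * r powr (-a)) * ennreal ((t - r) powr (a + (1 - a) - 1) * Beta a (1 - a))"
    using a True by (subst nn_integral_cmult) (simp_all only: nn_integral_Beta_interval, auto)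
  also have "\<dots> = ennreal (molchan_const H * Beta a (1 - a) * r powr (-a) * indicator {0<..<t} r)"
    using True by (subst ennreal_mult'[OF c, symmetric]) (simp add: ac_simps)
  finally show ?thesis .
next
  case False
  then have "molchan_kernel H t u * abel_kernel a r u = 0" for u
    by (cases "0 < r \<and> r < u \<and> 0 < u \<and> u < t") (auto simp: molchan_kernel_def abel_kernel_def)
  moreover have "indicator {0<..<t} r = (0::real)" using False by (auto simp: indicator_def)
  ultimately show ?thesis by (simp only: mult_zero_right ennreal_0 nn_integral_const mult_zero_left)
qed

lemma molchan_kernel_transform:
  assumes "t \<in> {0..T}"
  shows "integrable lborel (\<lambda>u. molchan_kernel H t u * indicator {0..T} u * abel_kernel a r u)"
    and "Lf (molchan_kernel H t) r = molchan_const H * Beta a (1 - a) * r powr (-a) * indicator {0<..<t} r"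
proof -
  have eq: "molchan_kernel H t u * indicator {0..T} u * abel_kernel a r u = molchan_kernel H t u * abel_kernel a r u" for u
    using assms by (auto simp: molchan_kernel_def indicator_def)
  have pos: "0 \<le> molchan_kernel H t u * abel_kernel a r u" for u
    by (intro mult_nonneg_nonneg molchan_kernel_nonneg abel_kernel_nonneg)
  have m: "(\<lambda>u. molchan_kernel H t u * abel_kernel a r u) \<in> borel_measurable lborel"
    using molchan_kernel_measurable by simp
  have B: "0 \<le> molchan_const H * Beta a (1 - a) * r powr (-a) * indicator {0<..<t} r"
    using molchan_const_pos Beta_real_positive[of a "1 - a"] a by simp
  have "integrable lborel (\<lambda>u. molchan_kernel H t u * abel_kernel a r u) \<and>
    (\<integral>u. molchan_kernel H t u * abel_kernel a r u \<partial>lborel) = molchan_const H * Beta a (1 - a) * r powr (-a) * indicator {0<..<t} r"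
    using nn_integral_eq_integrable[OF m _ B] molchan_kernel_transform_nn pos by simp
  then show "integrable lborel (\<lambda>u. molchan_kernel H t u * indicator {0..T} u * abel_kernel a r u)"
    and "Lf (molchan_kernel H t) r = molchan_const H * Beta a (1 - a) * r powr (-a) * indicator {0<..<t} r"
    unfolding abel_transform_def eq by auto
qed

text \<open>
  The Molchan constant is made for this identity: an integral over \<open>Z\<close> has variance equal to the
  squared norm of its integrand for the bracket, with factor one.  The factor matters, since the
  penalty exceeds the noise level by an arbitrarily small margin.
\<close>

lemma molchan_normalisation:
  "fbm_energy_const H * (molchan_const H * Beta a (1 - a))\<^sup>2 = 2 - 2 * H"
proof -
  define b where "b = H - 1/2"
  have b: "0 < b" "b < 1/2" using H by (auto simp: b_def)
  have G: "0 < Gamma b" "0 < Gamma (1 - b)" "0 < Gamma (1 - 2*b)"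
    using b by (auto intro!: Gamma_real_pos)
  have B1: "Beta b (1 - b) = Gamma b * Gamma (1 - b)"
    using Beta_mult_Gamma[of b "1 - b"] b by simp
  have "Beta b (1 - 2*b) * Gamma (1 - b) = Gamma b * Gamma (1 - 2*b)"
    using Beta_mult_Gamma[of b "1 - 2*b"] b by simp
  then have B2: "Beta b (1 - 2*b) = Gamma b * Gamma (1 - 2*b) / Gamma (1 - b)"
    using G by (subst eq_divide_eq) simp
  have c: "(molchan_const H)\<^sup>2 = Gamma (3 - 2*H) / (2 * H * Gamma (3/2 - H) ^ 3 * Gamma (H + 1/2))"
    unfolding molchan_const_def using H by (intro real_sqrt_pow2 divide_nonneg_nonneg mult_nonneg_nonneg zero_le_power less_imp_le[OF Gamma_real_pos]) auto
  have e: "3 - 2*H = (1 - 2*b) + 1" "3/2 - H = 1 - b" "H + 1/2 = b + 1" "2 - 2*H = 1 - 2*b" "2*H - 1 = 2*b" "H - 1/2 = b"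
    by (auto simp: b_def)
  have g1: "Gamma ((1 - 2*b) + 1) = (1 - 2*b) * Gamma (1 - 2*b)"
    using b nonpos_Ints_nonpos[of "1 - 2*b"] by (intro Gamma_plus1) auto
  have g2: "Gamma (b + 1) = b * Gamma b"
    using b nonpos_Ints_nonpos[of b] by (intro Gamma_plus1) auto
  have "H * (2*b) / (X * Y / Z) * (k * Y / (2 * H * Z ^ 3 * (b * X)) * (X * Z)\<^sup>2) = k" if "X > 0" "Y > 0" "Z > 0" for X Y Z k :: real
    using that b H by (simp add: field_simps power2_eq_square power3_eq_cube)
  from this[OF G(1) G(3) G(2), of "1 - 2*b"] show ?thesis
    unfolding power_mult_distrib c fbm_energy_const_def e g1 g2 B1 B2 .
qed

end

text \<open>
  Approximating lists are concatenated after the entries of the second one have been rescaled.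
\<close>

lemma is_wiener_integral_add_scaled:
  assumes Y: "\<And>t. t \<in> {0..T} \<Longrightarrow> Y t \<in> borel_measurable P"
    and add: "\<And>f g. f \<in> borel_measurable (lebesgue_Icc T) \<Longrightarrow> g \<in> borel_measurable (lebesgue_Icc T)
       \<Longrightarrow> nrm (\<lambda>x. f x + g x) \<le> 2 * (nrm f + nrm g)"
    and cmult: "\<And>f c. f \<in> borel_measurable (lebesgue_Icc T) \<Longrightarrow> nrm (\<lambda>x. c * f x) = ennreal (c\<^sup>2) * nrm f"
    and f: "f \<in> borel_measurable (lebesgue_Icc T)" "is_wiener_integral P nrm T Y f I"
    and g: "g \<in> borel_measurable (lebesgue_Icc T)" "is_wiener_integral P nrm T Y g J"
  shows "is_wiener_integral P nrm T Y (\<lambda>s. f s + c * g s) (\<lambda>\<omega>. I \<omega> + c * J \<omega>)"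
proof -
  obtain F where F: "\<forall>n::nat. step_list T (F n)" "(\<lambda>n. nrm (\<lambda>s. f s - step_fun (F n) s)) \<longlonglongrightarrow> 0"
     "(\<lambda>n. L2_norm_sq P (\<lambda>\<omega>. I \<omega> - step_integral (F n) Y \<omega>)) \<longlonglongrightarrow> 0" and I: "I \<in> borel_measurable P"
    using f(2) unfolding is_wiener_integral_def by auto
  obtain G where G: "\<forall>n::nat. step_list T (G n)" "(\<lambda>n. nrm (\<lambda>s. g s - step_fun (G n) s)) \<longlonglongrightarrow> 0"
     "(\<lambda>n. L2_norm_sq P (\<lambda>\<omega>. J \<omega> - step_integral (G n) Y \<omega>)) \<longlonglongrightarrow> 0" and J: "J \<in> borel_measurable P"
    using g(2) unfolding is_wiener_integral_def by auto
  define K where "K n = F n @ map (\<lambda>(x, u, v). (c * x, u, v)) (G n)" for n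
  have K1: "step_fun (K n) s = step_fun (F n) s + c * step_fun (G n) s" for n s
  proof -
    have "step_fun (map (\<lambda>(x, u, v). (c * x, u, v)) xs) s = c * step_fun xs s" for xs
      by (induction xs) (auto simp: step_fun_def algebra_simps)
    then show ?thesis by (simp add: K_def step_fun_def)
  qed
  have K2: "step_integral (K n) Y \<omega> = step_integral (F n) Y \<omega> + c * step_integral (G n) Y \<omega>" for n \<omega>
  proof -
    have "step_integral (map (\<lambda>(x, u, v). (c * x, u, v)) xs) Y \<omega> = c * step_integral xs Y \<omega>" for xs
      by (induction xs) (auto simp: step_integral_def algebra_simps)
    then show ?thesis by (simp add: K_def step_integral_def)
  qed
  have K: "\<forall>n. step_list T (K n)" using F(1) G(1) unfolding step_list_def K_def by (simp add: ball_Un case_prod_beta)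
  have sm: "step_fun xs \<in> borel_measurable (lebesgue_Icc T)" for xs
    unfolding lebesgue_Icc_def by (rule measurable_restrict_space1) simp
  have lim0: "(\<lambda>n. 2 * (u n + ennreal (c\<^sup>2) * v n)) \<longlonglongrightarrow> 0" if "u \<longlonglongrightarrow> 0" "v \<longlonglongrightarrow> 0" for u v :: "nat \<Rightarrow> ennreal"
  proof -
    have "(\<lambda>n. 2 * (u n + ennreal (c\<^sup>2) * v n)) \<longlonglongrightarrow> 2 * (0 + ennreal (c\<^sup>2) * 0)"
      using that by (intro ennreal_tendsto_cmult tendsto_add) auto
    then show ?thesis by simp
  qed
  have N: "nrm (\<lambda>s. f s + c * g s - step_fun (K n) s) \<le> 2 * (nrm (\<lambda>s. f s - step_fun (F n) s) + ennreal (c\<^sup>2) * nrm (\<lambda>s. g s - step_fun (G n) s))" for n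
  proof -
    have "(\<lambda>s. f s + c * g s - step_fun (K n) s) = (\<lambda>s. (f s - step_fun (F n) s) + c * (g s - step_fun (G n) s))"
      by (auto simp: K1 algebra_simps)
    then have "nrm (\<lambda>s. f s + c * g s - step_fun (K n) s) \<le> 2 * (nrm (\<lambda>s. f s - step_fun (F n) s) + nrm (\<lambda>s. c * (g s - step_fun (G n) s)))"
      by (simp only:) (rule add; intro borel_measurable_diff borel_measurable_times borel_measurable_const f(1) g(1) sm)
    also have "nrm (\<lambda>s. c * (g s - step_fun (G n) s)) = ennreal (c\<^sup>2) * nrm (\<lambda>s. g s - step_fun (G n) s)"
      by (rule cmult; intro borel_measurable_diff g(1) sm)
    finally show ?thesis .
  qed
  have Ym: "step_integral (F n) Y \<in> borel_measurable P" "step_integral (G n) Y \<in> borel_measurable P" for n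
    using F(1) G(1) by (auto intro!: measurable_step_integral[of T] Y)
  have L: "L2_norm_sq P (\<lambda>\<omega>. I \<omega> + c * J \<omega> - step_integral (K n) Y \<omega>)
     \<le> 2 * (L2_norm_sq P (\<lambda>\<omega>. I \<omega> - step_integral (F n) Y \<omega>) + ennreal (c\<^sup>2) * L2_norm_sq P (\<lambda>\<omega>. J \<omega> - step_integral (G n) Y \<omega>))" for n
  proof -
    have "(\<lambda>\<omega>. I \<omega> + c * J \<omega> - step_integral (K n) Y \<omega>) = (\<lambda>\<omega>. (I \<omega> - step_integral (F n) Y \<omega>) + c * (J \<omega> - step_integral (G n) Y \<omega>))"
      by (auto simp: K2 algebra_simps)
    then have "L2_norm_sq P (\<lambda>\<omega>. I \<omega> + c * J \<omega> - step_integral (K n) Y \<omega>) \<le> 2 * (L2_norm_sq P (\<lambda>\<omega>. I \<omega> - step_integral (F n) Y \<omega>) + L2_norm_sq P (\<lambda>\<omega>. c * (J \<omega> - step_integral (G n) Y \<omega>)))"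
      by (simp only:) (rule L2_norm_sq_add_le; intro borel_measurable_diff borel_measurable_times borel_measurable_const I J Ym)
    also have "L2_norm_sq P (\<lambda>\<omega>. c * (J \<omega> - step_integral (G n) Y \<omega>)) = ennreal (c\<^sup>2) * L2_norm_sq P (\<lambda>\<omega>. J \<omega> - step_integral (G n) Y \<omega>)"
      by (rule L2_norm_sq_cmult; intro borel_measurable_diff J Ym)
    finally show ?thesis .
  qed
  have "(\<lambda>n. nrm (\<lambda>s. f s + c * g s - step_fun (K n) s)) \<longlonglongrightarrow> 0"
    by (rule tendsto_sandwich[OF always_eventually always_eventually tendsto_const lim0[OF F(2) G(2)]], rule allI, rule zero_le, rule allI, rule N)
  moreover have "(\<lambda>n. L2_norm_sq P (\<lambda>\<omega>. I \<omega> + c * J \<omega> - step_integral (K n) Y \<omega>)) \<longlonglongrightarrow> 0"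
    by (rule tendsto_sandwich[OF always_eventually always_eventually tendsto_const lim0[OF F(3) G(3)]], rule allI, rule zero_le, rule allI, rule L)
  moreover have "(\<lambda>\<omega>. I \<omega> + c * J \<omega>) \<in> borel_measurable P" using I J by simp
  ultimately show ?thesis using K unfolding is_wiener_integral_def by blast
qed

context hurst
begin

lemma integral_bracket:
  assumes "f \<in> borel_measurable (lebesgue_Icc T)"
  shows "(\<integral>s. f s \<partial>bracket H T) = (\<integral>s. (2 - 2*H) * s powr (1 - 2*H) * f s \<partial>lebesgue_Icc T)"
  unfolding bracket_def using H assms
  by (subst integral_real_density) (auto intro: measurable_Icc_of_borel simp: mult.assoc)

text \<open>
  A step integral over the transformed process is a Wiener integral over the original one, whose
  integrand is the same combination of Molchan kernels.
\<close>

lemma step_integral_molchan: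
  assumes P: "prob_space P" and B: "fractional_brownian_motion P H T B" and Q: "continuous_on {0..T} Q"
    and R: "molchan_transform P H T (drifted Q B) R" and xs: "step_list T xs"
  shows "is_wiener_integral P (fbm_norm_sq H T) T (drifted Q B)
    (\<lambda>s. step_integral xs (\<lambda>t s. molchan_kernel H t s) s) (step_integral xs R)"
  using xs
proof (induction xs)
  case Nil
  show ?case unfolding is_wiener_integral_def
    by (auto intro!: exI[of _ "\<lambda>_. []"] simp: step_integral_def[abs_def] step_fun_def step_list_def L2_norm_sq_def fbm_norm_sq_def)
next
  case (Cons x xs)
  obtain c u v where x: "x = (c, u, v)" by (cases x)
  have uv: "u \<in> {0..T}" "v \<in> {0..T}" and xs: "step_list T xs" using Cons.prems by (auto simp: x step_list_def)
  have gauss: "gaussian_rv P (\<lambda>\<omega>. \<Sum>t\<in>A. c t * B t \<omega>)" if "finite A" "A \<subseteq> {0..T}" for A c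
    using B that unfolding fractional_brownian_motion_def by blast
  have Ym: "drifted Q B t \<in> borel_measurable P" if "t \<in> {0..T}" for t
  proof -
    have [measurable]: "B t \<in> borel_measurable P" using gauss[of "{t}" "\<lambda>_. 1"] that by (simp add: gaussian_rv_def)
    show ?thesis unfolding drifted_def[abs_def] by measurable
  qed
  have km: "molchan_kernel H t \<in> borel_measurable (lebesgue_Icc T)" for t
    by (rule measurable_Icc_of_borel[OF molchan_kernel_measurable])
  have R': "is_wiener_integral P (fbm_norm_sq H T) T (drifted Q B) (molchan_kernel H t) (R t)" if "t \<in> {0..T}" for t
    using R that unfolding molchan_transform_def by blast
  have xm: "(\<lambda>s. step_integral xs (\<lambda>t s. molchan_kernel H t s) s) \<in> borel_measurable (lebesgue_Icc T)"
    by (rule measurable_step_integral[OF xs km])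
  note lin = is_wiener_integral_add_scaled[where T=T and nrm="fbm_norm_sq H T" and P=P and Y="drifted Q B", OF Ym fbm_norm_sq_add_le fbm_norm_sq_cmult]
  have 1: "is_wiener_integral P (fbm_norm_sq H T) T (drifted Q B)
      (\<lambda>s. step_integral xs (\<lambda>t s. molchan_kernel H t s) s + c * molchan_kernel H v s) (\<lambda>\<omega>. step_integral xs R \<omega> + c * R v \<omega>)"
    by (rule lin[OF _ _ _ _ xm Cons.IH[OF xs] km R'[OF uv(2)]])
  have "is_wiener_integral P (fbm_norm_sq H T) T (drifted Q B)
      (\<lambda>s. step_integral xs (\<lambda>t s. molchan_kernel H t s) s + c * molchan_kernel H v s + (-c) * molchan_kernel H u s)
      (\<lambda>\<omega>. step_integral xs R \<omega> + c * R v \<omega> + (-c) * R u \<omega>)"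
    by (rule lin[OF _ _ _ _ borel_measurable_add[OF xm borel_measurable_times[OF borel_measurable_const km]] 1 km R'[OF uv(1)]])
  then show ?case by (simp add: x step_integral_def[abs_def] algebra_simps)
qed

text \<open>
  The combination of Molchan kernels that belongs to a step function has as its Abel transform a
  constant times \<open>r powr (-a)\<close> times the step function, and \<open>(r powr (-a))\<^sup>2 = r powr (1 - 2 * H)\<close> is the
  density of the bracket up to its constant.
\<close>

lemma molchan_step_exp_moment:
  assumes P: "prob_space P" and B: "fractional_brownian_motion P H T B" and Q: "continuous_on {0..T} Q"
    and R: "molchan_transform P H T (drifted Q B) R" and xs: "step_list T xs"
  shows "(\<integral>\<^sup>+\<omega>. ennreal (exp (step_integral xs R \<omega> - step_integral xs (\<lambda>t _. j_map H Q t) ())) \<partial>P)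
    \<le> ennreal (exp ((\<integral>s. (step_fun xs s)\<^sup>2 \<partial>bracket H T) / 2))"
proof -
  define A where "A = step_points xs"
  define c where "c = step_coeff xs"
  have A: "finite A" "A \<subseteq> {0..T}" using step_points_subset[OF xs] by (auto simp: A_def)
  define f where "f s = step_integral xs (\<lambda>t s. molchan_kernel H t s) s" for s
  have f: "f s = (\<Sum>t\<in>A. c t * molchan_kernel H t s)" for s
    unfolding f_def A_def c_def by (rule step_integral_eq_sum)
  have km: "molchan_kernel H t \<in> borel_measurable (lebesgue_Icc T)" for t
    by (rule measurable_Icc_of_borel[OF molchan_kernel_measurable])
  have fm: "f \<in> borel_measurable (lebesgue_Icc T)"
    unfolding f_def by (rule measurable_step_integral[OF xs km])
  let ?K = "molchan_const H * Beta a (1 - a)"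
  have Lf: "AE r in lborel. Lf f r = ?K * r powr (-a) * (step_fun xs r * indicator {0..T} r)"
  proof -
    have "AE r in lborel. \<forall>t\<in>A. r \<noteq> t"
      by (subst AE_finite_all[OF A(1)]) (auto intro: AE_lborel_singleton)
    then show ?thesis
    proof eventually_elim
      case (elim r)
      have pt: "f u * indicator {0..T} u * abel_kernel a r u = (\<Sum>t\<in>A. c t * (molchan_kernel H t u * indicator {0..T} u * abel_kernel a r u))" for u
        unfolding f sum_distrib_right by (intro sum.cong refl) (simp only: ac_simps)
      have "Lf f r = (\<Sum>t\<in>A. c t * Lf (molchan_kernel H t) r)"
      proof -
        have "Lf f r = (\<Sum>t\<in>A. (\<integral>u. c t * (molchan_kernel H t u * indicator {0..T} u * abel_kernel a r u) \<partial>lborel))"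
          unfolding abel_transform_def pt
          by (intro Bochner_Integration.integral_sum integrable_mult_right molchan_kernel_transform) (use A in auto)
        then show ?thesis unfolding abel_transform_def by simp
      qed
      also have "\<dots> = (\<Sum>t\<in>A. ?K * r powr (-a) * (c t * indicator {0<..t} r * indicator {0..T} r))"
      proof (rule sum.cong[OF refl])
        fix t assume t: "t \<in> A"
        have "indicator {0<..<t} r = (indicator {0<..t} r * indicator {0..T} r :: real)"
          using elim t A by (auto simp: indicator_def)
        then show "c t * Lf (molchan_kernel H t) r = ?K * r powr (-a) * (c t * indicator {0<..t} r * indicator {0..T} r)"
          using molchan_kernel_transform(2)[of t r] t A by auto
      qed
      also have "\<dots> = ?K * r powr (-a) * (step_fun xs r * indicator {0..T} r)"
        unfolding step_fun_eq_sum[OF xs] A_def c_def by (simp only: sum_distrib_left sum_distrib_right)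
      finally show ?case .
    qed
  qed
  have "(\<integral>r. (Lf f r)\<^sup>2 \<partial>lborel) = (\<integral>r. ?K\<^sup>2 * (indicator {0..T} r * (r powr (1 - 2*H) * (step_fun xs r)\<^sup>2)) \<partial>lborel)"
  proof (rule integral_cong_AE)
    show "(\<lambda>r. (Lf f r)\<^sup>2) \<in> borel_measurable lborel" using measurable_abel_transform[OF fm] by simp
    have "AE r in lborel. r \<noteq> (0::real)" by (rule AE_lborel_singleton)
    then show "AE r in lborel. (Lf f r)\<^sup>2 = ?K\<^sup>2 * (indicator {0..T} r * (r powr (1 - 2*H) * (step_fun xs r)\<^sup>2))"
      using Lf
    proof eventually_elim
      case (elim r)
      have "(r powr (-a))\<^sup>2 = r powr (1 - 2*H)" by (simp add: power2_eq_square flip: powr_add)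
      moreover have "(indicator {0..T} r)\<^sup>2 = (indicator {0..T} r :: real)" by (auto simp: indicator_def)
      ultimately show ?case unfolding elim by (simp only: power_mult_distrib ac_simps)
    qed
  qed simp
  then have "fbm_energy_const H * (\<integral>r. (Lf f r)\<^sup>2 \<partial>lborel)
     = fbm_energy_const H * ?K\<^sup>2 * (\<integral>r. indicator {0..T} r * (r powr (1 - 2*H) * (step_fun xs r)\<^sup>2) \<partial>lborel)" by simp
  also have "\<dots> = (2 - 2*H) * (\<integral>r. r powr (1 - 2*H) * (step_fun xs r)\<^sup>2 \<partial>lebesgue_Icc T)"
    unfolding molchan_normalisation integral_lebesgue_Icc ..
  also have "\<dots> = (\<integral>s. (step_fun xs s)\<^sup>2 \<partial>bracket H T)"
    by (subst integral_bracket) (auto intro!: measurable_Icc_of_borel simp: mult.assoc)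
  finally have var: "fbm_energy_const H * (\<integral>r. (Lf f r)\<^sup>2 \<partial>lborel) = (\<integral>s. (step_fun xs s)\<^sup>2 \<partial>bracket H T)" .
  have "(\<integral>s. f s * Q s \<partial>lebesgue_Icc T) = (\<Sum>t\<in>A. c t * j_map H Q t)"
  proof -
    obtain C where C: "0 < C" "\<forall>s\<in>{0..T}. \<bar>Q s\<bar> \<le> C" using continuous_bounded_Icc[OF Q] by auto
    have ki: "integrable (lebesgue_Icc T) (\<lambda>s. molchan_kernel H t s)" if "t \<in> A" for t
    proof (cases "t = 0")
      case False
      then have "0 < t" using that A by auto
      have "(\<integral>\<^sup>+s. ennreal (molchan_kernel H t s) \<partial>lborel) \<le> (\<integral>\<^sup>+s. ennreal (molchan_const H) * (ennreal ((s - 0) powr ((1 - a) - 1) * (t - s) powr ((1 - a) - 1)) * indicator {0..t} s) \<partial>lborel)"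
        using molchan_const_pos by (intro nn_integral_mono) (auto simp: molchan_kernel_def indicator_def ennreal_mult' mult.assoc)
      also have "\<dots> < \<infinity>"
        using a \<open>0 < t\<close> by (subst nn_integral_cmult, simp, subst nn_integral_Beta_interval) (auto simp: ennreal_mult_less_top)
      finally have i: "integrable lborel (molchan_kernel H t)"
        using molchan_kernel_measurable molchan_kernel_nonneg by (intro integrableI_nonneg) auto
      show ?thesis unfolding integrable_lebesgue_Icc
        by (rule integrable_real_mult_indicator[of "{0..T}" lborel, OF _ i, unfolded mult.commute[of _ "indicator _ _"]]) simp
    next
      case True
      then have "molchan_kernel H t = (\<lambda>_. 0)" by (auto simp: molchan_kernel_def indicator_def)
      then show ?thesis by simp
    qed
    have i: "integrable (lebesgue_Icc T) (\<lambda>s. molchan_kernel H t s * Q s)" if "t \<in> A" for t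
    proof (rule Bochner_Integration.integrable_bound)
      show "integrable (lebesgue_Icc T) (\<lambda>s. molchan_kernel H t s * C)" using ki[OF that] by (rule integrable_mult_left)
      show "(\<lambda>s. molchan_kernel H t s * Q s) \<in> borel_measurable (lebesgue_Icc T)"
        by (intro borel_measurable_times km continuous_imp_measurable_Icc Q)
      show "AE s in lebesgue_Icc T. norm (molchan_kernel H t s * Q s) \<le> norm (molchan_kernel H t s * C)"
      proof (rule AE_I2)
        fix s assume "s \<in> space (lebesgue_Icc T)"
        then have "\<bar>Q s\<bar> \<le> \<bar>C\<bar>" using C by force
        then show "norm (molchan_kernel H t s * Q s) \<le> norm (molchan_kernel H t s * C)"
          unfolding real_norm_def abs_mult by (rule mult_left_mono) simp
      qed
    qed
    have "(\<integral>s. f s * Q s \<partial>lebesgue_Icc T) = (\<integral>s. (\<Sum>t\<in>A. c t * (molchan_kernel H t s * Q s)) \<partial>lebesgue_Icc T)"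
      unfolding f sum_distrib_right by (simp only: mult.assoc)
    also have "\<dots> = (\<Sum>t\<in>A. \<integral>s. c t * (molchan_kernel H t s * Q s) \<partial>lebesgue_Icc T)"
      by (intro Bochner_Integration.integral_sum integrable_mult_right i)
    also have "\<dots> = (\<Sum>t\<in>A. c t * j_map H Q t)"
    proof (rule sum.cong[OF refl])
      fix t assume t: "t \<in> A"
      have "(\<integral>s. molchan_kernel H t s * Q s \<partial>lebesgue_Icc T) = j_map H Q t"
        unfolding j_map_def integral_lebesgue_Icc set_lebesgue_integral_def
        using t A by (intro Bochner_Integration.integral_cong) (auto simp: molchan_kernel_def indicator_def)
      then show "(\<integral>s. c t * (molchan_kernel H t s * Q s) \<partial>lebesgue_Icc T) = c t * j_map H Q t"
        by simp
    qed
    finally show ?thesis .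
  qed
  then have mean: "(\<integral>s. f s * Q s \<partial>lebesgue_Icc T) = step_integral xs (\<lambda>t _. j_map H Q t) ()"
    unfolding A_def c_def by (simp add: step_integral_eq_sum)
  have "is_wiener_integral P (fbm_norm_sq H T) T (drifted Q B) f (step_integral xs R)"
    unfolding f_def[abs_def] by (rule step_integral_molchan[OF P B Q R xs])
  from fbm_wiener_exp_moment[OF P B Q fm this] show ?thesis
    unfolding var mean .
qed

end

section \<open>The drift\<close>

lemma C1_on_Icc_imp_continuous_on:
  assumes "C1_on_Icc T Q"
  shows "continuous_on {0..T} Q"
proof -
  obtain Q' where "\<forall>t\<in>{0..T}. (Q has_real_derivative Q' t) (at t within {0..T})"
    using assms unfolding C1_on_Icc_def by auto
  then show ?thesis by (intro continuous_on_eq_continuous_within[THEN iffD2] ballI DERIV_continuous) blast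
qed

text \<open>
  Differentiation under the integral sign with one-sided derivatives at the end points.  Uniform
  continuity of \<open>Q'\<close> makes the remainder of the mean value theorem small uniformly in \<open>x\<close>.
\<close>

lemma dilation_integral_derivative:
  fixes Q Q' :: "real \<Rightarrow> real"
  assumes N: "finite_measure N" "space N = {0..1}" "sets N = sets (restrict_space borel {0..1})"
    and Q': "continuous_on {0..T} Q'"
    and deriv: "\<And>t. t \<in> {0..T} \<Longrightarrow> (Q has_real_derivative Q' t) (at t within {0..T})"
  shows "\<And>t. t \<in> {0..T} \<Longrightarrow> ((\<lambda>t. \<integral>x. Q (t * x) \<partial>N) has_real_derivative (\<integral>x. x * Q' (t * x) \<partial>N)) (at t within {0..T})"
    and "continuous_on {0..T} (\<lambda>t. \<integral>x. x * Q' (t * x) \<partial>N)"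
proof -
  interpret finite_measure N by fact
  define m where "m = measure N (space N)"
  have m: "0 \<le> m" by (simp add: m_def)
  have Qc: "continuous_on {0..T} Q"
    using deriv by (intro continuous_on_eq_continuous_within[THEN iffD2] ballI DERIV_continuous) blast
  have in01: "t * x \<in> {0..T}" if "t \<in> {0..T}" "x \<in> {0..1}" for t x
    using that mult_mono[of t T x 1] by auto
  have int: "integrable N (\<lambda>x. u x * f (t * x))"
    if "t \<in> {0..T}" "continuous_on {0..T} f" "continuous_on {0..1} u" for t :: real and f u :: "real \<Rightarrow> real"
  proof -
    have c: "continuous_on {0..1} (\<lambda>x. u x * f (t * x))"
      using that in01[OF that(1)] by (intro continuous_intros continuous_on_compose2[OF that(2)]) auto
    have meas: "(\<lambda>x. u x * f (t * x)) \<in> borel_measurable N"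
      using borel_measurable_continuous_on_restrict[OF c] measurable_cong_sets[OF N(3) refl] by blast
    have "bounded ((\<lambda>x. u x * f (t * x)) ` {0..1})"
      by (intro compact_imp_bounded compact_continuous_image c compact_Icc)
    then obtain B where "\<forall>x\<in>{0..1}. \<bar>u x * f (t * x)\<bar> \<le> B" by (auto simp: bounded_iff)
    then show ?thesis using N(2) by (intro integrable_const_bound[of _ B] AE_I2 meas) auto
  qed
  have unif: "\<exists>d>0. \<forall>y\<in>{0..T}. \<forall>z\<in>{0..T}. \<bar>y - z\<bar> < d \<longrightarrow> \<bar>Q' y - Q' z\<bar> < e" if "0 < e" for e
    using compact_uniformly_continuous[OF Q' compact_Icc] that unfolding uniformly_continuous_on_def dist_real_def by metis
  have remainder: "\<bar>Q y - Q z - Q' z * (y - z)\<bar> \<le> e * \<bar>y - z\<bar>"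
    if yz: "y \<in> {0..T}" "z \<in> {0..T}" "\<bar>y - z\<bar> < d"
      and d: "\<forall>y\<in>{0..T}. \<forall>z\<in>{0..T}. \<bar>y - z\<bar> < d \<longrightarrow> \<bar>Q' y - Q' z\<bar> < e" for y z d e
  proof -
    have ex: "\<exists>x\<in>{p..q}. Q q - Q p = Q' x * (q - p)" if "p \<le> q" "p \<in> {0..T}" "q \<in> {0..T}" for p q
    proof (rule mvt_very_simple[OF that(1), of Q "\<lambda>x. (*) (Q' x)", simplified])
      fix x assume "p \<le> x" "x \<le> q"
      then have "(Q has_real_derivative Q' x) (at x within {0..T})" "{p..q} \<subseteq> {0..T}" using that by (auto intro!: deriv)
      then show "(Q has_derivative (*) (Q' x)) (at x within {p..q})"
        unfolding has_field_derivative_def[symmetric] by (rule DERIV_subset)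
    qed
    have "\<exists>x\<in>{0..T}. \<bar>x - z\<bar> \<le> \<bar>y - z\<bar> \<and> Q y - Q z = Q' x * (y - z)"
    proof (cases "z \<le> y")
      case True
      then obtain x where "x \<in> {z..y}" "Q y - Q z = Q' x * (y - z)" using ex[of z y] yz by blast
      then show ?thesis using yz by (intro bexI[of _ x]) auto
    next
      case False
      then obtain x where "x \<in> {y..z}" "Q z - Q y = Q' x * (z - y)" using ex[of y z] yz by force
      moreover from this have "Q y - Q z = Q' x * (y - z)" by (simp add: algebra_simps)
      ultimately show ?thesis using yz by (intro bexI[of _ x]) auto
    qed
    then obtain x where x: "x \<in> {0..T}" "\<bar>x - z\<bar> \<le> \<bar>y - z\<bar>" "Q y - Q z = Q' x * (y - z)" by blast
    have "\<bar>Q' x - Q' z\<bar> \<le> e" using d x yz by (intro less_imp_le) auto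
    moreover have "Q y - Q z - Q' z * (y - z) = (Q' x - Q' z) * (y - z)" using x(3) by (simp add: algebra_simps)
    ultimately show ?thesis by (simp add: abs_mult mult_right_mono)
  qed
  have small: "\<bar>t * x - s * x\<bar> \<le> \<bar>t - s\<bar>" if "x \<in> {0..1}" for t s x :: real
  proof -
    have "\<bar>t * x - s * x\<bar> = \<bar>t - s\<bar> * x" using that by (simp add: abs_mult flip: left_diff_distrib)
    also have "\<dots> \<le> \<bar>t - s\<bar>" using that by (intro mult_left_le) auto
    finally show ?thesis .
  qed
  have ibound: "\<bar>\<integral>x. f x \<partial>N\<bar> \<le> m * B" if "integrable N f" "\<And>x. x \<in> {0..1} \<Longrightarrow> \<bar>f x\<bar> \<le> B" for f :: "real \<Rightarrow> real" and B
  proof -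
    have "\<bar>\<integral>x. f x \<partial>N\<bar> \<le> (\<integral>x. \<bar>f x\<bar> \<partial>N)" by (rule integral_abs_bound)
    also have "\<dots> \<le> (\<integral>x. B \<partial>N)" using that N(2) by (intro integral_mono) auto
    also have "\<dots> = m * B" by (simp add: m_def)
    finally show ?thesis .
  qed
  {
    fix t assume t: "t \<in> {0..T}"
    show "((\<lambda>t. \<integral>x. Q (t * x) \<partial>N) has_real_derivative (\<integral>x. x * Q' (t * x) \<partial>N)) (at t within {0..T})"
      unfolding has_field_derivative_def has_derivative_within_alt
    proof (intro conjI allI impI)
      show "bounded_linear ((*) (\<integral>x. x * Q' (t * x) \<partial>N))" by (rule bounded_linear_mult_right)
      fix e :: real assume e: "0 < e"
      define e' where "e' = e / (m + 1)"
      have e': "0 < e'" "m * e' \<le> e" using e m by (auto simp: e'_def field_simps)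
      obtain d where d: "0 < d" "\<forall>y\<in>{0..T}. \<forall>z\<in>{0..T}. \<bar>y - z\<bar> < d \<longrightarrow> \<bar>Q' y - Q' z\<bar> < e'"
        using unif[OF e'(1)] by blast
      show "\<exists>d>0. \<forall>y\<in>{0..T}. norm (y - t) < d \<longrightarrow>
          norm ((\<integral>x. Q (y * x) \<partial>N) - (\<integral>x. Q (t * x) \<partial>N) - (\<integral>x. x * Q' (t * x) \<partial>N) * (y - t)) \<le> e * norm (y - t)"
      proof (intro exI[of _ d] conjI ballI impI d)
        fix y assume y: "y \<in> {0..T}" "norm (y - t) < d"
        have i: "integrable N (\<lambda>x. Q (y * x))" "integrable N (\<lambda>x. Q (t * x))" "integrable N (\<lambda>x. x * Q' (t * x))"
          using int[of y Q "\<lambda>_. 1"] int[of t Q "\<lambda>_. 1"] int[of t Q' "\<lambda>x. x"] y t Qc Q' by auto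
        have "(\<integral>x. Q (y * x) \<partial>N) - (\<integral>x. Q (t * x) \<partial>N) - (\<integral>x. x * Q' (t * x) \<partial>N) * (y - t)
          = (\<integral>x. Q (y * x) - Q (t * x) - x * Q' (t * x) * (y - t) \<partial>N)"
          using i by simp
        also have "\<bar>\<dots>\<bar> \<le> m * (e' * \<bar>y - t\<bar>)"
        proof (rule ibound)
          show "integrable N (\<lambda>x. Q (y * x) - Q (t * x) - x * Q' (t * x) * (y - t))" using i by simp
          fix x :: real assume x: "x \<in> {0..1}"
          have "\<bar>Q (y * x) - Q (t * x) - Q' (t * x) * (y * x - t * x)\<bar> \<le> e' * \<bar>y * x - t * x\<bar>"
            using y x t small[OF x, of y t] by (intro remainder[OF _ _ _ d(2)] in01) auto
          also have "\<dots> \<le> e' * \<bar>y - t\<bar>" using small[OF x, of y t] e' by (intro mult_left_mono) auto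
          finally show "\<bar>Q (y * x) - Q (t * x) - x * Q' (t * x) * (y - t)\<bar> \<le> e' * \<bar>y - t\<bar>"
            by (simp add: algebra_simps)
        qed
        also have "\<dots> \<le> e * \<bar>y - t\<bar>" using e'(2) by (simp add: mult_right_mono flip: mult.assoc)
        finally show "norm ((\<integral>x. Q (y * x) \<partial>N) - (\<integral>x. Q (t * x) \<partial>N) - (\<integral>x. x * Q' (t * x) \<partial>N) * (y - t)) \<le> e * norm (y - t)"
          by simp
      qed
    qed
  }
  show "continuous_on {0..T} (\<lambda>t. \<integral>x. x * Q' (t * x) \<partial>N)"
    unfolding continuous_on_iff
  proof (intro ballI allI impI)
    fix t e :: real assume t: "t \<in> {0..T}" and e: "0 < e"
    define e' where "e' = e / (m + 1)"
    have e': "0 < e'" "m * e' < e" using e m by (auto simp: e'_def field_simps)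
    obtain d where d: "0 < d" "\<forall>y\<in>{0..T}. \<forall>z\<in>{0..T}. \<bar>y - z\<bar> < d \<longrightarrow> \<bar>Q' y - Q' z\<bar> < e'"
      using unif[OF e'(1)] by blast
    show "\<exists>d>0. \<forall>y\<in>{0..T}. dist y t < d \<longrightarrow> dist (\<integral>x. x * Q' (y * x) \<partial>N) (\<integral>x. x * Q' (t * x) \<partial>N) < e"
    proof (intro exI[of _ d] conjI ballI impI d)
      fix y assume y: "y \<in> {0..T}" "dist y t < d"
      have i: "integrable N (\<lambda>x. x * Q' (y * x))" "integrable N (\<lambda>x. x * Q' (t * x))"
        using int[of y Q' "\<lambda>x. x"] int[of t Q' "\<lambda>x. x"] y t Q' by auto
      have "\<bar>(\<integral>x. x * Q' (y * x) \<partial>N) - (\<integral>x. x * Q' (t * x) \<partial>N)\<bar> = \<bar>\<integral>x. x * Q' (y * x) - x * Q' (t * x) \<partial>N\<bar>"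
        using i by simp
      also have "\<dots> \<le> m * e'"
      proof (rule ibound)
        show "integrable N (\<lambda>x. x * Q' (y * x) - x * Q' (t * x))" using i by simp
        fix x :: real assume x: "x \<in> {0..1}"
        have "\<bar>Q' (y * x) - Q' (t * x)\<bar> < e'"
          using d(2) in01[OF y(1) x] in01[OF t x] small[OF x, of y t] y(2) by (auto simp: dist_real_def)
        then have "\<bar>x\<bar> * \<bar>Q' (y * x) - Q' (t * x)\<bar> \<le> 1 * e'" using x by (intro mult_mono) auto
        then show "\<bar>x * Q' (y * x) - x * Q' (t * x)\<bar> \<le> e'" by (simp flip: right_diff_distrib add: abs_mult)
      qed
      finally show "dist (\<integral>x. x * Q' (y * x) \<partial>N) (\<integral>x. x * Q' (t * x) \<partial>N) < e"
        using e'(2) by (simp add: dist_real_def)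
    qed
  qed
qed

context hurst
begin

lemma powr_measurable_Icc: "(\<lambda>s. s powr p) \<in> borel_measurable (lebesgue_Icc T)"
  by (rule measurable_Icc_of_borel) measurable

text \<open>
  The substitution \<open>s = t * x\<close> moves the variable \<open>t\<close> out of the singular kernel into the argument of
  \<open>Q\<close>, where it can be differentiated.
\<close>

lemma j_map_dilation:
  assumes t: "t \<in> {0..T}"
  shows "j_map H Q t = molchan_const H * t powr (1 - 2*a) *
    (\<integral>x. indicator {0<..<1} x * (x powr (-a) * (1 - x) powr (-a)) * Q (t * x) \<partial>lborel)"
proof (cases "t = 0")
  case True
  then have "indicator {0..t} s *\<^sub>R (molchan_kernel H t s * Q s) = 0" for s
    by (auto simp: molchan_kernel_def indicator_def)
  then have "j_map H Q t = 0" unfolding j_map_def set_lebesgue_integral_def by (simp only: Bochner_Integration.integral_zero)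
  then show ?thesis using True by simp
next
  case False
  then have t0: "0 < t" using t by auto
  have "j_map H Q t = \<bar>t\<bar> *\<^sub>R (\<integral>x. indicator {0..t} (0 + t * x) *\<^sub>R (molchan_kernel H t (0 + t * x) * Q (0 + t * x)) \<partial>lborel)"
    unfolding j_map_def set_lebesgue_integral_def by (rule lborel_integral_real_affine) (use t0 in auto)
  also have "\<dots> = t * (\<integral>x. molchan_const H * t powr (-2*a) * (indicator {0<..<1} x * (x powr (-a) * (1 - x) powr (-a)) * Q (t * x)) \<partial>lborel)"
  proof -
    have eq: "indicator {0..t} (0 + t * x) *\<^sub>R (molchan_kernel H t (0 + t * x) * Q (0 + t * x))
       = molchan_const H * t powr (-2*a) * (indicator {0<..<1} x * (x powr (-a) * (1 - x) powr (-a)) * Q (t * x))" for x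
    proof (cases "0 < x \<and> x < 1")
      case True
      then have i: "0 < t * x" "t * x < t" using t0 by auto
      have e: "1/2 - H = -a" "t - t * x = t * (1 - x)" by (auto simp: algebra_simps)
      have "t powr (-2*a) = t powr (-a) * t powr (-a)" by (simp flip: powr_add)
      then have "molchan_kernel H t (t * x) = molchan_const H * t powr (-2*a) * (x powr (-a) * (1 - x) powr (-a))"
        unfolding molchan_kernel_def e using i t0 True by (simp only: powr_mult ac_simps) (simp add: ac_simps)
      then show ?thesis using i True by (simp add: mult.assoc)
    next
      case False
      then have "indicator {0<..<t} (t * x) = (0::real)" "indicator {0<..<1} x = (0::real)" using t0 by (auto simp: indicator_def zero_less_mult_iff)
      then show ?thesis by (simp add: molchan_kernel_def)
    qed
    show ?thesis using t0 by (simp only: eq) (simp only: abs_of_pos real_scaleR_def)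
  qed
  also have "\<dots> = (t powr 1 * t powr (-2*a)) * molchan_const H * (\<integral>x. indicator {0<..<1} x * (x powr (-a) * (1 - x) powr (-a)) * Q (t * x) \<partial>lborel)"
    using t0 by simp
  also have "t powr 1 * t powr (-2*a) = t powr (1 - 2*a)" by (subst powr_add[symmetric]) simp
  finally show ?thesis by (simp only: ac_simps)
qed

text \<open>
  By \<open>j_map_dilation\<close> the function is \<open>t powr (1 - 2 * a)\<close> times a continuously differentiable one.
  The derivative given by the product rule is of order \<open>t powr (-2 * a)\<close> at zero and so integrable.
\<close>

lemma j_map_absolutely_continuous:
  assumes Q: "C1_on_Icc T Q"
  shows "\<exists>h. integrable (lebesgue_Icc T) h \<and>
    (\<forall>t\<in>{0..T}. j_map H Q t = (\<integral>s. indicator {0<..t} s * h s \<partial>lebesgue_Icc T)) \<and>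
    (\<forall>t\<in>{0<..T}. h t = (2 - 2*H) * t powr (1 - 2*H) * J_map H T Q t)"
proof -
  obtain Q' where Q': "continuous_on {0..T} Q'"
    and deriv: "\<And>t. t \<in> {0..T} \<Longrightarrow> (Q has_real_derivative Q' t) (at t within {0..T})"
    using Q unfolding C1_on_Icc_def by auto
  define w where "w x = x powr (-a) * (1 - x) powr (-a)" for x :: real
  define N where "N = density (lebesgue_Icc 1) (\<lambda>x. ennreal (w x))"
  have wm[measurable]: "w \<in> borel_measurable borel" unfolding w_def by measurable
  have wm1: "w \<in> borel_measurable (lebesgue_Icc 1)"
    unfolding lebesgue_Icc_def by (rule measurable_restrict_space1) simp
  have "emeasure N (space N) = (\<integral>\<^sup>+x. ennreal ((x - 0) powr ((1 - a) - 1) * (1 - x) powr ((1 - a) - 1)) * indicator {0..1} x \<partial>lborel)"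
  proof -
    have "emeasure N (space N) = (\<integral>\<^sup>+x. ennreal (w x) * indicator (space (lebesgue_Icc 1)) x \<partial>lebesgue_Icc 1)"
      unfolding N_def using emeasure_density[of "\<lambda>x. ennreal (w x)" "lebesgue_Icc 1" "space (lebesgue_Icc 1)"] wm1
      by (simp del: space_lebesgue_Icc)
    also have "\<dots> = (\<integral>\<^sup>+x. ennreal ((x - 0) powr ((1 - a) - 1) * (1 - x) powr ((1 - a) - 1)) * indicator {0..1} x \<partial>lborel)"
      unfolding nn_integral_lebesgue_Icc w_def by (intro nn_integral_cong) (auto split: split_indicator)
    finally show ?thesis .
  qed
  also have "\<dots> < \<infinity>" using a by (subst nn_integral_Beta_interval) auto
  finally have fin: "finite_measure N" by (intro finite_measureI) auto
  have N: "space N = {0..1}" "sets N = sets (restrict_space borel {0..1})"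
    unfolding N_def by (auto simp: lebesgue_Icc_def sets_restrict_space)
  define g where "g t = (\<integral>x. Q (t * x) \<partial>N)" for t
  define k where "k t = (\<integral>x. x * Q' (t * x) \<partial>N)" for t
  have gd: "(g has_real_derivative k t) (at t within {0..T})" if "t \<in> {0..T}" for t
    unfolding g_def[abs_def] k_def by (rule dilation_integral_derivative(1)[OF fin N Q' deriv that])
  have kc: "continuous_on {0..T} k"
    unfolding k_def[abs_def] by (rule dilation_integral_derivative(2)[OF fin N Q' deriv])
  have gc: "continuous_on {0..T} g"
    using gd by (intro continuous_on_eq_continuous_within[THEN iffD2] ballI DERIV_continuous) blast
  have Qc: "continuous_on {0..T} Q" by (rule C1_on_Icc_imp_continuous_on[OF Q])
  let ?c = "molchan_const H"
  have j: "j_map H Q t = ?c * (t powr (1 - 2*a) * g t)" if t: "t \<in> {0..T}" for t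
  proof -
    have "continuous_on {0..1} (\<lambda>x. Q (t * x))"
      using t mult_mono[of t T _ 1] by (intro continuous_on_compose2[OF Qc] continuous_intros) auto
    from borel_measurable_continuous_on_restrict[OF this]
    have "(\<lambda>x. Q (t * x)) \<in> borel_measurable (lebesgue_Icc 1)"
      using measurable_cong_sets[of "restrict_space borel {0..1::real}" "lebesgue_Icc 1" borel borel]
      by (auto simp: lebesgue_Icc_def sets_restrict_space)
    then have "g t = (\<integral>x. w x *\<^sub>R Q (t * x) \<partial>lebesgue_Icc 1)"
      unfolding g_def N_def by (rule integral_density[OF _ wm1]) (auto simp: w_def)
    also have "\<dots> = (\<integral>x. indicator {0..1} x *\<^sub>R (w x *\<^sub>R Q (t * x)) \<partial>lborel)"
      unfolding lebesgue_Icc_def by (subst integral_restrict_space) auto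
    also have "\<dots> = (\<integral>x. indicator {0<..<1} x * (x powr (-a) * (1 - x) powr (-a)) * Q (t * x) \<partial>lborel)"
      by (intro Bochner_Integration.integral_cong) (auto simp: w_def indicator_def)
    finally show ?thesis using j_map_dilation[OF t, of Q] by (simp add: mult.assoc)
  qed
  define h where "h t = ?c * ((1 - 2*a) * t powr (-2*a) * g t + t powr (1 - 2*a) * k t)" for t
  have jd: "(j_map H Q has_real_derivative h t) (at t within {0..T})" if t: "t \<in> {0<..T}" for t
  proof -
    have t': "0 < t" "t \<in> {0..T}" using t by auto
    have "((\<lambda>t. t powr (1 - 2*a)) has_real_derivative (1 - 2*a) * t powr (1 - 2*a - 1)) (at t within {0..T})"
      using has_real_derivative_powr[OF t'(1), of "1 - 2*a"] by (rule has_field_derivative_at_within)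
    from DERIV_mult[OF this gd[OF t'(2)]]
    have "((\<lambda>t. ?c * (t powr (1 - 2*a) * g t)) has_real_derivative h t) (at t within {0..T})"
      unfolding h_def by (intro DERIV_cmult) (simp add: ac_simps add.commute)
    then show ?thesis
      by (rule has_field_derivative_transform_within[OF _ zero_less_one t'(2)]) (use j in auto)
  qed
  have jc: "continuous_on {0..T} (j_map H Q)"
  proof -
    have "continuous_on {0..T} (\<lambda>t. ?c * (t powr (1 - 2*a) * g t))"
      using a gc by (intro continuous_on_mult continuous_on_const continuous_on_powr' continuous_on_id) auto
    then show ?thesis by (rule continuous_on_eq) (use j in auto)
  qed
  have hm: "h \<in> borel_measurable (lebesgue_Icc T)"
    unfolding h_def[abs_def]
    by (intro borel_measurable_times borel_measurable_add borel_measurable_const powr_measurable_Icc continuous_imp_measurable_Icc[OF gc] continuous_imp_measurable_Icc[OF kc])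
  have hi: "integrable (lebesgue_Icc T) h"
  proof -
    obtain C where C: "0 < C" "\<forall>s\<in>{0..T}. \<bar>g s\<bar> \<le> C" using continuous_bounded_Icc[OF gc] by auto
    obtain D where D: "0 < D" "\<forall>s\<in>{0..T}. \<bar>k s\<bar> \<le> D" using continuous_bounded_Icc[OF kc] by auto
    have "(\<integral>\<^sup>+s. ennreal (s powr (-2*a)) \<partial>lebesgue_Icc T) = ennreal (T powr (1 - 2*a) / (1 - 2*a))"
      unfolding nn_integral_lebesgue_Icc using nn_integral_powr_right[of "1 - 2*a" 0 T] a T by simp
    then have p: "integrable (lebesgue_Icc T) (\<lambda>s. s powr (-2*a))"
      by (intro integrableI_nonneg measurable_Icc_of_borel) auto
    have one: "integrable (lebesgue_Icc T) (\<lambda>s. 1::real)"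
      by (rule continuous_integrable_Icc) simp
    show ?thesis
    proof (rule Bochner_Integration.integrable_bound[OF _ hm])
      show "integrable (lebesgue_Icc T) (\<lambda>s. (?c * (1 - 2*a) * C) * s powr (-2*a) + (?c * T powr (1 - 2*a) * D) * 1)"
        by (intro Bochner_Integration.integrable_add integrable_mult_right p one)
      show "AE s in lebesgue_Icc T. norm (h s) \<le> norm ((?c * (1 - 2*a) * C) * s powr (-2*a) + (?c * T powr (1 - 2*a) * D) * 1)"
      proof (rule AE_I2)
        fix s assume "s \<in> space (lebesgue_Icc T)"
        then have s: "0 \<le> s" "s \<le> T" by auto
        have gb: "\<bar>(1 - 2*a) * s powr (-2*a) * g s\<bar> \<le> (1 - 2*a) * s powr (-2*a) * C"
          unfolding abs_mult using a s C by (intro mult_mono) auto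
        have kb: "\<bar>s powr (1 - 2*a) * k s\<bar> \<le> T powr (1 - 2*a) * D"
          unfolding abs_mult using a s D T by (intro mult_mono) (auto intro: powr_mono2)
        have "\<bar>h s\<bar> \<le> ?c * ((1 - 2*a) * s powr (-2*a) * C + T powr (1 - 2*a) * D)"
          unfolding h_def abs_mult[of ?c] using molchan_const_pos gb kb by (intro mult_mono) (auto intro: order_trans[OF abs_triangle_ineq add_mono])
        also have "\<dots> = (?c * (1 - 2*a) * C) * s powr (-2*a) + (?c * T powr (1 - 2*a) * D) * 1"
          by (simp only: distrib_left ac_simps mult_1_right)
        finally show "norm (h s) \<le> norm ((?c * (1 - 2*a) * C) * s powr (-2*a) + (?c * T powr (1 - 2*a) * D) * 1)"
          unfolding real_norm_def by (rule order_trans[OF _ abs_ge_self])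
      qed
    qed
  qed
  have jint: "j_map H Q t = (\<integral>s. indicator {0<..t} s * h s \<partial>lebesgue_Icc T)" if t: "t \<in> {0..T}" for t
  proof -
    \<comment> \<open>The derivative is singular at zero, hence the version of the fundamental theorem that asks for it
      only in the open interval.\<close>
    have 1: "(h has_integral j_map H Q t - j_map H Q 0) {0..t}"
    proof (rule fundamental_theorem_of_calculus_interior)
      show "0 \<le> t" using t by simp
      show "continuous_on {0..t} (j_map H Q)" by (rule continuous_on_subset[OF jc]) (use t in auto)
      fix x assume x: "x \<in> {0<..<t}"
      have "(j_map H Q has_real_derivative h x) (at x within {0<..<t})"
        by (rule DERIV_subset[OF jd]) (use x t in auto)
      then show "(j_map H Q has_vector_derivative h x) (at x)"
        using x by (simp add: has_real_derivative_iff_has_vector_derivative at_within_open[of x "{0<..<t}"])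
    qed
    have i: "integrable lborel (\<lambda>s. indicator {0..t} s * h s)"
    proof -
      have "integrable lborel (\<lambda>s. indicator {0..t} s * (indicator {0..T} s * h s))"
        using hi unfolding integrable_lebesgue_Icc
        using integrable_real_mult_indicator[of "{0..t}" lborel "\<lambda>s. indicator {0..T} s * h s"] by (simp add: mult.commute)
      moreover have "indicator {0..t} s * (indicator {0..T} s * h s) = indicator {0..t} s * h s" for s
        using t by (auto simp: indicator_def)
      ultimately show ?thesis by simp
    qed
    have "((\<lambda>s. indicator {0..t} s * h s) has_integral (\<integral>s. indicator {0..t} s * h s \<partial>lborel)) UNIV"
      by (rule has_integral_integral_lborel[OF i])
    moreover have "((\<lambda>s. indicator {0..t} s * h s) has_integral (j_map H Q t - j_map H Q 0)) UNIV"
    proof -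
      have "(\<lambda>s. indicator {0..t} s * h s) = (\<lambda>s. if s \<in> {0..t} then h s else 0)" by (auto simp: indicator_def)
      then show ?thesis using 1 has_integral_restrict_UNIV[of "{0..t}" h] by simp
    qed
    ultimately have "j_map H Q t - j_map H Q 0 = (\<integral>s. indicator {0..t} s * h s \<partial>lborel)"
      by (metis has_integral_unique)
    moreover have "j_map H Q 0 = 0" using j[of 0] T by simp
    moreover have "(\<integral>s. indicator {0..t} s * h s \<partial>lborel) = (\<integral>s. indicator {0<..t} s * h s \<partial>lebesgue_Icc T)"
      unfolding integral_lebesgue_Icc using t by (intro Bochner_Integration.integral_cong) (auto simp: indicator_def h_def)
    ultimately show ?thesis by simp
  qed
  have hJ: "h t = (2 - 2*H) * t powr (1 - 2*H) * J_map H T Q t" if t: "t \<in> {0<..T}" for t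
  proof -
    have "vector_derivative (j_map H Q) (at t within {0..T}) = h t"
      using jd[OF t] t T by (intro vector_derivative_within_cbox[where a=0 and b=T, simplified]) (auto simp: has_real_derivative_iff_has_vector_derivative)
    moreover have "t powr (1 - 2*H) * t powr (2*H - 1) = 1" using t by (simp flip: powr_add)
    ultimately show ?thesis unfolding J_map_def using H by (simp add: field_simps)
  qed
  show ?thesis using hi jint hJ by blast
qed

text \<open>
  The weight \<open>(2 - 2 * H) * s powr (1 - 2 * H)\<close> is both the density of the bracket and the factor
  between \<open>J_map\<close> and the derivative of \<open>j_map\<close>; so the drift of \<open>Z\<close> acts on integrands as an inner
  product in \<open>L\<^sup>2\<close> of the bracket.
\<close>

lemma step_integral_j_map:
  assumes Q: "C1_on_Icc T Q" and J: "L2_fun (bracket H T) (J_map H T Q)" and xs: "step_list T xs"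
  shows "step_integral xs (\<lambda>t _. j_map H Q t) () = (\<integral>s. step_fun xs s * J_map H T Q s \<partial>bracket H T)"
proof -
  obtain h where hi: "integrable (lebesgue_Icc T) h"
    and jint: "\<forall>t\<in>{0..T}. j_map H Q t = (\<integral>s. indicator {0<..t} s * h s \<partial>lebesgue_Icc T)"
    and hJ: "\<forall>t\<in>{0<..T}. h t = (2 - 2*H) * t powr (1 - 2*H) * J_map H T Q t"
    using j_map_absolutely_continuous[OF Q] by auto
  define A where "A = step_points xs"
  define c where "c = step_coeff xs"
  have A: "finite A" "A \<subseteq> {0..T}" using step_points_subset[OF xs] by (auto simp: A_def)
  have Jm: "J_map H T Q \<in> borel_measurable (lebesgue_Icc T)"
    using J unfolding L2_fun_def bracket_def by simp
  have hm: "h \<in> borel_measurable (lebesgue_Icc T)" using hi by simp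
  have i: "integrable (lebesgue_Icc T) (\<lambda>s. indicator {0<..t} s * h s)" for t
  proof (rule Bochner_Integration.integrable_bound[OF hi])
    show "(\<lambda>s. indicator {0<..t} s * h s) \<in> borel_measurable (lebesgue_Icc T)"
      by (rule borel_measurable_times[OF measurable_Icc_of_borel hm]) simp
  qed (auto simp: indicator_def)
  have "step_integral xs (\<lambda>t _. j_map H Q t) () = (\<Sum>t\<in>A. c t * (\<integral>s. indicator {0<..t} s * h s \<partial>lebesgue_Icc T))"
    unfolding step_integral_eq_sum A_def c_def using A jint by (intro sum.cong refl) (auto simp: A_def)
  also have "\<dots> = (\<integral>s. (\<Sum>t\<in>A. c t * (indicator {0<..t} s * h s)) \<partial>lebesgue_Icc T)"
    using i by (subst Bochner_Integration.integral_sum) auto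
  also have "\<dots> = (\<integral>s. step_fun xs s * h s \<partial>lebesgue_Icc T)"
    unfolding step_fun_eq_sum[OF xs] A_def c_def sum_distrib_right by (simp only: mult.assoc)
  also have "\<dots> = (\<integral>s. (2 - 2*H) * s powr (1 - 2*H) * (step_fun xs s * J_map H T Q s) \<partial>lebesgue_Icc T)"
  proof (rule integral_cong_AE)
    have "AE s in lebesgue_Icc T. s \<noteq> 0"
      unfolding lebesgue_Icc_def by (subst AE_restrict_space_iff) (auto intro: AE_mp[OF AE_lborel_singleton[of 0]])
    then show "AE s in lebesgue_Icc T. step_fun xs s * h s = (2 - 2*H) * s powr (1 - 2*H) * (step_fun xs s * J_map H T Q s)"
      using AE_space
    proof eventually_elim
      case (elim s)
      then have "h s = (2 - 2*H) * s powr (1 - 2*H) * J_map H T Q s" using hJ by auto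
      then show ?case by (simp only: ac_simps)
    qed
  qed (intro borel_measurable_times powr_measurable_Icc measurable_Icc_of_borel[OF measurable_step_fun] borel_measurable_const hm Jm)+
  also have "\<dots> = (\<integral>s. step_fun xs s * J_map H T Q s \<partial>bracket H T)"
    by (rule integral_bracket[symmetric]) (intro borel_measurable_times measurable_Icc_of_borel[OF measurable_step_fun] Jm)
  finally show ?thesis .
qed

end

section \<open>The inverse transform\<close>

text \<open>
  The positive and the negative part of \<open>d\<close> are densities of two measures that agree on half-lines
  and therefore coincide.
\<close>

lemma AE_zero_of_tail_integrals:
  fixes d :: "real \<Rightarrow> real"
  assumes d: "integrable lborel d" and zero: "\<And>x. (\<integral>s. indicator {x<..} s * d s \<partial>lborel) = 0"
  shows "AE s in lborel. d s = 0"
proof -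
  have [measurable]: "d \<in> borel_measurable borel" using d by simp
  let ?p = "\<lambda>s. max 0 (d s)" and ?n = "\<lambda>s. max 0 (- d s)"
  have i: "integrable lborel (\<lambda>s. indicator {x<..} s * ?p s)" "integrable lborel (\<lambda>s. indicator {x<..} s * ?n s)" for x
    by (rule Bochner_Integration.integrable_bound[OF d]; auto simp: indicator_def)+
  have em: "emeasure (density lborel (\<lambda>s. ennreal (f s))) {x<..} = ennreal (\<integral>s. indicator {x<..} s * f s \<partial>lborel)"
    if "f \<in> borel_measurable borel" "\<And>s. 0 \<le> f s" "integrable lborel (\<lambda>s. indicator {x<..} s * f s)" for f :: "real \<Rightarrow> real" and x
  proof -
    have "emeasure (density lborel (\<lambda>s. ennreal (f s))) {x<..} = (\<integral>\<^sup>+s. ennreal (f s) * indicator {x<..} s \<partial>lborel)"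
      by (rule emeasure_density) (use that(1) in simp, simp)
    also have "\<dots> = (\<integral>\<^sup>+s. ennreal (indicator {x<..} s * f s) \<partial>lborel)"
      by (intro nn_integral_cong) (auto simp: indicator_def)
    also have "\<dots> = ennreal (\<integral>s. indicator {x<..} s * f s \<partial>lborel)"
      using that by (intro nn_integral_eq_integral) auto
    finally show ?thesis .
  qed
  have "density lborel (\<lambda>s. ennreal (?p s)) = density lborel (\<lambda>s. ennreal (?n s))"
  proof (rule measure_eqI_lessThan)
    fix x
    show "emeasure (density lborel (\<lambda>s. ennreal (?p s))) {x<..} < \<infinity>"
      by (subst em) (auto intro: i)
    have "(\<integral>s. indicator {x<..} s * ?p s \<partial>lborel) - (\<integral>s. indicator {x<..} s * ?n s \<partial>lborel) = (\<integral>s. indicator {x<..} s * d s \<partial>lborel)"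
      by (subst Bochner_Integration.integral_diff[symmetric, OF i]) (auto intro!: Bochner_Integration.integral_cong simp: max_def indicator_def)
    then show "emeasure (density lborel (\<lambda>s. ennreal (?p s))) {x<..} = emeasure (density lborel (\<lambda>s. ennreal (?n s))) {x<..}"
      using zero[of x] by (subst (1 2) em) (auto intro: i)
  qed simp_all
  then have "AE s in lborel. ennreal (?p s) = ennreal (?n s)"
    by (subst (asm) sigma_finite_measure.density_unique_iff[OF sigma_finite_lborel]) auto
  then show ?thesis by eventually_elim (auto simp: max_def split: if_splits)
qed

text \<open>
  Fubini's theorem on the triangle \<open>0 < s < t \<le> \<tau>\<close>.  The mass \<open>\<rho>\<close> of the kernel is a parameter because
  the inversion of Abel's equation uses three kernels, two of them with the same mass.
\<close>

lemma triangle_Fubini: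
  fixes k :: "real \<Rightarrow> real \<Rightarrow> real" and f \<rho> :: "real \<Rightarrow> real"
  assumes km[measurable]: "case_prod k \<in> borel_measurable (borel \<Otimes>\<^sub>M borel)" and fm[measurable]: "f \<in> borel_measurable borel"
    and k0: "\<And>t s. 0 \<le> k t s"
    and \<rho>: "\<And>s. 0 < s \<Longrightarrow> s < \<tau> \<Longrightarrow> (\<integral>\<^sup>+t. ennreal (k t s) * indicator {s..\<tau>} t \<partial>lborel) = ennreal (\<rho> s)"
    and \<rho>0: "\<And>s. 0 < s \<Longrightarrow> s < \<tau> \<Longrightarrow> 0 \<le> \<rho> s"
    and int: "integrable lborel (\<lambda>s. indicator {0<..<\<tau>} s * (\<rho> s * f s))"
  shows "integrable lborel (\<lambda>t. indicator {0..\<tau>} t * (\<integral>s. indicator {0<..<t} s * (k t s * f s) \<partial>lborel))"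
    and "(\<integral>t. indicator {0..\<tau>} t * (\<integral>s. indicator {0<..<t} s * (k t s * f s) \<partial>lborel) \<partial>lborel)
      = (\<integral>s. indicator {0<..<\<tau>} s * (\<rho> s * f s) \<partial>lborel)"
proof -
  have [measurable]: "(\<lambda>x. k (u x) (v x)) \<in> borel_measurable M" if [measurable]: "u \<in> borel_measurable M" "v \<in> borel_measurable M" for u v and M :: "'z measure"
    using measurable_compose[OF measurable_Pair[OF that] km] by simp
  define F where "F t s = (if 0 < s \<and> s < t \<and> t \<le> \<tau> then k t s * f s else 0)" for t s
  have Fm[measurable]: "case_prod F \<in> borel_measurable (lborel \<Otimes>\<^sub>M lborel)"
  proof -
    have "case_prod F = (\<lambda>p. if 0 < snd p \<and> snd p < fst p \<and> fst p \<le> \<tau> then k (fst p) (snd p) * f (snd p) else 0)"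
      by (auto simp: F_def fun_eq_iff)
    moreover have "\<dots> \<in> borel_measurable (borel \<Otimes>\<^sub>M borel)" by measurable
    ultimately show ?thesis by simp
  qed
  have Ft: "(\<integral>\<^sup>+t. ennreal \<bar>F t s\<bar> \<partial>lborel) = ennreal (norm (indicator {0<..<\<tau>} s * (\<rho> s * f s)))" for s
  proof (cases "0 < s \<and> s < \<tau>")
    case True
    have "(\<integral>\<^sup>+t. ennreal \<bar>F t s\<bar> \<partial>lborel) = (\<integral>\<^sup>+t. ennreal \<bar>f s\<bar> * (ennreal (k t s) * indicator {s..\<tau>} t) \<partial>lborel)"
    proof (rule nn_integral_cong_AE)
      have "AE t in lborel. t \<noteq> s" by (rule AE_lborel_singleton)
      then show "AE t in lborel. ennreal \<bar>F t s\<bar> = ennreal \<bar>f s\<bar> * (ennreal (k t s) * indicator {s..\<tau>} t)"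
        by eventually_elim (use True k0 in \<open>auto simp: F_def indicator_def abs_mult ennreal_mult' mult.commute\<close>)
    qed
    also have "\<dots> = ennreal \<bar>f s\<bar> * ennreal (\<rho> s)"
      using True \<rho> by (subst nn_integral_cmult) auto
    finally show ?thesis using True \<rho>0[of s] by (simp add: abs_mult ennreal_mult'' mult.commute)
  next
    case False
    then have "F t s = 0" for t by (auto simp: F_def)
    moreover have "indicator {0<..<\<tau>} s = (0::real)" using False by (auto simp: indicator_def)
    ultimately show ?thesis by simp
  qed
  have Fi: "integrable (lborel \<Otimes>\<^sub>M lborel) (case_prod F)"
  proof (rule integrableI_bounded)
    have "(\<integral>\<^sup>+p. ennreal (norm (case_prod F p)) \<partial>(lborel \<Otimes>\<^sub>M lborel)) = (\<integral>\<^sup>+s. (\<integral>\<^sup>+t. ennreal (norm (case_prod F (t, s))) \<partial>lborel) \<partial>lborel)"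
      by (rule lborel_pair.nn_integral_snd[symmetric]) simp
    also have "\<dots> = (\<integral>\<^sup>+s. ennreal (norm (indicator {0<..<\<tau>} s * (\<rho> s * f s))) \<partial>lborel)"
      using Ft by simp
    also have "\<dots> < \<infinity>" using int unfolding integrable_iff_bounded by blast
    finally show "(\<integral>\<^sup>+p. ennreal (norm (case_prod F p)) \<partial>(lborel \<Otimes>\<^sub>M lborel)) < \<infinity>" .
  qed simp
  have inner: "(\<integral>s. F t s \<partial>lborel) = indicator {0..\<tau>} t * (\<integral>s. indicator {0<..<t} s * (k t s * f s) \<partial>lborel)" for t
  proof (cases "t \<in> {0..\<tau>}")
    case True
    then have "F t s = indicator {0<..<t} s * (k t s * f s)" for s by (auto simp: F_def indicator_def)
    then show ?thesis using True by simp
  next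
    case False
    then have "F t s = 0" for s by (auto simp: F_def)
    then show ?thesis using False by simp
  qed
  have outer: "(\<integral>t. F t s \<partial>lborel) = indicator {0<..<\<tau>} s * (\<rho> s * f s)" for s
  proof (cases "0 < s \<and> s < \<tau>")
    case True
    have kF: "F t s = f s * (if s < t \<and> t \<le> \<tau> then k t s else 0)" for t using True by (auto simp: F_def)
    have "(\<integral>\<^sup>+t. ennreal (if s < t \<and> t \<le> \<tau> then k t s else 0) \<partial>lborel) = (\<integral>\<^sup>+t. ennreal (k t s) * indicator {s..\<tau>} t \<partial>lborel)"
    proof (rule nn_integral_cong_AE)
      have "AE t in lborel. t \<noteq> s" by (rule AE_lborel_singleton)
      then show "AE t in lborel. ennreal (if s < t \<and> t \<le> \<tau> then k t s else 0) = ennreal (k t s) * indicator {s..\<tau>} t"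
        by eventually_elim (auto simp: indicator_def)
    qed
    then have "(\<integral>t. (if s < t \<and> t \<le> \<tau> then k t s else 0) \<partial>lborel) = \<rho> s"
      using True \<rho>[of s] \<rho>0[of s] k0 by (subst integral_eq_nn_integral) auto
    then show ?thesis unfolding kF using True by simp
  next
    case False
    then have "F t s = 0" for t by (auto simp: F_def)
    moreover have "indicator {0<..<\<tau>} s = (0::real)" using False by (auto simp: indicator_def)
    ultimately show ?thesis by simp
  qed
  show "integrable lborel (\<lambda>t. indicator {0..\<tau>} t * (\<integral>s. indicator {0<..<t} s * (k t s * f s) \<partial>lborel))"
    using lborel_pair.integrable_fst'[OF Fi] by (simp add: inner)
  show "(\<integral>t. indicator {0..\<tau>} t * (\<integral>s. indicator {0<..<t} s * (k t s * f s) \<partial>lborel) \<partial>lborel)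
      = (\<integral>s. indicator {0<..<\<tau>} s * (\<rho> s * f s) \<partial>lborel)"
    using lborel_pair.Fubini_integral[OF Fi] by (simp only: inner outer)
qed

context hurst
begin

lemma nn_integral_bracket:
  assumes "f \<in> borel_measurable (lebesgue_Icc T)"
  shows "(\<integral>\<^sup>+s. f s \<partial>bracket H T) = (\<integral>\<^sup>+s. ennreal ((2 - 2*H) * s powr (1 - 2*H)) * f s \<partial>lebesgue_Icc T)"
proof -
  have "(\<lambda>s. ennreal ((2 - 2*H) * s powr (1 - 2*H))) \<in> borel_measurable (lebesgue_Icc T)"
    by (intro measurable_compose[OF _ measurable_ennreal] borel_measurable_times borel_measurable_const powr_measurable_Icc)
  then show ?thesis unfolding bracket_def using assms by (rule nn_integral_density)
qed

definition inverse_kernel :: "real \<Rightarrow> real \<Rightarrow> real" where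
  "inverse_kernel t s = indicator {0..t} s * ((t - s) powr (H - 3/2) * s powr (1 - 2*H))"

lemma inverse_kernel_nonneg: "0 \<le> inverse_kernel t s"
  by (simp add: inverse_kernel_def)

lemma inverse_kernel_measurable[measurable]:
  assumes [measurable]: "u \<in> borel_measurable M" "v \<in> borel_measurable M"
  shows "(\<lambda>x. inverse_kernel (u x) (v x)) \<in> borel_measurable M"
proof -
  have "(\<lambda>x. inverse_kernel (u x) (v x)) = (\<lambda>x. if 0 \<le> v x \<and> v x \<le> u x then (u x - v x) powr (H - 3/2) * v x powr (1 - 2*H) else 0)"
    by (auto simp: inverse_kernel_def fun_eq_iff)
  then show ?thesis by simp
qed

lemma J_inv_kernel:
  assumes "t \<in> {0..T}"
  shows "J_inv H f t = inverse_const H * t powr a * (\<integral>s. inverse_kernel t s * (indicator {0..T} s * f s) \<partial>lborel)"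
  unfolding J_inv_def set_lebesgue_integral_def inverse_kernel_def
  using assms by (intro arg_cong2[where f="(*)"] refl Bochner_Integration.integral_cong) (auto simp: indicator_def)

lemma inverse_kernel_mass:
  assumes "0 < t"
  shows "(\<integral>\<^sup>+s. ennreal (inverse_kernel t s) \<partial>lborel) = ennreal (t powr (-a) * Beta (1 - 2*a) a)"
proof -
  have e: "(1 - 2*a) - 1 = 1 - 2*H" "a - 1 = H - 3/2" "1 - 2*a + a - 1 = -a" by auto
  have "(\<integral>\<^sup>+s. ennreal (inverse_kernel t s) \<partial>lborel)
    = (\<integral>\<^sup>+s. ennreal ((s - 0) powr ((1 - 2*a) - 1) * (t - s) powr (a - 1)) * indicator {0..t} s \<partial>lborel)"
    unfolding e by (intro nn_integral_cong) (auto simp: inverse_kernel_def indicator_def mult.commute)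
  also have "\<dots> = ennreal ((t - 0) powr (1 - 2*a + a - 1) * Beta (1 - 2*a) a)"
    using a assms by (intro nn_integral_Beta_interval) auto
  finally show ?thesis unfolding e by simp
qed

text \<open>
  After an exchange of the integrals, \<open>(t - s) powr (a - 1)\<close> integrates in \<open>t\<close> to at most
  \<open>T powr a / a\<close>, and the remaining weight \<open>s powr (1 - 2 * H)\<close> is that of the bracket.
\<close>

lemma inverse_kernel_weighted:
  assumes f: "f \<in> borel_measurable (lebesgue_Icc T)"
  shows "(\<integral>\<^sup>+t. indicator {0..T} t * (\<integral>\<^sup>+s. ennreal (inverse_kernel t s * (indicator {0..T} s * f s)\<^sup>2) \<partial>lborel) \<partial>lborel)
    \<le> ennreal (T powr a / (a * (2 - 2*H))) * L2_norm_sq (bracket H T) f"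
proof -
  have [measurable]: "(\<lambda>s. indicator {0..T} s * f s) \<in> borel_measurable borel"
    using f unfolding measurable_lebesgue_Icc_iff by (simp add: mult.commute)
  define g where "g s = (indicator {0..T} s * f s)\<^sup>2" for s
  have [measurable]: "g \<in> borel_measurable borel" unfolding g_def by measurable
  have e: "a - 1 = H - 3/2" by auto
  have "(\<integral>\<^sup>+t. indicator {0..T} t * (\<integral>\<^sup>+s. ennreal (inverse_kernel t s * g s) \<partial>lborel) \<partial>lborel)
    = (\<integral>\<^sup>+t. (\<integral>\<^sup>+s. indicator {0..T} t * ennreal (inverse_kernel t s * g s) \<partial>lborel) \<partial>lborel)"
    by (intro nn_integral_cong nn_integral_cmult[symmetric]) simp
  also have "\<dots> = (\<integral>\<^sup>+s. (\<integral>\<^sup>+t. indicator {0..T} t * ennreal (inverse_kernel t s * g s) \<partial>lborel) \<partial>lborel)"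
    by (rule lborel_pair.Fubini') simp
  also have "\<dots> \<le> (\<integral>\<^sup>+s. ennreal (T powr a / (a * (2 - 2*H))) * (ennreal ((2 - 2*H) * s powr (1 - 2*H)) * ennreal ((f s)\<^sup>2) * indicator {0..T} s) \<partial>lborel)"
  proof (rule nn_integral_mono)
    fix s
    show "(\<integral>\<^sup>+t. indicator {0..T} t * ennreal (inverse_kernel t s * g s) \<partial>lborel)
      \<le> ennreal (T powr a / (a * (2 - 2*H))) * (ennreal ((2 - 2*H) * s powr (1 - 2*H)) * ennreal ((f s)\<^sup>2) * indicator {0..T} s)"
    proof (cases "s \<in> {0..T}")
      case True
      have "(\<integral>\<^sup>+t. indicator {0..T} t * ennreal (inverse_kernel t s * g s) \<partial>lborel)
        = (\<integral>\<^sup>+t. ennreal (s powr (1 - 2*H) * (f s)\<^sup>2) * (ennreal ((t - s) powr (a - 1)) * indicator {s..T} t) \<partial>lborel)"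
        unfolding e using True by (intro nn_integral_cong) (auto simp: inverse_kernel_def g_def indicator_def ennreal_mult'[symmetric] ac_simps)
      also have "\<dots> = ennreal (s powr (1 - 2*H) * (f s)\<^sup>2) * ennreal ((T - s) powr a / a)"
        using a True nn_integral_powr_right[of a s T] by (subst nn_integral_cmult) auto
      also have "\<dots> \<le> ennreal (s powr (1 - 2*H) * (f s)\<^sup>2) * ennreal (T powr a / a)"
        using a True by (intro mult_left_mono ennreal_leI divide_right_mono powr_mono2) auto
      also have "\<dots> = ennreal (T powr a / (a * (2 - 2*H))) * (ennreal ((2 - 2*H) * s powr (1 - 2*H)) * ennreal ((f s)\<^sup>2) * indicator {0..T} s)"
      proof -
        have gen: "x * y * (z / p) = z / (p * q) * (q * x * y)" if "q \<noteq> 0" for x y z p q :: real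
          using that by (simp add: field_simps)
        have "s powr (1 - 2*H) * (f s)\<^sup>2 * (T powr a / a) = T powr a / (a * (2 - 2*H)) * ((2 - 2*H) * s powr (1 - 2*H) * (f s)\<^sup>2)"
          by (rule gen) (use H in simp)
        moreover have "0 \<le> 2 - 2*H" "0 \<le> T powr a / (a * (2 - 2*H))" using H by auto
        moreover have "indicator {0..T} s = (1::ennreal)" using True by simp
        ultimately show ?thesis
          by (simp only: ennreal_mult'[symmetric] mult_1_right mult_nonneg_nonneg powr_ge_zero zero_le_power2)
      qed
      finally show ?thesis .
    qed (auto simp: g_def)
  qed
  also have "\<dots> = ennreal (T powr a / (a * (2 - 2*H))) * (\<integral>\<^sup>+s. ennreal ((2 - 2*H) * s powr (1 - 2*H)) * ennreal ((f s)\<^sup>2) * indicator {0..T} s \<partial>lborel)"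
  proof (rule nn_integral_cmult)
    have "(\<lambda>s. ennreal ((2 - 2*H) * s powr (1 - 2*H)) * ennreal ((f s)\<^sup>2) * indicator {0..T} s) = (\<lambda>s. ennreal ((2 - 2*H) * s powr (1 - 2*H)) * ennreal (g s))"
      by (auto simp: g_def indicator_def)
    then show "(\<lambda>s. ennreal ((2 - 2*H) * s powr (1 - 2*H)) * ennreal ((f s)\<^sup>2) * indicator {0..T} s) \<in> borel_measurable lborel" by simp
  qed
  also have "(\<integral>\<^sup>+s. ennreal ((2 - 2*H) * s powr (1 - 2*H)) * ennreal ((f s)\<^sup>2) * indicator {0..T} s \<partial>lborel) = L2_norm_sq (bracket H T) f"
    unfolding L2_norm_sq_def nn_integral_lebesgue_Icc[symmetric]
    by (rule nn_integral_bracket[symmetric]) (intro measurable_compose[OF _ measurable_ennreal] borel_measurable_power f)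
  finally show ?thesis unfolding g_def .
qed

text \<open>
  Squared prefactor of \<open>J_inv\<close>, bound from \<open>inverse_kernel_mass\<close> and bound from
  \<open>inverse_kernel_weighted\<close>.
\<close>

definition inverse_norm_const :: real where
  "inverse_norm_const = (inverse_const H)\<^sup>2 * (T powr a * Beta (1 - 2*a) a) * (T powr a / (a * (2 - 2*H)))"

text \<open>
  Schur's test.  By Cauchy and Schwarz for the measure with density \<open>inverse_kernel t\<close>, the square of
  the integral is at most the mass of the kernel times the weighted integral of \<open>f\<^sup>2\<close>; the prefactor
  \<open>t powr (2 * a)\<close> outweighs the mass, which is of order \<open>t powr (-a)\<close>.
\<close>

lemma J_inv_bounded:
  assumes f: "f \<in> borel_measurable (lebesgue_Icc T)"
  shows "L2_norm_sq (lebesgue_Icc T) (J_inv H f) \<le> ennreal inverse_norm_const * L2_norm_sq (bracket H T) f"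
proof -
  have [measurable]: "(\<lambda>s. indicator {0..T} s * f s) \<in> borel_measurable borel"
    using f unfolding measurable_lebesgue_Icc_iff by (simp add: mult.commute)
  define g where "g s = indicator {0..T} s * f s" for s
  have [measurable]: "g \<in> borel_measurable borel" unfolding g_def by measurable
  have B: "0 < Beta (1 - 2*a) a" using a by (intro Beta_real_positive) auto
  have CS: "(\<integral>\<^sup>+s. ennreal \<bar>inverse_kernel t s * g s\<bar> \<partial>lborel)\<^sup>2
    \<le> (\<integral>\<^sup>+s. ennreal (inverse_kernel t s) \<partial>lborel) * (\<integral>\<^sup>+s. ennreal (inverse_kernel t s * (g s)\<^sup>2) \<partial>lborel)" for t
  proof -
    have "(\<integral>\<^sup>+s. ennreal (sqrt (inverse_kernel t s)) * ennreal (sqrt (inverse_kernel t s) * \<bar>g s\<bar>) \<partial>lborel)\<^sup>2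
      \<le> (\<integral>\<^sup>+s. (ennreal (sqrt (inverse_kernel t s)))\<^sup>2 \<partial>lborel) * (\<integral>\<^sup>+s. (ennreal (sqrt (inverse_kernel t s) * \<bar>g s\<bar>))\<^sup>2 \<partial>lborel)"
      by (rule Cauchy_Schwarz_nn_integral) auto
    moreover have "ennreal (sqrt (inverse_kernel t s)) * ennreal (sqrt (inverse_kernel t s) * \<bar>g s\<bar>) = ennreal \<bar>inverse_kernel t s * g s\<bar>" for s
    proof -
      have "sqrt (inverse_kernel t s) * (sqrt (inverse_kernel t s) * \<bar>g s\<bar>) = \<bar>inverse_kernel t s * g s\<bar>"
        using inverse_kernel_nonneg[of t s] by (simp add: abs_mult flip: mult.assoc)
      then show ?thesis using inverse_kernel_nonneg[of t s] by (simp flip: ennreal_mult')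
    qed
    ultimately show ?thesis
      using inverse_kernel_nonneg by (simp add: ennreal_power power_mult_distrib)
  qed
  have "L2_norm_sq (lebesgue_Icc T) (J_inv H f) = (\<integral>\<^sup>+t. ennreal ((J_inv H f t)\<^sup>2) * indicator {0..T} t \<partial>lborel)"
    unfolding L2_norm_sq_def nn_integral_lebesgue_Icc ..
  also have "\<dots> \<le> (\<integral>\<^sup>+t. ennreal ((inverse_const H)\<^sup>2 * (T powr a * Beta (1 - 2*a) a)) * (indicator {0..T} t * (\<integral>\<^sup>+s. ennreal (inverse_kernel t s * (g s)\<^sup>2) \<partial>lborel)) \<partial>lborel)"
  proof (rule nn_integral_mono)
    fix t
    let ?I = "\<integral>\<^sup>+s. ennreal (inverse_kernel t s * (g s)\<^sup>2) \<partial>lborel"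
    show "ennreal ((J_inv H f t)\<^sup>2) * indicator {0..T} t \<le> ennreal ((inverse_const H)\<^sup>2 * (T powr a * Beta (1 - 2*a) a)) * (indicator {0..T} t * ?I)"
    proof (cases "t \<in> {0<..T}")
      case True
      let ?G = "\<integral>s. inverse_kernel t s * g s \<partial>lborel"
      have "ennreal \<bar>?G\<bar> \<le> (\<integral>\<^sup>+s. ennreal \<bar>inverse_kernel t s * g s\<bar> \<partial>lborel)"
        using integral_norm_bound_ennreal[of lborel "\<lambda>s. inverse_kernel t s * g s"]
        by (cases "integrable lborel (\<lambda>s. inverse_kernel t s * g s)") (auto simp: not_integrable_integral_eq)
      then have "(ennreal \<bar>?G\<bar>)\<^sup>2 \<le> (\<integral>\<^sup>+s. ennreal \<bar>inverse_kernel t s * g s\<bar> \<partial>lborel)\<^sup>2" by (rule power_mono) simp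
      also note CS
      also have "(\<integral>\<^sup>+s. ennreal (inverse_kernel t s) \<partial>lborel) = ennreal (t powr (-a) * Beta (1 - 2*a) a)"
        using True by (intro inverse_kernel_mass) auto
      finally have G: "ennreal (?G\<^sup>2) \<le> ennreal (t powr (-a) * Beta (1 - 2*a) a) * ?I"
        by (simp add: ennreal_power)
      have "ennreal ((J_inv H f t)\<^sup>2) = ennreal ((inverse_const H * t powr a)\<^sup>2) * ennreal (?G\<^sup>2)"
        unfolding J_inv_kernel[of t f, folded g_def] using True
        by (subst J_inv_kernel) (auto simp: g_def power_mult_distrib ennreal_mult'[symmetric])
      also have "\<dots> \<le> ennreal ((inverse_const H * t powr a)\<^sup>2) * (ennreal (t powr (-a) * Beta (1 - 2*a) a) * ?I)"
        by (intro mult_left_mono G) simp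
      also have "\<dots> = ennreal ((inverse_const H)\<^sup>2 * (t powr a * Beta (1 - 2*a) a)) * ?I"
      proof -
        have "(t powr a)\<^sup>2 * t powr (-a) = t powr a" using True by (simp add: power2_eq_square flip: powr_add)
        then have "(inverse_const H * t powr a)\<^sup>2 * (t powr (-a) * Beta (1 - 2*a) a) = (inverse_const H)\<^sup>2 * (t powr a * Beta (1 - 2*a) a)"
          by (simp only: power_mult_distrib mult.assoc) (simp only: mult.assoc[symmetric])
        then show ?thesis by (simp only: mult.assoc[symmetric] ennreal_mult'[symmetric] zero_le_power2)
      qed
      also have "\<dots> \<le> ennreal ((inverse_const H)\<^sup>2 * (T powr a * Beta (1 - 2*a) a)) * ?I"
        using True a B by (intro mult_right_mono ennreal_leI mult_left_mono powr_mono2) auto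
      finally show ?thesis using True by simp
    next
      case False
      show ?thesis
      proof (cases "t = 0")
        case True
        then show ?thesis by (simp add: J_inv_def)
      next
        case False
        then have "indicator {0..T} t = (0::ennreal)" using \<open>t \<notin> {0<..T}\<close> by (auto simp: indicator_def)
        then show ?thesis by simp
      qed
    qed
  qed
  also have "\<dots> = ennreal ((inverse_const H)\<^sup>2 * (T powr a * Beta (1 - 2*a) a)) * (\<integral>\<^sup>+t. indicator {0..T} t * (\<integral>\<^sup>+s. ennreal (inverse_kernel t s * (g s)\<^sup>2) \<partial>lborel) \<partial>lborel)"
    by (rule nn_integral_cmult) simp
  also have "\<dots> \<le> ennreal ((inverse_const H)\<^sup>2 * (T powr a * Beta (1 - 2*a) a)) * (ennreal (T powr a / (a * (2 - 2*H))) * L2_norm_sq (bracket H T) f)"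
    unfolding g_def by (intro mult_left_mono inverse_kernel_weighted[OF f]) simp
  also have "\<dots> = ennreal inverse_norm_const * L2_norm_sq (bracket H T) f"
    unfolding inverse_norm_const_def using B by (subst ennreal_mult') (auto simp: mult.assoc)
  finally show ?thesis .
qed

text \<open>
  Linearity is restricted to almost every \<open>t\<close> because a divergent integral has value zero: the
  integrands have to be integrable, and \<open>inverse_kernel_weighted\<close> gives this for almost every \<open>t\<close>.
\<close>

lemma J_inv_diff_AE:
  assumes f: "f \<in> borel_measurable (lebesgue_Icc T)" "L2_norm_sq (bracket H T) f < \<infinity>"
    and g: "g \<in> borel_measurable (lebesgue_Icc T)" "L2_norm_sq (bracket H T) g < \<infinity>"
  shows "AE t in lebesgue_Icc T. J_inv H (\<lambda>s. f s - g s) t = J_inv H f t - J_inv H g t"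
proof -
  have int: "AE t in lborel. t \<in> {0..T} \<longrightarrow> integrable lborel (\<lambda>s. inverse_kernel t s * (indicator {0..T} s * u s))"
    if u: "u \<in> borel_measurable (lebesgue_Icc T)" "L2_norm_sq (bracket H T) u < \<infinity>" for u
  proof -
    have [measurable]: "(\<lambda>s. indicator {0..T} s * u s) \<in> borel_measurable borel"
      using u(1) unfolding measurable_lebesgue_Icc_iff by (simp add: mult.commute)
    have "(\<integral>\<^sup>+t. indicator {0..T} t * (\<integral>\<^sup>+s. ennreal (inverse_kernel t s * (indicator {0..T} s * u s)\<^sup>2) \<partial>lborel) \<partial>lborel) \<noteq> \<infinity>"
    proof -
      have "ennreal (T powr a / (a * (2 - 2*H))) * L2_norm_sq (bracket H T) u < \<infinity>" using u(2) by (simp add: ennreal_mult_less_top)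
      then show ?thesis using inverse_kernel_weighted[OF u(1)] by (metis infinity_ennreal_def leD top.not_eq_extremum)
    qed
    then have "AE t in lborel. indicator {0..T} t * (\<integral>\<^sup>+s. ennreal (inverse_kernel t s * (indicator {0..T} s * u s)\<^sup>2) \<partial>lborel) \<noteq> \<infinity>"
      by (intro nn_integral_PInf_AE) auto
    moreover have "AE t in lborel. t \<noteq> (0::real)" by (rule AE_lborel_singleton)
    ultimately show ?thesis
    proof eventually_elim
      case (elim t)
      show ?case
      proof (intro impI integrableI_bounded)
        assume t: "t \<in> {0..T}"
        then have t0: "0 < t" using elim by auto
        have fin: "(\<integral>\<^sup>+s. ennreal (inverse_kernel t s * (indicator {0..T} s * u s)\<^sup>2) \<partial>lborel) < \<infinity>"
          using elim t by (simp add: less_top)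
        have "(\<integral>\<^sup>+s. ennreal (norm (inverse_kernel t s * (indicator {0..T} s * u s))) \<partial>lborel)
          \<le> (\<integral>\<^sup>+s. ennreal (inverse_kernel t s) + ennreal (inverse_kernel t s * (indicator {0..T} s * u s)\<^sup>2) \<partial>lborel)"
        proof (rule nn_integral_mono)
          fix s
          have y: "\<bar>y\<bar> \<le> 1 + y\<^sup>2" for y :: real
            using sum_squares_bound[of "\<bar>y\<bar>" 1] zero_le_power2[of y] by (simp add: power2_eq_square abs_if split: if_splits)
          have "\<bar>inverse_kernel t s * (indicator {0..T} s * u s)\<bar> \<le> inverse_kernel t s * (1 + (indicator {0..T} s * u s)\<^sup>2)"
            unfolding abs_mult[of "inverse_kernel t s"] using inverse_kernel_nonneg[of t s] y by (intro mult_mono) auto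
          then show "ennreal (norm (inverse_kernel t s * (indicator {0..T} s * u s))) \<le> ennreal (inverse_kernel t s) + ennreal (inverse_kernel t s * (indicator {0..T} s * u s)\<^sup>2)"
            unfolding real_norm_def using inverse_kernel_nonneg[of t s]
            by (subst ennreal_plus[symmetric], simp, simp, intro ennreal_leI) (simp only: distrib_left mult_1_right)
        qed
        also have "\<dots> = (\<integral>\<^sup>+s. ennreal (inverse_kernel t s) \<partial>lborel) + (\<integral>\<^sup>+s. ennreal (inverse_kernel t s * (indicator {0..T} s * u s)\<^sup>2) \<partial>lborel)"
          by (rule nn_integral_add) simp_all
        also have "\<dots> < \<infinity>" using fin inverse_kernel_mass[OF t0] by simp
        finally show "(\<integral>\<^sup>+s. ennreal (norm (inverse_kernel t s * (indicator {0..T} s * u s))) \<partial>lborel) < \<infinity>" .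
      qed simp
    qed
  qed
  have "AE t in lborel. t \<in> {0..T} \<longrightarrow> J_inv H (\<lambda>s. f s - g s) t = J_inv H f t - J_inv H g t"
    using int[OF f] int[OF g]
  proof eventually_elim
    case (elim t)
    show ?case
    proof
      assume t: "t \<in> {0..T}"
      have "(\<integral>s. inverse_kernel t s * (indicator {0..T} s * (f s - g s)) \<partial>lborel)
         = (\<integral>s. inverse_kernel t s * (indicator {0..T} s * f s) - inverse_kernel t s * (indicator {0..T} s * g s) \<partial>lborel)"
        by (simp only: right_diff_distrib)
      also have "\<dots> = (\<integral>s. inverse_kernel t s * (indicator {0..T} s * f s) \<partial>lborel) - (\<integral>s. inverse_kernel t s * (indicator {0..T} s * g s) \<partial>lborel)"
        using elim t by (intro Bochner_Integration.integral_diff) auto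
      finally show "J_inv H (\<lambda>s. f s - g s) t = J_inv H f t - J_inv H g t"
        unfolding J_inv_kernel[OF t] by (simp only: right_diff_distrib)
    qed
  qed
  then show ?thesis unfolding lebesgue_Icc_def by (subst AE_restrict_space_iff) auto
qed

lemma inverse_const_normalisation:
  "inverse_const H * (molchan_const H * Beta a (1 - a)) = 2 - 2*H"
proof -
  define b where "b = H - 1/2"
  have b: "0 < b" "b < 1/2" using H by (auto simp: b_def)
  have e: "3/2 - H = 1 - b" "H - 1/2 = b" by (auto simp: b_def)
  have G: "0 < Gamma b" "0 < Gamma (1 - b)" using b by (auto intro!: Gamma_real_pos)
  have B: "Beta b (1 - b) = Gamma b * Gamma (1 - b)" using Beta_mult_Gamma[of b "1 - b"] b by simp
  show ?thesis unfolding inverse_const_def e B using G molchan_const_pos by simp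
qed

text \<open>
  Abel's classical inversion.  The integral of \<open>(\<tau> - t) powr (a - 1) * j_map H Q t\<close> over \<open>t\<close> in
  \<open>(0,\<tau>)\<close> is computed twice.  With \<open>j_map\<close> as the primitive of \<open>h\<close> it is the integral up to \<open>\<tau>\<close> of the left
  hand side; with the definition of \<open>j_map\<close> it is, by a Beta integral, the one of the right hand side.
  Functions with equal indefinite integrals agree almost everywhere.
\<close>

lemma abel_inversion:
  assumes hi: "integrable (lebesgue_Icc T) h"
    and j: "\<And>t. t \<in> {0..T} \<Longrightarrow> j_map H Q t = (\<integral>s. indicator {0<..t} s * h s \<partial>lebesgue_Icc T)"
    and Q: "continuous_on {0..T} Q"
  shows "AE t in lborel. t \<in> {0..T} \<longrightarrow>
    (\<integral>s. indicator {0<..<t} s * ((t - s) powr (a - 1) * (indicator {0<..T} s * h s)) \<partial>lborel)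
      = molchan_const H * Beta a (1 - a) * (t powr (-a) * Q t)"
proof -
  let ?c = "molchan_const H"
  define f where "f s = indicator {0<..T} s * h s" for s
  define q where "q s = indicator {0<..T} s * (?c * s powr (-a) * Q s)" for s
  have fi: "integrable lborel f"
  proof -
    have "integrable lborel (\<lambda>s. indicator {0<..T} s * (indicator {0..T} s * h s))"
      using hi unfolding integrable_lebesgue_Icc
      using integrable_real_mult_indicator[of "{0<..T}" lborel "\<lambda>s. indicator {0..T} s * h s"] by (simp add: mult.commute)
    moreover have "indicator {0<..T} s * (indicator {0..T} s * h s) = f s" for s
      by (auto simp: indicator_def f_def)
    ultimately show ?thesis by simp
  qed
  have fm[measurable]: "f \<in> borel_measurable borel" using fi by simp
  obtain C where C: "0 < C" "\<forall>s\<in>{0..T}. \<bar>Q s\<bar> \<le> C" using continuous_bounded_Icc[OF Q] by auto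
  have qm[measurable]: "q \<in> borel_measurable borel"
  proof -
    have "(\<lambda>s. Q s * indicator {0..T} s) \<in> borel_measurable borel"
      using continuous_imp_measurable_Icc[OF Q] measurable_lebesgue_Icc_iff by blast
    then have "(\<lambda>s. indicator {0<..T} s * (?c * s powr (-a) * (Q s * indicator {0..T} s))) \<in> borel_measurable borel" by measurable
    moreover have "indicator {0<..T} s * (?c * s powr (-a) * (Q s * indicator {0..T} s)) = q s" for s
      by (auto simp: q_def indicator_def)
    ultimately show ?thesis by simp
  qed
  have qi: "integrable lborel q"
  proof -
    have "(\<integral>\<^sup>+s. ennreal (s powr (-a) * indicator {0..T} s) \<partial>lborel) = ennreal (T powr (1 - a) / (1 - a))"
      using nn_integral_powr_right[of "1 - a" 0 T] a T by (simp add: ennreal_mult' ennreal_indicator)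
    then have "integrable lborel (\<lambda>s. s powr (-a) * indicator {0..T} s)"
      by (intro integrableI_nonneg) auto
    then have i: "integrable lborel (\<lambda>s. ?c * C * (s powr (-a) * indicator {0..T} s))" by (rule integrable_mult_right)
    show ?thesis
    proof (rule Bochner_Integration.integrable_bound[OF i], simp, rule AE_I2)
      fix s
      show "norm (q s) \<le> norm (?c * C * (s powr (-a) * indicator {0..T} s))"
      proof (cases "s \<in> {0<..T}")
        case True
        then have "\<bar>Q s\<bar> \<le> C" using C by auto
        then have "(?c * s powr (-a)) * \<bar>Q s\<bar> \<le> (?c * s powr (-a)) * C" using molchan_const_pos by (intro mult_left_mono) auto
        then show ?thesis using True molchan_const_pos C by (simp add: q_def abs_mult ac_simps)
      qed (simp add: q_def)
    qed
  qed
  have jf: "j_map H Q t = (\<integral>s. indicator {0<..<t} s * f s \<partial>lborel)" if t: "t \<in> {0..T}" for t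
  proof -
    have "j_map H Q t = (\<integral>s. indicator {0..T} s * (indicator {0<..t} s * h s) \<partial>lborel)"
      unfolding j[OF t] integral_lebesgue_Icc ..
    also have "\<dots> = (\<integral>s. indicator {0<..<t} s * f s \<partial>lborel)"
    proof (rule integral_cong_AE)
      have "AE s in lborel. s \<noteq> t" by (rule AE_lborel_singleton)
      then show "AE s in lborel. indicator {0..T} s * (indicator {0<..t} s * h s) = indicator {0<..<t} s * f s"
        by eventually_elim (use t in \<open>auto simp: indicator_def f_def\<close>)
      have eq: "(\<lambda>s. indicator {0..T} s * (indicator {0<..t} s * h s)) = (\<lambda>s. indicator {0<..t} s * f s)"
        using t by (auto simp: indicator_def f_def)
      show "(\<lambda>s. indicator {0..T} s * (indicator {0<..t} s * h s)) \<in> borel_measurable lborel" unfolding eq by simp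
    qed simp
    finally show ?thesis .
  qed
  have jq: "j_map H Q t = (\<integral>s. indicator {0<..<t} s * ((t - s) powr (-a) * q s) \<partial>lborel)" if t: "t \<in> {0..T}" for t
  proof -
    show ?thesis unfolding j_map_def set_lebesgue_integral_def
      using t by (intro Bochner_Integration.integral_cong) (auto simp: indicator_def q_def molchan_kernel_def)
  qed
  define A where "A t = (\<integral>s. indicator {0<..<t} s * ((t - s) powr (a - 1) * f s) \<partial>lborel)" for t
  let ?B = "Beta a (1 - a)"
  have rho: "(\<integral>\<^sup>+t. ennreal ((\<tau> - t) powr (a - 1)) * indicator {s..\<tau>} t \<partial>lborel) = ennreal ((\<tau> - s) powr a / a)" if "s < \<tau>" for s \<tau>
  proof -
    have "(\<integral>\<^sup>+t. ennreal ((\<tau> - t) powr (a - 1)) * indicator {s..\<tau>} t \<partial>lborel) = (\<integral>\<^sup>+v. ennreal ((v - 0) powr (a - 1)) * indicator {0..\<tau> - s} v \<partial>lborel)"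
      by (subst nn_integral_real_affine[where c="-1" and t=\<tau>]) (auto intro!: nn_integral_cong simp: indicator_def)
    also have "\<dots> = ennreal ((\<tau> - s - 0) powr a / a)" using that a by (intro nn_integral_powr_right) auto
    finally show ?thesis by simp
  qed
  have key: "integrable lborel (\<lambda>t. indicator {0..\<tau>} t * A t) \<and>
      (\<integral>t. indicator {0..\<tau>} t * A t \<partial>lborel) = (\<integral>s. indicator {0<..<\<tau>} s * (?B * q s) \<partial>lborel)" if \<tau>: "\<tau> \<in> {0..T}" for \<tau>
  proof -
    have pi: "integrable lborel (\<lambda>s. indicator {0<..<\<tau>} s * ((\<tau> - s) powr a / a * f s))"
    proof (rule Bochner_Integration.integrable_bound)
      show "integrable lborel (\<lambda>s. T powr a / a * f s)" using fi by (rule integrable_mult_right)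
      show "AE s in lborel. norm (indicator {0<..<\<tau>} s * ((\<tau> - s) powr a / a * f s)) \<le> norm (T powr a / a * f s)"
      proof (rule AE_I2)
        fix s
        show "norm (indicator {0<..<\<tau>} s * ((\<tau> - s) powr a / a * f s)) \<le> norm (T powr a / a * f s)"
        proof (cases "s \<in> {0<..<\<tau>}")
          case True
          then have "(\<tau> - s) powr a \<le> T powr a" using a \<tau> by (intro powr_mono2) auto
          then have "(\<tau> - s) powr a / a * \<bar>f s\<bar> \<le> T powr a / a * \<bar>f s\<bar>" using a by (intro mult_right_mono divide_right_mono) auto
          then show ?thesis using True a by (simp add: abs_mult del: times_divide_eq_left)
        qed simp
      qed
    qed simp
    have p0: "0 \<le> (\<tau> - s) powr a / a" for s using a by simp
    have km1: "case_prod (\<lambda>t s. (t - s) powr (a - 1)) \<in> borel_measurable (borel \<Otimes>\<^sub>M borel)"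
      "case_prod (\<lambda>t s. (\<tau> - t) powr (a - 1)) \<in> borel_measurable (borel \<Otimes>\<^sub>M borel)"
      "case_prod (\<lambda>t s. (\<tau> - t) powr (a - 1) * (t - s) powr (-a)) \<in> borel_measurable (borel \<Otimes>\<^sub>M borel)"
      by measurable
    have r1: "(\<integral>\<^sup>+t. ennreal ((t - s) powr (a - 1)) * indicator {s..\<tau>} t \<partial>lborel) = ennreal ((\<tau> - s) powr a / a)" if "0 < s" "s < \<tau>" for s
      using that a by (intro nn_integral_powr_right) auto
    have r3: "(\<integral>\<^sup>+t. ennreal ((\<tau> - t) powr (a - 1) * (t - s) powr (-a)) * indicator {s..\<tau>} t \<partial>lborel) = ennreal ?B" if "0 < s" "s < \<tau>" for s
    proof -
      have "(\<integral>\<^sup>+t. ennreal ((\<tau> - t) powr (a - 1) * (t - s) powr (-a)) * indicator {s..\<tau>} t \<partial>lborel) = ennreal ((\<tau> - s) powr (1 - a + a - 1) * Beta (1 - a) a)"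
      proof -
        have "(\<integral>\<^sup>+t. ennreal ((\<tau> - t) powr (a - 1) * (t - s) powr (-a)) * indicator {s..\<tau>} t \<partial>lborel)
          = (\<integral>\<^sup>+t. ennreal ((t - s) powr ((1 - a) - 1) * (\<tau> - t) powr (a - 1)) * indicator {s..\<tau>} t \<partial>lborel)"
          by (intro nn_integral_cong) (simp add: mult.commute)
        also have "\<dots> = ennreal ((\<tau> - s) powr (1 - a + a - 1) * Beta (1 - a) a)"
          by (rule nn_integral_Beta_interval) (use that a in auto)
        finally show ?thesis .
      qed
      moreover have "(\<tau> - s) powr (1 - a + a - 1) = 1" using that by simp
      ultimately show ?thesis by (simp only: mult_1_left Beta_commute[of "1 - a" a])
    qed
    have B0: "0 \<le> ?B" using Beta_real_positive[of a "1 - a"] a by simp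
    have qi': "integrable lborel (\<lambda>s. indicator {0<..<\<tau>} s * (?B * q s))"
      by (rule Bochner_Integration.integrable_bound[OF integrable_mult_right[OF qi, of ?B]]) (auto simp: indicator_def)
    \<comment> \<open>The kernels of \<open>t1\<close> and \<open>t2\<close> are exchanged by the reflection of \<open>(s,\<tau>)\<close>.  Their masses being equal,
      the integral of \<open>A\<close> is that of \<open>(\<tau> - t) powr (a - 1) * j_map H Q t\<close>, and \<open>t3\<close> evaluates the latter.\<close>
    note t1 = triangle_Fubini[OF km1(1) fm powr_ge_zero r1 p0 pi]
    note t2 = triangle_Fubini[OF km1(2) fm powr_ge_zero rho p0 pi]
    note t3 = triangle_Fubini[OF km1(3) qm mult_nonneg_nonneg[OF powr_ge_zero powr_ge_zero] r3 B0 qi']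
    have c2: "indicator {0..\<tau>} t * (\<integral>s. indicator {0<..<t} s * ((\<tau> - t) powr (a - 1) * f s) \<partial>lborel)
      = indicator {0..\<tau>} t * ((\<tau> - t) powr (a - 1) * j_map H Q t)" for t
    proof (cases "t \<in> {0..\<tau>}")
      case True
      have "(\<integral>s. indicator {0<..<t} s * ((\<tau> - t) powr (a - 1) * f s) \<partial>lborel) = (\<integral>s. (\<tau> - t) powr (a - 1) * (indicator {0<..<t} s * f s) \<partial>lborel)"
        by (simp only: mult.left_commute)
      also have "\<dots> = (\<tau> - t) powr (a - 1) * j_map H Q t" using jf[of t] True \<tau> by simp
      finally show ?thesis by simp
    qed simp
    have c3: "indicator {0..\<tau>} t * (\<integral>s. indicator {0<..<t} s * ((\<tau> - t) powr (a - 1) * (t - s) powr (-a) * q s) \<partial>lborel)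
      = indicator {0..\<tau>} t * ((\<tau> - t) powr (a - 1) * j_map H Q t)" for t
    proof (cases "t \<in> {0..\<tau>}")
      case True
      have "(\<integral>s. indicator {0<..<t} s * ((\<tau> - t) powr (a - 1) * (t - s) powr (-a) * q s) \<partial>lborel) = (\<integral>s. (\<tau> - t) powr (a - 1) * (indicator {0<..<t} s * ((t - s) powr (-a) * q s)) \<partial>lborel)"
        by (simp only: ac_simps)
      also have "\<dots> = (\<tau> - t) powr (a - 1) * j_map H Q t" using jq[of t] True \<tau> by simp
      finally show ?thesis by simp
    qed simp
    show ?thesis
      using t1 t2(2) t3(2) unfolding c2 c3 A_def by simp
  qed
  define d where "d t = indicator {0..T} t * A t - ?B * q t" for t
  have di: "integrable lborel d"
    unfolding d_def using key[of T] T qi by (intro Bochner_Integration.integrable_diff integrable_mult_right) auto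
  have "AE t in lborel. d t = 0"
  proof (rule AE_zero_of_tail_integrals[OF di])
    fix x
    \<comment> \<open>Truncation of \<open>x\<close> to \<open>[0,T]\<close>, outside of which \<open>d\<close> vanishes.\<close>
    define \<tau> where "\<tau> = max 0 (min x T)"
    have \<tau>: "\<tau> \<in> {0..T}" using T by (auto simp: \<tau>_def)
    have i: "integrable lborel (\<lambda>t. indicator {0..\<tau>} t * d t)"
      using integrable_real_mult_indicator[OF _ di, of "{0..\<tau>}"] by (simp add: mult.commute)
    have Z: "(\<integral>t. indicator {0..\<tau>} t * d t \<partial>lborel) = 0" if \<tau>: "\<tau> \<in> {0..T}" for \<tau>
    proof -
      have iq: "integrable lborel (\<lambda>s. indicator {0<..<\<tau>} s * (?B * q s))"
        by (rule Bochner_Integration.integrable_bound[OF integrable_mult_right[OF qi, of ?B]]) (auto simp: indicator_def)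
      have "(\<integral>t. indicator {0..\<tau>} t * d t \<partial>lborel) = (\<integral>t. indicator {0..\<tau>} t * A t - indicator {0<..<\<tau>} t * (?B * q t) \<partial>lborel)"
      proof (rule integral_cong_AE)
        have "AE t in lborel. t \<noteq> \<tau>" by (rule AE_lborel_singleton)
        then show "AE t in lborel. indicator {0..\<tau>} t * d t = indicator {0..\<tau>} t * A t - indicator {0<..<\<tau>} t * (?B * q t)"
          by eventually_elim (use \<tau> in \<open>auto simp: d_def indicator_def q_def\<close>)
        show "(\<lambda>t. indicator {0..\<tau>} t * d t) \<in> borel_measurable lborel" using di by simp
        show "(\<lambda>t. indicator {0..\<tau>} t * A t - indicator {0<..<\<tau>} t * (?B * q t)) \<in> borel_measurable lborel"
          using key[OF \<tau>] iq by (intro borel_measurable_diff) auto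
      qed
      also have "\<dots> = 0" using key[OF \<tau>] iq by (subst Bochner_Integration.integral_diff) auto
      finally show ?thesis .
    qed
    have "(\<integral>s. indicator {x<..} s * d s \<partial>lborel) = (\<integral>s. indicator {0..T} s * d s - indicator {0..\<tau>} s * d s \<partial>lborel)"
    proof (rule integral_cong_AE)
      have "AE t in lborel. t \<noteq> (0::real)" by (rule AE_lborel_singleton)
      then show "AE s in lborel. indicator {x<..} s * d s = indicator {0..T} s * d s - indicator {0..\<tau>} s * d s"
        by eventually_elim (use T in \<open>auto simp: \<tau>_def indicator_def d_def q_def\<close>)
    qed (use di in auto)
    also have "\<dots> = 0"
    proof -
      have "integrable lborel (\<lambda>t. indicator {0..T} t * d t)"
        using integrable_real_mult_indicator[OF _ di, of "{0..T}"] by (simp add: mult.commute)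
      then show ?thesis using i Z[OF \<tau>] Z[of T] T by (subst Bochner_Integration.integral_diff) auto
    qed
    finally show "(\<integral>s. indicator {x<..} s * d s \<partial>lborel) = 0" .
  qed
  moreover have "AE t in lborel. t \<noteq> (0::real)" by (rule AE_lborel_singleton)
  ultimately show ?thesis
  proof eventually_elim
    case (elim t)
    show ?case
    proof
      assume t: "t \<in> {0..T}"
      then have "A t = ?B * q t" "indicator {0<..T} t = (1::real)" using elim by (auto simp: d_def)
      then show "(\<integral>s. indicator {0<..<t} s * ((t - s) powr (a - 1) * (indicator {0<..T} s * h s)) \<partial>lborel) = ?c * ?B * (t powr (-a) * Q t)"
        unfolding A_def f_def q_def by (simp only: mult_1_left ac_simps)
    qed
  qed
qed

lemma J_inv_J_map:
  assumes Q: "C1_on_Icc T Q"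
  shows "AE t in lebesgue_Icc T. J_inv H (J_map H T Q) t = Q t"
proof -
  obtain h where hi: "integrable (lebesgue_Icc T) h"
    and jint: "\<forall>t\<in>{0..T}. j_map H Q t = (\<integral>s. indicator {0<..t} s * h s \<partial>lebesgue_Icc T)"
    and hJ: "\<forall>t\<in>{0<..T}. h t = (2 - 2*H) * t powr (1 - 2*H) * J_map H T Q t"
    using j_map_absolutely_continuous[OF Q] by auto
  have Qc: "continuous_on {0..T} Q" by (rule C1_on_Icc_imp_continuous_on[OF Q])
  have "AE t in lborel. t \<in> {0..T} \<longrightarrow>
    (\<integral>s. indicator {0<..<t} s * ((t - s) powr (a - 1) * (indicator {0<..T} s * h s)) \<partial>lborel)
      = molchan_const H * Beta a (1 - a) * (t powr (-a) * Q t)"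
    using jint by (intro abel_inversion[OF hi _ Qc]) auto
  moreover have "AE t in lborel. t \<noteq> (0::real)" by (rule AE_lborel_singleton)
  ultimately have "AE t in lborel. t \<in> {0..T} \<longrightarrow> J_inv H (J_map H T Q) t = Q t"
  proof eventually_elim
    case (elim t)
    show ?case
    proof
      assume t: "t \<in> {0..T}"
      have e: "H - 3/2 = a - 1" by simp
      have pt: "(2 - 2*H) * (indicator {0..t} s *\<^sub>R ((t - s) powr (a - 1) * s powr (1 - 2*H) * J_map H T Q s))
         = indicator {0<..<t} s * ((t - s) powr (a - 1) * (indicator {0<..T} s * h s))" if "s \<noteq> 0" for s
      proof (cases "s \<in> {0<..<t}")
        case True
        then show ?thesis using t hJ by (simp add: ac_simps)
      next
        case False
        then have "indicator {0..t} s = (0::real) \<or> s = t" using that by (auto simp: indicator_def)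
        then show ?thesis by (auto simp: indicator_def)
      qed
      have "(2 - 2*H) * (LINT s:{0..t}|lborel. (t - s) powr (a - 1) * s powr (1 - 2*H) * J_map H T Q s)
        = (\<integral>s. (2 - 2*H) * (indicator {0..t} s *\<^sub>R ((t - s) powr (a - 1) * s powr (1 - 2*H) * J_map H T Q s)) \<partial>lborel)"
        unfolding set_lebesgue_integral_def by simp
      also have "\<dots> = (\<integral>s. indicator {0<..<t} s * ((t - s) powr (a - 1) * (indicator {0<..T} s * h s)) \<partial>lborel)"
      proof -
        have "(2 - 2*H) * (indicator {0..t} s *\<^sub>R ((t - s) powr (a - 1) * s powr (1 - 2*H) * J_map H T Q s))
         = indicator {0<..<t} s * ((t - s) powr (a - 1) * (indicator {0<..T} s * h s))" for s
          using pt[of s] H by (cases "s = 0") auto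
        then show ?thesis by (simp only:)
      qed
      also have "\<dots> = molchan_const H * Beta a (1 - a) * (t powr (-a) * Q t)" using elim t by blast
      finally have I: "(2 - 2*H) * (LINT s:{0..t}|lborel. (t - s) powr (a - 1) * s powr (1 - 2*H) * J_map H T Q s)
        = molchan_const H * Beta a (1 - a) * (t powr (-a) * Q t)" .
      have "(2 - 2*H) * J_inv H (J_map H T Q) t = inverse_const H * t powr a * ((2 - 2*H) * (LINT s:{0..t}|lborel. (t - s) powr (a - 1) * s powr (1 - 2*H) * J_map H T Q s))"
        unfolding J_inv_def e by (simp only: ac_simps)
      also have "\<dots> = inverse_const H * (molchan_const H * Beta a (1 - a)) * ((t powr a * t powr (-a)) * Q t)"
        unfolding I by (simp only: ac_simps)
      also have "t powr a * t powr (-a) = 1" using elim by (simp flip: powr_add)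
      finally show "J_inv H (J_map H T Q) t = Q t" unfolding inverse_const_normalisation using H by simp
    qed
  qed
  then show ?thesis unfolding lebesgue_Icc_def by (subst AE_restrict_space_iff) auto
qed

text \<open>
  \<open>J_inv\<close> is a bounded left inverse of \<open>J_map\<close>, so that an estimator of \<open>J_map H T Q\<close> yields one of \<open>Q\<close>
  at the price of a constant.
\<close>

lemma J_inv_error:
  assumes Q: "C1_on_Icc T Q" and J: "L2_fun (bracket H T) (J_map H T Q)"
    and f: "f \<in> borel_measurable (lebesgue_Icc T)" "L2_norm_sq (bracket H T) f < \<infinity>"
  shows "L2_norm_sq (lebesgue_Icc T) (\<lambda>t. J_inv H f t - Q t)
    \<le> ennreal inverse_norm_const * L2_norm_sq (bracket H T) (\<lambda>s. f s - J_map H T Q s)"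
proof -
  have Jm: "J_map H T Q \<in> borel_measurable (lebesgue_Icc T)" and Jf: "L2_norm_sq (bracket H T) (J_map H T Q) < \<infinity>"
    using J L2_norm_sq_eq_integral[of "bracket H T" "J_map H T Q"] unfolding L2_fun_def by (auto simp: bracket_def)
  have "L2_norm_sq (lebesgue_Icc T) (\<lambda>t. J_inv H f t - Q t) = L2_norm_sq (lebesgue_Icc T) (J_inv H (\<lambda>s. f s - J_map H T Q s))"
    unfolding L2_norm_sq_def
  proof (rule nn_integral_cong_AE)
    show "AE t in lebesgue_Icc T. ennreal ((J_inv H f t - Q t)\<^sup>2) = ennreal ((J_inv H (\<lambda>s. f s - J_map H T Q s) t)\<^sup>2)"
      using J_inv_diff_AE[OF f Jm Jf] J_inv_J_map[OF Q] by eventually_elim simp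
  qed
  also have "\<dots> \<le> ennreal inverse_norm_const * L2_norm_sq (bracket H T) (\<lambda>s. f s - J_map H T Q s)"
    by (intro J_inv_bounded borel_measurable_diff f Jm)
  finally show ?thesis .
qed

end

section \<open>Sub-Gaussian vectors\<close>

lemma std_normal_exp_moment:
  "(\<integral>\<^sup>+g. ennreal (std_normal_density g) * ennreal (exp (c * g)) \<partial>lborel) = ennreal (exp (c\<^sup>2 / 2))"
proof -
  have dens: "std_normal_density g * exp (c * g) = exp (c\<^sup>2 / 2) * normal_density c 1 g" for g
  proof -
    have "- g\<^sup>2 / 2 + c * g = c\<^sup>2 / 2 + (- (g - c)\<^sup>2 / 2)" by (simp add: power2_eq_square field_simps)
    then have "exp (- g\<^sup>2 / 2) * exp (c * g) = exp (c\<^sup>2 / 2) * exp (- (g - c)\<^sup>2 / 2)"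
      by (simp only: exp_add[symmetric])
    then show ?thesis unfolding normal_density_def by (simp add: ac_simps)
  qed
  have "(\<integral>\<^sup>+g. ennreal (std_normal_density g) * ennreal (exp (c * g)) \<partial>lborel)
    = (\<integral>\<^sup>+g. ennreal (exp (c\<^sup>2 / 2)) * ennreal (normal_density c 1 g) \<partial>lborel)"
    by (intro nn_integral_cong) (simp add: dens flip: ennreal_mult')
  also have "\<dots> = ennreal (exp (c\<^sup>2 / 2)) * (\<integral>\<^sup>+g. ennreal (normal_density c 1 g) \<partial>lborel)"
    by (rule nn_integral_cmult) simp
  also have "(\<integral>\<^sup>+g. ennreal (normal_density c 1 g) \<partial>lborel) = 1"
    by (subst nn_integral_eq_integral) auto
  finally show ?thesis by simp
qed

lemma std_normal_square_exp_moment: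
  assumes "l < 1/2"
  shows "(\<integral>\<^sup>+g. ennreal (std_normal_density g) * ennreal (exp (l * g\<^sup>2)) \<partial>lborel) = ennreal (1 / sqrt (1 - 2*l))"
proof -
  let ?q = "1 / sqrt (1 - 2*l)"
  have q: "0 < ?q" using assms by simp
  have q2: "?q\<^sup>2 = 1 / (1 - 2*l)" using assms by (simp add: power_divide)
  have dens: "std_normal_density g * exp (l * g\<^sup>2) = ?q * normal_density 0 ?q g" for g
  proof -
    have "- g\<^sup>2 / 2 + l * g\<^sup>2 = - (g - 0)\<^sup>2 / (2 * ?q\<^sup>2)" unfolding q2 using assms by (simp add: field_simps)
    then have "exp (- g\<^sup>2 / 2) * exp (l * g\<^sup>2) = exp (- (g - 0)\<^sup>2 / (2 * ?q\<^sup>2))" by (simp only: exp_add[symmetric])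
    moreover have "?q * (1 / sqrt (2 * pi * ?q\<^sup>2)) = 1 / sqrt (2 * pi)"
      using q by (simp add: real_sqrt_mult)
    ultimately show ?thesis unfolding normal_density_def by (simp add: ac_simps)
  qed
  have "(\<integral>\<^sup>+g. ennreal (std_normal_density g) * ennreal (exp (l * g\<^sup>2)) \<partial>lborel)
    = (\<integral>\<^sup>+g. ennreal ?q * ennreal (normal_density 0 ?q g) \<partial>lborel)"
  proof (intro nn_integral_cong)
    fix g
    have "ennreal (std_normal_density g) * ennreal (exp (l * g\<^sup>2)) = ennreal (std_normal_density g * exp (l * g\<^sup>2))"
      by (simp add: ennreal_mult')
    also have "\<dots> = ennreal ?q * ennreal (normal_density 0 ?q g)" unfolding dens using q by (intro ennreal_mult') simp
    finally show "ennreal (std_normal_density g) * ennreal (exp (l * g\<^sup>2)) = ennreal ?q * ennreal (normal_density 0 ?q g)" .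
  qed
  also have "\<dots> = ennreal ?q * (\<integral>\<^sup>+g. ennreal (normal_density 0 ?q g) \<partial>lborel)"
    by (rule nn_integral_cmult) simp
  also have "(\<integral>\<^sup>+g. ennreal (normal_density 0 ?q g) \<partial>lborel) = 1"
    using q by (subst nn_integral_eq_integral) auto
  finally show ?thesis by simp
qed

text \<open>
  The part of being standard Gaussian that survives limits in mean square: an upper bound on joint
  exponential moments.
\<close>

definition subgaussian_vector :: "'w measure \<Rightarrow> nat \<Rightarrow> (nat \<Rightarrow> 'w \<Rightarrow> real) \<Rightarrow> bool" where
  "subgaussian_vector P n \<xi> \<longleftrightarrow>
     (\<forall>k\<in>{1..n}. \<xi> k \<in> borel_measurable P) \<and>
     (\<forall>t. (\<integral>\<^sup>+\<omega>. ennreal (exp (\<Sum>k=1..n. t k * \<xi> k \<omega>)) \<partial>P) \<le> ennreal (exp ((\<Sum>k=1..n. (t k)\<^sup>2) / 2)))"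

text \<open>
  Gaussian smoothing: for a standard normal \<open>g\<close>, \<open>exp (l * x\<^sup>2)\<close> is the mean of \<open>exp (sqrt (2 * l) * g * x)\<close>.
  Squares are thus replaced one after the other by linear terms.  The induction carries a linear form
  in the coordinates whose squares are not yet reached; it ends with a linear form alone, where the
  hypothesis applies.
\<close>

lemma subgaussian_chi_square:
  assumes P: "prob_space P" and \<xi>: "subgaussian_vector P n \<xi>" and l: "0 \<le> l" "l < 1/2" and m: "m \<le> n"
  shows "(\<integral>\<^sup>+\<omega>. ennreal (exp (l * (\<Sum>k=1..m. (\<xi> k \<omega>)\<^sup>2))) \<partial>P) \<le> ennreal ((1 / sqrt (1 - 2*l)) ^ m)"
proof -
  interpret prob_space P by fact
  interpret pair_sigma_finite P lborel ..
  let ?q = "1 / sqrt (1 - 2*l)"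
  have q: "0 < ?q" using l by simp
  define X where "X k \<omega> = (if k \<in> {1..n} then \<xi> k \<omega> else 0)" for k \<omega>
  have Xm[measurable]: "X k \<in> borel_measurable P" for k
    unfolding X_def[abs_def] using \<xi> by (cases "k \<in> {1..n}") (auto simp: subgaussian_vector_def)
  have "(\<integral>\<^sup>+\<omega>. ennreal (exp (l * (\<Sum>k=1..j. (X k \<omega>)\<^sup>2) + (\<Sum>k=Suc j..n. t k * X k \<omega>))) \<partial>P)
      \<le> ennreal (?q ^ j * exp ((\<Sum>k=Suc j..n. (t k)\<^sup>2) / 2))" if "j \<le> n" for j t
    using that
  proof (induction j arbitrary: t)
    case 0
    have "(\<Sum>k=1..n. t k * X k \<omega>) = (\<Sum>k=1..n. t k * \<xi> k \<omega>)" for \<omega>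
      by (intro sum.cong) (auto simp: X_def)
    then show ?case using \<xi> by (simp add: subgaussian_vector_def)
  next
    case (Suc j)
    let ?R = "\<lambda>\<omega>. l * (\<Sum>k=1..j. (X k \<omega>)\<^sup>2) + (\<Sum>k=Suc (Suc j)..n. t k * X k \<omega>)"
    \<comment> \<open>The linear form with the new coordinate attached to the auxiliary Gaussian variable.\<close>
    define u where "u g k = (if k = Suc j then sqrt (2*l) * g else t k)" for g k
    have split: "{Suc j..n} = insert (Suc j) {Suc (Suc j)..n}" using Suc.prems by auto
    have usum: "(\<Sum>k=Suc j..n. u g k * y k) = sqrt (2*l) * g * y (Suc j) + (\<Sum>k=Suc (Suc j)..n. t k * y k)" for g and y :: "nat \<Rightarrow> real"
      unfolding split by (subst sum.insert) (auto simp: u_def intro!: sum.cong)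
    have usq: "(\<Sum>k=Suc j..n. (u g k)\<^sup>2) = 2*l * g\<^sup>2 + (\<Sum>k=Suc (Suc j)..n. (t k)\<^sup>2)" for g
      unfolding split using l by (subst sum.insert) (auto simp: u_def power_mult_distrib intro!: sum.cong)
    have "(\<integral>\<^sup>+\<omega>. ennreal (exp (l * (\<Sum>k=1..Suc j. (X k \<omega>)\<^sup>2) + (\<Sum>k=Suc (Suc j)..n. t k * X k \<omega>))) \<partial>P)
      = (\<integral>\<^sup>+\<omega>. ennreal (exp (?R \<omega>)) * ennreal (exp ((sqrt (2*l) * X (Suc j) \<omega>)\<^sup>2 / 2)) \<partial>P)"
      using l by (intro nn_integral_cong) (simp add: power_mult_distrib distrib_left exp_add[symmetric] ennreal_mult'[symmetric] algebra_simps)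
    also have "\<dots> = (\<integral>\<^sup>+\<omega>. (\<integral>\<^sup>+g. ennreal (exp (?R \<omega>)) * (ennreal (std_normal_density g) * ennreal (exp (sqrt (2*l) * X (Suc j) \<omega> * g))) \<partial>lborel) \<partial>P)"
      by (intro nn_integral_cong) (subst std_normal_exp_moment[symmetric], rule nn_integral_cmult[symmetric], simp)
    also have "\<dots> = (\<integral>\<^sup>+g. (\<integral>\<^sup>+\<omega>. ennreal (exp (?R \<omega>)) * (ennreal (std_normal_density g) * ennreal (exp (sqrt (2*l) * X (Suc j) \<omega> * g))) \<partial>P) \<partial>lborel)"
      by (rule Fubini'[symmetric]) measurable
    also have "\<dots> = (\<integral>\<^sup>+g. ennreal (std_normal_density g) * (\<integral>\<^sup>+\<omega>. ennreal (exp (l * (\<Sum>k=1..j. (X k \<omega>)\<^sup>2) + (\<Sum>k=Suc j..n. u g k * X k \<omega>))) \<partial>P) \<partial>lborel)"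
    proof (intro nn_integral_cong)
      fix g :: real
      have "(\<integral>\<^sup>+\<omega>. ennreal (exp (?R \<omega>)) * (ennreal (std_normal_density g) * ennreal (exp (sqrt (2*l) * X (Suc j) \<omega> * g))) \<partial>P)
        = (\<integral>\<^sup>+\<omega>. ennreal (std_normal_density g) * ennreal (exp (l * (\<Sum>k=1..j. (X k \<omega>)\<^sup>2) + (\<Sum>k=Suc j..n. u g k * X k \<omega>))) \<partial>P)"
      proof (intro nn_integral_cong)
        fix \<omega>
        have "ennreal (exp (l * (\<Sum>k=1..j. (X k \<omega>)\<^sup>2) + (\<Sum>k=Suc j..n. u g k * X k \<omega>))) = ennreal (exp (?R \<omega>)) * ennreal (exp (sqrt (2*l) * X (Suc j) \<omega> * g))"
          unfolding usum by (simp add: exp_add[symmetric] ennreal_mult'[symmetric] algebra_simps)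
        then show "ennreal (exp (?R \<omega>)) * (ennreal (std_normal_density g) * ennreal (exp (sqrt (2*l) * X (Suc j) \<omega> * g)))
          = ennreal (std_normal_density g) * ennreal (exp (l * (\<Sum>k=1..j. (X k \<omega>)\<^sup>2) + (\<Sum>k=Suc j..n. u g k * X k \<omega>)))"
          by (simp only: ac_simps)
      qed
      also have "\<dots> = ennreal (std_normal_density g) * (\<integral>\<^sup>+\<omega>. ennreal (exp (l * (\<Sum>k=1..j. (X k \<omega>)\<^sup>2) + (\<Sum>k=Suc j..n. u g k * X k \<omega>))) \<partial>P)"
        by (rule nn_integral_cmult) measurable
      finally show "(\<integral>\<^sup>+\<omega>. ennreal (exp (?R \<omega>)) * (ennreal (std_normal_density g) * ennreal (exp (sqrt (2*l) * X (Suc j) \<omega> * g))) \<partial>P)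
        = ennreal (std_normal_density g) * (\<integral>\<^sup>+\<omega>. ennreal (exp (l * (\<Sum>k=1..j. (X k \<omega>)\<^sup>2) + (\<Sum>k=Suc j..n. u g k * X k \<omega>))) \<partial>P)" .
    qed
    also have "\<dots> \<le> (\<integral>\<^sup>+g. ennreal (std_normal_density g) * ennreal (?q ^ j * exp ((\<Sum>k=Suc j..n. (u g k)\<^sup>2) / 2)) \<partial>lborel)"
      using Suc.prems by (intro nn_integral_mono mult_left_mono Suc.IH) auto
    also have "\<dots> = (\<integral>\<^sup>+g. ennreal (?q ^ j * exp ((\<Sum>k=Suc (Suc j)..n. (t k)\<^sup>2) / 2)) * (ennreal (std_normal_density g) * ennreal (exp (l * g\<^sup>2))) \<partial>lborel)"
    proof (intro nn_integral_cong)
      fix g :: real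
      have "?q ^ j * exp ((\<Sum>k=Suc j..n. (u g k)\<^sup>2) / 2) = ?q ^ j * exp ((\<Sum>k=Suc (Suc j)..n. (t k)\<^sup>2) / 2) * exp (l * g\<^sup>2)"
        unfolding usq mult.assoc exp_add[symmetric] by (simp add: add_divide_distrib add.commute)
      then show "ennreal (std_normal_density g) * ennreal (?q ^ j * exp ((\<Sum>k=Suc j..n. (u g k)\<^sup>2) / 2))
        = ennreal (?q ^ j * exp ((\<Sum>k=Suc (Suc j)..n. (t k)\<^sup>2) / 2)) * (ennreal (std_normal_density g) * ennreal (exp (l * g\<^sup>2)))"
        using q by (simp only: ennreal_mult'' exp_ge_zero) (simp only: ac_simps)
    qed
    also have "\<dots> = ennreal (?q ^ j * exp ((\<Sum>k=Suc (Suc j)..n. (t k)\<^sup>2) / 2)) * ennreal ?q"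
      unfolding std_normal_square_exp_moment[OF l(2), symmetric] by (rule nn_integral_cmult) simp
    also have "\<dots> = ennreal (?q ^ Suc j * exp ((\<Sum>k=Suc (Suc j)..n. (t k)\<^sup>2) / 2))"
      using q by (subst ennreal_mult''[symmetric]) (auto simp: ac_simps)
    finally show ?case .
  qed
  from this[OF m, of "\<lambda>_. 0"]
  have "(\<integral>\<^sup>+\<omega>. ennreal (exp (l * (\<Sum>k=1..m. (X k \<omega>)\<^sup>2))) \<partial>P) \<le> ennreal (?q ^ m)" by simp
  moreover have "(\<Sum>k=1..m. (X k \<omega>)\<^sup>2) = (\<Sum>k=1..m. (\<xi> k \<omega>)\<^sup>2)" for \<omega>
    using m by (intro sum.cong) (auto simp: X_def)
  ultimately show ?thesis by simp
qed

lemma subgaussian_second_moment: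
  assumes \<xi>: "subgaussian_vector P n \<xi>" and k: "k \<in> {1..n}"
  shows "(\<integral>\<^sup>+\<omega>. ennreal ((\<xi> k \<omega>)\<^sup>2) \<partial>P) \<le> ennreal (4 * exp (1/2))"
proof -
  have [measurable]: "\<xi> k \<in> borel_measurable P" using \<xi> k by (simp add: subgaussian_vector_def)
  have one: "(\<integral>\<^sup>+\<omega>. ennreal (exp (c * \<xi> k \<omega>)) \<partial>P) \<le> ennreal (exp (1/2))" if "c\<^sup>2 = 1" for c :: real
  proof -
    let ?t = "\<lambda>i. if i = k then c else 0"
    have s: "(\<Sum>i=1..n. ?t i * \<xi> i \<omega>) = c * \<xi> k \<omega>" for \<omega>
      using k by (subst sum.remove[of _ k]) (auto intro!: sum.neutral)
    have s2: "(\<Sum>i=1..n. (?t i)\<^sup>2) = 1"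
      using k that by (subst sum.remove[of _ k]) (auto intro!: sum.neutral)
    have "\<And>t. (\<integral>\<^sup>+\<omega>. ennreal (exp (\<Sum>k=1..n. t k * \<xi> k \<omega>)) \<partial>P) \<le> ennreal (exp ((\<Sum>k=1..n. (t k)\<^sup>2) / 2))"
      using \<xi> by (simp add: subgaussian_vector_def)
    from this[of ?t] show ?thesis unfolding s s2 .
  qed
  have x: "x\<^sup>2 \<le> 2 * exp (1 * x) + 2 * exp ((-1) * x)" for x :: real
  proof -
    have "1 + \<bar>x\<bar> + \<bar>x\<bar>\<^sup>2 / 2 \<le> exp \<bar>x\<bar>" by (rule exp_lower_Taylor_quadratic) simp
    then have "x\<^sup>2 \<le> 2 * exp \<bar>x\<bar>" by simp
    also have "\<dots> \<le> 2 * exp (1 * x) + 2 * exp ((-1) * x)" by (cases "0 \<le> x") auto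
    finally show ?thesis .
  qed
  have "(\<integral>\<^sup>+\<omega>. ennreal ((\<xi> k \<omega>)\<^sup>2) \<partial>P) \<le> (\<integral>\<^sup>+\<omega>. ennreal 2 * ennreal (exp (1 * \<xi> k \<omega>)) + ennreal 2 * ennreal (exp ((-1) * \<xi> k \<omega>)) \<partial>P)"
  proof (intro nn_integral_mono)
    fix \<omega>
    have "ennreal ((\<xi> k \<omega>)\<^sup>2) \<le> ennreal (2 * exp (1 * \<xi> k \<omega>) + 2 * exp ((-1) * \<xi> k \<omega>))" by (rule ennreal_leI[OF x])
    also have "\<dots> = ennreal 2 * ennreal (exp (1 * \<xi> k \<omega>)) + ennreal 2 * ennreal (exp ((-1) * \<xi> k \<omega>))"
      by (simp only: ennreal_mult'[symmetric] zero_le_numeral ennreal_plus mult_nonneg_nonneg exp_ge_zero)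
    finally show "ennreal ((\<xi> k \<omega>)\<^sup>2) \<le> ennreal 2 * ennreal (exp (1 * \<xi> k \<omega>)) + ennreal 2 * ennreal (exp ((-1) * \<xi> k \<omega>))" .
  qed
  also have "\<dots> = ennreal 2 * (\<integral>\<^sup>+\<omega>. ennreal (exp (1 * \<xi> k \<omega>)) \<partial>P) + ennreal 2 * (\<integral>\<^sup>+\<omega>. ennreal (exp ((-1) * \<xi> k \<omega>)) \<partial>P)"
    by (subst nn_integral_add) (auto simp: nn_integral_cmult simp del: ennreal_numeral)
  also have "\<dots> \<le> ennreal 2 * ennreal (exp (1/2)) + ennreal 2 * ennreal (exp (1/2))"
    by (intro add_mono mult_left_mono one) auto
  also have "\<dots> = ennreal (4 * exp (1/2))"
    by (simp only: ennreal_mult'[symmetric] zero_le_numeral ennreal_plus[symmetric] mult_nonneg_nonneg exp_ge_zero) simp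
  finally show ?thesis .
qed

text \<open>
  From \<open>l * y \<le> exp (l * y)\<close> and \<open>subgaussian_chi_square\<close> the \<open>m\<close>-th excess has mean at most \<open>r ^ m / l\<close>
  with \<open>r = exp (- l * \<kappa>) / sqrt (1 - 2 * l)\<close>, and for a suitable \<open>l\<close> the ratio \<open>r\<close> is less than one.
  The geometric series bounds the sum over all dimensions by a constant.
\<close>

lemma chi_square_excess:
  assumes "1 < \<kappa>"
  shows "\<exists>C>0. \<forall>(P :: 'w measure) n \<xi>. prob_space P \<and> subgaussian_vector P n \<xi> \<longrightarrow>
    (\<integral>\<^sup>+\<omega>. ennreal (\<Sum>m=1..n. max 0 ((\<Sum>k=1..m. (\<xi> k \<omega>)\<^sup>2) - \<kappa> * real m)) \<partial>P) \<le> ennreal C"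
proof -
  \<comment> \<open>With \<open>1 - 2 * l = 1 / s\<close> and \<open>\<kappa> = s\<^sup>2\<close>, the claim \<open>r < 1\<close> reduces to \<open>s \<le> exp (s - 1)\<close>.\<close>
  define s where "s = sqrt \<kappa>"
  have s: "1 < s" "\<kappa> = s\<^sup>2" using assms by (auto simp: s_def)
  define l where "l = (1 - 1/s) / 2"
  have l: "0 < l" "l < 1/2" "1 - 2*l = 1/s" using s by (auto simp: l_def field_simps)
  define r where "r = sqrt s * exp (- (l * \<kappa>))"
  have lk: "l * \<kappa> = (s * (s - 1)) / 2" using s by (simp add: l_def power2_eq_square field_simps)
  have r0: "0 < r" using s by (simp add: r_def)
  have r1: "r < 1"
  proof -
    have "s \<le> exp (s - 1)" using exp_ge_add_one_self[of "s - 1"] by simp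
    then have "sqrt s \<le> sqrt (exp (s - 1))" by simp
    also have "\<dots> = exp ((s - 1) / 2)"
      by (rule real_sqrt_unique) (simp_all add: power2_eq_square flip: exp_add)
    also have "\<dots> < exp (l * \<kappa>)"
    proof -
      have "1 * (s - 1) < s * (s - 1)" using s by (intro mult_strict_right_mono) auto
      then show ?thesis unfolding lk by simp
    qed
    finally show ?thesis by (simp add: r_def exp_minus field_simps)
  qed
  define C where "C = (1 / l) * (r / (1 - r))"
  have C: "0 < C" using l r0 r1 by (simp add: C_def)
  show ?thesis
  proof (intro exI[of _ C] conjI C allI impI)
    fix P :: "'w measure" and n \<xi>
    assume "prob_space P \<and> subgaussian_vector P n \<xi>"
    then have P: "prob_space P" and \<xi>: "subgaussian_vector P n \<xi>" by auto
    have \<xi>m: "\<xi> k \<in> borel_measurable P" if "k \<in> {1..n}" for k using \<xi> that by (simp add: subgaussian_vector_def)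
    have Sm: "(\<lambda>\<omega>. \<Sum>k=1..m. (\<xi> k \<omega>)\<^sup>2) \<in> borel_measurable P" if "m \<le> n" for m
      using that by (intro borel_measurable_sum borel_measurable_power \<xi>m) auto
    have one: "(\<integral>\<^sup>+\<omega>. ennreal (max 0 ((\<Sum>k=1..m. (\<xi> k \<omega>)\<^sup>2) - \<kappa> * real m)) \<partial>P) \<le> ennreal ((1 / l) * r ^ m)" if m: "m \<le> n" for m
    proof -
      have "(\<integral>\<^sup>+\<omega>. ennreal (max 0 ((\<Sum>k=1..m. (\<xi> k \<omega>)\<^sup>2) - \<kappa> * real m)) \<partial>P)
        \<le> (\<integral>\<^sup>+\<omega>. ennreal ((1 / l) * exp (- (l * \<kappa>)) ^ m) * ennreal (exp (l * (\<Sum>k=1..m. (\<xi> k \<omega>)\<^sup>2))) \<partial>P)"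
      proof (intro nn_integral_mono)
        fix \<omega>
        let ?x = "(\<Sum>k=1..m. (\<xi> k \<omega>)\<^sup>2) - \<kappa> * real m"
        have "l * ?x \<le> exp (l * ?x)" using exp_ge_add_one_self[of "l * ?x"] by linarith
        then have "?x \<le> (1 / l) * exp (l * ?x)" using l by (simp add: field_simps)
        then have "max 0 ?x \<le> (1 / l) * exp (l * ?x)" using l by simp
        also have "exp (l * ?x) = exp (- (l * \<kappa>)) ^ m * exp (l * (\<Sum>k=1..m. (\<xi> k \<omega>)\<^sup>2))"
          by (simp add: algebra_simps flip: exp_of_nat_mult exp_add)
        finally have "max 0 ?x \<le> ((1 / l) * exp (- (l * \<kappa>)) ^ m) * exp (l * (\<Sum>k=1..m. (\<xi> k \<omega>)\<^sup>2))" by (simp only: mult.assoc)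
        then have "ennreal (max 0 ?x) \<le> ennreal (((1 / l) * exp (- (l * \<kappa>)) ^ m) * exp (l * (\<Sum>k=1..m. (\<xi> k \<omega>)\<^sup>2)))" by (rule ennreal_leI)
        also have "\<dots> = ennreal ((1 / l) * exp (- (l * \<kappa>)) ^ m) * ennreal (exp (l * (\<Sum>k=1..m. (\<xi> k \<omega>)\<^sup>2)))"
          by (rule ennreal_mult'') simp
        finally show "ennreal (max 0 ?x) \<le> ennreal ((1 / l) * exp (- (l * \<kappa>)) ^ m) * ennreal (exp (l * (\<Sum>k=1..m. (\<xi> k \<omega>)\<^sup>2)))" .
      qed
      also have "\<dots> = ennreal ((1 / l) * exp (- (l * \<kappa>)) ^ m) * (\<integral>\<^sup>+\<omega>. ennreal (exp (l * (\<Sum>k=1..m. (\<xi> k \<omega>)\<^sup>2))) \<partial>P)"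
        using Sm[OF m] by (intro nn_integral_cmult) simp
      also have "\<dots> \<le> ennreal ((1 / l) * exp (- (l * \<kappa>)) ^ m) * ennreal ((1 / sqrt (1 - 2*l)) ^ m)"
        using l by (intro mult_left_mono subgaussian_chi_square[OF P \<xi> _ _ m]) auto
      also have "\<dots> = ennreal ((1 / l) * r ^ m)"
      proof -
        have "1 / sqrt (1 - 2*l) = sqrt s" unfolding l(3) using s by (simp add: real_sqrt_divide)
        then show ?thesis using l s by (subst ennreal_mult'[symmetric]) (auto simp: r_def power_mult_distrib)
      qed
      finally show ?thesis .
    qed
    have "(\<integral>\<^sup>+\<omega>. ennreal (\<Sum>m=1..n. max 0 ((\<Sum>k=1..m. (\<xi> k \<omega>)\<^sup>2) - \<kappa> * real m)) \<partial>P)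
      = (\<Sum>m=1..n. (\<integral>\<^sup>+\<omega>. ennreal (max 0 ((\<Sum>k=1..m. (\<xi> k \<omega>)\<^sup>2) - \<kappa> * real m)) \<partial>P))"
      using Sm by (subst sum_ennreal[symmetric], simp) (intro nn_integral_sum measurable_compose[OF _ measurable_ennreal] borel_measurable_max borel_measurable_const borel_measurable_diff, auto)
    also have "\<dots> \<le> (\<Sum>m=1..n. ennreal ((1 / l) * r ^ m))" by (intro sum_mono one) auto
    also have "\<dots> = ennreal ((1 / l) * (\<Sum>m=1..n. r ^ m))"
      using l r0 by (subst sum_ennreal) (auto simp: sum_distrib_left)
    also have "\<dots> \<le> ennreal C"
    proof (rule ennreal_leI)
      have "(\<Sum>m=1..n. r ^ m) = r * (\<Sum>m<n. r ^ m)"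
        by (simp add: sum_distrib_left sum.atLeast1_atMost_eq)
      also have "(\<Sum>m<n. r ^ m) = (1 - r ^ n) / (1 - r)" using r1 by (subst sum_gp_strict) auto
      also have "r * ((1 - r ^ n) / (1 - r)) \<le> r / (1 - r)" using r0 r1 by (simp add: divide_right_mono)
      finally show "(1 / l) * (\<Sum>m=1..n. r ^ m) \<le> C" unfolding C_def using l by (intro mult_left_mono) auto
    qed
    finally show "(\<integral>\<^sup>+\<omega>. ennreal (\<Sum>m=1..n. max 0 ((\<Sum>k=1..m. (\<xi> k \<omega>)\<^sup>2) - \<kappa> * real m)) \<partial>P) \<le> ennreal C" .
  qed
qed

section \<open>Penalised selection in a sequence model\<close>

text \<open>
  Here \<open>b m\<close> is the bias in dimension \<open>m\<close>, \<open>x\<close> the noise, and \<open>m'\<close> a dimension that the penalised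
  criterion prefers to \<open>m\<close>.  If \<open>m \<le> m'\<close>, the additional penalty is at most the energy of the
  observations between \<open>m\<close> and \<open>m'\<close>: signal there is bounded by \<open>b m\<close>, and noise is, up to \<open>\<Delta>\<close>, a
  fraction of the penalty less than one, so that \<open>m'\<close> itself is controlled.  If \<open>m' < m\<close>, the
  signal lost between \<open>m'\<close> and \<open>m\<close> is bounded by twice the penalty that is saved plus twice the
  noise up to \<open>m\<close>.
\<close>

lemma sequence_oracle_inequality:
  fixes d x b :: "nat \<Rightarrow> real" and c \<kappa> \<alpha> \<Delta> N energy :: real and M m m' :: nat
  assumes N: "0 < N" and \<alpha>: "0 < \<alpha>" and \<kappa>: "1 < \<kappa>" and c: "(1 + \<alpha>) * \<kappa> < c" and \<Delta>: "0 \<le> \<Delta>"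
    and b: "\<And>m. m \<in> {1..M} \<Longrightarrow> 0 \<le> b m" "\<And>m. b m = energy - (\<Sum>k=1..m. (d k)\<^sup>2)"
    and excess: "\<And>m. m \<in> {1..M} \<Longrightarrow> (\<Sum>k=1..m. (x k)\<^sup>2) \<le> \<kappa> * real m + \<Delta>"
    and mm: "m \<in> {1..M}" "m' \<in> {1..M}"
    and opt: "- (\<Sum>k=1..m'. (d k + x k / sqrt N)\<^sup>2) + c * real m' / N \<le> - (\<Sum>k=1..m. (d k + x k / sqrt N)\<^sup>2) + c * real m / N"
  shows "b m' + (\<Sum>k=1..m'. (x k)\<^sup>2) / N
    \<le> (3 + 2*c + 2*\<kappa> + \<kappa> / (c - (1 + \<alpha>) * \<kappa>) * (c + 2 + 1/\<alpha> + \<alpha>)) * (b m + real m / N + \<Delta> / N)"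
proof -
  define S where "S m = (\<Sum>k=1..m. (x k)\<^sup>2)" for m
  define D where "D m = (\<Sum>k=1..m. (d k)\<^sup>2)" for m
  define Z where "Z m = (\<Sum>k=1..m. (d k + x k / sqrt N)\<^sup>2)" for m
  \<comment> \<open>The part of the penalty per dimension that noise cannot compensate.\<close>
  define \<delta> where "\<delta> = c - (1 + \<alpha>) * \<kappa>"
  have \<delta>: "0 < \<delta>" using c by (simp add: \<delta>_def)
  have c0: "0 < c" using c \<alpha> \<kappa> by (smt (verit) mult_pos_pos)
  have diff: "(\<Sum>k=1..q. f k) - (\<Sum>k=1..p. f k) = (\<Sum>k\<in>{p<..q}. f k)" if "p \<le> q" for p q and f :: "nat \<Rightarrow> real"
  proof -
    have "{1..q} = {1..p} \<union> {p<..q}" using that by auto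
    then have "(\<Sum>k=1..q. f k) = (\<Sum>k=1..p. f k) + (\<Sum>k\<in>{p<..q}. f k)" by (simp add: sum.union_disjoint ivl_disj_int)
    then show ?thesis by simp
  qed
  have young: "(u + v)\<^sup>2 \<le> (1 + 1/e) * u\<^sup>2 + (1 + e) * v\<^sup>2" if "0 < e" for u v e :: real
  proof -
    have "0 \<le> (u / sqrt e - sqrt e * v)\<^sup>2" by simp
    moreover have "(u / sqrt e - sqrt e * v)\<^sup>2 = u\<^sup>2 / e + e * v\<^sup>2 - 2 * (u * v)"
      using that by (simp add: power2_diff power_divide power_mult_distrib)
    ultimately show ?thesis by (simp add: power2_sum distrib_right)
  qed
  have pos: "0 \<le> b m" "0 \<le> real m / N" "0 \<le> \<Delta> / N" using b(1) mm N \<Delta> by auto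
  let ?E = "\<kappa> / \<delta> * (c + 2 + 1/\<alpha> + \<alpha>)"
  have E0: "0 \<le> ?E" using \<kappa> \<delta> c0 \<alpha> by simp
  have "b m' + S m' / N \<le> (3 + 2*c + 2*\<kappa> + ?E) * (b m + real m / N + \<Delta> / N)"
  proof (cases "m \<le> m'")
    case True
    have Dd: "D m' - D m \<le> b m" using b(1)[OF mm(2)] b(2)[of m] b(2)[of m'] by (simp add: D_def)
    have D0: "0 \<le> D m' - D m" unfolding D_def diff[OF True] by (intro sum_nonneg) auto
    have "Z m' - Z m \<le> (\<Sum>k\<in>{m<..m'}. (1 + 1/\<alpha>) * (d k)\<^sup>2 + (1 + \<alpha>) * (x k / sqrt N)\<^sup>2)"
      unfolding Z_def diff[OF True] by (intro sum_mono young \<alpha>)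
    also have "\<dots> = (1 + 1/\<alpha>) * (D m' - D m) + (1 + \<alpha>) * ((S m' - S m) / N)"
      unfolding D_def S_def diff[OF True] using N by (simp add: sum.distrib sum_distrib_left power_divide sum_divide_distrib)
    also have "\<dots> \<le> (1 + 1/\<alpha>) * b m + (1 + \<alpha>) * (S m' / N)"
      using \<alpha> Dd N by (intro add_mono mult_left_mono divide_right_mono) (auto simp: S_def sum_nonneg)
    also have "\<dots> \<le> (1 + 1/\<alpha>) * b m + (1 + \<alpha>) * ((\<kappa> * real m' + \<Delta>) / N)"
      using excess[OF mm(2)] \<alpha> N by (intro add_mono mult_left_mono divide_right_mono) (auto simp: S_def)
    finally have "c * real m' / N - c * real m / N \<le> (1 + 1/\<alpha>) * b m + (1 + \<alpha>) * ((\<kappa> * real m' + \<Delta>) / N)"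
      using opt by (simp add: Z_def)
    then have "\<delta> * (real m' / N) \<le> c * (real m / N) + (1 + 1/\<alpha>) * b m + (1 + \<alpha>) * (\<Delta> / N)"
      by (simp add: \<delta>_def algebra_simps add_divide_distrib)
    also have "\<dots> \<le> (c + 2 + 1/\<alpha> + \<alpha>) * (real m / N) + (c + 2 + 1/\<alpha> + \<alpha>) * b m + (c + 2 + 1/\<alpha> + \<alpha>) * (\<Delta> / N)"
    proof -
      have "0 < 1 / \<alpha>" using \<alpha> by simp
      then have "c \<le> c + 2 + 1/\<alpha> + \<alpha>" "1 + 1/\<alpha> \<le> c + 2 + 1/\<alpha> + \<alpha>" "1 + \<alpha> \<le> c + 2 + 1/\<alpha> + \<alpha>"
        using \<alpha> c0 by linarith+
      from mult_right_mono[OF this(1) pos(2)] mult_right_mono[OF this(2) pos(1)] mult_right_mono[OF this(3) pos(3)]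
      show ?thesis by linarith
    qed
    also have "\<dots> = (c + 2 + 1/\<alpha> + \<alpha>) * (b m + real m / N + \<Delta> / N)" by (simp add: distrib_left)
    finally have m': "real m' / N \<le> (c + 2 + 1/\<alpha> + \<alpha>) * (b m + real m / N + \<Delta> / N) / \<delta>"
      using \<delta> by (simp add: field_simps)
    have "b m' \<le> b m" using D0 b(2)[of m] b(2)[of m'] by (simp add: D_def)
    moreover have "S m' / N \<le> (\<kappa> * real m' + \<Delta>) / N"
      using excess[OF mm(2)] N by (intro divide_right_mono) (auto simp: S_def)
    then have "S m' / N \<le> \<kappa> * (real m' / N) + \<Delta> / N" by (simp add: add_divide_distrib)
    moreover have "\<kappa> * (real m' / N) \<le> \<kappa> * ((c + 2 + 1/\<alpha> + \<alpha>) * (b m + real m / N + \<Delta> / N) / \<delta>)"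
      using \<kappa> m' by (intro mult_left_mono) auto
    ultimately have "b m' + S m' / N \<le> b m + \<Delta> / N + ?E * (b m + real m / N + \<Delta> / N)" by simp
    also have "\<dots> \<le> (3 + 2*c + 2*\<kappa>) * (b m + real m / N + \<Delta> / N) + ?E * (b m + real m / N + \<Delta> / N)"
    proof (intro add_right_mono)
      have "b m + \<Delta> / N \<le> 1 * (b m + real m / N + \<Delta> / N)" using pos by simp
      also have "\<dots> \<le> (3 + 2*c + 2*\<kappa>) * (b m + real m / N + \<Delta> / N)" using pos c0 \<kappa> by (intro mult_right_mono) auto
      finally show "b m + \<Delta> / N \<le> (3 + 2*c + 2*\<kappa>) * (b m + real m / N + \<Delta> / N)" .
    qed
    also have "\<dots> = (3 + 2*c + 2*\<kappa> + ?E) * (b m + real m / N + \<Delta> / N)" by (simp only: distrib_right)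
    finally show ?thesis .
  next
    case False
    then have le: "m' \<le> m" by simp
    have "D m - D m' = (\<Sum>k\<in>{m'<..m}. ((d k + x k / sqrt N) + (- (x k / sqrt N)))\<^sup>2)" unfolding D_def diff[OF le] by simp
    also have "\<dots> \<le> (\<Sum>k\<in>{m'<..m}. (1 + 1/1) * (d k + x k / sqrt N)\<^sup>2 + (1 + 1) * (- (x k / sqrt N))\<^sup>2)"
      by (intro sum_mono young) simp
    also have "\<dots> = 2 * (Z m - Z m') + 2 * ((S m - S m') / N)"
      unfolding Z_def S_def diff[OF le] using N by (simp add: sum.distrib sum_distrib_left power_divide sum_divide_distrib)
    also have "Z m - Z m' \<le> c * real m / N - c * real m' / N" using opt by (simp add: Z_def)
    also have "\<dots> \<le> c * (real m / N)" using c0 N by simp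
    finally have "D m - D m' \<le> 2 * (c * (real m / N)) + 2 * ((S m - S m') / N)" by simp
    moreover have "b m' = b m + (D m - D m')" using b(2)[of m] b(2)[of m'] by (simp add: D_def)
    moreover have "S m / N \<le> (\<kappa> * real m + \<Delta>) / N"
      using excess[OF mm(1)] N by (intro divide_right_mono) (auto simp: S_def)
    moreover have "0 \<le> S m' / N" using N by (simp add: S_def sum_nonneg)
    ultimately have "b m' + S m' / N \<le> b m + (2*c + 2*\<kappa>) * (real m / N) + 2 * (\<Delta> / N)"
      by (simp add: diff_divide_distrib add_divide_distrib distrib_right)
    also have "\<dots> \<le> (3 + 2*c + 2*\<kappa> + ?E) * b m + (3 + 2*c + 2*\<kappa> + ?E) * (real m / N) + (3 + 2*c + 2*\<kappa> + ?E) * (\<Delta> / N)"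
    proof -
      have "1 \<le> 3 + 2*c + 2*\<kappa> + ?E" "2*c + 2*\<kappa> \<le> 3 + 2*c + 2*\<kappa> + ?E" "2 \<le> 3 + 2*c + 2*\<kappa> + ?E"
        using c0 \<kappa> E0 by linarith+
      from mult_right_mono[OF this(1) pos(1)] mult_right_mono[OF this(2) pos(2)] mult_right_mono[OF this(3) pos(3)]
      show ?thesis by linarith
    qed
    finally show ?thesis by (simp only: distrib_left)
  qed
  then show ?thesis by (simp add: S_def \<delta>_def)
qed

section \<open>Orthonormal bases of the approximation spaces\<close>

lemma span_upto_memI: "(\<lambda>t. \<Sum>j=1..m. a j * \<phi> j t) \<in> span_upto \<phi> m"
  unfolding span_upto_def by blast

lemma span_upto_lincomb:
  assumes "g \<in> span_upto \<phi> m" "h \<in> span_upto \<phi> m"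
  shows "(\<lambda>t. u * g t + v * h t) \<in> span_upto \<phi> m"
proof -
  obtain a b where ab: "g = (\<lambda>t. \<Sum>j=1..m. a j * \<phi> j t)" "h = (\<lambda>t. \<Sum>j=1..m. b j * \<phi> j t)"
    using assms unfolding span_upto_def by blast
  have "(\<lambda>t. u * g t + v * h t) = (\<lambda>t. \<Sum>j=1..m. (u * a j + v * b j) * \<phi> j t)"
    unfolding ab by (auto simp: sum_distrib_left sum.distrib[symmetric] algebra_simps intro!: sum.cong)
  then show ?thesis using span_upto_memI[where a="\<lambda>j. u * a j + v * b j"] by simp
qed

lemma span_upto_SucI:
  assumes "g \<in> span_upto \<phi> m"
  shows "(\<lambda>t. g t + c * \<phi> (Suc m) t) \<in> span_upto \<phi> (Suc m)"
proof -
  obtain a where g: "g = (\<lambda>t. \<Sum>j=1..m. a j * \<phi> j t)" using assms unfolding span_upto_def by auto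
  define a' where "a' = a(Suc m := c)"
  have "(\<Sum>j=1..m. a j * \<phi> j t) = (\<Sum>j=1..m. a' j * \<phi> j t)" for t
    by (intro sum.cong) (auto simp: a'_def)
  then have "(\<lambda>t. g t + c * \<phi> (Suc m) t) = (\<lambda>t. \<Sum>j=1..Suc m. a' j * \<phi> j t)" unfolding g by (simp add: a'_def)
  then show ?thesis by (simp only: span_upto_memI)
qed

lemma span_upto_SucE:
  assumes "f \<in> span_upto \<phi> (Suc m)"
  shows "\<exists>g c. g \<in> span_upto \<phi> m \<and> f = (\<lambda>t. g t + c * \<phi> (Suc m) t)"
proof -
  obtain a where "f = (\<lambda>t. \<Sum>j=1..Suc m. a j * \<phi> j t)" using assms unfolding span_upto_def by auto
  then have "f = (\<lambda>t. (\<Sum>j=1..m. a j * \<phi> j t) + a (Suc m) * \<phi> (Suc m) t)" by simp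
  then show ?thesis by (intro exI[of _ "\<lambda>t. \<Sum>j=1..m. a j * \<phi> j t"] exI[of _ "a (Suc m)"] conjI span_upto_memI)
qed

lemma span_upto_cong:
  assumes "\<And>k. k \<in> {1..m} \<Longrightarrow> f k = g k"
  shows "span_upto f m = span_upto g m"
proof -
  have "(\<Sum>j=1..m. a j * f j t) = (\<Sum>j=1..m. a j * g j t)" for a t using assms by (intro sum.cong) auto
  then show ?thesis unfolding span_upto_def by simp
qed

lemma span_upto_mono:
  assumes "m \<le> n"
  shows "span_upto \<phi> m \<subseteq> span_upto \<phi> n"
  using assms
proof (induction n rule: dec_induct)
  case (step n)
  have "g \<in> span_upto \<phi> (Suc n)" if "g \<in> span_upto \<phi> n" for g
    using span_upto_SucI[OF that, of 0] by simp
  then show ?case using step.IH by blast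
qed simp

lemma span_upto_L2:
  fixes \<phi> :: "nat \<Rightarrow> real \<Rightarrow> real"
  assumes \<phi>: "\<And>j. j \<in> {1..n} \<Longrightarrow> \<phi> j \<in> borel_measurable M" "\<And>j. j \<in> {1..n} \<Longrightarrow> integrable M (\<lambda>x. (\<phi> j x)\<^sup>2)"
    and m: "m \<le> n" "g \<in> span_upto \<phi> m"
  shows "g \<in> borel_measurable M" "integrable M (\<lambda>x. (g x)\<^sup>2)"
proof -
  obtain a where g: "g = (\<lambda>t. \<Sum>j=1..m. a j * \<phi> j t)" using m(2) unfolding span_upto_def by blast
  show "g \<in> borel_measurable M" unfolding g using \<phi>(1) m(1) by (intro borel_measurable_sum borel_measurable_times) auto
  have sq: "(g x)\<^sup>2 = (\<Sum>i=1..m. \<Sum>j=1..m. a i * a j * (\<phi> i x * \<phi> j x))" for x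
    unfolding g by (simp add: power2_eq_square sum_product ac_simps)
  show "integrable M (\<lambda>x. (g x)\<^sup>2)"
    unfolding sq using \<phi> m(1)
    by (intro Bochner_Integration.integrable_sum integrable_mult_right integrable_mult_of_sq) auto
qed

text \<open>
  Linear independence is stated as a positive distance from the span of the predecessors, since
  functions that agree almost everywhere are not identified.
\<close>

lemma gram_schmidt_L2:
  fixes \<phi> :: "nat \<Rightarrow> real \<Rightarrow> real"
  assumes \<phi>: "\<And>j. j \<in> {1..n} \<Longrightarrow> \<phi> j \<in> borel_measurable M" "\<And>j. j \<in> {1..n} \<Longrightarrow> integrable M (\<lambda>x. (\<phi> j x)\<^sup>2)"
    and indep: "\<And>m g. m < n \<Longrightarrow> g \<in> span_upto \<phi> m \<Longrightarrow> (\<integral>x. (\<phi> (Suc m) x - g x)\<^sup>2 \<partial>M) \<noteq> 0"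
  shows "\<exists>e. (\<forall>m\<le>n. span_upto e m = span_upto \<phi> m) \<and>
    (\<forall>i\<in>{1..n}. \<forall>j\<in>{1..n}. (\<integral>x. e i x * e j x \<partial>M) = (if i = j then 1 else 0))"
  using assms
proof (induction n)
  case 0
  show ?case by (intro exI[of _ \<phi>]) auto
next
  case (Suc n)
  have "\<exists>e. (\<forall>m\<le>n. span_upto e m = span_upto \<phi> m) \<and>
    (\<forall>i\<in>{1..n}. \<forall>j\<in>{1..n}. (\<integral>x. e i x * e j x \<partial>M) = (if i = j then 1 else 0))"
    by (rule Suc.IH) (use Suc.prems in auto)
  then obtain e where e: "\<And>m. m \<le> n \<Longrightarrow> span_upto e m = span_upto \<phi> m"
    and orth: "\<And>i j. i \<in> {1..n} \<Longrightarrow> j \<in> {1..n} \<Longrightarrow> (\<integral>x. e i x * e j x \<partial>M) = (if i = j then 1 else 0)" by blast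
  have ein: "e k \<in> span_upto \<phi> n" if "k \<in> {1..n}" for k
  proof -
    have "(\<Sum>j=1..n. (if j = k then 1 else 0) * e j t) = e k t" for t
      using that by (subst sum.remove[of _ k]) (auto intro!: sum.neutral)
    then have "e k = (\<lambda>t. \<Sum>j=1..n. (if j = k then 1 else 0) * e j t)" by simp
    also have "\<dots> \<in> span_upto e n" by (rule span_upto_memI)
    finally show ?thesis using e[of n] by simp
  qed
  have em: "e k \<in> borel_measurable M" "integrable M (\<lambda>x. (e k x)\<^sup>2)" if "k \<in> {1..n}" for k
    using span_upto_L2[where n="Suc n" and m=n, OF Suc.prems(1,2) _ ein[OF that]] by auto
  let ?f = "\<phi> (Suc n)"
  have fm: "?f \<in> borel_measurable M" "integrable M (\<lambda>x. (?f x)\<^sup>2)" using Suc.prems by auto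
  define p where "p = (\<lambda>x. \<Sum>j=1..n. (\<integral>y. ?f y * e j y \<partial>M) * e j x)"
  have pS: "p \<in> span_upto \<phi> n" unfolding p_def unfolding e[OF order_refl, symmetric] by (rule span_upto_memI)
  have pm: "p \<in> borel_measurable M" "integrable M (\<lambda>x. (p x)\<^sup>2)"
    using span_upto_L2[where n="Suc n" and m=n, OF Suc.prems(1,2) _ pS] by auto
  define \<psi> where "\<psi> = (\<lambda>x. ?f x - p x)"
  define s where "s = sqrt (\<integral>x. (\<psi> x)\<^sup>2 \<partial>M)"
  have "(\<integral>x. (\<psi> x)\<^sup>2 \<partial>M) \<noteq> 0" unfolding \<psi>_def by (rule Suc.prems(3)[OF _ pS]) simp
  moreover have "0 \<le> (\<integral>x. (\<psi> x)\<^sup>2 \<partial>M)" by simp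
  ultimately have s: "0 < s" "s\<^sup>2 = (\<integral>x. (\<psi> x)\<^sup>2 \<partial>M)" unfolding s_def by (auto simp: less_le)
  have \<psi>e: "(\<integral>x. \<psi> x * e i x \<partial>M) = 0" if i: "i \<in> {1..n}" for i
  proof -
    have fe: "integrable M (\<lambda>x. ?f x * e i x)" using fm em[OF i] by (intro integrable_mult_of_sq)
    have ee: "integrable M (\<lambda>x. c * (e j x * e i x))" if "j \<in> {1..n}" for j c
      using em[OF i] em[OF that] by (intro integrable_mult_right integrable_mult_of_sq)
    have pe: "p x * e i x = (\<Sum>j=1..n. (\<integral>y. ?f y * e j y \<partial>M) * (e j x * e i x))" for x
      unfolding p_def sum_distrib_right by (simp add: mult.assoc)
    have "(\<integral>x. p x * e i x \<partial>M) = (\<Sum>j=1..n. (\<integral>y. ?f y * e j y \<partial>M) * (\<integral>x. e j x * e i x \<partial>M))"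
      unfolding pe using ee by (subst Bochner_Integration.integral_sum) auto
    also have "\<dots> = (\<Sum>j=1..n. (\<integral>y. ?f y * e j y \<partial>M) * (if j = i then 1 else 0))"
      using orth i by (intro sum.cong) auto
    also have "\<dots> = (\<integral>y. ?f y * e i y \<partial>M)" using i by (subst sum.remove[of _ i]) (auto intro!: sum.neutral)
    finally have "(\<integral>x. p x * e i x \<partial>M) = (\<integral>y. ?f y * e i y \<partial>M)" .
    moreover have "integrable M (\<lambda>x. p x * e i x)" using pm em[OF i] by (intro integrable_mult_of_sq)
    ultimately show ?thesis unfolding \<psi>_def left_diff_distrib using fe by simp
  qed
  define e' where "e' = e(Suc n := (\<lambda>x. \<psi> x / s))"
  have e'old: "e' k = e k" if "k \<in> {1..n}" for k using that by (auto simp: e'_def)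
  have spans: "span_upto e' m = span_upto \<phi> m" if "m \<le> Suc n" for m
  proof (cases "m = Suc n")
    case False
    then have "span_upto e' m = span_upto e m" using that e'old by (intro span_upto_cong) auto
    then show ?thesis using e[of m] that False by simp
  next
    case True
    have en: "span_upto e' n = span_upto \<phi> n" using span_upto_cong[of n e' e] e'old e[of n] by simp
    have "span_upto e' (Suc n) = span_upto \<phi> (Suc n)"
    proof (intro equalityI subsetI)
      fix f assume "f \<in> span_upto e' (Suc n)"
      then obtain g c where f: "f = (\<lambda>t. g t + c * e' (Suc n) t)" and g: "g \<in> span_upto \<phi> n"
        using span_upto_SucE[of f e' n] en by auto
      have "f = (\<lambda>t. (1 * g t + (- (c / s)) * p t) + (c / s) * ?f t)"
        unfolding f by (auto simp: e'_def \<psi>_def diff_divide_distrib algebra_simps)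
      then show "f \<in> span_upto \<phi> (Suc n)" using span_upto_SucI[OF span_upto_lincomb[OF g pS, of 1 "- (c / s)"], of "c / s"] by (simp only:)
    next
      fix f assume "f \<in> span_upto \<phi> (Suc n)"
      then obtain g c where f: "f = (\<lambda>t. g t + c * ?f t)" and g: "g \<in> span_upto \<phi> n"
        using span_upto_SucE[of f \<phi> n] by auto
      have cs: "c * s * (x / s) = c * x" for x using s(1) by simp
      have "f = (\<lambda>t. (1 * g t + c * p t) + (c * s) * e' (Suc n) t)"
        unfolding f e'_def fun_upd_same cs by (simp add: \<psi>_def algebra_simps)
      then show "f \<in> span_upto e' (Suc n)"
        using span_upto_SucI[of "\<lambda>t. 1 * g t + c * p t" e' n "c * s"] span_upto_lincomb[OF g pS, of 1 c] en by (simp only:)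
    qed
    then show ?thesis using True by simp
  qed
  have "(\<integral>x. e' i x * e' j x \<partial>M) = (if i = j then 1 else 0)" if ij: "i \<in> {1..Suc n}" "j \<in> {1..Suc n}" for i j
  proof -
    have new: "(\<integral>x. e k x * (\<psi> x / s) \<partial>M) = 0" "(\<integral>x. \<psi> x / s * e k x \<partial>M) = 0" if "k \<in> {1..n}" for k
    proof -
      have "(\<integral>x. \<psi> x / s * e k x \<partial>M) = (\<integral>x. (1 / s) * (\<psi> x * e k x) \<partial>M)" by simp
      also have "\<dots> = 0" using \<psi>e[OF that] by (simp only: integral_mult_right_zero mult_zero_right)
      finally show 1: "(\<integral>x. \<psi> x / s * e k x \<partial>M) = 0" .
      then show "(\<integral>x. e k x * (\<psi> x / s) \<partial>M) = 0" by (simp only: mult.commute)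
    qed
    have nn: "(\<integral>x. \<psi> x / s * (\<psi> x / s) \<partial>M) = 1"
    proof -
      have "(\<integral>x. \<psi> x / s * (\<psi> x / s) \<partial>M) = (\<integral>x. (1 / s\<^sup>2) * (\<psi> x)\<^sup>2 \<partial>M)" by (simp add: power2_eq_square)
      also have "\<dots> = 1" using s(1) by (simp only: integral_mult_right_zero s(2)[symmetric]) simp
      finally show ?thesis .
    qed
    show ?thesis
    proof (cases "i = Suc n")
      case i: True
      show ?thesis
      proof (cases "j = Suc n")
        case True
        then show ?thesis unfolding i True e'_def fun_upd_same using nn by (simp only: if_True refl)
      next
        case False
        then have "j \<in> {1..n}" using ij by auto
        then show ?thesis using i False new(2)[of j] e'old[of j] by (simp add: e'_def)
      qed
    next
      case i: False
      then have i': "i \<in> {1..n}" using ij by auto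
      show ?thesis
      proof (cases "j = Suc n")
        case True
        then show ?thesis using i i' new(1)[of i] e'old[of i] by (simp add: e'_def)
      next
        case False
        then have "j \<in> {1..n}" using ij by auto
        then show ?thesis using i' orth e'old by simp
      qed
    qed
  qed
  then show ?case using spans by blast
qed

section \<open>The noise of the sample\<close>

lemma L2_norm_sq_sum_tendsto_0:
  fixes X :: "nat \<Rightarrow> 'b \<Rightarrow> 'a \<Rightarrow> real"
  assumes "finite A" "\<And>n i. i \<in> A \<Longrightarrow> X n i \<in> borel_measurable P"
    and "\<And>i. i \<in> A \<Longrightarrow> (\<lambda>n. L2_norm_sq P (X n i)) \<longlonglongrightarrow> 0"
  shows "(\<lambda>n. L2_norm_sq P (\<lambda>\<omega>. \<Sum>i\<in>A. X n i \<omega>)) \<longlonglongrightarrow> 0"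
  using assms
proof (induction A rule: finite_induct)
  case empty
  show ?case by (simp add: L2_norm_sq_def)
next
  case (insert i A)
  have IH: "(\<lambda>n. L2_norm_sq P (\<lambda>\<omega>. \<Sum>i\<in>A. X n i \<omega>)) \<longlonglongrightarrow> 0" using insert by auto
  have "(\<lambda>n. 2 * (L2_norm_sq P (X n i) + L2_norm_sq P (\<lambda>\<omega>. \<Sum>i\<in>A. X n i \<omega>))) \<longlonglongrightarrow> 2 * (0 + 0)"
    using insert.prems(2)[of i] by (intro ennreal_tendsto_cmult tendsto_add IH) auto
  then have lim: "(\<lambda>n. 2 * (L2_norm_sq P (X n i) + L2_norm_sq P (\<lambda>\<omega>. \<Sum>i\<in>A. X n i \<omega>))) \<longlonglongrightarrow> 0" by simp
  have le: "L2_norm_sq P (\<lambda>\<omega>. \<Sum>j\<in>insert i A. X n j \<omega>) \<le> 2 * (L2_norm_sq P (X n i) + L2_norm_sq P (\<lambda>\<omega>. \<Sum>i\<in>A. X n i \<omega>))" for n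
    unfolding sum.insert[OF insert.hyps] using insert.prems(1) by (intro L2_norm_sq_add_le borel_measurable_sum) auto
  show ?case
    by (rule tendsto_sandwich[OF always_eventually always_eventually tendsto_const lim], rule allI, rule zero_le, rule allI, rule le)
qed

context hurst
begin

lemma finite_measure_bracket: "finite_measure (bracket H T)"
proof (rule finite_measureI)
  have "emeasure (bracket H T) (space (bracket H T)) = (\<integral>\<^sup>+s. 1 \<partial>bracket H T)" by simp
  also have "\<dots> = (\<integral>\<^sup>+s. ennreal ((2 - 2*H) * s powr (1 - 2*H)) * 1 \<partial>lebesgue_Icc T)"
    by (rule nn_integral_bracket) simp
  also have "\<dots> = (\<integral>\<^sup>+s. ennreal (2 - 2*H) * (ennreal ((s - 0) powr ((2 - 2*H) - 1)) * indicator {0..T} s) \<partial>lborel)"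
    unfolding nn_integral_lebesgue_Icc using H by (intro nn_integral_cong) (auto simp: ennreal_mult' mult.assoc)
  also have "\<dots> = ennreal (2 - 2*H) * ennreal ((T - 0) powr (2 - 2*H) / (2 - 2*H))"
    using nn_integral_powr_right[of "2 - 2*H" 0 T] H T by (subst nn_integral_cmult) simp_all
  finally show "emeasure (bracket H T) (space (bracket H T)) \<noteq> \<infinity>" by (simp add: ennreal_mult_eq_top_iff)
qed

lemma bounded_L2_bracket:
  fixes f :: "real \<Rightarrow> real"
  assumes "f \<in> borel_measurable (lebesgue_Icc T)" "\<And>s. s \<in> {0..T} \<Longrightarrow> \<bar>f s\<bar> \<le> C"
  shows "f \<in> borel_measurable (bracket H T)" "integrable (bracket H T) (\<lambda>s. (f s)\<^sup>2)"
proof -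
  interpret finite_measure "bracket H T" by (rule finite_measure_bracket)
  show m: "f \<in> borel_measurable (bracket H T)" using assms(1) by (simp add: bracket_def)
  show "integrable (bracket H T) (\<lambda>s. (f s)\<^sup>2)"
  proof (rule integrable_const_bound[of _ "C\<^sup>2"])
    show "AE s in bracket H T. norm ((f s)\<^sup>2) \<le> C\<^sup>2"
    proof (rule AE_I2)
      fix s assume "s \<in> space (bracket H T)"
      then have "\<bar>f s\<bar> \<le> C" using assms(2) by (simp add: bracket_def)
      then have "\<bar>f s\<bar>\<^sup>2 \<le> C\<^sup>2" by (rule power_mono) simp
      then show "norm ((f s)\<^sup>2) \<le> C\<^sup>2" by simp
    qed
  qed (use m in simp)
qed

lemma step_fun_L2_bracket:
  shows "step_fun xs \<in> borel_measurable (bracket H T)" "integrable (bracket H T) (\<lambda>s. (step_fun xs s)\<^sup>2)"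
proof -
  have b: "\<bar>step_fun xs s\<bar> \<le> (\<Sum>(a, u, v) \<leftarrow> xs. \<bar>a\<bar>)" for s
  proof (induction xs)
    case (Cons x xs)
    obtain c u v where x: "x = (c, u, v)" by (cases x)
    have "\<bar>step_fun (x # xs) s\<bar> \<le> \<bar>c * indicator {u<..v} s\<bar> + \<bar>step_fun xs s\<bar>"
      unfolding x step_fun_def by simp
    also have "\<bar>c * indicator {u<..v} s\<bar> \<le> \<bar>c\<bar>" by (simp add: indicator_def)
    finally show ?case using Cons by (simp add: x)
  qed (simp add: step_fun_def)
  show "step_fun xs \<in> borel_measurable (bracket H T)" "integrable (bracket H T) (\<lambda>s. (step_fun xs s)\<^sup>2)"
    using bounded_L2_bracket[OF measurable_Icc_of_borel[OF measurable_step_fun] b] by auto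
qed

text \<open>
  Independence is known for the paths of the \<open>Z i\<close>, not for the versions \<open>I i\<close> of the integrals.  The
  product formula is therefore used for step integrals, which are measurable functions of the paths,
  and the bound passes to the limit by \<open>exp_moment_L2_limit\<close>.
\<close>

lemma molchan_sample_exp_moment:
  assumes Q: "C1_on_Icc T Q" and J: "L2_fun (bracket H T) (J_map H T Q)"
    and sample: "molchan_sample P H T Q N B M Z"
    and K: "K \<in> borel_measurable (bracket H T)" "integrable (bracket H T) (\<lambda>s. (K s)\<^sup>2)"
    and I: "\<And>i. i \<in> {1..N} \<Longrightarrow> is_wiener_integral P (L2_norm_sq (bracket H T)) T (Z i) K (I i)"
  shows "(\<integral>\<^sup>+\<omega>. ennreal (exp (\<Sum>i=1..N. I i \<omega> - (\<integral>s. K s * J_map H T Q s \<partial>bracket H T))) \<partial>P)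
    \<le> ennreal (exp (real N * (\<integral>s. (K s)\<^sup>2 \<partial>bracket H T) / 2))"
proof -
  have P: "prob_space P" and indep: "independent_processes P T N Z"
    and ind: "\<And>i. i \<in> {1..N} \<Longrightarrow> fractional_brownian_motion P H T (B i)"
       "\<And>i. i \<in> {1..N} \<Longrightarrow> molchan_transform P H T (drifted Q (B i)) (Z i)"
    using sample unfolding molchan_sample_def by auto
  interpret prob_space P by fact
  have Qc: "continuous_on {0..T} Q" by (rule C1_on_Icc_imp_continuous_on[OF Q])
  let ?J = "J_map H T Q" and ?br = "bracket H T"
  have Jm: "?J \<in> borel_measurable ?br" "integrable ?br (\<lambda>s. (?J s)\<^sup>2)" using J by (auto simp: L2_fun_def)
  define k where "k = (\<integral>s. K s * ?J s \<partial>?br)"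
  have "\<forall>i\<in>{1..N}. \<exists>F. (\<forall>n::nat. step_list T (F n)) \<and>
          (\<lambda>n. L2_norm_sq ?br (\<lambda>s. K s - step_fun (F n) s)) \<longlonglongrightarrow> 0 \<and>
          (\<lambda>n. L2_norm_sq P (\<lambda>\<omega>. I i \<omega> - step_integral (F n) (Z i) \<omega>)) \<longlonglongrightarrow> 0"
    using I unfolding is_wiener_integral_def by blast
  then obtain F where F: "\<And>i n. i \<in> {1..N} \<Longrightarrow> step_list T (F i n)"
      "\<And>i. i \<in> {1..N} \<Longrightarrow> (\<lambda>n. L2_norm_sq ?br (\<lambda>s. K s - step_fun (F i n) s)) \<longlonglongrightarrow> 0"
      "\<And>i. i \<in> {1..N} \<Longrightarrow> (\<lambda>n. L2_norm_sq P (\<lambda>\<omega>. I i \<omega> - step_integral (F i n) (Z i) \<omega>)) \<longlonglongrightarrow> 0"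
    by (subst (asm) bchoice_iff) blast
  have Im: "I i \<in> borel_measurable P" if "i \<in> {1..N}" for i using I[OF that] unfolding is_wiener_integral_def by blast
  have Zm: "Z i t \<in> borel_measurable P" if "i \<in> {1..N}" "t \<in> {0..T}" for i t
    using ind(2)[OF that(1)] that(2) unfolding molchan_transform_def is_wiener_integral_def by blast
  have Sm: "step_integral (F i n) (Z i) \<in> borel_measurable P" if "i \<in> {1..N}" for i n
    by (rule measurable_step_integral[OF F(1)[OF that] Zm[OF that]])
  define v where "v i n = (\<integral>s. (step_fun (F i n) s)\<^sup>2 \<partial>?br) / 2 + (\<integral>s. step_fun (F i n) s * ?J s \<partial>?br) - k" for i n
  have v: "v i \<longlonglongrightarrow> (\<integral>s. (K s)\<^sup>2 \<partial>?br) / 2" if i: "i \<in> {1..N}" for i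
  proof -
    have "(\<lambda>n. \<integral>s. (step_fun (F i n) s)\<^sup>2 \<partial>?br) \<longlonglongrightarrow> (\<integral>s. (K s)\<^sup>2 \<partial>?br)"
      by (intro integral_sq_tendsto step_fun_L2_bracket K F(2)[OF i])
    moreover have "(\<lambda>n. \<integral>s. step_fun (F i n) s * ?J s \<partial>?br) \<longlonglongrightarrow> k"
      unfolding k_def by (intro integral_mult_tendsto step_fun_L2_bracket K F(2)[OF i] Jm)
    ultimately have "v i \<longlonglongrightarrow> (\<integral>s. (K s)\<^sup>2 \<partial>?br) / 2 + k - k"
      unfolding v_def by (intro tendsto_intros) auto
    then show ?thesis by simp
  qed
  \<comment> \<open>Centring by the limit \<open>k\<close> instead of the drift of the step function leaves a correction that
    tends to zero in \<open>v i n\<close>.\<close>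
  have one: "(\<integral>\<^sup>+\<omega>. ennreal (exp (step_integral (F i n) (Z i) \<omega> - k)) \<partial>P) \<le> ennreal (exp (v i n))" if i: "i \<in> {1..N}" for i n
  proof -
    let ?m = "step_integral (F i n) (\<lambda>t _. j_map H Q t) ()"
    have "(\<integral>\<^sup>+\<omega>. ennreal (exp (step_integral (F i n) (Z i) \<omega> - k)) \<partial>P)
      = (\<integral>\<^sup>+\<omega>. ennreal (exp (?m - k)) * ennreal (exp (step_integral (F i n) (Z i) \<omega> - ?m)) \<partial>P)"
      by (intro nn_integral_cong) (simp add: exp_add[symmetric] ennreal_mult'[symmetric])
    also have "\<dots> = ennreal (exp (?m - k)) * (\<integral>\<^sup>+\<omega>. ennreal (exp (step_integral (F i n) (Z i) \<omega> - ?m)) \<partial>P)"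
      using Sm[OF i] by (intro nn_integral_cmult) simp
    also have "\<dots> \<le> ennreal (exp (?m - k)) * ennreal (exp ((\<integral>s. (step_fun (F i n) s)\<^sup>2 \<partial>?br) / 2))"
      by (intro mult_left_mono molchan_step_exp_moment[OF P ind(1)[OF i] Qc ind(2)[OF i] F(1)[OF i]]) simp
    also have "\<dots> = ennreal (exp (v i n))"
      unfolding step_integral_j_map[OF Q J F(1)[OF i]] v_def
      by (simp add: exp_add[symmetric] ennreal_mult'[symmetric] algebra_simps)
    finally show ?thesis .
  qed
  show ?thesis unfolding k_def[symmetric]
  proof (rule exp_moment_L2_limit[where X="\<lambda>n \<omega>. \<Sum>i=1..N. step_integral (F i n) (Z i) \<omega> - k" and s="\<lambda>n. \<Sum>i=1..N. v i n"])
    show "(\<lambda>\<omega>. \<Sum>i=1..N. step_integral (F i n) (Z i) \<omega> - k) \<in> borel_measurable P" for n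
      by (intro borel_measurable_sum borel_measurable_diff Sm borel_measurable_const)
    show "(\<lambda>\<omega>. \<Sum>i=1..N. I i \<omega> - k) \<in> borel_measurable P"
      by (intro borel_measurable_sum borel_measurable_diff Im borel_measurable_const)
    have "(\<lambda>n. L2_norm_sq P (\<lambda>\<omega>. \<Sum>i=1..N. I i \<omega> - step_integral (F i n) (Z i) \<omega>)) \<longlonglongrightarrow> 0"
      by (rule L2_norm_sq_sum_tendsto_0[where X="\<lambda>n i \<omega>. I i \<omega> - step_integral (F i n) (Z i) \<omega>"], simp,
          rule borel_measurable_diff, erule Im, erule Sm, erule F(3))
    then show "(\<lambda>n. L2_norm_sq P (\<lambda>\<omega>. (\<Sum>i=1..N. I i \<omega> - k) - (\<Sum>i=1..N. step_integral (F i n) (Z i) \<omega> - k))) \<longlonglongrightarrow> 0"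
      by (simp add: sum_subtractf)
    have "(\<lambda>n. \<Sum>i=1..N. v i n) \<longlonglongrightarrow> (\<Sum>i=1..N. (\<integral>s. (K s)\<^sup>2 \<partial>?br) / 2)" by (intro tendsto_sum v)
    then show "(\<lambda>n. \<Sum>i=1..N. v i n) \<longlonglongrightarrow> real N * (\<integral>s. (K s)\<^sup>2 \<partial>?br) / 2" by simp
    fix n
    define g where "g i p = ennreal (exp (step_integral (F i n) (\<lambda>t p. p t) p - k))" for i and p :: "real \<Rightarrow> real"
    have gm: "g i \<in> Pi\<^sub>M {0..T} (\<lambda>_. borel) \<rightarrow>\<^sub>M borel" if i: "i \<in> {1..N}" for i
    proof -
      have "step_integral (F i n) (\<lambda>t p. p t) \<in> borel_measurable (Pi\<^sub>M {0..T} (\<lambda>_. borel))"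
        by (rule measurable_step_integral[OF F(1)[OF i]]) (rule measurable_component_singleton)
      then show ?thesis unfolding g_def[abs_def] by simp
    qed
    have gZ: "g i (\<lambda>t\<in>{0..T}. Z i t \<omega>) = ennreal (exp (step_integral (F i n) (Z i) \<omega> - k))" if i: "i \<in> {1..N}" for i \<omega>
    proof -
      have "step_integral (F i n) (\<lambda>t p. p t) (\<lambda>t\<in>{0..T}. Z i t \<omega>) = step_integral (F i n) (Z i) \<omega>"
        unfolding step_integral_eq_sum using step_points_subset[OF F(1)[OF i, of n]] by (intro sum.cong) auto
      then show ?thesis by (simp add: g_def)
    qed
    have iv: "indep_vars (\<lambda>_. borel) (\<lambda>i \<omega>. g i (\<lambda>t\<in>{0..T}. Z i t \<omega>)) {1..N}"
      using indep unfolding independent_processes_def by (rule indep_vars_compose2) (rule gm)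
    have "(\<integral>\<^sup>+\<omega>. ennreal (exp (\<Sum>i=1..N. step_integral (F i n) (Z i) \<omega> - k)) \<partial>P) = (\<integral>\<^sup>+\<omega>. (\<Prod>i=1..N. g i (\<lambda>t\<in>{0..T}. Z i t \<omega>)) \<partial>P)"
      by (intro nn_integral_cong) (simp add: gZ exp_sum prod_ennreal)
    also have "\<dots> = (\<Prod>i=1..N. \<integral>\<^sup>+\<omega>. g i (\<lambda>t\<in>{0..T}. Z i t \<omega>) \<partial>P)"
      by (rule indep_vars_nn_integral[OF _ iv]) auto
    also have "\<dots> \<le> (\<Prod>i=1..N. ennreal (exp (v i n)))"
      using one by (intro prod_mono_ennreal) (simp add: gZ)
    also have "\<dots> = ennreal (exp (\<Sum>i=1..N. v i n))" by (simp add: prod_ennreal exp_sum)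
    finally show "(\<integral>\<^sup>+\<omega>. ennreal (exp (\<Sum>i=1..N. step_integral (F i n) (Z i) \<omega> - k)) \<partial>P) \<le> ennreal (exp (\<Sum>i=1..N. v i n))" .
  qed
qed

end

section \<open>Reduction to the sequence model\<close>

lemma arg_min_attains:
  fixes f :: "'a \<Rightarrow> real"
  assumes "P x0" "\<And>y. P y \<Longrightarrow> f x0 \<le> f y"
  shows "P (arg_min f P)" "\<And>y. P y \<Longrightarrow> f (arg_min f P) \<le> f y"
proof -
  have "is_arg_min f P x0" using assms by (auto simp: is_arg_min_def not_less)
  then have "is_arg_min f P (arg_min f P)" unfolding arg_min_def by (rule someI)
  then show "P (arg_min f P)" "\<And>y. P y \<Longrightarrow> f (arg_min f P) \<le> f y"
    by (auto simp: is_arg_min_def not_less)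
qed

lemma orthonormal_distance:
  fixes e :: "nat \<Rightarrow> 'a \<Rightarrow> real"
  assumes e: "\<And>k. k \<in> {1..n} \<Longrightarrow> e k \<in> borel_measurable M" "\<And>k. k \<in> {1..n} \<Longrightarrow> integrable M (\<lambda>x. (e k x)\<^sup>2)"
    and orth: "\<And>i j. i \<in> {1..n} \<Longrightarrow> j \<in> {1..n} \<Longrightarrow> (\<integral>x. e i x * e j x \<partial>M) = (if i = j then 1 else 0)"
    and J: "J \<in> borel_measurable M" "integrable M (\<lambda>x. (J x)\<^sup>2)" and m: "m \<le> n"
  shows "(\<integral>x. ((\<Sum>k=1..m. y k * e k x) - J x)\<^sup>2 \<partial>M)
    = (\<integral>x. (J x)\<^sup>2 \<partial>M) - (\<Sum>k=1..m. (\<integral>x. e k x * J x \<partial>M)\<^sup>2) + (\<Sum>k=1..m. (y k - (\<integral>x. e k x * J x \<partial>M))\<^sup>2)"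
    and "(\<integral>x. (\<Sum>k=1..m. y k * e k x)\<^sup>2 \<partial>M) = (\<Sum>k=1..m. (y k)\<^sup>2)"
    and "(\<integral>x. (\<Sum>k=1..m. y k * e k x) * J x \<partial>M) = (\<Sum>k=1..m. y k * (\<integral>x. e k x * J x \<partial>M))"
    and "integrable M (\<lambda>x. ((\<Sum>k=1..m. y k * e k x) - J x)\<^sup>2)"
proof -
  define K where "K x = (\<Sum>k=1..m. y k * e k x)" for x
  have em: "e k \<in> borel_measurable M" "integrable M (\<lambda>x. (e k x)\<^sup>2)" if "k \<in> {1..m}" for k using e that m by auto
  have ee: "integrable M (\<lambda>x. e i x * e j x)" if "i \<in> {1..m}" "j \<in> {1..m}" for i j
    using em[OF that(1)] em[OF that(2)] by (intro integrable_mult_of_sq)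
  have eJ: "integrable M (\<lambda>x. e i x * J x)" if "i \<in> {1..m}" for i
    using em[OF that] J by (intro integrable_mult_of_sq)
  have sq: "(K x)\<^sup>2 = (\<Sum>i=1..m. \<Sum>j=1..m. y i * y j * (e i x * e j x))" for x
    unfolding K_def by (simp add: power2_eq_square sum_product ac_simps)
  have Ki: "integrable M (\<lambda>x. (K x)\<^sup>2)" unfolding sq
    by (intro Bochner_Integration.integrable_sum integrable_mult_right ee)
  have KJ: "K x * J x = (\<Sum>k=1..m. y k * (e k x * J x))" for x
    unfolding K_def sum_distrib_right by (simp add: mult.assoc)
  have KJi: "integrable M (\<lambda>x. K x * J x)" unfolding KJ
    by (intro Bochner_Integration.integrable_sum integrable_mult_right eJ)
  have 2: "(\<integral>x. (K x)\<^sup>2 \<partial>M) = (\<Sum>k=1..m. (y k)\<^sup>2)"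
  proof -
    have "(\<integral>x. (K x)\<^sup>2 \<partial>M) = (\<Sum>i=1..m. \<integral>x. (\<Sum>j=1..m. y i * y j * (e i x * e j x)) \<partial>M)"
      unfolding sq by (intro Bochner_Integration.integral_sum Bochner_Integration.integrable_sum integrable_mult_right ee)
    also have "\<dots> = (\<Sum>i=1..m. \<Sum>j=1..m. \<integral>x. y i * y j * (e i x * e j x) \<partial>M)"
      by (intro sum.cong refl Bochner_Integration.integral_sum integrable_mult_right ee)
    also have "\<dots> = (\<Sum>i=1..m. \<Sum>j=1..m. y i * y j * (if i = j then 1 else 0))"
      using orth m by (intro sum.cong refl) auto
    also have "\<dots> = (\<Sum>i=1..m. (y i)\<^sup>2)"
    proof (intro sum.cong refl)
      fix i assume "i \<in> {1..m}"
      then show "(\<Sum>j=1..m. y i * y j * (if i = j then 1 else 0)) = (y i)\<^sup>2"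
        by (subst sum.remove[of _ i]) (auto intro!: sum.neutral simp: power2_eq_square)
    qed
    finally show ?thesis .
  qed
  have 3: "(\<integral>x. K x * J x \<partial>M) = (\<Sum>k=1..m. y k * (\<integral>x. e k x * J x \<partial>M))"
  proof -
    have "(\<integral>x. K x * J x \<partial>M) = (\<Sum>k=1..m. \<integral>x. y k * (e k x * J x) \<partial>M)"
      unfolding KJ by (intro Bochner_Integration.integral_sum integrable_mult_right eJ)
    then show ?thesis by simp
  qed
  have d: "(K x - J x)\<^sup>2 = (K x)\<^sup>2 + (J x)\<^sup>2 - 2 * (K x * J x)" for x by (simp add: power2_diff)
  show "integrable M (\<lambda>x. ((\<Sum>k=1..m. y k * e k x) - J x)\<^sup>2)"
    unfolding K_def[symmetric] d using Ki KJi J(2) by simp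
  have "(\<integral>x. (K x - J x)\<^sup>2 \<partial>M) = (\<Sum>k=1..m. (y k)\<^sup>2) + (\<integral>x. (J x)\<^sup>2 \<partial>M) - 2 * (\<Sum>k=1..m. y k * (\<integral>x. e k x * J x \<partial>M))"
    unfolding d using Ki KJi J(2) by (simp add: 2 3)
  also have "\<dots> = (\<integral>x. (J x)\<^sup>2 \<partial>M) - (\<Sum>k=1..m. (\<integral>x. e k x * J x \<partial>M)\<^sup>2) + (\<Sum>k=1..m. (y k - (\<integral>x. e k x * J x \<partial>M))\<^sup>2)"
    by (simp add: power2_diff sum.distrib sum_subtractf sum_distrib_left mult.assoc)
  finally show "(\<integral>x. ((\<Sum>k=1..m. y k * e k x) - J x)\<^sup>2 \<partial>M)
    = (\<integral>x. (J x)\<^sup>2 \<partial>M) - (\<Sum>k=1..m. (\<integral>x. e k x * J x \<partial>M)\<^sup>2) + (\<Sum>k=1..m. (y k - (\<integral>x. e k x * J x \<partial>M))\<^sup>2)"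
    unfolding K_def .
  show "(\<integral>x. (\<Sum>k=1..m. y k * e k x)\<^sup>2 \<partial>M) = (\<Sum>k=1..m. (y k)\<^sup>2)" using 2 unfolding K_def .
  show "(\<integral>x. (\<Sum>k=1..m. y k * e k x) * J x \<partial>M) = (\<Sum>k=1..m. y k * (\<integral>x. e k x * J x \<partial>M))" using 3 unfolding K_def .
qed

context hurst
begin

lemma continuous_L2_bracket:
  fixes f :: "real \<Rightarrow> real"
  assumes "continuous_on {0..T} f"
  shows "f \<in> borel_measurable (bracket H T)" "integrable (bracket H T) (\<lambda>s. (f s)\<^sup>2)"
proof -
  obtain C where C: "\<forall>s\<in>{0..T}. \<bar>f s\<bar> \<le> C" using continuous_bounded_Icc[OF assms] by auto
  then show "f \<in> borel_measurable (bracket H T)" "integrable (bracket H T) (\<lambda>s. (f s)\<^sup>2)"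
    by (intro bounded_L2_bracket[OF continuous_imp_measurable_Icc[OF assms], of C]; blast)+
qed

text \<open>
  The density of the bracket is positive on \<open>(0,T]\<close>, so that a function of norm zero for the bracket
  vanishes almost everywhere; orthonormality for Lebesgue measure excludes this.
\<close>

lemma orthonormal_family_bracket_independent:
  assumes \<phi>: "\<And>j. j \<in> {1..N} \<Longrightarrow> continuous_on {0..T} (\<phi> j)" and on: "orthonormal_family T N \<phi>"
    and m: "m < N" and g: "g \<in> span_upto \<phi> m"
  shows "(\<integral>s. (\<phi> (Suc m) s - g s)\<^sup>2 \<partial>bracket H T) \<noteq> 0"
proof
  assume z: "(\<integral>s. (\<phi> (Suc m) s - g s)\<^sup>2 \<partial>bracket H T) = 0"
  obtain c where c: "g = (\<lambda>t. \<Sum>j=1..m. c j * \<phi> j t)" using g unfolding span_upto_def by auto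
  have gc: "continuous_on {0..T} g" unfolding c using \<phi> m by (intro continuous_intros) auto
  have pc: "continuous_on {0..T} (\<phi> (Suc m))" using \<phi> m by auto
  define f where "f s = \<phi> (Suc m) s - g s" for s
  have fc: "continuous_on {0..T} f" unfolding f_def[abs_def] by (intro continuous_intros pc gc)
  note f2 = continuous_L2_bracket[OF fc]
  have "AE s in bracket H T. (f s)\<^sup>2 = 0"
    using z integral_nonneg_eq_0_iff_AE[OF f2(2)] unfolding f_def by auto
  then have "AE s in lebesgue_Icc T. 0 < ennreal ((2 - 2*H) * s powr (1 - 2*H)) \<longrightarrow> (f s)\<^sup>2 = 0"
    unfolding bracket_def
    by (subst (asm) AE_density) (intro measurable_compose[OF _ measurable_ennreal] borel_measurable_times borel_measurable_const powr_measurable_Icc)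
  moreover have "AE s in lebesgue_Icc T. s \<noteq> 0"
    unfolding lebesgue_Icc_def by (subst AE_restrict_space_iff) (auto intro: AE_mp[OF AE_lborel_singleton[of 0]])
  ultimately have ae: "AE s in lebesgue_Icc T. \<phi> (Suc m) s = g s"
    using AE_space by eventually_elim (use H in \<open>auto simp: f_def\<close>)
  have ip: "(\<integral>t. \<phi> i t * \<phi> j t \<partial>lebesgue_Icc T) = (if i = j then 1 else 0)" if "i \<in> {1..N}" "j \<in> {1..N}" for i j
    using on that unfolding orthonormal_family_def by blast
  have prod: "integrable (lebesgue_Icc T) (\<lambda>t. \<phi> i t * \<phi> j t)" if "i \<in> {1..N}" "j \<in> {1..N}" for i j
    by (rule continuous_integrable_Icc) (intro continuous_intros \<phi> that)
  have "1 = (\<integral>t. \<phi> (Suc m) t * \<phi> (Suc m) t \<partial>lebesgue_Icc T)" using ip[of "Suc m" "Suc m"] m by simp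
  also have "\<dots> = (\<integral>t. (\<Sum>j=1..m. c j * (\<phi> j t * \<phi> (Suc m) t)) \<partial>lebesgue_Icc T)"
  proof (rule integral_cong_AE)
    show "AE t in lebesgue_Icc T. \<phi> (Suc m) t * \<phi> (Suc m) t = (\<Sum>j=1..m. c j * (\<phi> j t * \<phi> (Suc m) t))"
      using ae
    proof eventually_elim
      case (elim t)
      have "\<phi> (Suc m) t * \<phi> (Suc m) t = g t * \<phi> (Suc m) t" using elim by simp
      also have "\<dots> = (\<Sum>j=1..m. c j * (\<phi> j t * \<phi> (Suc m) t))" unfolding c sum_distrib_right by (simp only: mult.assoc)
      finally show ?case .
    qed
    show "(\<lambda>t. \<phi> (Suc m) t * \<phi> (Suc m) t) \<in> borel_measurable (lebesgue_Icc T)"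
      using prod[of "Suc m" "Suc m"] m by auto
    show "(\<lambda>t. \<Sum>j=1..m. c j * (\<phi> j t * \<phi> (Suc m) t)) \<in> borel_measurable (lebesgue_Icc T)"
      using m by (intro borel_measurable_sum borel_measurable_times borel_measurable_const continuous_imp_measurable_Icc \<phi>) auto
  qed
  also have "\<dots> = (\<Sum>j=1..m. \<integral>t. c j * (\<phi> j t * \<phi> (Suc m) t) \<partial>lebesgue_Icc T)"
    using m by (intro Bochner_Integration.integral_sum integrable_mult_right prod) auto
  also have "\<dots> = 0" using ip m by (intro sum.neutral) auto
  finally show False by simp
qed

text \<open>
  In a basis \<open>e\<close> that is orthonormal for the bracket and compatible with all spans, the contrast of
  \<open>\<Sum>k\<le>m. y k * e k\<close> is \<open>\<Sum>k\<le>m. (y k - z k)\<^sup>2\<close> minus the constant \<open>\<Sum>k\<le>m. (z k)\<^sup>2\<close>, where \<open>z k\<close> is the empirical mean of the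
  integrals of \<open>e k\<close>.  Its minimiser has the coefficients \<open>z k = d k + \<xi> k / sqrt N\<close>, with \<open>d k\<close> the
  coefficient of \<open>J_map H T Q\<close>.  A linear form in \<open>\<xi>\<close> is again a sum of integrals over the \<open>Z i\<close>, so that
  \<open>molchan_sample_exp_moment\<close> makes \<open>\<xi>\<close> sub-Gaussian.
\<close>

lemma sequence_model:
  assumes Q: "C1_on_Icc T Q" and J: "L2_fun (bracket H T) (J_map H T Q)" and N: "1 \<le> N"
    and sample: "molchan_sample P H T Q N B M Z"
    and \<phi>: "\<forall>j\<in>{1..N}. continuous_on {0..T} (\<phi> j)" and on: "orthonormal_family T N \<phi>"
    and D: "integral_version P H T N Z (span_upto \<phi> N) D"
  shows "\<exists>d \<xi> b b0. subgaussian_vector P N \<xi> \<and>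
    (\<forall>m. b m = b0 - (\<Sum>k=1..m. (d k)\<^sup>2)) \<and>
    (\<forall>m\<in>{1..N}. 0 \<le> b m \<and> ennreal (b m) \<le> bias_sq H T Q \<phi> m) \<and>
    (AE \<omega> in P. \<forall>m\<in>{1..N}.
       contrast H T N D \<omega> (J_hat H T N \<phi> D m \<omega>) = - (\<Sum>k=1..m. (d k + \<xi> k \<omega> / sqrt (real N))\<^sup>2) \<and>
       L2_norm_sq (lebesgue_Icc T) (\<lambda>t. Q_hat H T N \<phi> D m \<omega> t - Q t)
         \<le> ennreal inverse_norm_const * ennreal (b m + (\<Sum>k=1..m. (\<xi> k \<omega>)\<^sup>2) / real N))"
proof -
  let ?br = "bracket H T" and ?J = "J_map H T Q" and ?S = "span_upto \<phi> N"
  have Jm: "?J \<in> borel_measurable ?br" "integrable ?br (\<lambda>s. (?J s)\<^sup>2)" using J by (auto simp: L2_fun_def)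
  have phim: "\<phi> j \<in> borel_measurable (lebesgue_Icc T)" "\<phi> j \<in> borel_measurable ?br" "integrable ?br (\<lambda>s. (\<phi> j s)\<^sup>2)" if j: "j \<in> {1..N}" for j
  proof -
    have c: "continuous_on {0..T} (\<phi> j)" using \<phi> j by auto
    show "\<phi> j \<in> borel_measurable ?br" "integrable ?br (\<lambda>s. (\<phi> j s)\<^sup>2)"
      by (rule continuous_L2_bracket[OF c])+
    show "\<phi> j \<in> borel_measurable (lebesgue_Icc T)" by (rule continuous_imp_measurable_Icc[OF c])
  qed
  have "\<exists>e. (\<forall>m\<le>N. span_upto e m = span_upto \<phi> m) \<and>
    (\<forall>i\<in>{1..N}. \<forall>j\<in>{1..N}. (\<integral>x. e i x * e j x \<partial>?br) = (if i = j then 1 else 0))"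
  proof (rule gram_schmidt_L2)
    show "(\<integral>s. (\<phi> (Suc m) s - g s)\<^sup>2 \<partial>?br) \<noteq> 0" if "m < N" "g \<in> span_upto \<phi> m" for m g
      using \<phi> by (intro orthonormal_family_bracket_independent[OF _ on that]) blast
  qed (erule phim)+
  then obtain e where span: "\<And>m. m \<le> N \<Longrightarrow> span_upto e m = span_upto \<phi> m"
    and orth: "\<And>i j. i \<in> {1..N} \<Longrightarrow> j \<in> {1..N} \<Longrightarrow> (\<integral>x. e i x * e j x \<partial>?br) = (if i = j then 1 else 0)" by blast
  have comb: "(\<lambda>t. \<Sum>k=1..m. y k * e k t) \<in> span_upto \<phi> m" "(\<lambda>t. \<Sum>k=1..m. y k * e k t) \<in> ?S" if "m \<le> N" for m y
    using span_upto_memI[where m=m and a=y and \<phi>=e] span[OF that] span_upto_mono[OF that, of \<phi>] by auto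
  have eS: "e k \<in> ?S" if "k \<in> {1..N}" for k
  proof -
    have "(\<Sum>j=1..N. (if j = k then 1 else 0) * e j t) = e k t" for t
      using that by (subst sum.remove[of _ k]) (auto intro!: sum.neutral)
    then show ?thesis using comb(2)[OF order_refl, of "\<lambda>j. if j = k then 1 else 0"] by simp
  qed
  have em: "e k \<in> borel_measurable ?br" "integrable ?br (\<lambda>s. (e k s)\<^sup>2)" if "k \<in> {1..N}" for k
    using span_upto_L2[OF phim(2,3) order_refl eS[OF that]] by auto
  have dist: "(\<integral>x. ((\<Sum>k=1..m. y k * e k x) - ?J x)\<^sup>2 \<partial>?br)
      = (\<integral>x. (?J x)\<^sup>2 \<partial>?br) - (\<Sum>k=1..m. (\<integral>x. e k x * ?J x \<partial>?br)\<^sup>2) + (\<Sum>k=1..m. (y k - (\<integral>x. e k x * ?J x \<partial>?br))\<^sup>2)"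
    "(\<integral>x. (\<Sum>k=1..m. y k * e k x)\<^sup>2 \<partial>?br) = (\<Sum>k=1..m. (y k)\<^sup>2)"
    "(\<integral>x. (\<Sum>k=1..m. y k * e k x) * ?J x \<partial>?br) = (\<Sum>k=1..m. y k * (\<integral>x. e k x * ?J x \<partial>?br))"
    "integrable ?br (\<lambda>x. ((\<Sum>k=1..m. y k * e k x) - ?J x)\<^sup>2)" if m: "m \<le> N" for m y
    by (rule orthonormal_distance[OF _ _ _ Jm m], erule em(1), erule em(2), erule (1) orth)+
  define d where "d k = (\<integral>s. e k s * ?J s \<partial>?br)" for k
  define b0 where "b0 = (\<integral>s. (?J s)\<^sup>2 \<partial>?br)"
  define b where "b m = b0 - (\<Sum>k=1..m. (d k)\<^sup>2)" for m
  have loss: "L2_norm_sq ?br (\<lambda>s. (\<Sum>k=1..m. y k * e k s) - ?J s) = ennreal (b m + (\<Sum>k=1..m. (y k - d k)\<^sup>2))"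
    and loss0: "0 \<le> b m + (\<Sum>k=1..m. (y k - d k)\<^sup>2)" if m: "m \<le> N" for m y
  proof -
    have eq: "(\<integral>s. ((\<Sum>k=1..m. y k * e k s) - ?J s)\<^sup>2 \<partial>?br) = b m + (\<Sum>k=1..m. (y k - d k)\<^sup>2)"
      unfolding b_def b0_def d_def by (rule dist(1)[OF m])
    show "L2_norm_sq ?br (\<lambda>s. (\<Sum>k=1..m. y k * e k s) - ?J s) = ennreal (b m + (\<Sum>k=1..m. (y k - d k)\<^sup>2))"
      unfolding eq[symmetric] by (rule L2_norm_sq_eq_integral[OF dist(4)[OF m]])
    show "0 \<le> b m + (\<Sum>k=1..m. (y k - d k)\<^sup>2)" unfolding eq[symmetric] by simp
  qed
  have b0': "0 \<le> b m" if "m \<le> N" for m using loss0[OF that, of d] by simp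
  have bias: "ennreal (b m) \<le> bias_sq H T Q \<phi> m" if m: "m \<le> N" for m
    unfolding bias_sq_def
  proof (rule INF_greatest)
    fix f assume "f \<in> span_upto \<phi> m"
    then obtain y where f: "f = (\<lambda>t. \<Sum>k=1..m. y k * e k t)"
      unfolding span[OF m, symmetric] unfolding span_upto_def by auto
    show "ennreal (b m) \<le> L2_norm_sq ?br (\<lambda>s. f s - ?J s)"
      unfolding f loss[OF m] by (intro ennreal_leI) (simp add: sum_nonneg)
  qed
  define \<xi> where "\<xi> k \<omega> = sqrt (real N) * ((1 / real N) * (\<Sum>i=1..N. D i (e k) \<omega>) - d k)" for k \<omega>
  have D_int: "is_wiener_integral P (L2_norm_sq ?br) T (Z i) K (D i K)" if "i \<in> {1..N}" "K \<in> ?S" for i K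
    using D that unfolding integral_version_def by blast
  have D_lin: "AE \<omega> in P. \<forall>i\<in>{1..N}. \<forall>K\<in>?S. \<forall>L\<in>?S. \<forall>u v. D i (\<lambda>t. u * K t + v * L t) \<omega> = u * D i K \<omega> + v * D i L \<omega>"
    using D unfolding integral_version_def by (subst AE_finite_all) auto
  have lin: "D i (\<lambda>t. \<Sum>k=1..m. y k * e k t) \<omega> = (\<Sum>k=1..m. y k * D i (e k) \<omega>)"
    if hyp: "\<forall>i\<in>{1..N}. \<forall>K\<in>?S. \<forall>L\<in>?S. \<forall>u v. D i (\<lambda>t. u * K t + v * L t) \<omega> = u * D i K \<omega> + v * D i L \<omega>"
      and i: "i \<in> {1..N}" and m: "m \<le> N" for i m y \<omega>
    using m
  proof (induction m)
    case 0
    have "e 1 \<in> ?S" using N by (intro eS) auto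
    then have "D i (\<lambda>t. 0 * e 1 t + 0 * e 1 t) \<omega> = 0 * D i (e 1) \<omega> + 0 * D i (e 1) \<omega>" using hyp i by blast
    then show ?case by simp
  next
    case (Suc m)
    have S: "e (Suc m) \<in> ?S" "(\<lambda>t. \<Sum>k=1..m. y k * e k t) \<in> ?S"
      by (rule eS, use Suc.prems in simp) (rule comb(2), use Suc.prems in simp)
    have "D i (\<lambda>t. 1 * (\<Sum>k=1..m. y k * e k t) + y (Suc m) * e (Suc m) t) \<omega>
      = 1 * D i (\<lambda>t. \<Sum>k=1..m. y k * e k t) \<omega> + y (Suc m) * D i (e (Suc m)) \<omega>"
      by (rule hyp[rule_format, OF i S(2) S(1)])
    then show ?case using Suc by simp
  qed
  have sN: "sqrt (real N) * sqrt (real N) = real N" "0 < sqrt (real N)" using N by auto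
  have sub: "subgaussian_vector P N \<xi>"
    unfolding subgaussian_vector_def
  proof (intro conjI ballI allI)
    have Dm: "D i K \<in> borel_measurable P" if "i \<in> {1..N}" "K \<in> ?S" for i K
      using D_int[OF that] unfolding is_wiener_integral_def by blast
    show "\<xi> k \<in> borel_measurable P" if "k \<in> {1..N}" for k
      unfolding \<xi>_def[abs_def] using that
      by (intro borel_measurable_times borel_measurable_diff borel_measurable_const borel_measurable_sum Dm eS)
    fix t :: "nat \<Rightarrow> real"
    define y where "y k = t k / sqrt (real N)" for k
    define K where "K = (\<lambda>s. \<Sum>k=1..N. y k * e k s)"
    have K: "K \<in> ?S" unfolding K_def by (rule comb(2)) simp
    have Km: "K \<in> borel_measurable ?br" "integrable ?br (\<lambda>s. (K s)\<^sup>2)"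
      using span_upto_L2[OF phim(2,3) order_refl K] by auto
    have KJ: "(\<integral>s. K s * ?J s \<partial>?br) = (\<Sum>k=1..N. y k * d k)"
      unfolding K_def d_def by (rule dist(3)) simp
    have K2: "real N * (\<integral>s. (K s)\<^sup>2 \<partial>?br) / 2 = (\<Sum>k=1..N. (t k)\<^sup>2) / 2"
    proof -
      have "(\<integral>s. (K s)\<^sup>2 \<partial>?br) = (\<Sum>k=1..N. (y k)\<^sup>2)" unfolding K_def by (rule dist(2)) simp
      then show ?thesis using N by (simp add: y_def power_divide flip: sum_divide_distrib)
    qed
    have "AE \<omega> in P. (\<Sum>k=1..N. t k * \<xi> k \<omega>) = (\<Sum>i=1..N. D i K \<omega> - (\<integral>s. K s * ?J s \<partial>?br))"
      using D_lin
    proof eventually_elim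
      case (elim \<omega>)
      have "(\<Sum>i=1..N. D i K \<omega> - (\<integral>s. K s * ?J s \<partial>?br)) = (\<Sum>i=1..N. \<Sum>k=1..N. y k * (D i (e k) \<omega> - d k))"
      proof (intro sum.cong refl)
        fix i assume i: "i \<in> {1..N}"
        show "D i K \<omega> - (\<integral>s. K s * ?J s \<partial>?br) = (\<Sum>k=1..N. y k * (D i (e k) \<omega> - d k))"
          unfolding KJ unfolding K_def lin[OF elim i order_refl] by (simp add: sum_subtractf right_diff_distrib)
      qed
      also have "\<dots> = (\<Sum>k=1..N. \<Sum>i=1..N. y k * (D i (e k) \<omega> - d k))" by (rule sum.swap)
      also have "\<dots> = (\<Sum>k=1..N. t k * \<xi> k \<omega>)"
      proof (intro sum.cong refl)
        fix k
        have "(\<Sum>i=1..N. y k * (D i (e k) \<omega> - d k)) = y k * ((\<Sum>i=1..N. D i (e k) \<omega>) - real N * d k)"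
          by (simp add: sum_distrib_left[symmetric] sum_subtractf)
        also have "\<dots> = y k * (real N * ((1 / real N) * (\<Sum>i=1..N. D i (e k) \<omega>) - d k))"
          using N by (simp add: right_diff_distrib)
        also have "\<dots> = t k * \<xi> k \<omega>"
          unfolding y_def \<xi>_def using sN by (simp add: field_simps)
        finally show "(\<Sum>i=1..N. y k * (D i (e k) \<omega> - d k)) = t k * \<xi> k \<omega>" .
      qed
      finally show ?case by simp
    qed
    then have "(\<integral>\<^sup>+\<omega>. ennreal (exp (\<Sum>k=1..N. t k * \<xi> k \<omega>)) \<partial>P)
      = (\<integral>\<^sup>+\<omega>. ennreal (exp (\<Sum>i=1..N. D i K \<omega> - (\<integral>s. K s * ?J s \<partial>?br))) \<partial>P)"
      by (intro nn_integral_cong_AE) auto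
    also have "\<dots> \<le> ennreal (exp (real N * (\<integral>s. (K s)\<^sup>2 \<partial>?br) / 2))"
      by (rule molchan_sample_exp_moment[OF Q J sample Km D_int[OF _ K]])
    finally show "(\<integral>\<^sup>+\<omega>. ennreal (exp (\<Sum>k=1..N. t k * \<xi> k \<omega>)) \<partial>P) \<le> ennreal (exp ((\<Sum>k=1..N. (t k)\<^sup>2) / 2))"
      unfolding K2 .
  qed
  have ae: "AE \<omega> in P. \<forall>m\<in>{1..N}.
       contrast H T N D \<omega> (J_hat H T N \<phi> D m \<omega>) = - (\<Sum>k=1..m. (d k + \<xi> k \<omega> / sqrt (real N))\<^sup>2) \<and>
       L2_norm_sq (lebesgue_Icc T) (\<lambda>t. Q_hat H T N \<phi> D m \<omega> t - Q t)
         \<le> ennreal inverse_norm_const * ennreal (b m + (\<Sum>k=1..m. (\<xi> k \<omega>)\<^sup>2) / real N)"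
    using D_lin
  proof eventually_elim
    case (elim \<omega>)
    define z where "z k = (1 / real N) * (\<Sum>i=1..N. D i (e k) \<omega>)" for k
    have zd: "z k = d k + \<xi> k \<omega> / sqrt (real N)" for k
      unfolding z_def \<xi>_def using sN by (simp add: field_simps)
    have contr: "contrast H T N D \<omega> (\<lambda>t. \<Sum>k=1..m. y k * e k t) = (\<Sum>k=1..m. (y k - z k)\<^sup>2) - (\<Sum>k=1..m. (z k)\<^sup>2)" if m: "m \<le> N" for m y
    proof -
      have "contrast H T N D \<omega> (\<lambda>t. \<Sum>k=1..m. y k * e k t)
        = 1 / real N * (\<Sum>i=1..N. (\<Sum>k=1..m. (y k)\<^sup>2) - 2 * (\<Sum>k=1..m. y k * D i (e k) \<omega>))"
        unfolding contrast_def dist(2)[OF m]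
      proof (intro arg_cong2[where f="(*)"] refl sum.cong)
        fix i assume i: "i \<in> {1..N}"
        show "(\<Sum>k=1..m. (y k)\<^sup>2) - 2 * D i (\<lambda>t. \<Sum>k=1..m. y k * e k t) \<omega> = (\<Sum>k=1..m. (y k)\<^sup>2) - 2 * (\<Sum>k=1..m. y k * D i (e k) \<omega>)"
          unfolding lin[OF elim i m] ..
      qed
      also have "\<dots> = (\<Sum>k=1..m. (y k)\<^sup>2) - 2 * (1 / real N * (\<Sum>i=1..N. \<Sum>k=1..m. y k * D i (e k) \<omega>))"
        using N by (simp add: sum_subtractf sum_distrib_left[symmetric] right_diff_distrib diff_divide_distrib)
      also have "1 / real N * (\<Sum>i=1..N. \<Sum>k=1..m. y k * D i (e k) \<omega>) = (\<Sum>k=1..m. y k * z k)"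
        unfolding z_def by (subst sum.swap) (simp add: sum_distrib_left sum_divide_distrib)
      finally show ?thesis by (simp add: power2_diff sum.distrib sum_subtractf sum_distrib_left mult.assoc)
    qed
    show ?case
    proof
      fix m assume "m \<in> {1..N}"
      then have m: "m \<le> N" by simp
      let ?f = "contrast H T N D \<omega>" and ?z = "\<lambda>t. \<Sum>k=1..m. z k * e k t"
      have zmin: "?f ?z \<le> ?f K" if KS: "K \<in> span_upto \<phi> m" for K
      proof -
        obtain y where K: "K = (\<lambda>t. \<Sum>k=1..m. y k * e k t)"
          using KS unfolding span[OF m, symmetric] unfolding span_upto_def by auto
        show ?thesis unfolding K contr[OF m] by (simp add: sum_nonneg)
      qed
      have hat: "J_hat H T N \<phi> D m \<omega> \<in> span_upto \<phi> m" "?f (J_hat H T N \<phi> D m \<omega>) \<le> ?f ?z"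
        unfolding J_hat_def
        using arg_min_attains[of "\<lambda>K. K \<in> span_upto \<phi> m" ?z ?f, OF comb(1)[OF m] zmin] comb(1)[OF m] by auto
      obtain y where y: "J_hat H T N \<phi> D m \<omega> = (\<lambda>t. \<Sum>k=1..m. y k * e k t)"
        using hat(1) unfolding span[OF m, symmetric] unfolding span_upto_def by auto
      have "(\<Sum>k=1..m. (y k - z k)\<^sup>2) \<le> 0" using hat(2) unfolding y contr[OF m] by simp
      then have "(\<Sum>k=1..m. (y k - z k)\<^sup>2) = 0" by (intro antisym sum_nonneg) auto
      then have yz: "y k = z k" if "k \<in> {1..m}" for k
        using that by (subst (asm) sum_nonneg_eq_0_iff) auto
      have Jz: "J_hat H T N \<phi> D m \<omega> = ?z" unfolding y using yz by (intro ext sum.cong) auto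
      have "?f (J_hat H T N \<phi> D m \<omega>) = - (\<Sum>k=1..m. (d k + \<xi> k \<omega> / sqrt (real N))\<^sup>2)"
        unfolding Jz contr[OF m] zd by simp
      moreover have "L2_norm_sq (lebesgue_Icc T) (\<lambda>t. Q_hat H T N \<phi> D m \<omega> t - Q t)
         \<le> ennreal inverse_norm_const * ennreal (b m + (\<Sum>k=1..m. (\<xi> k \<omega>)\<^sup>2) / real N)"
      proof -
        have zS: "?z \<in> ?S" by (rule comb(2)[OF m])
        have z1: "?z \<in> borel_measurable (lebesgue_Icc T)"
        proof -
          obtain c where "?z = (\<lambda>t. \<Sum>j=1..N. c j * \<phi> j t)" using zS unfolding span_upto_def by auto
          then show ?thesis using phim(1) by (simp only:) (intro borel_measurable_sum borel_measurable_times borel_measurable_const, auto)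
        qed
        have z2: "L2_norm_sq ?br ?z < \<infinity>"
          using L2_norm_sq_eq_integral[OF span_upto_L2(2)[OF phim(2,3) order_refl zS]] by simp
        have "L2_norm_sq (lebesgue_Icc T) (\<lambda>t. Q_hat H T N \<phi> D m \<omega> t - Q t)
          \<le> ennreal inverse_norm_const * L2_norm_sq ?br (\<lambda>s. ?z s - ?J s)"
          unfolding Q_hat_def Jz by (rule J_inv_error[OF Q J z1 z2])
        also have "L2_norm_sq ?br (\<lambda>s. ?z s - ?J s) = ennreal (b m + (\<Sum>k=1..m. (z k - d k)\<^sup>2))"
          by (rule loss[OF m])
        also have "(\<Sum>k=1..m. (z k - d k)\<^sup>2) = (\<Sum>k=1..m. (\<xi> k \<omega>)\<^sup>2) / real N"
          unfolding zd by (simp add: power_divide sum_divide_distrib)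
        finally show ?thesis .
      qed
      ultimately show "?f (J_hat H T N \<phi> D m \<omega>) = - (\<Sum>k=1..m. (d k + \<xi> k \<omega> / sqrt (real N))\<^sup>2) \<and>
        L2_norm_sq (lebesgue_Icc T) (\<lambda>t. Q_hat H T N \<phi> D m \<omega> t - Q t)
         \<le> ennreal inverse_norm_const * ennreal (b m + (\<Sum>k=1..m. (\<xi> k \<omega>)\<^sup>2) / real N)" by blast
    qed
  qed
  show ?thesis
    using sub b_def b0' bias ae by (intro exI[of _ d] exI[of _ \<xi>] exI[of _ b] exI[of _ b0] conjI) auto
qed

section \<open>Risk bounds\<close>

lemma inverse_norm_const_nonneg: "0 \<le> inverse_norm_const"
  unfolding inverse_norm_const_def using Beta_real_positive[of "1 - 2*a" a] a H by simp

text \<open>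
  In the sequence model the loss is the squared bias plus \<open>m\<close> squared noise terms, each of mean at most
  \<open>4 * exp (1/2) / N\<close>.
\<close>

lemma projection_risk:
  assumes Q: "C1_on_Icc T Q" and J: "L2_fun (bracket H T) (J_map H T Q)" and N: "1 \<le> N"
    and sample: "molchan_sample P H T Q N B M Z"
    and \<phi>: "\<forall>j\<in>{1..N}. continuous_on {0..T} (\<phi> j)" and on: "orthonormal_family T N \<phi>"
    and D: "integral_version P H T N Z (span_upto \<phi> N) D" and m: "m \<in> {1..N}"
  shows "risk P T Q (Q_hat H T N \<phi> D m)
    \<le> ennreal ((inverse_norm_const + 1) * (1 + 4 * exp (1/2))) * (bias_sq H T Q \<phi> m + ennreal (real m / real N))"
proof -
  obtain d \<xi> b b0 where sub: "subgaussian_vector P N \<xi>"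
    and b: "\<forall>m\<in>{1..N}. 0 \<le> b m \<and> ennreal (b m) \<le> bias_sq H T Q \<phi> m"
    and ae: "AE \<omega> in P. \<forall>m\<in>{1..N}.
       contrast H T N D \<omega> (J_hat H T N \<phi> D m \<omega>) = - (\<Sum>k=1..m. (d k + \<xi> k \<omega> / sqrt (real N))\<^sup>2) \<and>
       L2_norm_sq (lebesgue_Icc T) (\<lambda>t. Q_hat H T N \<phi> D m \<omega> t - Q t)
         \<le> ennreal inverse_norm_const * ennreal (b m + (\<Sum>k=1..m. (\<xi> k \<omega>)\<^sup>2) / real N)"
    using sequence_model[OF Q J N sample \<phi> on D] by (elim exE conjE) (rule that)
  have P: "prob_space P" using sample by (simp add: molchan_sample_def)
  interpret prob_space P by fact
  have \<xi>m: "\<xi> k \<in> borel_measurable P" if "k \<in> {1..N}" for k using sub that by (simp add: subgaussian_vector_def)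
  have bm: "0 \<le> b m" "ennreal (b m) \<le> bias_sq H T Q \<phi> m" using b m by auto
  have sq_meas: "(\<lambda>\<omega>. ennreal ((\<xi> k \<omega>)\<^sup>2)) \<in> borel_measurable P" if "k \<in> {1..m}" for k
    using \<xi>m[of k] that m by simp
  define W where "W \<omega> = (\<Sum>k=1..m. ennreal ((\<xi> k \<omega>)\<^sup>2))" for \<omega>
  have Wm[measurable]: "W \<in> borel_measurable P" unfolding W_def[abs_def] by (rule borel_measurable_sum[OF sq_meas])
  have WE: "(\<integral>\<^sup>+\<omega>. W \<omega> \<partial>P) = (\<Sum>k=1..m. \<integral>\<^sup>+\<omega>. ennreal ((\<xi> k \<omega>)\<^sup>2) \<partial>P)"
    unfolding W_def by (rule nn_integral_sum[OF sq_meas])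
  have "risk P T Q (Q_hat H T N \<phi> D m) \<le> (\<integral>\<^sup>+\<omega>. ennreal inverse_norm_const * ennreal (b m + (\<Sum>k=1..m. (\<xi> k \<omega>)\<^sup>2) / real N) \<partial>P)"
    unfolding risk_def by (intro nn_integral_mono_AE) (use ae m in \<open>auto elim!: eventually_mono\<close>)
  also have "\<dots> = (\<integral>\<^sup>+\<omega>. ennreal inverse_norm_const * (ennreal (b m) + ennreal (1 / real N) * W \<omega>) \<partial>P)"
    unfolding W_def using bm(1) N by (intro nn_integral_cong) (simp add: sum_nonneg ennreal_plus[symmetric] ennreal_mult'[symmetric] del: ennreal_plus)
  also have "\<dots> = ennreal inverse_norm_const * (ennreal (b m) + ennreal (1 / real N) * (\<Sum>k=1..m. \<integral>\<^sup>+\<omega>. ennreal ((\<xi> k \<omega>)\<^sup>2) \<partial>P))"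
    by (simp add: nn_integral_cmult nn_integral_add emeasure_space_1 WE)
  also have "\<dots> \<le> ennreal inverse_norm_const * (ennreal (b m) + ennreal (1 / real N) * (\<Sum>k=1..m. ennreal (4 * exp (1/2))))"
    using m by (intro mult_left_mono add_left_mono sum_mono subgaussian_second_moment[OF sub]) auto
  also have "(\<Sum>k=1..m. ennreal (4 * exp (1/2))) = ennreal (real m * (4 * exp (1/2)))"
    by (simp add: ennreal_of_nat_eq_real_of_nat ennreal_mult')
  also have "ennreal (1 / real N) * ennreal (real m * (4 * exp (1/2))) = ennreal (4 * exp (1/2)) * ennreal (real m / real N)"
    by (simp add: ennreal_mult'[symmetric] mult.commute)
  also have "ennreal inverse_norm_const * (ennreal (b m) + ennreal (4 * exp (1/2)) * ennreal (real m / real N))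
    \<le> ennreal (inverse_norm_const + 1) * (ennreal (1 + 4 * exp (1/2)) * bias_sq H T Q \<phi> m + ennreal (1 + 4 * exp (1/2)) * ennreal (real m / real N))"
  proof (intro mult_mono add_mono ennreal_leI)
    have "1 * ennreal (b m) \<le> ennreal (1 + 4 * exp (1/2)) * bias_sq H T Q \<phi> m"
      using bm(2) by (intro mult_mono) (auto simp flip: ennreal_1 simp del: ennreal_plus intro!: ennreal_leI)
    then show "ennreal (b m) \<le> ennreal (1 + 4 * exp (1/2)) * bias_sq H T Q \<phi> m" by simp
  qed auto
  also have "\<dots> = ennreal ((inverse_norm_const + 1) * (1 + 4 * exp (1/2))) * (bias_sq H T Q \<phi> m + ennreal (real m / real N))"
    using inverse_norm_const_nonneg by (subst ennreal_mult') (simp_all add: distrib_left mult.assoc del: ennreal_plus)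
  finally show ?thesis .
qed

text \<open>
  \<open>sequence_oracle_inequality\<close> is applied for each outcome, with \<open>\<Delta>\<close> the sum of the excesses of all
  dimensions; its mean is bounded independently of \<open>N\<close> by \<open>chi_square_excess\<close> and contributes the
  term of order \<open>1/N\<close>.
\<close>

lemma selected_risk:
  assumes c: "1 < c"
  shows "\<exists>c\<^sub>2>0. \<forall>N\<ge>1. \<forall>m_max\<in>{1..N}. \<forall>(P :: 'w measure) B M Z \<phi> D Q.
    C1_on_Icc T Q \<and> L2_fun (bracket H T) (J_map H T Q) \<and> molchan_sample P H T Q N B M Z \<and>
    (\<forall>j\<in>{1..N}. continuous_on {0..T} (\<phi> j)) \<and> orthonormal_family T N \<phi> \<and>
    integral_version P H T N Z (span_upto \<phi> N) D \<longrightarrow>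
    risk P T Q (\<lambda>\<omega>. Q_hat H T N \<phi> D (m_hat H T N \<phi> D c m_max \<omega>) \<omega>)
      \<le> ennreal c\<^sub>2 * (Min ((\<lambda>m. bias_sq H T Q \<phi> m + ennreal (real m / real N)) ` {1..m_max}) + ennreal (1 / real N))"
proof -
  \<comment> \<open>The margin \<open>c > 1\<close> is split: \<open>\<kappa> > 1\<close> pays for the fluctuation of the noise, and \<open>1 + \<alpha> < \<kappa>\<close> for the
    cross terms between signal and noise.\<close>
  define \<kappa> where "\<kappa> = sqrt c"
  have \<kappa>: "1 < \<kappa>" "\<kappa> * \<kappa> = c" using c by (auto simp: \<kappa>_def)
  define \<alpha> where "\<alpha> = (\<kappa> - 1) / 2"
  have \<alpha>: "0 < \<alpha>" using \<kappa> by (simp add: \<alpha>_def)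
  have c\<kappa>: "(1 + \<alpha>) * \<kappa> < c"
  proof -
    have "1 + \<alpha> < \<kappa>" using \<kappa> by (simp add: \<alpha>_def field_simps)
    then have "(1 + \<alpha>) * \<kappa> < \<kappa> * \<kappa>" using \<kappa> by (intro mult_strict_right_mono) auto
    then show ?thesis using \<kappa> by simp
  qed
  define E where "E = 3 + 2*c + 2*\<kappa> + \<kappa> / (c - (1 + \<alpha>) * \<kappa>) * (c + 2 + 1/\<alpha> + \<alpha>)"
  have E: "0 < E"
  proof -
    have "0 \<le> \<kappa> / (c - (1 + \<alpha>) * \<kappa>) * (c + 2 + 1/\<alpha> + \<alpha>)" using c c\<kappa> \<kappa> \<alpha> by (intro mult_nonneg_nonneg divide_nonneg_nonneg) auto
    then show ?thesis unfolding E_def using c \<kappa> by linarith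
  qed
  obtain C where C: "0 < C" and excess: "\<forall>(P :: 'w measure) n \<xi>. prob_space P \<and> subgaussian_vector P n \<xi> \<longrightarrow>
    (\<integral>\<^sup>+\<omega>. ennreal (\<Sum>m=1..n. max 0 ((\<Sum>k=1..m. (\<xi> k \<omega>)\<^sup>2) - \<kappa> * real m)) \<partial>P) \<le> ennreal C"
    using chi_square_excess[OF \<kappa>(1), where 'w='w] by blast
  define c2 where "c2 = (inverse_norm_const + 1) * E * (1 + C)"
  have c2: "0 < c2" unfolding c2_def using inverse_norm_const_nonneg E C by (intro mult_pos_pos) auto
  show ?thesis
  proof (intro exI[of _ c2] conjI c2 allI impI ballI)
    fix N :: nat and M' P B M Z \<phi> D Q
    assume N: "1 \<le> N" and M': "M' \<in> {1..N}"
    assume "C1_on_Icc T Q \<and> L2_fun (bracket H T) (J_map H T Q) \<and> molchan_sample P H T Q N B M Z \<and>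
      (\<forall>j\<in>{1..N}. continuous_on {0..T} (\<phi> j)) \<and> orthonormal_family T N \<phi> \<and>
      integral_version P H T N Z (span_upto \<phi> N) (D :: nat \<Rightarrow> (real \<Rightarrow> real) \<Rightarrow> 'w \<Rightarrow> real)"
    then have Q: "C1_on_Icc T Q" and J: "L2_fun (bracket H T) (J_map H T Q)" and sample: "molchan_sample P H T Q N B M Z"
      and \<phi>: "\<forall>j\<in>{1..N}. continuous_on {0..T} (\<phi> j)" and on: "orthonormal_family T N \<phi>"
      and D: "integral_version P H T N Z (span_upto \<phi> N) D" by auto
    obtain d \<xi> b b0 where sub: "subgaussian_vector P N \<xi>"
      and b: "\<forall>m. b m = b0 - (\<Sum>k=1..m. (d k)\<^sup>2)" "\<forall>m\<in>{1..N}. 0 \<le> b m \<and> ennreal (b m) \<le> bias_sq H T Q \<phi> m"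
      and ae: "AE \<omega> in P. \<forall>m\<in>{1..N}.
         contrast H T N D \<omega> (J_hat H T N \<phi> D m \<omega>) = - (\<Sum>k=1..m. (d k + \<xi> k \<omega> / sqrt (real N))\<^sup>2) \<and>
         L2_norm_sq (lebesgue_Icc T) (\<lambda>t. Q_hat H T N \<phi> D m \<omega> t - Q t)
           \<le> ennreal inverse_norm_const * ennreal (b m + (\<Sum>k=1..m. (\<xi> k \<omega>)\<^sup>2) / real N)"
      using sequence_model[OF Q J N sample \<phi> on D] by (elim exE conjE) (rule that)
    have P: "prob_space P" using sample by (simp add: molchan_sample_def)
    interpret prob_space P by fact
    define \<Delta> where "\<Delta> \<omega> = (\<Sum>m=1..N. max 0 ((\<Sum>k=1..m. (\<xi> k \<omega>)\<^sup>2) - \<kappa> * real m))" for \<omega>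
    have \<Delta>0: "0 \<le> \<Delta> \<omega>" for \<omega> unfolding \<Delta>_def by (intro sum_nonneg) auto
    have \<Delta>m: "\<Delta> \<in> borel_measurable P"
      unfolding \<Delta>_def[abs_def] using sub unfolding subgaussian_vector_def
      by (intro borel_measurable_sum borel_measurable_max borel_measurable_const borel_measurable_diff borel_measurable_power) auto
    have \<Delta>E: "(\<integral>\<^sup>+\<omega>. ennreal (\<Delta> \<omega>) \<partial>P) \<le> ennreal C"
      using excess P sub unfolding \<Delta>_def by blast
    let ?g = "\<lambda>m. bias_sq H T Q \<phi> m + ennreal (real m / real N)"
    have "Min (?g ` {1..M'}) \<in> ?g ` {1..M'}" using M' by (intro Min_in) auto
    then obtain m where m: "m \<in> {1..M'}" "Min (?g ` {1..M'}) = ?g m" by auto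
    have mN: "m \<in> {1..N}" using m M' by auto
    have bm: "0 \<le> b m" "ennreal (b m) \<le> bias_sq H T Q \<phi> m" using b(2) mN by auto
    have loss: "AE \<omega> in P. L2_norm_sq (lebesgue_Icc T) (\<lambda>t. Q_hat H T N \<phi> D (m_hat H T N \<phi> D c M' \<omega>) \<omega> t - Q t)
        \<le> ennreal (inverse_norm_const * E * (b m + real m / real N)) + ennreal (inverse_norm_const * E / real N) * ennreal (\<Delta> \<omega>)"
      using ae
    proof eventually_elim
      case (elim \<omega>)
      let ?crit = "\<lambda>m. contrast H T N D \<omega> (J_hat H T N \<phi> D m \<omega>) + c * real m / real N"
      define mh where "mh = m_hat H T N \<phi> D c M' \<omega>"
      have "finite {1..M'}" "{1..M'} \<noteq> {}" using M' by auto
      from ex_min_if_finite[of "?crit ` {1..M'}"] this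
      have "\<exists>x0\<in>{1..M'}. \<forall>y\<in>{1..M'}. ?crit x0 \<le> ?crit y" by (force simp: not_less)
      then obtain x0 where x0: "x0 \<in> {1..M'}" "\<And>y. y \<in> {1..M'} \<Longrightarrow> ?crit x0 \<le> ?crit y" by blast
      have mh: "mh \<in> {1..M'}" "?crit mh \<le> ?crit m"
        unfolding mh_def m_hat_def using arg_min_attains[of "\<lambda>m. m \<in> {1..M'}" x0 ?crit, OF x0] m(1) by auto
      have mhN: "mh \<in> {1..N}" using mh(1) M' by auto
      have "b mh + (\<Sum>k=1..mh. (\<xi> k \<omega>)\<^sup>2) / real N \<le> E * (b m + real m / real N + \<Delta> \<omega> / real N)"
        unfolding E_def
      proof (rule sequence_oracle_inequality[where M=M' and energy=b0 and d=d and b=b, OF _ \<alpha> \<kappa>(1) c\<kappa> \<Delta>0])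
        show "0 < real N" using N by simp
        show "0 \<le> b m" if "m \<in> {1..M'}" for m
        proof -
          have "m \<in> {1..N}" using that M' by auto
          then show ?thesis using b(2) by blast
        qed
        show "b m = b0 - (\<Sum>k=1..m. (d k)\<^sup>2)" for m using b(1) by blast
        show "m \<in> {1..M'}" "mh \<in> {1..M'}" by fact+
        show "(\<Sum>k=1..m. (\<xi> k \<omega>)\<^sup>2) \<le> \<kappa> * real m + \<Delta> \<omega>" if "m \<in> {1..M'}" for m
        proof -
          have "max 0 ((\<Sum>k=1..m. (\<xi> k \<omega>)\<^sup>2) - \<kappa> * real m) \<le> \<Delta> \<omega>"
            unfolding \<Delta>_def using that M'
            by (intro member_le_sum[where f="\<lambda>m. max 0 ((\<Sum>k=1..m. (\<xi> k \<omega>)\<^sup>2) - \<kappa> * real m)"]) auto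
          then show ?thesis by linarith
        qed
        show "- (\<Sum>k=1..mh. (d k + \<xi> k \<omega> / sqrt (real N))\<^sup>2) + c * real mh / real N \<le> - (\<Sum>k=1..m. (d k + \<xi> k \<omega> / sqrt (real N))\<^sup>2) + c * real m / real N"
          using mh(2) elim mhN mN by simp
      qed
      then have "ennreal inverse_norm_const * ennreal (b mh + (\<Sum>k=1..mh. (\<xi> k \<omega>)\<^sup>2) / real N)
        \<le> ennreal inverse_norm_const * ennreal (E * (b m + real m / real N + \<Delta> \<omega> / real N))"
        by (intro mult_left_mono ennreal_leI) auto
      also have "\<dots> = ennreal (inverse_norm_const * E * (b m + real m / real N) + inverse_norm_const * E / real N * \<Delta> \<omega>)"
        using inverse_norm_const_nonneg by (subst ennreal_mult'[symmetric]) (auto simp: algebra_simps)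
      also have "\<dots> = ennreal (inverse_norm_const * E * (b m + real m / real N)) + ennreal (inverse_norm_const * E / real N) * ennreal (\<Delta> \<omega>)"
      proof -
        have p: "0 \<le> inverse_norm_const * E * (b m + real m / real N)" "0 \<le> inverse_norm_const * E / real N"
          using inverse_norm_const_nonneg E bm(1) by auto
        show ?thesis
          by (simp only: ennreal_plus[OF p(1) mult_nonneg_nonneg[OF p(2) \<Delta>0]] ennreal_mult''[OF \<Delta>0])
      qed
      finally show ?case using elim mhN unfolding mh_def by (meson order_trans)
    qed
    have "risk P T Q (\<lambda>\<omega>. Q_hat H T N \<phi> D (m_hat H T N \<phi> D c M' \<omega>) \<omega>)
      \<le> (\<integral>\<^sup>+\<omega>. ennreal (inverse_norm_const * E * (b m + real m / real N)) + ennreal (inverse_norm_const * E / real N) * ennreal (\<Delta> \<omega>) \<partial>P)"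
      unfolding risk_def by (rule nn_integral_mono_AE[OF loss])
    also have "\<dots> = ennreal (inverse_norm_const * E * (b m + real m / real N)) + ennreal (inverse_norm_const * E / real N) * (\<integral>\<^sup>+\<omega>. ennreal (\<Delta> \<omega>) \<partial>P)"
      using \<Delta>m by (simp add: nn_integral_add nn_integral_cmult emeasure_space_1)
    also have "\<dots> \<le> ennreal (inverse_norm_const * E * (b m + real m / real N)) + ennreal (inverse_norm_const * E / real N) * ennreal C"
      by (intro add_left_mono mult_left_mono \<Delta>E) auto
    also have "\<dots> = ennreal (inverse_norm_const * E) * (ennreal (b m) + ennreal (real m / real N)) + ennreal (inverse_norm_const * E * C) * ennreal (1 / real N)"
      using inverse_norm_const_nonneg E C bm(1) by (simp add: ennreal_mult'[symmetric] ennreal_plus[symmetric] mult.commute del: ennreal_plus)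
    also have "\<dots> \<le> ennreal c2 * (bias_sq H T Q \<phi> m + ennreal (real m / real N)) + ennreal c2 * ennreal (1 / real N)"
    proof (intro add_mono mult_mono ennreal_leI bm(2) order_refl)
      have "inverse_norm_const * E * 1 \<le> (inverse_norm_const + 1) * E * (1 + C)"
        using inverse_norm_const_nonneg E C by (intro mult_mono) auto
      then show "inverse_norm_const * E \<le> c2" by (simp add: c2_def)
      show "inverse_norm_const * E * C \<le> c2"
        unfolding c2_def using inverse_norm_const_nonneg E C by (intro mult_mono) auto
    qed auto
    also have "\<dots> = ennreal c2 * (Min (?g ` {1..M'}) + ennreal (1 / real N))"
      unfolding m(2) by (simp only: distrib_left)
    finally show "risk P T Q (\<lambda>\<omega>. Q_hat H T N \<phi> D (m_hat H T N \<phi> D c M' \<omega>) \<omega>)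
      \<le> ennreal c2 * (Min (?g ` {1..M'}) + ennreal (1 / real N))" .
  qed
qed

end

theorem proposition4:
  fixes T H \<gamma> :: real and b\<^sub>0 \<sigma> Q\<^sub>0 :: "real \<Rightarrow> real"
  assumes "0 < T" and "1/2 < H" and "H < 1"
    and "continuous_on {0..T} b\<^sub>0"
    and "1 - H < \<gamma>" and "\<gamma> \<le> 1" and "holder_on T \<gamma> \<sigma>"
    and "\<And>t. t \<in> {0..T} \<Longrightarrow> \<sigma> t \<noteq> 0"
    and "\<And>t. t \<in> {0..T} \<Longrightarrow> Q\<^sub>0 t = b\<^sub>0 t / \<sigma> t"
    and "C1_on_Icc T Q\<^sub>0"
    and "L2_fun (bracket H T) (J_map H T Q\<^sub>0)"
  shows
    "(\<exists>c\<^sub>1>0. \<forall>N\<ge>1. \<forall>(P :: 'w measure) B M Z \<phi> D.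
        molchan_sample P H T Q\<^sub>0 N B M Z \<and>
        (\<forall>j\<in>{1..N}. continuous_on {0..T} (\<phi> j)) \<and>
        orthonormal_family T N \<phi> \<and>
        integral_version P H T N Z (span_upto \<phi> N) D \<and>
        (\<forall>j\<in>{1..N}. \<phi> j \<in> J_space H T) \<longrightarrow>
        (\<forall>m\<in>{1..N}.
           risk P T Q\<^sub>0 (Q_hat H T N \<phi> D m)
             \<le> ennreal c\<^sub>1 * (bias_sq H T Q\<^sub>0 \<phi> m + ennreal (real m / real N))))
     \<and>
     (\<forall>c_cal>1. \<exists>c\<^sub>2>0. \<forall>N\<ge>1. \<forall>m_max\<in>{1..N}. \<forall>(P :: 'w measure) B M Z \<phi> D.
        molchan_sample P H T Q\<^sub>0 N B M Z \<and>
        (\<forall>j\<in>{1..N}. continuous_on {0..T} (\<phi> j)) \<and>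
        orthonormal_family T N \<phi> \<and>
        integral_version P H T N Z (span_upto \<phi> N) D \<and>
        (\<forall>j\<in>{1..N}. \<phi> j \<in> J_space H T) \<and>
        (\<forall>m\<in>{1..N}. \<forall>m'\<in>{1..N}. m' < m \<longrightarrow> span_upto \<phi> m' \<subseteq> span_upto \<phi> m) \<longrightarrow>
        risk P T Q\<^sub>0 (\<lambda>\<omega>. Q_hat H T N \<phi> D (m_hat H T N \<phi> D c_cal m_max \<omega>) \<omega>)
          \<le> ennreal c\<^sub>2 *
             (Min ((\<lambda>m. bias_sq H T Q\<^sub>0 \<phi> m + ennreal (real m / real N)) ` {1..m_max})
              + ennreal (1 / real N)))"
proof -
  interpret hurst H T using assms by unfold_locales
  note Q = \<open>C1_on_Icc T Q\<^sub>0\<close> and J = \<open>L2_fun (bracket H T) (J_map H T Q\<^sub>0)\<close>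
  show ?thesis
  proof (intro conjI allI impI)
    show "\<exists>c\<^sub>1>0. \<forall>N\<ge>1. \<forall>(P :: 'w measure) B M Z \<phi> D.
        molchan_sample P H T Q\<^sub>0 N B M Z \<and>
        (\<forall>j\<in>{1..N}. continuous_on {0..T} (\<phi> j)) \<and>
        orthonormal_family T N \<phi> \<and>
        integral_version P H T N Z (span_upto \<phi> N) D \<and>
        (\<forall>j\<in>{1..N}. \<phi> j \<in> J_space H T) \<longrightarrow>
        (\<forall>m\<in>{1..N}.
           risk P T Q\<^sub>0 (Q_hat H T N \<phi> D m)
             \<le> ennreal c\<^sub>1 * (bias_sq H T Q\<^sub>0 \<phi> m + ennreal (real m / real N)))"
    proof (intro exI[of _ "(inverse_norm_const + 1) * (1 + 4 * exp (1/2))"] conjI allI impI ballI)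
      have "0 < inverse_norm_const + 1" using inverse_norm_const_nonneg by linarith
      moreover have "0 < 1 + 4 * exp (1/2 :: real)" by (simp add: add_pos_pos)
      ultimately show "0 < (inverse_norm_const + 1) * (1 + 4 * exp (1/2))" by (rule mult_pos_pos)
    qed (elim conjE, rule projection_risk[OF Q J])
  next
    fix c_cal :: real assume "1 < c_cal"
    from selected_risk[OF this, where 'w='w] obtain c\<^sub>2 where c2: "0 < c\<^sub>2"
      and bound: "\<forall>N\<ge>1. \<forall>m_max\<in>{1..N}. \<forall>(P :: 'w measure) B M Z \<phi> D Q.
        C1_on_Icc T Q \<and> L2_fun (bracket H T) (J_map H T Q) \<and> molchan_sample P H T Q N B M Z \<and>
        (\<forall>j\<in>{1..N}. continuous_on {0..T} (\<phi> j)) \<and> orthonormal_family T N \<phi> \<and>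
        integral_version P H T N Z (span_upto \<phi> N) D \<longrightarrow>
        risk P T Q (\<lambda>\<omega>. Q_hat H T N \<phi> D (m_hat H T N \<phi> D c_cal m_max \<omega>) \<omega>)
          \<le> ennreal c\<^sub>2 * (Min ((\<lambda>m. bias_sq H T Q \<phi> m + ennreal (real m / real N)) ` {1..m_max}) + ennreal (1 / real N))"
      by blast
    show "\<exists>c\<^sub>2>0. \<forall>N\<ge>1. \<forall>m_max\<in>{1..N}. \<forall>(P :: 'w measure) B M Z \<phi> D.
        molchan_sample P H T Q\<^sub>0 N B M Z \<and>
        (\<forall>j\<in>{1..N}. continuous_on {0..T} (\<phi> j)) \<and>
        orthonormal_family T N \<phi> \<and>
        integral_version P H T N Z (span_upto \<phi> N) D \<and>
        (\<forall>j\<in>{1..N}. \<phi> j \<in> J_space H T) \<and>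
        (\<forall>m\<in>{1..N}. \<forall>m'\<in>{1..N}. m' < m \<longrightarrow> span_upto \<phi> m' \<subseteq> span_upto \<phi> m) \<longrightarrow>
        risk P T Q\<^sub>0 (\<lambda>\<omega>. Q_hat H T N \<phi> D (m_hat H T N \<phi> D c_cal m_max \<omega>) \<omega>)
          \<le> ennreal c\<^sub>2 *
             (Min ((\<lambda>m. bias_sq H T Q\<^sub>0 \<phi> m + ennreal (real m / real N)) ` {1..m_max})
              + ennreal (1 / real N))"
      by (intro exI[of _ c\<^sub>2] conjI c2 allI ballI impI, elim conjE, rule bound[rule_format], assumption, assumption)
         (intro conjI Q J ballI; blast)
  qed
qed

end
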